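(* Let $D\subset\mathbb{C}^n$ be a pseudoconvex domain, $z_0\in D$, and let $C_1,C_2>0$ be constants. Let $\varphi$ be a negative plurisubharmonic function on $D$ and $F$ a holomorphic function on $D$ such that 1) $\|F\|_\varphi^2=\int_D|F|^2e^{-\varphi}\,d\lambda_n\le C_1$, and 2) $K^{-1}_{\varphi,F}(z_0)\ge C_2$. Then for every real $p>1$ with $\theta(p)>C_1/C_2$ we have $(F,z_0)\in\mathcal{I}(p\varphi)_{z_0}$, i.e. $|F|^2e^{-p\varphi}$ is integrable on some neighborhood of $z_0$.
   Context: $d\lambda_n$ is Lebesgue measure on $\mathbb{C}^n$. For a plurisubharmonic function $\psi$, the multiplier ideal sheaf $\mathcal{I}(\psi)$ consists of germs of holomorphic functions $f$ at $z$ such that $|f|^2e^{-\psi}$ is integrable on a neighborhood of $z$; $\mathcal{I}_+(\psi):=\bigcup_{\varepsilon>0}\mathcal{I}((1+\varepsilon)\psi)$. The jumping number is $c^F_{z_0}(\varphi):=\sup\{c\ge0: |F|^2e^{-2c\varphi}\text{ is integrable on a neighborhood of }z_0\}$. The generalized Bergman kernel $K_{\varphi,F}$ on $D$ is defined by $$K^{-1}_{\varphi,F}(z_0):=\inf\Big\{\int_D|F_1|^2d\lambda_n:\ F_1\in\mathcal{O}(D),\ (F_1-F,z_0)\in\mathcal{I}_+\big(2c^F_{z_0}(\varphi)\varphi\big)_{z_0}\Big\}$$ (infimum of the empty set is $+\infty$; if $c^F_{z_0}(\varphi)=+\infty$ set $K^{-1}_{\varphi,F}(z_0):=0$). The function $\theta:(1,\infty)\to\mathbb{R}$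 is $\theta(t):=\big(\frac{1}{(t-1)(2t-1)}\big)^{1/t}$. *)

theory Defs
  imports "HOL-Analysis.Analysis"
begin

text \<open>C^n is represented as complex ^ 'n (with 'n a finite index type, n = CARD('n));
  Lebesgue measure on C^n = R^{2n} is lborel on this euclidean space.\<close>

definition holomorphic_on_Cn :: "(complex ^ 'n \<Rightarrow> complex) \<Rightarrow> (complex ^ 'n) set \<Rightarrow> bool" where
  "holomorphic_on_Cn f D \<longleftrightarrow> open D \<and>
     (\<forall>z\<in>D. \<exists>L. (f has_derivative L) (at z) \<and> (\<forall>c v. L (c *s v) = c * L v))"

definition eexp :: "ereal \<Rightarrow> ennreal" where
  "eexp x = (if x = \<infinity> then \<infinity> else if x = -\<infinity> then 0 else ennreal (exp (real_of_ereal x)))"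

definition circle_mean :: "(complex ^ 'n \<Rightarrow> ereal) \<Rightarrow> complex ^ 'n \<Rightarrow> complex ^ 'n \<Rightarrow> ereal" where
  "circle_mean u a b =
     (enn2ereal (\<integral>\<^sup>+ t. indicator {0..2*pi} t * e2ennreal (max 0 (u (a + cis t *s b))) \<partial>lborel)
      - enn2ereal (\<integral>\<^sup>+ t. indicator {0..2*pi} t * e2ennreal (max 0 (- u (a + cis t *s b))) \<partial>lborel))
     / ereal (2 * pi)"

definition psh_on :: "(complex ^ 'n) set \<Rightarrow> (complex ^ 'n \<Rightarrow> ereal) \<Rightarrow> bool" where
  "psh_on D u \<longleftrightarrow> open D \<and>
     (\<forall>z\<in>D. u z \<noteq> \<infinity>) \<and>
     (\<forall>z\<in>D. \<forall>c. u z < c \<longrightarrow> (\<forall>\<^sub>F w in at z. u w < c)) \<and>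
     (\<forall>a b. (\<forall>\<zeta>::complex. cmod \<zeta> \<le> 1 \<longrightarrow> a + \<zeta> *s b \<in> D) \<longrightarrow> u a \<le> circle_mean u a b) \<and>
     (\<exists>z\<in>D. u z \<noteq> -\<infinity>)"

definition domain_Cn :: "(complex ^ 'n) set \<Rightarrow> bool" where
  "domain_Cn D \<longleftrightarrow> open D \<and> connected D \<and> D \<noteq> {}"

definition pseudoconvex_domain :: "(complex ^ 'n) set \<Rightarrow> bool" where
  "pseudoconvex_domain D \<longleftrightarrow> domain_Cn D \<and>
     (\<exists>\<psi> :: complex ^ 'n \<Rightarrow> real. continuous_on D \<psi> \<and> psh_on D (\<lambda>z. ereal (\<psi> z)) \<and>
        (\<forall>c. compact (closure {z\<in>D. \<psi> z < c}) \<and> closure {z\<in>D. \<psi> z < c} \<subseteq> D))"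

definition wsq :: "(complex ^ 'n \<Rightarrow> complex) \<Rightarrow> real \<Rightarrow> (complex ^ 'n \<Rightarrow> ereal) \<Rightarrow> complex ^ 'n \<Rightarrow> ennreal" where
  "wsq f c u z = ennreal ((cmod (f z))\<^sup>2) * eexp (- (ereal c * u z))"

definition in_mult_ideal :: "(complex ^ 'n \<Rightarrow> complex) \<Rightarrow> real \<Rightarrow> (complex ^ 'n \<Rightarrow> ereal) \<Rightarrow> complex ^ 'n \<Rightarrow> bool" where
  "in_mult_ideal f c u z0 \<longleftrightarrow> (\<exists>U. open U \<and> z0 \<in> U \<and> (\<integral>\<^sup>+ z. indicator U z * wsq f c u z \<partial>lborel) < \<infinity>)"

definition in_mult_ideal_plus :: "(complex ^ 'n \<Rightarrow> complex) \<Rightarrow> real \<Rightarrow> (complex ^ 'n \<Rightarrow> ereal) \<Rightarrow> complex ^ 'n \<Rightarrow> bool" where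
  "in_mult_ideal_plus f c u z0 \<longleftrightarrow> (\<exists>\<epsilon>>0. in_mult_ideal f ((1 + \<epsilon>) * c) u z0)"

definition jumping_number :: "(complex ^ 'n \<Rightarrow> complex) \<Rightarrow> (complex ^ 'n \<Rightarrow> ereal) \<Rightarrow> complex ^ 'n \<Rightarrow> ereal" where
  "jumping_number F u z0 = Sup {ereal c | c. c \<ge> 0 \<and> in_mult_ideal F (2 * c) u z0}"

text \<open>Inverse of the generalized Bergman kernel K^{-1}_{phi,F}(z0) (Inf {} = inf).\<close>
definition bergman_inv :: "(complex ^ 'n) set \<Rightarrow> (complex ^ 'n \<Rightarrow> ereal) \<Rightarrow> (complex ^ 'n \<Rightarrow> complex) \<Rightarrow> complex ^ 'n \<Rightarrow> ennreal" where
  "bergman_inv D u F z0 =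
     (if jumping_number F u z0 = \<infinity> then 0
      else Inf {(\<integral>\<^sup>+ z. indicator D z * ennreal ((cmod (F1 z))\<^sup>2) \<partial>lborel) | F1.
                  holomorphic_on_Cn F1 D \<and>
                  in_mult_ideal_plus (\<lambda>z. F1 z - F z) (2 * real_of_ereal (jumping_number F u z0)) u z0})"

definition theta :: "real \<Rightarrow> real" where
  "theta t = (1 / ((t - 1) * (2 * t - 1))) powr (1 / t)"

end

theory Submission
 imports Defs "HOL-Complex_Analysis.Complex_Analysis"
begin

text \<open>
Suppose \<open>F\<close> is not in the multiplier ideal of \<open>p\<phi>\<close>. Then the jumping number \<open>c\<close> satisfies \<open>1 \<le> 2c \<le> p\<close>.
Since \<open>\<theta>(p) \<le> p/(p-1)\<close>, there are \<open>p' > p\<close> and \<open>\<kappa>\<close> close to \<open>a = 1 - 1/p'\<close> with \<open>\<kappa> C\<^sub>1 < C\<^sub>2\<close>, and it suffices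
to find \<open>H\<close> holomorphic on \<open>D\<close> with \<open>\<integral>|H|\<^sup>2 \<le> \<kappa> \<integral>|F|\<^sup>2 exp(-\<phi>)\<close> and \<open>|H - F|\<^sup>2 exp(-p'\<phi>)\<close> integrable: this \<open>H\<close> competes
in the infimum defining \<open>1/K\<close> and contradicts the lower bound \<open>C\<^sub>2\<close>.

Put \<open>\<psi> = p'\<phi>\<close>, \<open>x = exp \<psi>\<close>, and let \<open>l\<close> be a concave profile on \<open>[0,1]\<close> with \<open>l(0) = 0\<close>, \<open>l(1) = 1\<close>, \<open>l''' \<ge> 0\<close> and
\<open>l'(x) \<le> \<kappa> x^(a-1)\<close> (a normalised shift of \<open>x\<^sup>a\<close>). With \<open>b = (l - x)/(1 - x)\<close> one solves \<open>dbar u = dbar (b F)\<close> by a twisted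
L2 estimate whose weights are functions of \<open>\<psi>\<close>, so that \<open>\<integral>|u|\<^sup>2/b \<le> \<integral>(1 - x) b'(x) |F|\<^sup>2\<close>. For \<open>H = F - (b F - u)\<close>,
convexity gives \<open>|H|\<^sup>2 \<le> |u|\<^sup>2/b + (1 - b)|F|\<^sup>2\<close>, and \<open>(1 - x) b' + 1 - b = l'\<close> yields the bound; \<open>b = O(x)\<close> yields
integrability of \<open>|H - F|\<^sup>2/x\<close>. The estimate is proved for mollified \<open>\<psi>\<close> on sublevel sets of a mollified exhaustion \<open>r\<close>;
a small correction of the weights that blows up at \<open>r = 0\<close> makes cutoff functions of \<open>log (-r)\<close> admissible. Bochner's
inequality, the Riesz representation theorem and Weyl's lemma give the solution, Montel's theorem and Fatou's lemma the limit.
\<close>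

unbundle no fps_syntax

text \<open>The model profile is the power \<open>x^a\<close> with \<open>a = 1 - 1/p'\<close>. For
  it \<open>l'(exp \<psi>)\<close> is \<open>a * exp (-\<phi>)\<close>, so the competitor H costs
  \<open>a\<close> times the given norm of F, and \<open>1/a\<close> tends to \<open>p/(p-1)\<close>
  as p' decreases to p. The obstacle is the duality argument. Forms of compact support need not be
  dense in the domain of the Hilbert space adjoint of dbar, and a test form need not be closed. This
  defect is removed as in Gaffney's theorem. The equation is tested with a cutoff of the mollified
  defect itself; the curl of dbar is zero, so only the gradient of the cutoff survives, together
  with a commutator of mollification. The gradient has to be small relative to
  \<open>exp ((zeta - xi) / 2)\<close>, where xi and zeta are the two weights of the twisted
  estimate. That completeness is not given by functions of \<psi> alone, which are bounded up to the
  boundary; it is bought by the correction in r.\<close>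

abbreviation (input) intbl :: "('a::euclidean_space \<Rightarrow> 'b::{banach, second_countable_topology}) \<Rightarrow> bool" where
 "intbl \<equiv> integrable lborel"

abbreviation (input) nnl :: "('a::euclidean_space \<Rightarrow> ennreal) \<Rightarrow> ennreal" (binder "NNL " 10) where
 "nnl \<equiv> nn_integral lborel"

abbreviation (input) csq :: "complex \<Rightarrow> real" where
 "csq z \<equiv> (cmod z)\<^sup>2"

lemmas bi_integrable_add = Bochner_Integration.integrable_add
lemmas bi_integrable_bound = Bochner_Integration.integrable_bound
lemmas bi_integrable_diff = Bochner_Integration.integrable_diff
lemmas bi_integrable_sum = Bochner_Integration.integrable_sum
lemmas bi_integral_add = Bochner_Integration.integral_add
lemmas bi_integral_cong = Bochner_Integration.integral_cong
lemmas bi_integral_diff = Bochner_Integration.integral_diff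
lemmas bi_integral_nonneg = Bochner_Integration.integral_nonneg
lemmas bi_norm_bound = Bochner_Integration.integral_norm_bound_integral
lemmas bi_integral_sum = Bochner_Integration.integral_sum

section \<open>Calculus with directional derivatives\<close>

definition dd :: "('a::real_normed_vector => 'b::real_normed_vector) => 'a => 'a => 'b" where
 "dd f v x = frechet_derivative f (at x) v"

text \<open>Continuity is asked of each directional derivative separately. In finite dimension this
  is the usual class C^1, and no topology on the space of linear maps is involved.\<close>

definition c1 :: "'a::euclidean_space set => ('a => 'b::real_normed_vector) => bool" where
 "c1 U f \<longleftrightarrow> (\<forall>x\<in>U. f differentiable (at x)) \<and> (\<forall>v. continuous_on U (dd f v))"

definition c2 :: "'a::euclidean_space set => ('a => 'b::real_normed_vector) => bool" where
 "c2 U f \<longleftrightarrow> c1 U f \<and> (\<forall>v. c1 U (dd f v))"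

lemma dd_eq: "(f has_derivative f') (at x) ==> dd f v x = f' v"
 unfolding dd_def using frechet_derivative_at by metis

lemma c1_has: "c1 U f ==> x \<in> U ==> (f has_derivative (%v. dd f v x)) (at x)"
 unfolding c1_def dd_def using frechet_derivative_works by metis

lemma c1_cont_dd: "c1 U f ==> continuous_on U (dd f v)"
 by (simp add: c1_def)

lemma c2_c1: "c2 U f ==> c1 U f" and c2_dd: "c2 U f ==> c1 U (dd f v)"
 by (simp_all add: c2_def)

lemma c1I:
 assumes "!!x. x \<in> U ==> (f has_derivative (%v. g v x)) (at x)" "!!v. continuous_on U (g v)"
 shows "c1 U f"
proof -
 have "continuous_on U (dd f v)" for v
  using assms(2)[of v] by (rule continuous_on_eq) (simp add: dd_eq[OF assms(1)])
 thus ?thesis unfolding c1_def using assms(1) differentiable_def by blast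
qed

lemma c2I:
 assumes "!!x. x \<in> U ==> (f has_derivative (%v. g v x)) (at x)" "!!v. c1 U (g v)" "open U"
 shows "c2 U f"
proof -
 have cg: "continuous_on U (g v)" for v
  using c1_has[OF assms(2)] has_derivative_continuous
  by (metis continuous_at_imp_continuous_on)
 have "c1 U (dd f v)" for v
 proof (rule c1I)
  show "(dd f v has_derivative (%w. dd (g v) w x)) (at x)" if "x \<in> U" for x
   using c1_has[OF assms(2) that, of v]
   by (rule has_derivative_transform_within_open[OF _ \<open>open U\<close> that]) (simp add: dd_eq[OF assms(1)])
  show "continuous_on U (dd (g v) w)" for w by (rule c1_cont_dd[OF assms(2)])
 qed
 thus ?thesis unfolding c2_def using c1I[OF assms(1) cg] by blast
qed

lemma c1_continuous: "c1 U f ==> continuous_on U f"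
 using c1_has has_derivative_continuous by (metis continuous_at_imp_continuous_on)

lemma c2_continuous: "c2 U f ==> continuous_on U f"
 using c1_continuous c2_c1 by blast

lemma c1_subset: "c1 U f ==> V \<subseteq> U ==> c1 V f"
 unfolding c1_def by (meson continuous_on_subset subsetD)

lemma c2_subset: "c2 U f ==> V \<subseteq> U ==> c2 V f"
 unfolding c2_def by (meson c1_subset)

lemma dd_cong:
 assumes "open U" "!!y. y \<in> U ==> f y = g y" "x \<in> U" shows "dd f v x = dd g v x"
proof -
 have "(f has_derivative f') (at x) \<longleftrightarrow> (g has_derivative f') (at x)" for f'
  using has_derivative_transform_within_open[OF _ assms(1,3), of f f' UNIV g]
   has_derivative_transform_within_open[OF _ assms(1,3), of g f' UNIV f] assms(2) by auto
 thus ?thesis unfolding dd_def frechet_derivative_def by presburger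
qed

lemma c1_cong:
 assumes "open U" "!!y. y \<in> U ==> f y = g y" "c1 U f" shows "c1 U g"
proof (rule c1I[where g="dd f"])
 show "(g has_derivative (%v. dd f v x)) (at x)" if "x \<in> U" for x
  using c1_has[OF assms(3) that] has_derivative_transform_within_open[OF _ assms(1) that] assms(2) by blast
qed (rule c1_cont_dd[OF assms(3)])

lemma c2_cong:
 assumes "open U" "!!y. y \<in> U ==> f y = g y" "c2 U f" shows "c2 U g"
proof -
 have "c1 U (dd g v)" for v
  by (rule c1_cong[OF assms(1) _ c2_dd[OF assms(3)], of v]) (rule dd_cong[OF assms(1,2)])
 thus ?thesis unfolding c2_def using c1_cong[OF assms(1,2) c2_c1[OF assms(3)]] by blast
qed

lemma c1_union: "c1 U f ==> c1 V f ==> open U ==> open V ==> c1 (U \<union> V) f"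
 unfolding c1_def using continuous_on_open_Un by blast

lemma c2_union: "c2 U f ==> c2 V f ==> open U ==> open V ==> c2 (U \<union> V) f"
 unfolding c2_def using c1_union by blast

lemma dd_bilinear:
 assumes "bounded_bilinear p" "c1 U f" "c1 U g" "x \<in> U"
 shows "dd (%x. p (f x) (g x)) v x = p (f x) (dd g v x) + p (dd f v x) (g x)"
 by (rule dd_eq[OF bounded_bilinear.FDERIV[OF assms(1) c1_has[OF assms(2,4)] c1_has[OF assms(3,4)]]])

lemma c1_bilinear:
 assumes "bounded_bilinear p" "c1 U f" "c1 U g"
 shows "c1 U (%x. p (f x) (g x))"
proof (rule c1I)
 show "((%x. p (f x) (g x)) has_derivative (%v. p (f x) (dd g v x) + p (dd f v x) (g x))) (at x)" if "x \<in> U" for x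
  by (rule bounded_bilinear.FDERIV[OF assms(1) c1_has[OF assms(2) that] c1_has[OF assms(3) that]])
 show "continuous_on U (%x. p (f x) (dd g v x) + p (dd f v x) (g x))" for v
  by (intro continuous_on_add bounded_bilinear.continuous_on[OF assms(1)] c1_continuous c1_cont_dd assms(2,3))
qed

lemma c1_linear:
 assumes "bounded_linear h" "c1 U f" shows "c1 U (%x. h (f x))"
proof (rule c1I)
 show "((%x. h (f x)) has_derivative (%v. h (dd f v x))) (at x)" if "x \<in> U" for x
  by (rule bounded_linear.has_derivative[OF assms(1) c1_has[OF assms(2) that]])
 show "continuous_on U (%x. h (dd f v x))" for v
  by (rule bounded_linear.continuous_on[OF assms(1) c1_cont_dd[OF assms(2)]])
qed

lemma dd_linear:
 assumes "bounded_linear h" "c1 U f" "x \<in> U" shows "dd (%x. h (f x)) v x = h (dd f v x)"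
 by (rule dd_eq[OF bounded_linear.has_derivative[OF assms(1) c1_has[OF assms(2,3)]]])

lemma c1_add: "c1 U f ==> c1 U g ==> c1 U (%x. f x + g x)"
 by (rule c1I[where g="%v x. dd f v x + dd g v x"])
   (auto intro!: has_derivative_add continuous_on_add c1_has c1_cont_dd)

lemma dd_add: "c1 U f ==> c1 U g ==> x \<in> U ==> dd (%x. f x + g x) v x = dd f v x + dd g v x"
 by (rule dd_eq) (auto intro!: has_derivative_add c1_has)

lemma c1_const: "c1 U (%x. c)"
 by (rule c1I[where g="%v x. 0"]) auto

lemma dd_const: "dd (%x. c) v x = 0"
 by (rule dd_eq) auto

lemma c1_sum: "(!!i. i \<in> I ==> c1 U (f i)) ==> c1 U (%x. \<Sum>i\<in>I. f i x)"
proof (induction I rule: infinite_finite_induct)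
 case (insert a A)
 have "c1 U (%x. f a x + (\<Sum>i\<in>A. f i x))" by (rule c1_add) (use insert in auto)
 thus ?case using insert by simp
qed (auto simp: c1_const)

lemma dd_sum: "(!!i. i \<in> I ==> c1 U (f i)) ==> x \<in> U ==> dd (%x. \<Sum>i\<in>I. f i x) v x = (\<Sum>i\<in>I. dd (f i) v x)"
 by (rule dd_eq[where f'="%v. \<Sum>i\<in>I. dd (f i) v x"]) (auto intro!: has_derivative_sum c1_has)

lemma c2_bilinear:
 assumes "bounded_bilinear p" "c2 U f" "c2 U g" "open U"
 shows "c2 U (%x. p (f x) (g x))"
proof (rule c2I)
 show "((%x. p (f x) (g x)) has_derivative (%v. p (f x) (dd g v x) + p (dd f v x) (g x))) (at x)" if "x \<in> U" for x
  by (rule bounded_bilinear.FDERIV[OF assms(1) c1_has[OF c2_c1[OF assms(2)] that] c1_has[OF c2_c1[OF assms(3)] that]])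
 show "c1 U (%x. p (f x) (dd g v x) + p (dd f v x) (g x))" for v
  by (rule c1_add[OF c1_bilinear[OF assms(1) c2_c1[OF assms(2)] c2_dd[OF assms(3)]]
     c1_bilinear[OF assms(1) c2_dd[OF assms(2)] c2_c1[OF assms(3)]]])
qed fact

lemma c2_linear:
 assumes "bounded_linear h" "c2 U f" "open U" shows "c2 U (%x. h (f x))"
proof (rule c2I)
 show "((%x. h (f x)) has_derivative (%v. h (dd f v x))) (at x)" if "x \<in> U" for x
  by (rule bounded_linear.has_derivative[OF assms(1) c1_has[OF c2_c1[OF assms(2)] that]])
 show "c1 U (%x. h (dd f v x))" for v
  by (rule c1_linear[OF assms(1) c2_dd[OF assms(2)]])
qed fact

lemma c2_add:
 assumes "c2 U f" "c2 U g" "open U" shows "c2 U (%x. f x + g x)"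
proof (rule c2I)
 show "((%x. f x + g x) has_derivative (%v. dd f v x + dd g v x)) (at x)" if "x \<in> U" for x
  by (rule has_derivative_add[OF c1_has[OF c2_c1[OF assms(1)] that] c1_has[OF c2_c1[OF assms(2)] that]])
 show "c1 U (%x. dd f v x + dd g v x)" for v
  by (rule c1_add[OF c2_dd[OF assms(1)] c2_dd[OF assms(2)]])
qed fact

lemma c2_const: "open U ==> c2 U (%x. c)"
 by (rule c2I[where g="%v x. 0"]) (simp_all add: c1_const)

lemma c2_bounded_linear: "bounded_linear h ==> open U ==> c2 U h"
 by (rule c2I[where g="%v x. h v"]) (simp_all add: c1_const bounded_linear_imp_has_derivative)

lemmas c1_mult = c1_bilinear[OF bounded_bilinear_mult]
lemmas c1_scaleR = c1_bilinear[OF bounded_bilinear_scaleR]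
lemmas c2_mult = c2_bilinear[OF bounded_bilinear_mult]
lemmas c2_scaleR = c2_bilinear[OF bounded_bilinear_scaleR]
lemmas dd_mult = dd_bilinear[OF bounded_bilinear_mult]
lemmas dd_scaleR = dd_bilinear[OF bounded_bilinear_scaleR]
lemmas c1_minus = c1_linear[OF bounded_linear_minus[OF bounded_linear_ident]]

lemma c1_diff: "c1 U f ==> c1 U g ==> c1 U (%x. f x - g x)"
 by (rule c1I[where g="%v x. dd f v x - dd g v x"])
   (auto intro!: has_derivative_diff continuous_on_diff c1_has c1_cont_dd)

lemma dd_diff: "c1 U f ==> c1 U g ==> x \<in> U ==> dd (%x. f x - g x) v x = dd f v x - dd g v x"
 by (rule dd_eq) (auto intro!: has_derivative_diff c1_has)

lemma c2_diff:
 assumes "c2 U f" "c2 U g" "open U" shows "c2 U (%x. f x - g x)"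
proof (rule c2I)
 show "((%x. f x - g x) has_derivative (%v. dd f v x - dd g v x)) (at x)" if "x \<in> U" for x
  by (rule has_derivative_diff[OF c1_has[OF c2_c1[OF assms(1)] that] c1_has[OF c2_c1[OF assms(2)] that]])
 show "c1 U (%x. dd f v x - dd g v x)" for v
  by (rule c1_diff[OF c2_dd[OF assms(1)] c2_dd[OF assms(2)]])
qed fact

lemma has_derivative_real_compose:
 assumes "(g has_real_derivative g') (at (f x))" "(f has_derivative f') (at x)"
 shows "((%x. g (f x)) has_derivative (%v. g' * f' v)) (at x)"
 using has_derivative_compose[OF assms(2) assms(1)[unfolded has_field_derivative_def]] by simp

lemma c1_compose:
 fixes f :: "'a::euclidean_space => real"
 assumes "c1 U f" "!!x. x \<in> U ==> (g has_real_derivative g' (f x)) (at (f x))" "continuous_on (f ` U) g'"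
 shows "c1 U (%x. g (f x))"
proof (rule c1I)
 show "((%x. g (f x)) has_derivative (%v. g' (f x) * dd f v x)) (at x)" if "x \<in> U" for x
  by (rule has_derivative_real_compose[OF assms(2)[OF that] c1_has[OF assms(1) that]])
 show "continuous_on U (%x. g' (f x) * dd f v x)" for v
  by (rule continuous_on_mult[OF continuous_on_compose2[OF assms(3) c1_continuous[OF assms(1)]] c1_cont_dd[OF assms(1)]]) auto
qed

lemma c2_compose:
 fixes f :: "'a::euclidean_space => real"
 assumes "c2 U f" "open U" "!!x. x \<in> U ==> (g has_real_derivative g' (f x)) (at (f x))"
  "!!x. x \<in> U ==> (g' has_real_derivative g'' (f x)) (at (f x))" "continuous_on (f ` U) g''"
 shows "c2 U (%x. g (f x))"
proof (rule c2I)
 show "((%x. g (f x)) has_derivative (%v. g' (f x) * dd f v x)) (at x)" if "x \<in> U" for x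
  by (rule has_derivative_real_compose[OF assms(3)[OF that] c1_has[OF c2_c1[OF assms(1)] that]])
 show "c1 U (%x. g' (f x) * dd f v x)" for v
  by (rule c1_mult[OF c1_compose[OF c2_c1[OF assms(1)], where g'=g''] c2_dd[OF assms(1)]]) (use assms in auto)
qed fact

text \<open>The open sets \<open>U\<close> and \<open>- K\<close> cover the space, and f is C^1 on
  both. Products of functions known only on U with a compactly supported factor become global in
  this way.\<close>

lemma c1_zero_extend:
 assumes "c1 U f" "open U" "closed K" "K \<subseteq> U" "!!x. x \<notin> K ==> f x = 0"
 shows "c1 UNIV f"
proof -
 have "c1 (- K) f"
  by (rule c1_cong[OF _ _ c1_const[of _ 0]]) (use assms in auto)
 hence "c1 (U \<union> - K) f" using c1_union assms by blast
 moreover have "U \<union> -K = UNIV" using assms by auto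
 ultimately show ?thesis by simp
qed

lemma c2_zero_extend:
 assumes "c2 U f" "open U" "closed K" "K \<subseteq> U" "!!x. x \<notin> K ==> f x = 0"
 shows "c2 UNIV f"
proof -
 have "c2 (- K) f"
  by (rule c2_cong[OF _ _ c2_const[of _ 0]]) (use assms in auto)
 hence "c2 (U \<union> - K) f" using c2_union assms by blast
 moreover have "U \<union> -K = UNIV" using assms by auto
 ultimately show ?thesis by simp
qed

lemma dd_zero_outside:
 assumes "closed K" "!!x. x \<notin> K ==> f x = 0" "x \<notin> K"
 shows "dd f v x = 0"
 using dd_cong[of "-K" f "%_. 0" x v] assms by (auto simp: dd_const)

lemma dd_linear_vec: "c1 U f ==> x \<in> U ==> linear (%v. dd f v x)"
 using c1_has has_derivative_linear by blast

text \<open>The second difference is the increment in t of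
  \<open>f (x + t v + s w) - f (x + t v)\<close>. Its t-derivative is a difference of two values of
  \<open>dd f v\<close> near x, which differentiability at the single point x identifies with
  \<open>s L w\<close> up to \<open>e * s\<close>; the mean value inequality does the rest.\<close>

lemma second_difference_bound:
 assumes f: "!!y. y \<in> ball x r ==> (f has_derivative (%v. dd f v y)) (at y)"
  and d: "(dd f v has_derivative L) (at x)" and "r > 0" "e > 0"
 shows "\<exists>d>0. \<forall>s. 0 < s \<and> s < d -->
  norm (f (x + s *\<^sub>R v + s *\<^sub>R w) - f (x + s *\<^sub>R v) - f (x + s *\<^sub>R w) + f x - (s * s) *\<^sub>R L w) <= e * (s * s)"
proof -
 \<comment> \<open>Every point \<open>x + t v + s' w\<close> with t and s' in [0,s] lies within
   \<open>s * c\<close> of x. Each of the two linearisation errors below is then at most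
   \<open>e * s / 2\<close>.\<close>
 define c where "c = norm v + norm w + 1"
 have c: "c > 0" by (simp add: c_def add_nonneg_pos)
 obtain d where d0: "d > 0" and dL: "!!y. norm (y - x) < d ==> norm (dd f v y - dd f v x - L (y - x)) <= (e / (2 * c)) * norm (y - x)"
  using d unfolding has_derivative_at_alt
  by (metis (no_types, opaque_lifting) assms(4) c divide_pos_pos mult_pos_pos zero_less_numeral)
 have lin: "linear L" using d has_derivative_linear by blast
 show ?thesis
 proof (intro exI[of _ "min d r / c"] conjI allI impI)
  show "min d r / c > 0" using d0 \<open>r > 0\<close> c by auto
  fix s assume s: "0 < s \<and> s < min d r / c"
  hence sc: "s * c < d" "s * c < r" using c by (auto simp: field_simps)
  let ?g = "%t. f (x + t *\<^sub>R v + s *\<^sub>R w) - f (x + t *\<^sub>R v) - t *\<^sub>R (s *\<^sub>R L w)"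
  have nb: "norm (t *\<^sub>R v + s' *\<^sub>R w) <= s * c" if "t \<in> {0..s}" "s' \<in> {0..s}" for t s'
  proof -
   have "norm (t *\<^sub>R v + s' *\<^sub>R w) <= t * norm v + s' * norm w"
    using that norm_triangle_ineq[of "t *\<^sub>R v" "s' *\<^sub>R w"] by auto
   also have "... <= s * norm v + s * norm w" using that by (intro add_mono mult_right_mono) auto
   also have "... <= s * c" using s by (simp add: c_def algebra_simps)
   finally show ?thesis .
  qed
  have "norm (?g s - ?g 0) <= (e * s) * norm (s - 0)"
  proof (rule differentiable_bound[where S="{0..s}" and f="?g" and f'="%t h. h *\<^sub>R (dd f v (x + t *\<^sub>R v + s *\<^sub>R w) - dd f v (x + t *\<^sub>R v) - s *\<^sub>R L w)"])
   show "convex {0..s}" by simp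
   show "s \<in> {0..s}" "0 \<in> {0..s}" using s by auto
   fix t assume t: "t \<in> {0..s}"
   have in1: "x + t *\<^sub>R v + s *\<^sub>R w \<in> ball x r" "x + t *\<^sub>R v \<in> ball x r"
   proof -
    have "dist x (x + (t *\<^sub>R v + s *\<^sub>R w)) < r" "dist x (x + (t *\<^sub>R v + 0 *\<^sub>R w)) < r"
     using nb[OF t, of s] nb[OF t, of 0] sc s by (simp_all only: dist_norm norm_minus_commute[of x] add_diff_cancel_left') auto
    thus "x + t *\<^sub>R v + s *\<^sub>R w \<in> ball x r" "x + t *\<^sub>R v \<in> ball x r"
     by (simp_all add: add.assoc)
   qed
   have l1: "linear (%v. dd f v (x + t *\<^sub>R v' + s'))" if "x + t *\<^sub>R v' + s' \<in> ball x r" for v' s'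
    using f[OF that] has_derivative_linear by blast
   have D1: "((%t. f (x + t *\<^sub>R v + s *\<^sub>R w)) has_derivative (%h. h *\<^sub>R dd f v (x + t *\<^sub>R v + s *\<^sub>R w))) (at t within {0..s})"
   proof -
    have "((%t. x + t *\<^sub>R v + s *\<^sub>R w) has_derivative (%h. h *\<^sub>R v)) (at t within {0..s})"
     by (auto intro!: derivative_eq_intros)
    from has_derivative_compose[OF this f[OF in1(1)]]
    show ?thesis using linear_scale[OF has_derivative_linear[OF f[OF in1(1)]]] by simp
   qed
   have D2: "((%t. f (x + t *\<^sub>R v)) has_derivative (%h. h *\<^sub>R dd f v (x + t *\<^sub>R v))) (at t within {0..s})"
   proof -
    have "((%t. x + t *\<^sub>R v) has_derivative (%h. h *\<^sub>R v)) (at t within {0..s})"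
     by (auto intro!: derivative_eq_intros)
    from has_derivative_compose[OF this f[OF in1(2)]]
    show ?thesis using linear_scale[OF has_derivative_linear[OF f[OF in1(2)]]] by simp
   qed
   show "(?g has_derivative (%h. h *\<^sub>R (dd f v (x + t *\<^sub>R v + s *\<^sub>R w) - dd f v (x + t *\<^sub>R v) - s *\<^sub>R L w))) (at t within {0..s})"
    using D1 D2 by (auto intro!: derivative_eq_intros simp: algebra_simps)
   let ?y1 = "x + t *\<^sub>R v + s *\<^sub>R w" and ?y2 = "x + t *\<^sub>R v"
   have "norm (?y1 - x) <= s * c" "norm (?y2 - x) <= s * c"
    using nb[OF t, of s] nb[OF t, of 0] s by (auto simp: add.assoc)
   hence b1: "norm (dd f v ?y1 - dd f v x - L (?y1 - x)) <= (e / (2*c)) * (s * c)"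
    and b2: "norm (dd f v ?y2 - dd f v x - L (?y2 - x)) <= (e / (2*c)) * (s * c)"
    using order_trans[OF dL[of ?y1] mult_left_mono[of _ "s * c" "e / (2*c)"]]
     order_trans[OF dL[of ?y2] mult_left_mono[of _ "s * c" "e / (2*c)"]] sc \<open>e > 0\<close> c
    by force+
   have "dd f v ?y1 - dd f v ?y2 - s *\<^sub>R L w =
     (dd f v ?y1 - dd f v x - L (?y1 - x)) - (dd f v ?y2 - dd f v x - L (?y2 - x))"
    by (simp add: linear_add[OF lin] linear_diff[OF lin] linear_scale[OF lin] algebra_simps)
   hence "norm (dd f v ?y1 - dd f v ?y2 - s *\<^sub>R L w) <= (e / (2*c)) * (s * c) + (e / (2*c)) * (s * c)"
    using norm_triangle_ineq4 b1 b2 by (smt (verit))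
   also have "... = e * s" using c by (simp add: field_simps)
   finally have "norm (dd f v ?y1 - dd f v ?y2 - s *\<^sub>R L w) <= e * s" .
   thus "onorm (%h. h *\<^sub>R (dd f v ?y1 - dd f v ?y2 - s *\<^sub>R L w)) <= e * s"
    by (intro onorm_le) (metis mult.commute mult_left_mono norm_ge_zero norm_scaleR real_norm_def)
  qed
  thus "norm (f (x + s *\<^sub>R v + s *\<^sub>R w) - f (x + s *\<^sub>R v) - f (x + s *\<^sub>R w) + f x - (s * s) *\<^sub>R L w) <= e * (s * s)"
   using s by (simp add: algebra_simps)
 qed
qed

text \<open>The second difference is symmetric in v and w, and divided by \<open>s * s\<close> it
  approximates both mixed derivatives.\<close>

lemma dd_symmetric:
 assumes "c2 U f" "open U" "x \<in> U"
 shows "dd (dd f v) w x = dd (dd f w) v x"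
proof -
 obtain r where r: "r > 0" "ball x r \<subseteq> U" using assms openE by blast
 have f: "!!y. y \<in> ball x r ==> (f has_derivative (%v. dd f v y)) (at y)"
  using c1_has[OF c2_c1[OF assms(1)]] r by blast
 have "norm (dd (dd f v) w x - dd (dd f w) v x) <= e" if "e > 0" for e
 proof -
  have e2: "e / 2 > 0" using that by simp
  obtain d1 where d1: "d1 > 0" "\<forall>s. 0 < s \<and> s < d1 -->
   norm (f (x + s *\<^sub>R v + s *\<^sub>R w) - f (x + s *\<^sub>R v) - f (x + s *\<^sub>R w) + f x - (s * s) *\<^sub>R dd (dd f v) w x) <= e/2 * (s * s)"
   using second_difference_bound[OF f c1_has[OF c2_dd[OF assms(1)] assms(3)] r(1) e2] by blast
  obtain d2 where d2: "d2 > 0" "\<forall>s. 0 < s \<and> s < d2 -->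
   norm (f (x + s *\<^sub>R w + s *\<^sub>R v) - f (x + s *\<^sub>R w) - f (x + s *\<^sub>R v) + f x - (s * s) *\<^sub>R dd (dd f w) v x) <= e/2 * (s * s)"
   using second_difference_bound[OF f c1_has[OF c2_dd[OF assms(1)] assms(3)] r(1) e2] by blast
  define s where "s = min d1 d2 / 2"
  have s: "0 < s" "s < d1" "s < d2" using d1 d2 by (auto simp: s_def)
  let ?q = "f (x + s *\<^sub>R v + s *\<^sub>R w) - f (x + s *\<^sub>R v) - f (x + s *\<^sub>R w) + f x"
  have q: "?q = f (x + s *\<^sub>R w + s *\<^sub>R v) - f (x + s *\<^sub>R w) - f (x + s *\<^sub>R v) + f x"
   by (simp add: algebra_simps)
  have "norm (?q - (s * s) *\<^sub>R dd (dd f v) w x) <= e/2 * (s * s)" "norm (?q - (s * s) *\<^sub>R dd (dd f w) v x) <= e/2 * (s * s)"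
   using d1(2)[rule_format, of s] d2(2)[rule_format, of s] s by (simp_all add: q[symmetric])
  hence "norm ((s * s) *\<^sub>R dd (dd f v) w x - (s * s) *\<^sub>R dd (dd f w) v x) <= e/2 * (s * s) + e/2 * (s * s)"
   using norm_triangle_ineq4[of "?q - (s * s) *\<^sub>R dd (dd f w) v x" "?q - (s * s) *\<^sub>R dd (dd f v) w x"]
   by (simp add: algebra_simps)
  hence "(s * s) * norm (dd (dd f v) w x - dd (dd f w) v x) <= (s * s) * e"
   unfolding scaleR_diff_right[symmetric] norm_scaleR by (simp add: mult.commute)
  thus ?thesis using s by simp
 qed
 hence "norm (dd (dd f v) w x - dd (dd f w) v x) <= 0"
  by (meson dense_ge)
 thus ?thesis by simp
qed

lemma dd_basis:
 assumes "c1 U f" "x \<in> U" shows "dd f v x = (\<Sum>b\<in>Basis. (v \<bullet> b) *\<^sub>R dd f b x)"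
proof -
 have "dd f (\<Sum>b\<in>Basis. (v \<bullet> b) *\<^sub>R b) x = (\<Sum>b\<in>Basis. (v \<bullet> b) *\<^sub>R dd f b x)"
  by (simp add: linear_sum[OF dd_linear_vec[OF assms]] linear_scale[OF dd_linear_vec[OF assms]])
 thus ?thesis by (simp add: euclidean_representation)
qed

lemma compact_subset_cball0: "compact K ==> \<exists>R. K \<subseteq> cball (0::'a::euclidean_space) R"
 using compact_imp_bounded[of K] unfolding bounded_iff by (metis mem_cball_0 subsetI)

section \<open>Uniform expansions and integration by parts for functions of compact support\<close>

lemma uniformly_continuous_compact_support:
 fixes f :: "'a::euclidean_space => 'b::real_normed_vector"
 assumes "continuous_on UNIV f" "compact K" "!!x. x \<notin> K ==> f x = 0"
 shows "uniformly_continuous_on UNIV f"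
 unfolding uniformly_continuous_on_def
proof (intro allI impI)
 fix e :: real assume e: "e > 0"
 obtain R where R: "K \<subseteq> cball 0 R" using compact_subset_cball0[OF assms(2)] by blast
 have "uniformly_continuous_on (cball 0 (R+1)) f"
  by (intro compact_uniformly_continuous continuous_on_subset[OF assms(1)]) auto
 then obtain d where d: "d > 0" "!!x y. x \<in> cball 0 (R+1) ==> y \<in> cball 0 (R+1) ==> dist y x < d ==> dist (f y) (f x) < e"
  using e unfolding uniformly_continuous_on_def by metis
 have "dist (f y) (f x) < e" if "dist y x < min d 1" for x y
 proof (cases "x \<in> cball 0 (R+1) \<and> y \<in> cball 0 (R+1)")
  case False
  have "norm x <= norm y + dist y x" "norm y <= norm x + dist y x"
   by (metis dist_norm norm_triangle_sub add.commute dist_commute)+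
  hence "norm x > R" "norm y > R" using False that by auto
  hence "x \<notin> K" "y \<notin> K" using R by auto
  thus ?thesis using assms(3) e by simp
 qed (use d that in auto)
 thus "\<exists>d>0. \<forall>x\<in>UNIV. \<forall>x'\<in>UNIV. dist x' x < d --> dist (f x') (f x) < e"
  using d by (intro exI[of _ "min d 1"]) auto
qed

text \<open>The error is uniform in x because the finitely many basis derivatives are uniformly
  continuous. This uniformity takes the place of dominated convergence when a derivative is taken
  under an integral.\<close>

lemma uniform_taylor:
 fixes f :: "'a::euclidean_space => 'b::real_normed_vector"
 assumes f: "c1 UNIV f" and K: "compact K" "!!x. x \<notin> K ==> f x = 0" and e: "e > 0"
 shows "\<exists>d>0. \<forall>x h. norm h < d --> norm (f (x + h) - f x - dd f h x) <= e * norm h"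
proof -
 define e' where "e' = e / real DIM('a)"
 have e': "e' > 0" using e by (simp add: e'_def)
 have "\<exists>d>0. \<forall>x y. dist y x < d --> dist (dd f b y) (dd f b x) < e'" for b
 proof -
  have "uniformly_continuous_on UNIV (dd f b)"
   by (rule uniformly_continuous_compact_support[OF c1_cont_dd[OF f] K(1)])
     (rule dd_zero_outside[OF compact_imp_closed[OF K(1)]], use K(2) in auto)
  thus ?thesis using e' unfolding uniformly_continuous_on_def by auto
 qed
 then obtain D where D: "!!b. D b > 0" "!!b x y. dist y x < D b ==> dist (dd f b y) (dd f b x) < e'"
  by metis
 define d where "d = Min (D ` (Basis::'a set))"
 have d0: "d > 0" unfolding d_def using D(1) by (subst Min_gr_iff) auto
 have dle: "d <= D b" if "b \<in> Basis" for b unfolding d_def using that by auto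
 have "norm (f (x + h) - f x - dd f h x) <= e * norm h" if h: "norm h < d" for x h
 proof -
  have "norm (f (x + h) - f x - dd f (x + h - x) x) <= norm (x + h - x) * e"
  proof (rule differentiable_bound_linearization[where S="ball x d" and f'="%y v. dd f v y"])
   show "x + t *\<^sub>R (x + h - x) \<in> ball x d" if "t \<in> {0..1}" for t
   proof -
    have "norm (t *\<^sub>R h) <= 1 * norm h" using that unfolding norm_scaleR by (intro mult_right_mono) auto
    thus ?thesis using h by (simp add: dist_norm)
   qed
   show "(f has_derivative (%v. dd f v y)) (at y within ball x d)" for y
    using c1_has[OF f] has_derivative_at_withinI by blast
   show "x \<in> ball x d" using d0 by simp
   fix y assume y: "y \<in> ball x d"
   show "onorm ((%v. dd f v y) - (%v. dd f v x)) <= e"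
   proof (rule onorm_le)
    fix v
    have "norm (dd f v y - dd f v x) = norm (\<Sum>b\<in>Basis. (v \<bullet> b) *\<^sub>R (dd f b y - dd f b x))"
     by (simp add: dd_basis[OF f, of _ v] scaleR_diff_right sum_subtractf)
    also have "... <= (\<Sum>b\<in>(Basis::'a set). norm v * e')"
    proof (rule order_trans[OF norm_sum sum_mono])
     fix b :: 'a assume b: "b \<in> Basis"
     have "norm (dd f b y - dd f b x) <= e'"
      using D(2)[of y x b] dle[OF b] y by (simp add: dist_norm norm_minus_commute)
     moreover have "\<bar>v \<bullet> b\<bar> <= norm v" by (rule Basis_le_norm[OF b])
     ultimately show "norm ((v \<bullet> b) *\<^sub>R (dd f b y - dd f b x)) <= norm v * e'"
      unfolding norm_scaleR by (intro mult_mono) auto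
    qed
    also have "... = e * norm v" by (simp add: e'_def)
    finally show "norm (((%v. dd f v y) - (%v. dd f v x)) v) <= e * norm v" by (simp add: fun_diff_def)
   qed
  qed
  thus ?thesis by (simp add: mult.commute)
 qed
 thus ?thesis using d0 by blast
qed

lemma integrable_compact_support:
 fixes f :: "'a::euclidean_space => 'b::{banach, second_countable_topology}"
 assumes "continuous_on UNIV f" "compact K" "!!x. x \<notin> K ==> f x = 0"
 shows "intbl f"
proof -
 have "(%x. indicator K x *\<^sub>R f x) = f" using assms(3) by (auto simp: indicator_def fun_eq_iff)
 thus ?thesis using borel_integrable_compact[OF assms(2) continuous_on_subset[OF assms(1)]] by simp
qed

lemma lborel_reflect: "distr lborel borel (%x. t - x) = (lborel :: 'a::euclidean_space measure)"
 using lborel_affine[of "-1" t] by (simp add: density_1)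

lemma lborel_shift: "distr lborel borel (%x. x + t) = (lborel :: 'a::euclidean_space measure)"
 using lborel_affine[of "1" t] by (simp add: density_1 add.commute)

lemma nn_integral_shift:
 fixes f :: "'a::euclidean_space => ennreal"
 shows "f \<in> borel_measurable borel ==> (NNL x. f (x + t)) = (NNL x. f x)"
 using nn_integral_distr[of "%x. x + t" lborel borel f] lborel_shift[of t] by simp

lemma
 fixes f :: "'a::euclidean_space => 'b::{banach, second_countable_topology}"
 assumes "f \<in> borel_measurable borel"
 shows integral_shift: "(LBINT x. f (x + t)) = (LBINT x. f x)"
  and integrable_shift: "intbl (%x. f (x + t)) \<longleftrightarrow> intbl f"
  and integral_reflect: "(LBINT x. f (t - x)) = (LBINT x. f x)"
  and integrable_reflect: "intbl (%x. f (t - x)) \<longleftrightarrow> intbl f"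
 using integral_distr[of "%x. x + t" lborel borel f] integrable_distr_eq[of "%x. x + t" lborel borel f]
  integral_distr[of "%x. t - x" lborel borel f] integrable_distr_eq[of "%x. t - x" lborel borel f]
  lborel_shift[of t] lborel_reflect[of t] assms by simp_all

text \<open>By translation invariance the integral of \<open>f (x + t v) - f x\<close> is zero, and
  this difference is t times the derivative up to a uniformly small error supported in a fixed
  ball.\<close>

lemma integral_dd_zero:
 fixes f :: "'a::euclidean_space => 'b::{banach, second_countable_topology}"
 assumes f: "c1 UNIV f" and K: "compact K" "!!x. x \<notin> K ==> f x = 0"
 shows "intbl (dd f v)" "(LBINT x. dd f v x) = 0"
proof -
 have z: "dd f v x = 0" if "x \<notin> K" for v x
  by (rule dd_zero_outside[OF compact_imp_closed[OF K(1)]]) (use K(2) that in auto)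
 show int: "intbl (dd f v)" for v
  by (rule integrable_compact_support[OF c1_cont_dd[OF f] K(1) z])
 have intf: "intbl f" by (rule integrable_compact_support[OF c1_continuous[OF f] K])
 hence mf: "f \<in> borel_measurable borel" by simp
 obtain R where R: "K \<subseteq> cball 0 R" using compact_subset_cball0[OF K(1)] by blast
 let ?B = "cball (0::'a) (R + 1)"
 have fin: "emeasure lborel ?B < \<infinity>" by (rule emeasure_lborel_cball_finite)
 have "norm (LBINT x. dd f v x) <= e * (norm v * measure lborel ?B)" if e: "e > 0" for e
 proof -
  obtain d where d: "d > 0" "!!x h. norm h < d ==> norm (f (x + h) - f x - dd f h x) <= e * norm h"
   using uniform_taylor[OF f K e] by blast
  \<comment> \<open>The length of \<open>t v\<close> is below d, for the expansion, and at most 1,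
    so that the shifted support stays in the ball of radius \<open>R + 1\<close>.\<close>
  define t where "t = min d 1 / (2 * (1 + norm v))"
  have nv: "1 + norm v > 0" by (simp add: add_pos_nonneg)
  have t: "t > 0" using d nv by (simp add: t_def)
  have "t * norm v <= t * (1 + norm v)" using t by simp
  also have "... = min d 1 / 2" using nv unfolding t_def by (metis (no_types, lifting) divide_divide_eq_left' nonzero_eq_divide_eq less_irrefl mult.commute)
  finally have tv: "norm (t *\<^sub>R v) < d" "norm (t *\<^sub>R v) <= 1" using t d by auto
  let ?g = "%x. f (x + t *\<^sub>R v) - f x - dd f (t *\<^sub>R v) x"
  have i1: "intbl (%x. f (x + t *\<^sub>R v))" using intf integrable_shift[OF mf] by blast
  have ig: "intbl ?g" using i1 intf int by (intro bi_integrable_diff)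
  have "(LBINT x. ?g x) = (LBINT x. f (x + t *\<^sub>R v)) - (LBINT x. f x) - (LBINT x. dd f (t *\<^sub>R v) x)"
   using i1 intf int by simp
  also have "... = - (LBINT x. t *\<^sub>R dd f v x)"
   using integral_shift[OF mf] linear_scale[OF dd_linear_vec[OF f]] by simp
  finally have "t * norm (LBINT x. dd f v x) = norm (LBINT x. ?g x)" using t by simp
  also have "... <= (LBINT x. norm (?g x))" by (rule integral_norm_bound)
  also have "... <= (LBINT x. indicator ?B x * (e * norm (t *\<^sub>R v)))"
  proof (rule integral_mono)
   show "intbl (%x. norm (?g x))" using ig by simp
   show "intbl (%x. indicator ?B x * (e * norm (t *\<^sub>R v)))"
    using fin by (intro integrable_mult_left integrable_real_indicator) auto
   show "norm (?g x) <= indicator ?B x * (e * norm (t *\<^sub>R v))" for x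
   proof (cases "x \<in> ?B")
    case False
    have "norm x <= norm (x + t *\<^sub>R v) + norm (t *\<^sub>R v)" by (metis add_diff_cancel_right' norm_triangle_ineq4)
    hence "x \<notin> K" "x + t *\<^sub>R v \<notin> K" using False R tv by auto
    thus ?thesis using K z e by simp
   next
    case True
    show ?thesis using d(2)[OF tv(1), of x] True by (simp del: norm_scaleR)
   qed
  qed
  also have "... = t * (e * (norm v * measure lborel ?B))" using t by simp
  finally show ?thesis using t by simp
 qed
 hence "norm (LBINT x. dd f v x) <= 0"
 proof -
  assume *: "!!e. 0 < e ==> norm (LBINT x. dd f v x) <= e * (norm v * measure lborel ?B)"
  let ?c = "norm v * measure lborel ?B"
  have c: "?c + 1 > 0" by (simp add: add_nonneg_pos)
  show ?thesis
  proof (rule field_le_epsilon)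
   fix e :: real assume "e > 0"
   have "norm (LBINT x. dd f v x) <= (e / (?c + 1)) * ?c" by (rule *) (use \<open>e > 0\<close> c in simp)
   also have "... <= e" using \<open>e > 0\<close> c by (simp add: field_simps)
   finally show "norm (LBINT x. dd f v x) <= 0 + e" by simp
  qed
 qed
 thus "(LBINT x. dd f v x) = 0" by simp
qed

section \<open>Mollification\<close>

definition conv :: "('a::euclidean_space => real) => ('a => 'b::{banach, second_countable_topology}) => 'a => 'b" where
 "conv k f z = (LBINT w. k (z - w) *\<^sub>R f w)"

lemma bounded_compact_support:
 fixes k :: "'a::euclidean_space => 'b::real_normed_vector"
 assumes "continuous_on UNIV k" "compact K" "!!x. x \<notin> K ==> k x = 0"
 shows "\<exists>B. \<forall>x. norm (k x) <= B"
proof -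
 have "bounded (k ` K)"
  by (intro compact_imp_bounded compact_continuous_image continuous_on_subset[OF assms(1)] assms(2)) auto
 then obtain B where B: "!!x. x \<in> K ==> norm (k x) <= B" by (auto simp: bounded_iff)
 have "norm (k x) <= max B 0" for x
  using B[of x] assms(3)[of x] by (cases "x \<in> K") auto
 thus ?thesis by blast
qed

lemma conv_integrable:
 fixes f :: "'a::euclidean_space => 'b::{banach, second_countable_topology}"
 assumes "continuous_on UNIV k" "!!x. \<bar>k x\<bar> <= B" "intbl f"
 shows "intbl (%w. k (z - w) *\<^sub>R f w)"
proof (rule bi_integrable_bound[where f="%w. B * norm (f w)"])
 show "intbl (%w. B * norm (f w))" using assms(3) by simp
 have [measurable]: "k \<in> borel_measurable borel" by (rule borel_measurable_continuous_onI[OF assms(1)])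
 show "(%w. k (z - w) *\<^sub>R f w) \<in> borel_measurable lborel"
  using borel_measurable_integrable[OF assms(3)] by measurable
 show "AE w in lborel. norm (k (z - w) *\<^sub>R f w) <= norm (B * norm (f w))"
  using assms(2) by (intro AE_I2) (simp add: abs_mult, metis abs_ge_self mult_right_mono norm_ge_zero order_trans)
qed

lemma conv_continuous:
 fixes f :: "'a::euclidean_space => 'b::{banach, second_countable_topology}"
 assumes k: "continuous_on UNIV k" "compact K" "!!x. x \<notin> K ==> k x = 0" and f: "intbl f"
 shows "continuous_on UNIV (conv k f)"
 unfolding continuous_on_iff
proof (intro ballI allI impI)
 fix z :: 'a and e :: real assume e: "e > 0"
 obtain B where B: "!!x. \<bar>k x\<bar> <= B" using bounded_compact_support[OF k] by auto
 define I where "I = (LBINT w. norm (f w)) + 1"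
 have I: "I > 0" "(LBINT w. norm (f w)) < I" by (simp_all add: I_def add_nonneg_pos)
 have "e / I > 0" using e I by simp
 then obtain d where d: "d > 0" "!!x y. dist y x < d ==> dist (k y) (k x) < e / I"
  using uniformly_continuous_compact_support[OF k] unfolding uniformly_continuous_on_def by (metis UNIV_I)
 have "dist (conv k f z') (conv k f z) < e" if z': "dist z' z < d" for z'
 proof -
  have "conv k f z' - conv k f z = (LBINT w. (k (z' - w) - k (z - w)) *\<^sub>R f w)"
   unfolding conv_def scaleR_diff_left
   by (rule bi_integral_diff[symmetric]; rule conv_integrable[OF k(1) B f])
  hence "dist (conv k f z') (conv k f z) <= (LBINT w. norm ((k (z' - w) - k (z - w)) *\<^sub>R f w))"
   using integral_norm_bound[of lborel "%w. (k (z' - w) - k (z - w)) *\<^sub>R f w"] by (simp only: dist_norm)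
  also have "... <= (LBINT w. (e / I) * norm (f w))"
  proof (rule integral_mono)
   show "intbl (%w. norm ((k (z' - w) - k (z - w)) *\<^sub>R f w))"
    unfolding scaleR_diff_left
    by (intro integrable_norm bi_integrable_diff conv_integrable[OF k(1) B f])
   show "intbl (%w. (e / I) * norm (f w))" using f by simp
   show "norm ((k (z' - w) - k (z - w)) *\<^sub>R f w) <= (e / I) * norm (f w)" for w
    unfolding norm_scaleR using d(2)[of "z' - w" "z - w"] z'
    by (intro mult_right_mono) (auto simp: dist_norm)
  qed
  also have "... = (e / I) * (LBINT w. norm (f w))" by simp
  also have "... < (e / I) * I" by (rule mult_strict_left_mono) (use I e in auto)
  also have "... = e" using I by simp
  finally show ?thesis .
 qed
 thus "\<exists>d>0. \<forall>x'\<in>UNIV. dist x' z < d --> dist (conv k f x') (conv k f z) < e" using d(1) by blast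
qed

text \<open>All derivatives fall on the kernel, so f need only be integrable: the uniform expansion
  of k is integrated against \<open>norm (f w)\<close>.\<close>

lemma conv_has_derivative:
 fixes f :: "'a::euclidean_space => 'b::{banach, second_countable_topology}"
 assumes k: "c1 UNIV k" "compact K" "!!x. x \<notin> K ==> k x = 0" and f: "intbl f"
 shows "(conv k f has_derivative (%v. conv (dd k v) f z)) (at z)"
proof -
 have kz: "dd k v x = 0" if "x \<notin> K" for v x
  by (rule dd_zero_outside[OF compact_imp_closed[OF k(2)]]) (use k(3) that in auto)
 obtain B where B: "!!x. \<bar>k x\<bar> <= B" using bounded_compact_support[OF c1_continuous[OF k(1)] k(2,3)] by auto
 have "\<exists>B. \<forall>x. \<bar>dd k v x\<bar> <= B" for v
  using bounded_compact_support[OF c1_cont_dd[OF k(1)] k(2) kz] by auto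
 then obtain B' where B': "!!v x. \<bar>dd k v x\<bar> <= B' v" by metis
 note i1 = conv_integrable[OF c1_continuous[OF k(1)] B f]
 note i2 = conv_integrable[OF c1_cont_dd[OF k(1)] B' f]
 have "linear (%v. conv (dd k v) f z)"
 proof (rule linearI)
  fix a b :: 'a and r :: real
  show "conv (dd k (a + b)) f z = conv (dd k a) f z + conv (dd k b) f z"
   unfolding conv_def using bi_integral_add[OF i2[of a z] i2[of b z]]
   by (simp add: linear_add[OF dd_linear_vec[OF k(1) UNIV_I]] scaleR_add_left)
  show "conv (dd k (r *\<^sub>R a)) f z = r *\<^sub>R conv (dd k a) f z"
   unfolding conv_def
   by (simp add: linear_scale[OF dd_linear_vec[OF k(1) UNIV_I]] flip: scaleR_scaleR)
 qed
 hence bl: "bounded_linear (%v. conv (dd k v) f z)" using linear_conv_bounded_linear by blast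
 define I where "I = (LBINT w. norm (f w)) + 1"
 have I: "I > 0" "(LBINT w. norm (f w)) <= I" by (simp_all add: I_def add_nonneg_pos)
 have "\<exists>d>0. \<forall>y. norm (y - z) < d --> norm (conv k f y - conv k f z - conv (dd k (y - z)) f z) <= e * norm (y - z)"
  if e: "e > 0" for e
 proof -
  have "e / I > 0" using e I by simp
  then obtain d where d: "d > 0" "!!x h. norm h < d ==> norm (k (x + h) - k x - dd k h x) <= (e / I) * norm h"
   using uniform_taylor[OF k, of "e / I"] by blast
  have "norm (conv k f y - conv k f z - conv (dd k (y - z)) f z) <= e * norm (y - z)" if y: "norm (y - z) < d" for y
  proof -
   let ?g = "%w. (k (y - w) - k (z - w) - dd k (y - z) (z - w)) *\<^sub>R f w"
   have ig: "intbl ?g"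
    unfolding scaleR_diff_left by (intro bi_integrable_diff i1 i2)
   have "conv k f y - conv k f z - conv (dd k (y - z)) f z = (LBINT w. ?g w)"
    unfolding conv_def scaleR_diff_left
    using i1[of y] i1[of z] i2[of "y - z" z] by simp
   hence "norm (conv k f y - conv k f z - conv (dd k (y - z)) f z) <= (LBINT w. norm (?g w))"
    using integral_norm_bound[of lborel ?g] by (simp only:)
   also have "... <= (LBINT w. ((e / I) * norm (y - z)) * norm (f w))"
   proof (rule integral_mono)
    show "intbl (%w. norm (?g w))" by (rule integrable_norm[OF ig])
    show "intbl (%w. ((e / I) * norm (y - z)) * norm (f w))" using f by simp
    show "norm (?g w) <= ((e / I) * norm (y - z)) * norm (f w)" for w
     unfolding norm_scaleR using d(2)[of "y - z" "z - w"] y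
     by (intro mult_right_mono) auto
   qed
   also have "... = ((e / I) * norm (y - z)) * (LBINT w. norm (f w))" by simp
   also have "... <= ((e / I) * norm (y - z)) * I" by (rule mult_left_mono) (use I e in auto)
   also have "... = e * norm (y - z)" using I by simp
   finally show ?thesis .
  qed
  thus ?thesis using d(1) by blast
 qed
 thus ?thesis unfolding has_derivative_at_alt using bl by blast
qed

lemma
 fixes f :: "'a::euclidean_space => 'b::{banach, second_countable_topology}"
 assumes k: "c1 UNIV k" "compact K" "!!x. x \<notin> K ==> k x = 0" and f: "intbl f"
 shows conv_c1: "c1 UNIV (conv k f)" and dd_conv: "dd (conv k f) v z = conv (dd k v) f z"
proof -
 have kz: "dd k v x = 0" if "x \<notin> K" for v x
  by (rule dd_zero_outside[OF compact_imp_closed[OF k(2)]]) (use k(3) that in auto)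
 show "dd (conv k f) v z = conv (dd k v) f z"
  by (rule dd_eq[OF conv_has_derivative[OF k f]])
 show "c1 UNIV (conv k f)"
  by (rule c1I[OF conv_has_derivative[OF k f]]) (assumption, rule conv_continuous[OF c1_cont_dd[OF k(1)] k(2) kz f])
qed

lemma conv_c2:
 fixes f :: "'a::euclidean_space => 'b::{banach, second_countable_topology}"
 assumes k: "c2 UNIV k" "compact K" "!!x. x \<notin> K ==> k x = 0" and f: "intbl f"
 shows "c2 UNIV (conv k f)"
proof (rule c2I[OF conv_has_derivative[OF c2_c1[OF k(1)] k(2,3) f]])
 have kz: "dd k v x = 0" if "x \<notin> K" for v x
  by (rule dd_zero_outside[OF compact_imp_closed[OF k(2)]]) (use k(3) that in auto)
 show "c1 UNIV (conv (dd k v) f)" for v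
  by (rule conv_c1[OF c2_dd[OF k(1)] k(2) kz f])
qed auto

section \<open>A twice differentiable mollifier\<close>

lemma max0_power_deriv:
 "((%t. (max 0 t) ^ Suc (Suc n)) has_real_derivative real (Suc (Suc n)) * (max 0 t) ^ Suc n) (at t)" for t :: real
proof -
 consider "t > 0" | "t < 0" | "t = 0" by linarith
 thus ?thesis
 proof cases
  case 1
  have "((%t. t ^ Suc (Suc n)) has_real_derivative real (Suc (Suc n)) * (max 0 t) ^ Suc n) (at t)"
   using DERIV_pow[of "Suc (Suc n)" t UNIV] 1 by simp
  thus ?thesis
   by (rule has_field_derivative_transform_within_open[where S="{0<..}"]) (use 1 in auto)
 next
  case 2
  have "((%t. 0) has_real_derivative real (Suc (Suc n)) * (max 0 t) ^ Suc n) (at t)"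
   using 2 by auto
  thus ?thesis
   by (rule has_field_derivative_transform_within_open[where S="{..<0}"]) (use 2 in auto)
 next
  case 3
  have "((%h::real. (max 0 h) ^ Suc n) \<longlongrightarrow> (max 0 0) ^ Suc n) (at 0)" by (intro tendsto_intros)
  hence *: "((%h::real. (max 0 h) ^ Suc n) \<longlongrightarrow> 0) (at 0)" by simp
  have "((%h::real. ((max 0 (0 + h)) ^ Suc (Suc n) - (max 0 0) ^ Suc (Suc n)) / h) \<longlongrightarrow> 0) (at 0)"
  proof (rule Lim_null_comparison[OF _ *])
   show "\<forall>\<^sub>F h::real in at 0. norm (((max 0 (0 + h)) ^ Suc (Suc n) - (max 0 0) ^ Suc (Suc n)) / h) <= (max 0 h) ^ Suc n"
    by (rule eventuallyI) (auto simp: max_def field_simps power_abs)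
  qed
  thus ?thesis using 3 by (simp add: DERIV_def)
 qed
qed

text \<open>The cube of the positive part is C^2 and no better. This is enough, since no function is
  differentiated more than twice, and it serves both for mollifiers and for cutoff
  functions.\<close>

definition pcube :: "real => real" where "pcube t = (max 0 t) ^ 3"

lemma pcube_deriv: "(pcube has_real_derivative 3 * (max 0 t)^2) (at t)"
 using max0_power_deriv[of 1 t] unfolding pcube_def[abs_def] by (simp add: numeral_eq_Suc)

lemma pcube_deriv2: "((%t. 3 * (max 0 t)^2) has_real_derivative 6 * max 0 t) (at t)" for t :: real
 using DERIV_cmult[OF max0_power_deriv[of 0 t], of 3] by (simp add: numeral_eq_Suc)

lemma c2_pcube: fixes f :: "'a::euclidean_space => real"
 shows "c2 U f ==> open U ==> c2 U (%x. pcube (f x))"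
 by (rule c2_compose[where g'="%t. 3 * (max 0 t)^2" and g''="%t. 6 * max 0 t"])
   (auto simp: pcube_deriv pcube_deriv2 intro!: continuous_intros)

text \<open>A function of the norm only, so that on complex n-space the mollifier is invariant under
  multiplication by \<open>cis t\<close>; the mean value arguments rest on this.\<close>

definition ker0 :: "real => 'a::euclidean_space => real" where "ker0 e z = pcube (1 - (1/e\<^sup>2) * (z \<bullet> z))"

definition moll :: "real => 'a::euclidean_space => real" where
 "moll e z = (1 / (LBINT w. ker0 e (w::'a))) * ker0 e z"

lemma c2_ker0: "c2 UNIV (ker0 e :: 'a::euclidean_space => real)"
proof -
 have id: "c2 UNIV (%z::'a. z)" by (rule c2_bounded_linear) auto
 have "c2 UNIV (%z::'a. (1/e\<^sup>2) * (z \<bullet> z))"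
  by (rule c2_mult[OF c2_const c2_bilinear[OF bounded_bilinear_inner id id]]) auto
 hence "c2 UNIV (%z::'a. 1 - (1/e\<^sup>2) * (z \<bullet> z))" by (intro c2_diff c2_const) auto
 thus ?thesis unfolding ker0_def[abs_def] by (rule c2_pcube) auto
qed

lemma ker0_zero: "e > 0 ==> norm z >= e ==> ker0 e z = 0"
proof -
 assume "e > 0" "norm z >= e"
 hence "e\<^sup>2 <= z \<bullet> z" using power_mono[of e "norm z" 2] by (simp add: dot_square_norm)
 hence "1 - (1/e\<^sup>2) * (z \<bullet> z) <= 0" using \<open>e > 0\<close> by (simp add: field_simps)
 thus ?thesis by (simp add: ker0_def pcube_def)
qed

lemma ker0_nonneg: "ker0 e z >= 0" by (simp add: ker0_def pcube_def)

lemma ker0_integrable: "e > 0 ==> intbl (ker0 e :: 'a::euclidean_space => real)"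
 by (rule integrable_compact_support[OF c2_continuous[OF c2_ker0] compact_cball[of 0 e]]) (auto simp: ker0_zero)

lemma ker0_integral_pos: assumes "e > 0" shows "(LBINT w. ker0 e (w::'a::euclidean_space)) > 0"
proof -
 have b: "ker0 e w >= 1/8" if "norm w < e/2" for w :: 'a
 proof -
  have "(norm w)^2 <= (e/2)^2" using that by (intro power_mono) auto
  hence "(1/e\<^sup>2) * (w \<bullet> w) <= 1/4" using assms by (simp add: dot_square_norm field_simps)
  hence "(1/2::real) <= max 0 (1 - (1/e\<^sup>2) * (w \<bullet> w))" by linarith
  hence "(1/2::real) ^ 3 <= (max 0 (1 - (1/e\<^sup>2) * (w \<bullet> w))) ^ 3" by (rule power_mono) simp
  thus ?thesis by (simp add: ker0_def pcube_def power3_eq_cube)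
 qed
 have "0 < (1/8) * measure lborel (ball (0::'a) (e/2))"
  using assms content_ball_pos[of "e/2" "0::'a"] by simp
 also have "... = (LBINT w. indicator (ball (0::'a) (e/2)) w * (1/8))" by simp
 also have "... <= (LBINT w. ker0 e (w::'a))"
 proof (rule integral_mono)
  show "intbl (%w. indicator (ball (0::'a) (e/2)) w * (1/8::real))"
   using emeasure_lborel_ball_finite[of "0::'a" "e/2"] by (intro integrable_mult_left integrable_real_indicator) auto
 qed (use b ker0_nonneg ker0_integrable[OF assms] in \<open>auto simp: indicator_def\<close>)
 finally show ?thesis .
qed

lemma moll_nonneg: "e > 0 ==> moll e z >= 0"
 unfolding moll_def using ker0_integral_pos ker0_nonneg by (metis mult_nonneg_nonneg divide_nonneg_pos zero_le_one)

lemma c2_moll: "c2 UNIV (moll e :: 'a::euclidean_space => real)"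
 unfolding moll_def[abs_def] by (rule c2_mult[OF c2_const c2_ker0]) auto

lemma moll_zero: "e > 0 ==> norm z >= e ==> moll e z = 0"
 by (simp add: moll_def ker0_zero)

lemma moll_zero': "e > 0 ==> z \<notin> cball 0 e ==> moll e z = 0"
 by (simp add: moll_zero)

lemma moll_integrable: "e > 0 ==> intbl (moll e :: 'a::euclidean_space => real)"
 unfolding moll_def[abs_def] by (intro integrable_mult_right ker0_integrable)

lemma moll_integral: "e > 0 ==> (LBINT w. moll e (w::'a::euclidean_space)) = 1"
 unfolding moll_def[abs_def] using ker0_integral_pos[of e, where 'a='a] by simp

lemma moll_even: "moll e (- z) = moll e z" by (simp add: moll_def ker0_def)

lemma moll_swap: "moll e (z - w) = moll e (w - z)"
 using moll_even[of e "w - z"] by simp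

lemma moll_norm: "norm z = norm w ==> moll e z = moll e w" for z w :: "'a::euclidean_space"
 by (simp add: moll_def ker0_def dot_square_norm)

lemma moll_measurable[measurable]: "moll e \<in> borel_measurable borel"
 by (rule borel_measurable_continuous_onI[OF c2_continuous[OF c2_moll]])

lemma moll_bound: "e > 0 ==> \<exists>B. \<forall>x. \<bar>moll e (x::'a::euclidean_space)\<bar> <= B"
 using bounded_compact_support[OF c2_continuous[OF c2_moll[of e]] compact_cball[of "0::'a" e]] moll_zero'[of e] by auto

lemma moll_conv_integrable:
 fixes f :: "'a::euclidean_space => 'b::{banach, second_countable_topology}"
 assumes "e > 0" "intbl f" shows "intbl (%w. moll e (z - w) *\<^sub>R f w)"
 using conv_integrable[OF c2_continuous[OF c2_moll] _ assms(2)] moll_bound[OF assms(1)] by blast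

lemma c2_conv_moll:
 fixes f :: "'a::euclidean_space => 'b::{banach, second_countable_topology}"
 assumes "e > 0" "intbl f" shows "c2 UNIV (conv (moll e) f)"
 by (rule conv_c2[OF c2_moll compact_cball moll_zero'[OF assms(1)] assms(2)])

lemma integral_moll_shift: "e > 0 ==> (LBINT w. moll e (z - w)) = 1" "e > 0 ==> intbl (%w. moll e (z - w))"
 for z :: "'a::euclidean_space"
 using integral_reflect[of "moll e" z] integrable_reflect[of "moll e" z] moll_integral[of e, where 'a='a] moll_integrable[of e, where 'a='a] by auto

section \<open>Cauchy-Schwarz inequalities and mollification in L2\<close>

lemma cs_integral:
 fixes u v :: "'a => real"
 assumes [measurable]: "u \<in> borel_measurable M" "v \<in> borel_measurable M"
  and i: "integrable M (%x. (u x)^2)" "integrable M (%x. (v x)^2)"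
 shows "integrable M (%x. u x * v x)" "(\<integral>x. u x * v x \<partial>M)^2 <= (\<integral>x. (u x)^2 \<partial>M) * (\<integral>x. (v x)^2 \<partial>M)"
proof -
 show int: "integrable M (%x. u x * v x)"
 proof (rule bi_integrable_bound[OF bi_integrable_add[OF i]])
  show "AE x in M. norm (u x * v x) <= norm ((u x)^2 + (v x)^2)"
  proof (rule AE_I2)
   fix x
   have "0 <= (\<bar>u x\<bar> - \<bar>v x\<bar>)^2" by simp
   hence "2 * (\<bar>u x\<bar> * \<bar>v x\<bar>) <= (u x)^2 + (v x)^2" by (simp add: power2_diff)
   moreover have "0 <= \<bar>u x\<bar> * \<bar>v x\<bar>" by simp
   ultimately have "\<bar>u x\<bar> * \<bar>v x\<bar> <= (u x)^2 + (v x)^2" by linarith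
   thus "norm (u x * v x) <= norm ((u x)^2 + (v x)^2)" by (simp add: abs_mult)
  qed
 qed simp
 define A B C where "A = (\<integral>x. (u x)^2 \<partial>M)" and "B = (\<integral>x. u x * v x \<partial>M)" and "C = (\<integral>x. (v x)^2 \<partial>M)"
 have q: "0 <= A + 2 * t * B + t\<^sup>2 * C" for t
 proof -
  have "0 <= (\<integral>x. (u x + t * v x)^2 \<partial>M)" by simp
  also have "(%x. (u x + t * v x)^2) = (%x. (u x)^2 + (2 * t) * (u x * v x) + t\<^sup>2 * (v x)^2)"
   by (simp add: power2_sum power_mult_distrib fun_eq_iff)
  finally show ?thesis using i int by (simp add: A_def B_def C_def)
 qed
 have "C >= 0" "A >= 0" by (simp_all add: C_def A_def)
 have "B\<^sup>2 <= A * C"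
 proof (cases "C = 0")
  case True
  have "B = 0"
  proof (rule ccontr)
   assume "B \<noteq> 0"
   thus False using q[of "- (A + 1) / (2 * B)"] True by (simp add: field_simps)
  qed
  thus ?thesis using True by simp
 next
  case False
  have "0 <= (A + 2 * (- B / C) * B + (- B / C)^2 * C) * C" using q[of "- B / C"] \<open>C >= 0\<close> by simp
  also have "... = A * C - B\<^sup>2" using False by (simp add: field_simps power2_eq_square)
  finally show ?thesis by simp
 qed
 thus "(\<integral>x. u x * v x \<partial>M)^2 <= (\<integral>x. (u x)^2 \<partial>M) * (\<integral>x. (v x)^2 \<partial>M)" by (simp add: A_def B_def C_def)
qed

lemma cs_inner:
 fixes f g :: "'a => 'v::euclidean_space"
 assumes [measurable]: "f \<in> borel_measurable M" "g \<in> borel_measurable M"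
  and i: "integrable M (%x. (norm (f x))^2)" "integrable M (%x. (norm (g x))^2)"
 shows "integrable M (%x. f x \<bullet> g x)" "(\<integral>x. f x \<bullet> g x \<partial>M)^2 <= (\<integral>x. (norm (f x))^2 \<partial>M) * (\<integral>x. (norm (g x))^2 \<partial>M)"
proof -
 note cs = cs_integral[of "%x. norm (f x)" M "%x. norm (g x)", OF _ _ i]
 have ip: "integrable M (%x. norm (f x) * norm (g x))" using cs by simp
 show int: "integrable M (%x. f x \<bullet> g x)"
  by (rule bi_integrable_bound[OF ip]) (auto simp: Cauchy_Schwarz_ineq2)
 have "\<bar>\<integral>x. f x \<bullet> g x \<partial>M\<bar> <= (\<integral>x. norm (f x) * norm (g x) \<partial>M)"
  using integral_abs_bound[of M "%x. f x \<bullet> g x"]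
  by (rule order_trans) (rule integral_mono, use int ip in \<open>auto simp: Cauchy_Schwarz_ineq2\<close>)
 hence "\<bar>\<integral>x. f x \<bullet> g x \<partial>M\<bar>\<^sup>2 <= (\<integral>x. norm (f x) * norm (g x) \<partial>M)^2" by (intro power_mono) auto
 also have "... <= (\<integral>x. (norm (f x))^2 \<partial>M) * (\<integral>x. (norm (g x))^2 \<partial>M)" using cs by simp
 finally show "(\<integral>x. f x \<bullet> g x \<partial>M)^2 <= (\<integral>x. (norm (f x))^2 \<partial>M) * (\<integral>x. (norm (g x))^2 \<partial>M)" by simp
qed

text \<open>Jensen's inequality for the probability density \<open>moll e (z - w)\<close>, obtained
  from Cauchy-Schwarz by splitting off the square root of the density.\<close>

lemma conv_moll_sq:
 fixes f :: "'a::euclidean_space => 'b::{banach, second_countable_topology}"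
 assumes e: "e > 0" and f: "intbl f" "intbl (%x. (norm (f x))^2)"
 shows "(norm (conv (moll e) f z))^2 <= conv (moll e) (%x. (norm (f x))^2) z"
proof -
 have [measurable]: "f \<in> borel_measurable borel" using f(1) by simp
 have nn: "moll e x >= 0" for x :: 'a using moll_nonneg[OF e] .
 have "norm (conv (moll e) f z) <= (LBINT w. norm (moll e (z - w) *\<^sub>R f w))"
  unfolding conv_def by (rule integral_norm_bound)
 also have "... = (LBINT w. sqrt (moll e (z - w)) * (sqrt (moll e (z - w)) * norm (f w)))"
  using nn by (simp flip: mult.assoc)
 finally have "(norm (conv (moll e) f z))^2 <= (LBINT w. sqrt (moll e (z - w)) * (sqrt (moll e (z - w)) * norm (f w)))^2"
  by (intro power_mono) auto
 also have "... <= (LBINT w. (sqrt (moll e (z - w)))^2) * (LBINT w. (sqrt (moll e (z - w)) * norm (f w))^2)"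
 proof (rule cs_integral(2))
  show "intbl (%w. (sqrt (moll e (z - w)))^2)" using nn integral_moll_shift(2)[OF e] by simp
  show "intbl (%w. (sqrt (moll e (z - w)) * norm (f w))^2)"
   using moll_conv_integrable[OF e f(2), of z] nn by (simp add: power_mult_distrib)
 qed measurable
 also have "... = conv (moll e) (%x. (norm (f x))^2) z"
  using nn integral_moll_shift(1)[OF e, of z] by (simp add: power_mult_distrib conv_def)
 finally show ?thesis .
qed

lemma conv_moll_nonneg: "e > 0 ==> (!!x. f x >= (0::real)) ==> conv (moll e) f z >= 0"
 unfolding conv_def by (rule bi_integral_nonneg) (simp add: moll_nonneg)

lemma nn_integral_conv_moll:
 fixes g :: "'a::euclidean_space => real"
 assumes e: "e > 0" and g: "intbl g" "!!x. g x >= 0"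
 shows "(NNL z. ennreal (conv (moll e) g z)) = (NNL w. ennreal (g w))"
proof -
 have [measurable]: "g \<in> borel_measurable borel" using g(1) by simp
 have "(NNL z. ennreal (conv (moll e) g z)) = (NNL z. \<integral>\<^sup>+w. ennreal (moll e (z - w) * g w) \<partial>lborel)"
  unfolding conv_def real_scaleR_def
  by (intro nn_integral_cong nn_integral_eq_integral[symmetric])
    (use moll_conv_integrable[OF e g(1)] in simp, intro AE_I2 mult_nonneg_nonneg moll_nonneg[OF e] g(2))
 also have "... = (NNL w. \<integral>\<^sup>+z. ennreal (moll e (z - w) * g w) \<partial>lborel)"
  by (rule lborel_pair.Fubini') measurable
 also have "... = (NNL w. ennreal (g w))"
 proof (rule nn_integral_cong)
  fix w :: 'a
  have "(NNL z. ennreal (moll e (z - w) * g w)) = (NNL z. ennreal (moll e (z - w)) * ennreal (g w))"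
   by (intro nn_integral_cong ennreal_mult moll_nonneg[OF e] g(2))
  also have "... = (NNL z. ennreal (moll e (z - w))) * ennreal (g w)" by (rule nn_integral_multc) measurable
  also have "(NNL z. ennreal (moll e (z - w))) = ennreal (LBINT z. moll e (w - z))"
   unfolding moll_swap[of e _ w]
   by (intro nn_integral_eq_integral) (use integral_moll_shift(2)[OF e] moll_nonneg[OF e] in auto)
  also have "... = 1" using integral_moll_shift(1)[OF e, of w] by simp
  finally show "(NNL z. ennreal (moll e (z - w) * g w)) = ennreal (g w)" by simp
 qed
 finally show ?thesis .
qed

lemma conv_moll_integral:
 fixes g :: "'a::euclidean_space => real"
 assumes e: "e > 0" and g: "intbl g" "!!x. g x >= 0"
 shows "intbl (conv (moll e) g)" "(LBINT z. conv (moll e) g z) = (LBINT w. g w)"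
proof -
 have m: "conv (moll e) g \<in> borel_measurable lborel"
  using borel_measurable_continuous_onI[OF c2_continuous[OF c2_conv_moll[OF e g(1)]]] by simp
 have eq: "(NNL z. ennreal (conv (moll e) g z)) = ennreal (LBINT w. g w)"
  using nn_integral_conv_moll[OF e g] nn_integral_eq_integral[OF g(1)] g(2) by simp
 show "intbl (conv (moll e) g)" "(LBINT z. conv (moll e) g z) = (LBINT w. g w)"
  using nn_integral_eq_integrable[of "conv (moll e) g" lborel "\<integral>w. g w \<partial>lborel"] m eq
   conv_moll_nonneg[OF e, of g] g(2) by auto
qed

lemma conv_moll_adjoint:
 fixes f g :: "'a::euclidean_space => 'v::euclidean_space"
 assumes e: "e > 0" and f: "intbl f" and g: "intbl g"
 shows "(LBINT z. conv (moll e) f z \<bullet> g z) = (LBINT w. f w \<bullet> conv (moll e) g w)"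
proof -
 have [measurable]: "f \<in> borel_measurable borel" "g \<in> borel_measurable borel" using f g by simp_all
 obtain B where B: "!!x::'a. \<bar>moll e x\<bar> <= B" using moll_bound[OF e] by blast
 let ?h = "%(z,w). moll e (z - w) * (f w \<bullet> g z)"
 let ?H = "%(z,w). norm (g z) * (B * norm (f w))"
 have iH: "integrable (lborel \<Otimes>\<^sub>M lborel) ?H"
 proof (rule lborel_pair.Fubini_integrable)
  show "intbl (%x. \<integral>y. norm (case (x, y) of (z, w) => norm (g z) * (B * norm (f w))) \<partial>lborel)"
   using g by (simp add: abs_mult)
  show "AE x in lborel. intbl (%y. case (x, y) of (z, w) => norm (g z) * (B * norm (f w)))"
   using f by simp
 qed measurable
 have ih: "integrable (lborel \<Otimes>\<^sub>M lborel) ?h"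
 proof (rule bi_integrable_bound[OF iH])
  show "AE x in lborel \<Otimes>\<^sub>M lborel. norm (?h x) <= norm (?H x)"
  proof (rule AE_I2, clarify)
   fix z w
   have "\<bar>moll e (z - w)\<bar> * \<bar>f w \<bullet> g z\<bar> <= B * (norm (f w) * norm (g z))"
    using B Cauchy_Schwarz_ineq2 by (intro mult_mono) (auto intro: order_trans[OF abs_ge_zero B])
   also have "... = norm (g z) * (B * norm (f w))" by simp
   also have "... <= \<bar>norm (g z) * (B * norm (f w))\<bar>" by simp
   finally show "norm (moll e (z - w) * (f w \<bullet> g z)) <= norm (norm (g z) * (B * norm (f w)))"
    by (simp only: real_norm_def abs_mult)
  qed
 qed measurable
 have "(LBINT z. conv (moll e) f z \<bullet> g z) = (LBINT z. (LBINT w. ?h (z, w)))"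
  unfolding conv_def by (intro bi_integral_cong refl)
   (simp add: integral_inner_left[OF moll_conv_integrable[OF e f], symmetric])
 also have "... = (LBINT w. (LBINT z. ?h (z, w)))"
  using lborel_pair.Fubini_integral[of "%z w. ?h (z, w)"] ih by simp
 also have "... = (LBINT w. f w \<bullet> conv (moll e) g w)"
  unfolding conv_def by (intro bi_integral_cong refl)
   (simp add: integral_inner_right[OF moll_conv_integrable[OF e g], symmetric] moll_swap[of e _ "_::'a"] inner_commute)
 finally show ?thesis .
qed

section \<open>The Riesz representation theorem in L2\<close>

text \<open>The rate is built into the hypothesis, so no subsequence has to be extracted. Weighting
  the k-th squared step by \<open>2 ^ k\<close> keeps the sum of the integrals finite and bounds the
  steps by a geometric sequence almost everywhere; Fatou's lemma then gives the rate for the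
  limit.\<close>

lemma L2_complete:
 fixes W :: "nat => 'a => 'v::euclidean_space"
 assumes [measurable]: "!!i. W i \<in> borel_measurable M"
  and int: "!!i. integrable M (%x. (norm (W i x))^2)"
  and cau: "!!i j. i <= j ==> (\<integral>x. (norm (W i x - W j x))^2 \<partial>M) <= (1/4) ^ i"
 obtains w where "w \<in> borel_measurable M" "!!i. integrable M (%x. (norm (W i x - w x))^2)"
  "!!i. (\<integral>x. (norm (W i x - w x))^2 \<partial>M) <= (1/4) ^ i"
proof -
 have id: "integrable M (%x. (norm (W i x - W j x))^2)" for i j
 proof (rule bi_integrable_bound[where f="%x. 2 * (norm (W i x))^2 + 2 * (norm (W j x))^2"])
  show "integrable M (%x. 2 * (norm (W i x))^2 + 2 * (norm (W j x))^2)"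
   by (intro bi_integrable_add integrable_mult_right int)
  show "AE x in M. norm ((norm (W i x - W j x))^2) <= norm (2 * (norm (W i x))^2 + 2 * (norm (W j x))^2)"
  proof (rule AE_I2)
   fix x
   have "(norm (W i x - W j x))^2 <= (norm (W i x) + norm (W j x))^2"
    by (intro power_mono norm_triangle_ineq4) auto
   also have "... <= 2 * (norm (W i x))^2 + 2 * (norm (W j x))^2" using sum_squares_bound[of "norm (W i x)" "norm (W j x)"] by (simp add: power2_sum)
   finally show "norm ((norm (W i x - W j x))^2) <= norm (2 * (norm (W i x))^2 + 2 * (norm (W j x))^2)" by simp
  qed
 qed measurable
 have nd: "(\<integral>\<^sup>+x. ennreal ((norm (W i x - W j x))^2) \<partial>M) <= ennreal ((1/4)^i)" if "i <= j" for i j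
  using nn_integral_eq_integral[OF id[of i j]] cau[OF that] by (simp add: ennreal_leI)
 have "(\<integral>\<^sup>+x. (\<Sum>k. ennreal (2 ^ k * (norm (W k x - W (Suc k) x))^2)) \<partial>M)
   = (\<Sum>k. \<integral>\<^sup>+x. ennreal (2 ^ k * (norm (W k x - W (Suc k) x))^2) \<partial>M)"
  by (rule nn_integral_suminf) measurable
 also have "... <= (\<Sum>k. ennreal ((1/2) ^ k))"
 proof (rule suminf_le)
  fix k
  have "(\<integral>\<^sup>+x. ennreal (2 ^ k * (norm (W k x - W (Suc k) x))^2) \<partial>M)
    = ennreal (2 ^ k) * (\<integral>\<^sup>+x. ennreal ((norm (W k x - W (Suc k) x))^2) \<partial>M)"
   by (subst nn_integral_cmult[symmetric]) (auto simp: ennreal_mult')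
  also have "... <= ennreal (2 ^ k) * ennreal ((1/4) ^ k)" by (intro mult_left_mono nd) auto
  also have "... = ennreal ((1/2) ^ k)" by (simp add: ennreal_mult'[symmetric] power_mult_distrib[symmetric])
  finally show "(\<integral>\<^sup>+x. ennreal (2 ^ k * (norm (W k x - W (Suc k) x))^2) \<partial>M) <= ennreal ((1/2) ^ k)" .
 qed auto
 also have "... = ennreal (\<Sum>k. (1/2) ^ k)" by (rule suminf_ennreal2) (auto intro: summable_geometric)
 also have "... < \<infinity>" by simp
 finally have "AE x in M. (\<Sum>k. ennreal (2 ^ k * (norm (W k x - W (Suc k) x))^2)) \<noteq> \<infinity>"
  by (intro nn_integral_PInf_AE) auto
 hence conv: "AE x in M. convergent (%k. W k x)"
 proof eventually_elim
  fix x assume fin: "(\<Sum>k. ennreal (2 ^ k * (norm (W k x - W (Suc k) x))^2)) \<noteq> \<infinity>"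
  have "summable (%k. 2 ^ k * (norm (W k x - W (Suc k) x))^2)"
   using fin by (intro summable_suminf_not_top) auto
  hence "Bseq (%k. 2 ^ k * (norm (W k x - W (Suc k) x))^2)"
   by (rule convergent_imp_Bseq[OF convergentI[OF summable_LIMSEQ_zero]])
  then obtain B where "!!k. norm (2 ^ k * (norm (W k x - W (Suc k) x))^2) <= B" by (rule BseqE) blast
  hence B: "!!k. 2 ^ k * (norm (W k x - W (Suc k) x))^2 <= B"
   by (simp add: abs_mult)
  have B0: "B >= 0" using order_trans[OF _ B[of 0]] by simp
  have "norm (W (Suc k) x - W k x) <= sqrt B * (sqrt (1/2)) ^ k" for k
  proof -
   have "(norm (W k x - W (Suc k) x))^2 <= B * (1/2) ^ k" using B[of k] by (simp add: field_simps)
   hence "sqrt ((norm (W k x - W (Suc k) x))^2) <= sqrt (B * (1/2) ^ k)" by (rule real_sqrt_le_mono)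
   thus ?thesis by (simp add: real_sqrt_mult real_sqrt_power norm_minus_commute)
  qed
  moreover have "summable (%k. sqrt B * (sqrt (1/2)) ^ k)"
   by (intro summable_mult summable_geometric) (simp add: real_sqrt_divide)
  ultimately have "summable (%k. W (Suc k) x - W k x)"
   by (rule summable_comparison_test'[rotated, where N=0])
  hence "convergent (%n. \<Sum>k<n. W (Suc k) x - W k x)" by (simp add: summable_iff_convergent)
  hence "convergent (%n. W n x - W 0 x)" by (simp only: sum_lessThan_telescope[of "%k. W k x"])
  hence "convergent (%n. (W n x - W 0 x) + W 0 x)" by (intro convergent_add convergent_const)
  thus "convergent (%n. W n x)" by simp
 qed
 define w where "w x = lim (%k. W k x)" for x
 have mw [measurable]: "w \<in> borel_measurable M"
  unfolding w_def[abs_def] by (rule borel_measurable_lim_metric) measurable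
 have b: "(\<integral>\<^sup>+x. ennreal ((norm (W i x - w x))^2) \<partial>M) <= ennreal ((1/4)^i)" for i
 proof -
  have "(\<integral>\<^sup>+x. ennreal ((norm (W i x - w x))^2) \<partial>M) = (\<integral>\<^sup>+x. liminf (%j. ennreal ((norm (W i x - W j x))^2)) \<partial>M)"
  proof (rule nn_integral_cong_AE, use conv in eventually_elim)
   fix x assume "convergent (%k. W k x)"
   hence "(%k. W k x) \<longlonglongrightarrow> w x" unfolding w_def by (simp add: convergent_LIMSEQ_iff)
   hence "(%j. ennreal ((norm (W i x - W j x))^2)) \<longlonglongrightarrow> ennreal ((norm (W i x - w x))^2)"
    by (intro tendsto_intros)
   thus "ennreal ((norm (W i x - w x))^2) = liminf (%j. ennreal ((norm (W i x - W j x))^2))"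
    by (rule lim_imp_Liminf[OF sequentially_bot, symmetric])
  qed
  also have "... <= liminf (%j. \<integral>\<^sup>+x. ennreal ((norm (W i x - W j x))^2) \<partial>M)"
   by (rule nn_integral_liminf) measurable
  also have "... <= ennreal ((1/4)^i)"
   by (rule order_trans[OF Liminf_le_Limsup Limsup_bounded])
     (auto simp: eventually_sequentially intro!: exI[of _ i] nd)
  finally show ?thesis .
 qed
 show ?thesis
 proof (rule that[OF mw])
  fix i
  show ii: "integrable M (%x. (norm (W i x - w x))^2)"
   by (rule integrableI_bounded) (use b[of i] in \<open>auto simp: le_less_trans\<close>)
  show "(\<integral>x. (norm (W i x - w x))^2 \<partial>M) <= (1/4) ^ i"
   using b[of i] nn_integral_eq_integral[OF ii] by simp
 qed
qed

lemma quadratic_nonneg_zero: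
 fixes a n :: real
 assumes "!!s. 0 <= 2 * s * a + s\<^sup>2 * n" shows "a = 0"
proof (rule ccontr)
 assume a: "a \<noteq> 0"
 define m where "m = \<bar>n\<bar> + 1"
 have m: "m > 0" "n <= m" by (auto simp: m_def)
 have "0 <= 2 * (- a / m) * a + (- a / m)^2 * n" by (rule assms)
 also have "... <= 2 * (- a / m) * a + (- a / m)^2 * m" using m by (intro add_left_mono mult_left_mono) auto
 also have "... = - (a\<^sup>2 / m)" using m by (simp add: field_simps power2_eq_square)
 also have "... < 0" using a m by simp
 finally show False by simp
qed

text \<open>The functional lives on an index set T of test objects, which W carries into L2; no
  closure of the image is formed. A minimising sequence of the squared norm minus
  \<open>2 * L\<close> converges in L2, and its limit represents L. Complex values count as a real
  Euclidean space, so real linearity is enough.\<close>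

lemma riesz_L2:
 fixes W :: "'i => 'a => 'v::euclidean_space" and L :: "'i => real"
 assumes lin: "!!b c s. b \<in> T ==> c \<in> T ==> \<exists>d\<in>T. (\<forall>x. W d x = W b x + s *\<^sub>R W c x) \<and> L d = L b + s * L c"
  and ne: "T \<noteq> {}" and C: "C >= 0"
  and m: "!!b. b \<in> T ==> W b \<in> borel_measurable M"
  and i: "!!b. b \<in> T ==> integrable M (%x. (norm (W b x))^2)"
  and bd: "!!b. b \<in> T ==> (L b)^2 <= C * (\<integral>x. (norm (W b x))^2 \<partial>M)"
 obtains w where "w \<in> borel_measurable M" "integrable M (%x. (norm (w x))^2)"
  "(\<integral>x. (norm (w x))^2 \<partial>M) <= C" "!!b. b \<in> T ==> L b = (\<integral>x. w x \<bullet> W b x \<partial>M)"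
proof -
 define N where "N b = (\<integral>x. (norm (W b x))^2 \<partial>M)" for b
 define I where "I b c = (\<integral>x. W b x \<bullet> W c x \<partial>M)" for b c
 define J where "J b = N b - 2 * L b" for b
 have ii: "integrable M (%x. W b x \<bullet> W c x)" if "b \<in> T" "c \<in> T" for b c
  by (rule cs_inner(1)) (use that m i in auto)
 have comb: "N d = N b + 2 * s * I b c + s\<^sup>2 * N c" if "b \<in> T" "c \<in> T" "\<forall>x. W d x = W b x + s *\<^sub>R W c x" for b c d s
 proof -
  have "(norm (W d x))^2 = (norm (W b x))^2 + (2 * s) * (W b x \<bullet> W c x) + s\<^sup>2 * (norm (W c x))^2" for x
   unfolding that(3)[rule_format] power2_norm_eq_inner
   by (simp add: inner_add_left inner_add_right inner_commute power2_eq_square algebra_simps)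
  thus ?thesis using i[OF that(1)] i[OF that(2)] ii[OF that(1,2)] by (simp add: N_def I_def)
 qed
 have Jlow: "J b >= - C" if "b \<in> T" for b
 proof -
  have "N b >= 0" by (simp add: N_def)
  have "L b <= sqrt (C * N b)" using bd[OF that] real_le_rsqrt by (simp add: N_def)
  also have "... <= (C + N b) / 2" using arith_geo_mean_sqrt[OF C \<open>N b >= 0\<close>] by simp
  finally show ?thesis by (simp add: J_def)
 qed
 define d where "d = Inf (J ` T)"
 have bb: "bdd_below (J ` T)" using Jlow by (auto intro!: bdd_belowI2[of _ "- C"])
 have dle: "d <= J b" if "b \<in> T" for b unfolding d_def using that bb by (intro cInf_lower) auto
 \<comment> \<open>The excess is tuned to the rate in \<open>L2_complete\<close>: the parallelogram
   law turns it into half of \<open>(1/4)^p\<close> and half of \<open>(1/4)^q\<close>.\<close>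
 have "\<exists>b\<in>T. J b < d + (1/4)^k / 4" for k :: nat
 proof -
  have "Inf (J ` T) < d + (1/4)^k / 4" by (simp add: d_def)
  thus ?thesis using cInf_less_iff[of "J ` T"] ne bb by auto
 qed
 then obtain be where be: "!!k::nat. be k \<in> T" "!!k. J (be k) < d + (1/4)^k / 4" by metis
 have cau: "(\<integral>x. (norm (W (be p) x - W (be q) x))^2 \<partial>M) <= (1/4) ^ p" if "p <= q" for p q
 proof -
  \<comment> \<open>\<open>e1\<close> stands for the difference and \<open>e2\<close> for the
    midpoint of the two elements; J at the midpoint is at least d.\<close>
  obtain e1 where e1: "e1 \<in> T" "\<forall>x. W e1 x = W (be q) x + (-1) *\<^sub>R W (be p) x" "L e1 = L (be q) + (-1) * L (be p)"
   using lin[OF be(1)[of q] be(1)[of p], of "-1"] by blast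
  obtain e2 where e2: "e2 \<in> T" "\<forall>x. W e2 x = W (be p) x + (1/2) *\<^sub>R W e1 x" "L e2 = L (be p) + (1/2) * L e1"
   using lin[OF be(1)[of p] e1(1), of "1/2"] by blast
  have n1: "N e1 = N (be q) + 2 * (-1) * I (be q) (be p) + (-1)^2 * N (be p)" by (rule comb[OF be(1) be(1) e1(2)])
  have n2: "N e2 = N (be p) + 2 * (1/2) * I (be p) e1 + (1/2)^2 * N e1" by (rule comb[OF be(1) e1(1) e2(2)])
  have "I (be p) e1 = (\<integral>x. W (be p) x \<bullet> W (be q) x - (norm (W (be p) x))^2 \<partial>M)"
   unfolding I_def using e1(2) by (simp add: inner_diff_right power2_norm_eq_inner)
  also have "... = I (be p) (be q) - N (be p)" using ii[OF be(1) be(1)] i[OF be(1)] by (simp add: I_def N_def)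
  finally have i1: "I (be p) e1 = I (be q) (be p) - N (be p)" by (simp add: I_def inner_commute)
  have "(\<integral>x. (norm (W (be p) x - W (be q) x))^2 \<partial>M) = N e1" using e1(2) by (simp add: N_def norm_minus_commute)
  also have "... = 2 * J (be p) + 2 * J (be q) - 4 * J e2"
   using n1 n2 i1 e1(3) e2(3) by (simp add: J_def power2_eq_square field_simps)
  also have "... <= (1/4)^p / 2 + (1/4)^q / 2" using be(2)[of p] be(2)[of q] dle[OF e2(1)] by linarith
  also have "... <= (1/4)^p"
  proof -
   have "(1/4::real)^q <= (1/4)^p" by (rule power_decreasing[OF that]) auto
   thus ?thesis by linarith
  qed
  finally show ?thesis .
 qed
 obtain w where w: "w \<in> borel_measurable M" "!!k. integrable M (%x. (norm (W (be k) x - w x))^2)"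
  "!!k. (\<integral>x. (norm (W (be k) x - w x))^2 \<partial>M) <= (1/4) ^ k"
  by (rule L2_complete[of "%k. W (be k)" M, OF m[OF be(1)] i[OF be(1)] cau]) blast+
 note [measurable] = w(1) m[OF be(1)]
 have q0: "(%k. (1/4::real)^k) \<longlonglongrightarrow> 0" by (simp add: LIMSEQ_power_zero)
 have D0: "(%k. (\<integral>x. (norm (W (be k) x - w x))^2 \<partial>M)) \<longlonglongrightarrow> 0"
  by (rule tendsto_sandwich[OF _ _ tendsto_const q0]) (auto intro!: always_eventually w(3))
 have iw: "integrable M (%x. (norm (w x))^2)"
 proof (rule bi_integrable_bound)
  show "integrable M (%x. 2 * (norm (W (be 0) x))^2 + 2 * (norm (W (be 0) x - w x))^2)"
   by (intro bi_integrable_add integrable_mult_right i[OF be(1)] w(2))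
  show "AE x in M. norm ((norm (w x))^2) <= norm (2 * (norm (W (be 0) x))^2 + 2 * (norm (W (be 0) x - w x))^2)"
  proof (rule AE_I2)
   fix x
   let ?a = "norm (W (be 0) x)" and ?b = "norm (W (be 0) x - w x)"
   have "norm (w x) <= ?a + ?b" by (metis add_diff_cancel_left' diff_add_cancel norm_triangle_ineq4)
   hence "(norm (w x))^2 <= (?a + ?b)^2" by (intro power_mono) auto
   also have "... <= 2 * ?a\<^sup>2 + 2 * ?b\<^sup>2" using sum_squares_bound[of ?a ?b] by (simp add: power2_sum)
   finally show "norm ((norm (w x))^2) <= norm (2 * ?a\<^sup>2 + 2 * ?b\<^sup>2)" by simp
  qed
 qed measurable
 have lim: "(%k. \<integral>x. W (be k) x \<bullet> g x \<partial>M) \<longlonglongrightarrow> (\<integral>x. w x \<bullet> g x \<partial>M)"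
  if g: "g \<in> borel_measurable M" "integrable M (%x. (norm (g x))^2)" for g
 proof -
  have "(%k. (\<integral>x. W (be k) x \<bullet> g x \<partial>M) - (\<integral>x. w x \<bullet> g x \<partial>M)) \<longlonglongrightarrow> 0"
  proof (rule Lim_null_comparison)
   show "(%k. sqrt ((\<integral>x. (norm (W (be k) x - w x))^2 \<partial>M) * (\<integral>x. (norm (g x))^2 \<partial>M))) \<longlonglongrightarrow> 0"
    using tendsto_real_sqrt[OF tendsto_mult_left_zero[OF D0]] by simp
   show "\<forall>\<^sub>F k in sequentially. norm ((\<integral>x. W (be k) x \<bullet> g x \<partial>M) - (\<integral>x. w x \<bullet> g x \<partial>M))
    <= sqrt ((\<integral>x. (norm (W (be k) x - w x))^2 \<partial>M) * (\<integral>x. (norm (g x))^2 \<partial>M))"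
   proof (rule always_eventually, rule allI)
    fix k
    have "(\<integral>x. W (be k) x \<bullet> g x \<partial>M) - (\<integral>x. w x \<bullet> g x \<partial>M) = (\<integral>x. (W (be k) x - w x) \<bullet> g x \<partial>M)"
     unfolding inner_diff_left
     by (rule bi_integral_diff[symmetric]; rule cs_inner(1)) (use i[OF be(1)] iw g in auto)
    moreover have "(\<integral>x. (W (be k) x - w x) \<bullet> g x \<partial>M)^2 <= (\<integral>x. (norm (W (be k) x - w x))^2 \<partial>M) * (\<integral>x. (norm (g x))^2 \<partial>M)"
     by (rule cs_inner(2)) (use w(2) g in auto)
    ultimately show "norm ((\<integral>x. W (be k) x \<bullet> g x \<partial>M) - (\<integral>x. w x \<bullet> g x \<partial>M))
     <= sqrt ((\<integral>x. (norm (W (be k) x - w x))^2 \<partial>M) * (\<integral>x. (norm (g x))^2 \<partial>M))"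
     by (simp add: real_le_rsqrt)
   qed
  qed
  thus ?thesis using LIM_zero_iff by blast
 qed
 have EL: "L b = (\<integral>x. w x \<bullet> W b x \<partial>M)" if b: "b \<in> T" for b
 proof -
  let ?I = "\<integral>x. w x \<bullet> W b x \<partial>M"
  have li: "(%k. I (be k) b) \<longlonglongrightarrow> ?I" unfolding I_def by (rule lim[OF m[OF b] i[OF b]])
  \<comment> \<open>First variation: moving a near-minimiser by \<open>s\<close> times b cannot push
    J below d. In the limit this is a quadratic in s without constant term, so its linear
    coefficient is zero.\<close>
  have "0 <= 2 * s * (?I - L b) + s\<^sup>2 * N b" for s
  proof (rule LIMSEQ_le_const)
   show "(%k. (1/4)^k + (2 * s * (I (be k) b - L b) + s\<^sup>2 * N b)) \<longlonglongrightarrow> 2 * s * (?I - L b) + s\<^sup>2 * N b"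
    using tendsto_add[OF q0, of "%k. 2 * s * (I (be k) b - L b) + s\<^sup>2 * N b"] li
    by (auto intro!: tendsto_eq_intros)
   show "\<exists>n. \<forall>k\<ge>n. 0 <= (1/4)^k + (2 * s * (I (be k) b - L b) + s\<^sup>2 * N b)"
   proof (intro exI allI impI)
    fix k :: nat
    obtain c where c: "c \<in> T" "\<forall>x. W c x = W (be k) x + s *\<^sub>R W b x" "L c = L (be k) + s * L b"
     using lin[OF be(1) b] by blast
    have "d <= J c" by (rule dle[OF c(1)])
    also have "J c = J (be k) + 2 * s * (I (be k) b - L b) + s\<^sup>2 * N b"
     using comb[OF be(1) b c(2)] c(3) by (simp add: J_def algebra_simps)
    also have "... <= d + (1/4)^k / 4 + (2 * s * (I (be k) b - L b) + s\<^sup>2 * N b)" using be(2)[of k] by linarith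
    finally show "0 <= (1/4)^k + (2 * s * (I (be k) b - L b) + s\<^sup>2 * N b)"
     using zero_le_power[of "1/4::real" k] by linarith
   qed
  qed
  hence "?I - L b = 0" by (rule quadratic_nonneg_zero)
  thus ?thesis by simp
 qed
 let ?P = "\<integral>x. (norm (w x))^2 \<partial>M"
 have l1: "(%k. \<integral>x. W (be k) x \<bullet> w x \<partial>M) \<longlonglongrightarrow> ?P"
  using lim[OF w(1) iw] by (simp add: power2_norm_eq_inner)
 have lN: "(%k. N (be k)) \<longlonglongrightarrow> ?P"
 proof -
  have "N (be k) = (\<integral>x. (norm (W (be k) x - w x))^2 \<partial>M) + 2 * (\<integral>x. W (be k) x \<bullet> w x \<partial>M) - ?P" for k
  proof -
   have "(norm (W (be k) x))^2 = (norm (W (be k) x - w x))^2 + 2 * (W (be k) x \<bullet> w x) - (norm (w x))^2" for x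
    unfolding power2_norm_eq_inner by (simp add: inner_diff_left inner_diff_right inner_commute)
   moreover have "integrable M (%x. W (be k) x \<bullet> w x)" by (rule cs_inner(1)) (use i[OF be(1)] iw in auto)
   ultimately show ?thesis using w(2)[of k] iw by (simp add: N_def)
  qed
  thus ?thesis using tendsto_diff[OF tendsto_add[OF D0 tendsto_mult[OF tendsto_const[of 2] l1]] tendsto_const[of ?P]]
   by simp
 qed
 \<comment> \<open>On the minimising sequence \<open>L (be k)\<close> is the pairing with w. Both
   sides of the bound on its square converge, the left one to the square of
   \<open>?P\<close>.\<close>
 have "?P * ?P <= C * ?P"
 proof (rule LIMSEQ_le[OF tendsto_mult[OF l1 l1] tendsto_mult[OF tendsto_const lN]])
  show "\<exists>n. \<forall>k\<ge>n. (\<integral>x. W (be k) x \<bullet> w x \<partial>M) * (\<integral>x. W (be k) x \<bullet> w x \<partial>M) <= C * N (be k)"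
   using bd[OF be(1)] EL[OF be(1)] by (simp add: N_def power2_eq_square inner_commute)
 qed
 moreover have "?P >= 0" by simp
 ultimately have "?P <= C" using C by (metis mult_right_le_imp_le order.order_iff_strict)
 thus ?thesis using that[OF w(1) iw] EL by blast
qed

section \<open>Wirtinger derivatives and the Bochner inequality\<close>

text \<open>\<open>dz j\<close> and \<open>db j\<close> are the Wirtinger derivatives in the j-th
  coordinate and in its conjugate; \<open>axis j 1\<close> and \<open>axis j \<i>\<close> are the
  real and the imaginary direction.\<close>

definition dz :: "'n => (complex ^ 'n => complex) => complex ^ 'n => complex" where
 "dz j f z = (1/2) * (dd f (axis j 1) z - \<i> * dd f (axis j \<i>) z)"

definition db :: "'n => (complex ^ 'n => complex) => complex ^ 'n => complex" where
 "db j f z = (1/2) * (dd f (axis j 1) z + \<i> * dd f (axis j \<i>) z)"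

abbreviation cr :: "('a => real) => 'a => complex" where "cr f \<equiv> %z. complex_of_real (f z)"

lemma wirt_continuous:
 assumes "c1 U f" shows "continuous_on U (dz j f)" "continuous_on U (db j f)"
 unfolding dz_def[abs_def] db_def[abs_def]
 by (intro continuous_on_mult continuous_on_add continuous_on_diff continuous_on_const c1_cont_dd[OF assms])+

lemma wirt_c1:
 assumes "c2 U f" shows "c1 U (dz j f)" "c1 U (db j f)"
 unfolding dz_def[abs_def] db_def[abs_def]
 by (rule c1_mult[OF c1_const c1_diff[OF c2_dd[OF assms] c1_mult[OF c1_const c2_dd[OF assms]]]])
   (rule c1_mult[OF c1_const c1_add[OF c2_dd[OF assms] c1_mult[OF c1_const c2_dd[OF assms]]]])

lemma wirt_add:
 assumes "c1 U f" "c1 U g" "z \<in> U"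
 shows "dz j (%z. f z + g z) z = dz j f z + dz j g z" "db j (%z. f z + g z) z = db j f z + db j g z"
 unfolding dz_def db_def dd_add[OF assms] by (simp_all add: algebra_simps)

lemma wirt_diff:
 assumes "c1 U f" "c1 U g" "z \<in> U"
 shows "dz j (%z. f z - g z) z = dz j f z - dz j g z" "db j (%z. f z - g z) z = db j f z - db j g z"
 unfolding dz_def db_def dd_diff[OF assms] by (simp_all add: algebra_simps)

lemma wirt_sum:
 assumes "!!i. i \<in> I ==> c1 U (f i)" "z \<in> U"
 shows "dz j (%z. \<Sum>i\<in>I. f i z) z = (\<Sum>i\<in>I. dz j (f i) z)" "db j (%z. \<Sum>i\<in>I. f i z) z = (\<Sum>i\<in>I. db j (f i) z)"
proof -
 have d: "dd (%z. \<Sum>i\<in>I. f i z) v z = (\<Sum>i\<in>I. dd (f i) v z)" for v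
  by (rule dd_sum[of I U]) (use assms in auto)
 show "dz j (%z. \<Sum>i\<in>I. f i z) z = (\<Sum>i\<in>I. dz j (f i) z)" "db j (%z. \<Sum>i\<in>I. f i z) z = (\<Sum>i\<in>I. db j (f i) z)"
  unfolding dz_def db_def d by (simp_all add: sum_distrib_left sum_subtractf sum.distrib algebra_simps)
qed

lemma wirt_mult:
 assumes "c1 U f" "c1 U g" "z \<in> U"
 shows "dz j (%z. f z * g z) z = f z * dz j g z + dz j f z * g z"
  "db j (%z. f z * g z) z = f z * db j g z + db j f z * g z"
 unfolding dz_def db_def dd_mult[OF assms] by (simp_all add: algebra_simps)

lemma c1_cnj: "c1 U f ==> c1 U (%z. cnj (f z))"
 by (rule c1_linear[OF bounded_linear_cnj])

lemma wirt_cnj: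
 assumes "c1 U f" "z \<in> U"
 shows "dz j (%z. cnj (f z)) z = cnj (db j f z)" "db j (%z. cnj (f z)) z = cnj (dz j f z)"
 unfolding dz_def db_def dd_linear[OF bounded_linear_cnj assms] by simp_all

lemma c1_cr: "c1 U f ==> c1 U (cr f)"
 by (rule c1_linear[OF bounded_linear_of_real])

lemma c2_cr: "c2 U f ==> open U ==> c2 U (cr f)"
 by (rule c2_linear[OF bounded_linear_of_real])

lemma wirt_real: assumes "c1 U f" "z \<in> U" shows "db j (cr f) z = cnj (dz j (cr f) z)"
 unfolding dz_def db_def dd_linear[OF bounded_linear_of_real assms] by simp

lemma wirt_compose:
 assumes "c1 U f" "z \<in> U" "(g has_real_derivative g') (at (f z))"
 shows "dz j (%z. complex_of_real (g (f z))) z = of_real g' * dz j (cr f) z"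
  "db j (%z. complex_of_real (g (f z))) z = of_real g' * db j (cr f) z"
proof -
 have "((%z. complex_of_real (g (f z))) has_derivative (%v. of_real (g' * dd f v z))) (at z)"
  by (rule bounded_linear.has_derivative[OF bounded_linear_of_real has_derivative_real_compose[OF assms(3) c1_has[OF assms(1,2)]]])
 from dd_eq[OF this] show "dz j (%z. complex_of_real (g (f z))) z = of_real g' * dz j (cr f) z"
  "db j (%z. complex_of_real (g (f z))) z = of_real g' * db j (cr f) z"
  unfolding dz_def db_def dd_linear[OF bounded_linear_of_real assms(1,2)] by (simp_all add: algebra_simps)
qed

lemma wirt_cong:
 assumes "open U" "!!y. y \<in> U ==> f y = g y" "x \<in> U"
 shows "dz j f x = dz j g x" "db j f x = db j g x"
proof -
 have d: "dd f v x = dd g v x" for v by (rule dd_cong[of U]) (use assms in auto)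
 show "dz j f x = dz j g x" "db j f x = db j g x" unfolding dz_def db_def d by simp_all
qed

lemma wirt_const: "dz j (%_. c) z = 0" "db j (%_. c) z = 0"
 by (simp_all add: dz_def db_def dd_const)

lemma wirt_zero:
 assumes "closed K" "!!x. x \<notin> K ==> f x = 0" "x \<notin> K"
 shows "dz j f x = 0" "db j f x = 0"
 using dd_zero_outside[OF assms] by (simp_all add: dz_def db_def)

lemma wirt_commute:
 assumes "c2 U f" "open U" "z \<in> U"
 shows "db k (dz j f) z = dz j (db k f) z" "db k (db j f) z = db j (db k f) z"
proof -
 have d: "dd (dz j f) v z = (1/2) * (dd (dd f (axis j 1)) v z - \<i> * dd (dd f (axis j \<i>)) v z)" for j v
  unfolding dz_def[abs_def]
  dd_mult[OF c1_const c1_diff[OF c2_dd[OF assms(1)] c1_mult[OF c1_const c2_dd[OF assms(1)]]] assms(3)]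
  dd_diff[OF c2_dd[OF assms(1)] c1_mult[OF c1_const c2_dd[OF assms(1)]] assms(3)]
  dd_mult[OF c1_const c2_dd[OF assms(1)] assms(3)] by (simp add: dd_const)
 have e: "dd (db j f) v z = (1/2) * (dd (dd f (axis j 1)) v z + \<i> * dd (dd f (axis j \<i>)) v z)" for j v
  unfolding db_def[abs_def]
  dd_mult[OF c1_const c1_add[OF c2_dd[OF assms(1)] c1_mult[OF c1_const c2_dd[OF assms(1)]]] assms(3)]
  dd_add[OF c2_dd[OF assms(1)] c1_mult[OF c1_const c2_dd[OF assms(1)]] assms(3)]
  dd_mult[OF c1_const c2_dd[OF assms(1)] assms(3)] by (simp add: dd_const)
 note s = dd_symmetric[OF assms]
 show "db k (dz j f) z = dz j (db k f) z"
  unfolding db_def[of k "dz j f"] dz_def[of j "db k f"] d e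
  using s[of "axis j 1" "axis k 1"] s[of "axis j 1" "axis k \<i>"] s[of "axis j \<i>" "axis k 1"] s[of "axis j \<i>" "axis k \<i>"]
  by (simp add: algebra_simps)
 show "db k (db j f) z = db j (db k f) z"
  unfolding db_def[of k "db j f"] db_def[of j "db k f"] e
  using s[of "axis j 1" "axis k 1"] s[of "axis j 1" "axis k \<i>"] s[of "axis j \<i>" "axis k 1"] s[of "axis j \<i>" "axis k \<i>"]
  by (simp add: algebra_simps)
qed

lemma integral_wirt:
 assumes "c1 UNIV f" "compact K" "!!x. x \<notin> K ==> f x = 0"
 shows "intbl (dz j f)" "(LBINT z. dz j f z) = 0" "intbl (db j f)" "(LBINT z. db j f z) = 0"
 unfolding dz_def[abs_def] db_def[abs_def]
 using integral_dd_zero[OF assms] by simp_all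

text \<open>The Levi form (complex Hessian) of f at z, evaluated on b. For f of class C^2 the matrix
  is Hermitian, so the double sum is real and \<open>Re\<close> only adjusts the type.
  \<open>pd\<close> below is the (1,0)-part of the differential, evaluated on b.\<close>

definition lev :: "(complex ^ 'n => real) => complex ^ 'n => complex ^ 'n => real" where
 "lev f z b = Re (\<Sum>j\<in>UNIV. \<Sum>k\<in>UNIV. db k (dz j (cr f)) z * b $ j * cnj (b $ k))"

definition pd :: "(complex ^ 'n => real) => complex ^ 'n => complex ^ 'n => complex" where
 "pd f z b = (\<Sum>j\<in>UNIV. dz j (cr f) z * b $ j)"

lemma lev_add:
 assumes "c2 U f" "c2 U g" "open U" "z \<in> U" shows "lev (%z. f z + g z) z b = lev f z b + lev g z b"
proof -
 have "db k (dz j (cr (%z. f z + g z))) z = db k (dz j (cr f)) z + db k (dz j (cr g)) z" for j k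
 proof -
  have "db k (dz j (cr (%z. f z + g z))) z = db k (%z. dz j (cr f) z + dz j (cr g) z) z"
   by (rule wirt_cong(2)[OF assms(3) _ assms(4)])
     (simp add: wirt_add(1)[OF c1_cr[OF c2_c1[OF assms(1)]] c1_cr[OF c2_c1[OF assms(2)]]])
  also have "... = db k (dz j (cr f)) z + db k (dz j (cr g)) z"
   by (rule wirt_add(2)[OF wirt_c1(1)[OF c2_cr[OF assms(1,3)]] wirt_c1(1)[OF c2_cr[OF assms(2,3)]] assms(4)])
  finally show ?thesis .
 qed
 thus ?thesis by (simp add: lev_def sum.distrib distrib_right)
qed

lemma lev_compose:
 assumes "c2 U f" "open U" "z \<in> U"
  and g: "!!x. x \<in> U ==> (g has_real_derivative g' (f x)) (at (f x))"
  and g': "(g' has_real_derivative g'' (f z)) (at (f z))" "c1 U (%x. g' (f x))"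
 shows "lev (%z. g (f z)) z b = g' (f z) * lev f z b + g'' (f z) * (cmod (pd f z b))^2"
proof -
 have *: "db k (dz j (cr (%z. g (f z)))) z =
   of_real (g' (f z)) * db k (dz j (cr f)) z + of_real (g'' (f z)) * (dz j (cr f) z * cnj (dz k (cr f) z))" for j k
 proof -
  have "db k (dz j (cr (%z. g (f z)))) z = db k (%z. of_real (g' (f z)) * dz j (cr f) z) z"
   by (rule wirt_cong(2)[OF assms(2) _ assms(3)])
     (use wirt_compose(1)[OF c2_c1[OF assms(1)] _ g] in simp)
  also have "... = of_real (g' (f z)) * db k (dz j (cr f)) z + db k (%z. of_real (g' (f z))) z * dz j (cr f) z"
   by (rule wirt_mult(2)[OF c1_cr[OF g'(2)] wirt_c1(1)[OF c2_cr[OF assms(1,2)]] assms(3)])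
  also have "db k (%z. of_real (g' (f z))) z = of_real (g'' (f z)) * db k (cr f) z"
   by (rule wirt_compose(2)[OF c2_c1[OF assms(1)] assms(3) g'(1)])
  also have "db k (cr f) z = cnj (dz k (cr f) z)" by (rule wirt_real[OF c2_c1[OF assms(1)] assms(3)])
  finally show ?thesis by (simp add: algebra_simps)
 qed
 have "complex_of_real ((cmod (pd f z b))^2) = pd f z b * cnj (pd f z b)" by (rule complex_norm_square)
 also have "... = (\<Sum>j\<in>UNIV. \<Sum>k\<in>UNIV. (dz j (cr f) z * cnj (dz k (cr f) z)) * b $ j * cnj (b $ k))"
  unfolding pd_def cnj_sum sum_product by (intro sum.cong refl) (simp add: algebra_simps)
 finally have p: "(cmod (pd f z b))^2 = Re (\<Sum>j\<in>UNIV. \<Sum>k\<in>UNIV. (dz j (cr f) z * cnj (dz k (cr f) z)) * b $ j * cnj (b $ k))"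
  by (metis Re_complex_of_real)
 have "(\<Sum>j\<in>UNIV. \<Sum>k\<in>UNIV. db k (dz j (cr (%z. g (f z)))) z * b $ j * cnj (b $ k))
   = of_real (g' (f z)) * (\<Sum>j\<in>UNIV. \<Sum>k\<in>UNIV. db k (dz j (cr f)) z * b $ j * cnj (b $ k))
   + of_real (g'' (f z)) * (\<Sum>j\<in>UNIV. \<Sum>k\<in>UNIV. (dz j (cr f) z * cnj (dz k (cr f) z)) * b $ j * cnj (b $ k))"
  unfolding * by (simp add: sum_distrib_left sum.distrib distrib_right mult.assoc)
 thus ?thesis unfolding p unfolding lev_def by simp
qed

text \<open>\<open>- del f\<close> is the formal adjoint of dbar with respect to the weight \<open>exp (- f)\<close>.\<close>

definition del :: "(complex ^ 'n => real) => (complex ^ 'n => complex ^ 'n) => complex ^ 'n => complex" where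
 "del f be z = (\<Sum>j\<in>UNIV. dz j (%z. be z $ j) z - be z $ j * dz j (cr f) z)"

text \<open>This is dbar of the (0,1)-form with coefficients \<open>be\<close>. Both orders of each
  index pair are listed, so the squared norm counts every component twice; hence the factors 1/2 in
  the estimates.\<close>

definition curl :: "(complex ^ 'n => complex ^ 'n) => complex ^ 'n => complex ^ 'n ^ 'n" where
 "curl be z = (\<chi> j k. db j (%z. be z $ k) z - db k (%z. be z $ j) z)"

definition tst :: "(complex ^ 'n) set => (complex ^ 'n => complex ^ 'n) => bool" where
 "tst U be \<longleftrightarrow> c2 UNIV be \<and> (\<exists>K. compact K \<and> K \<subseteq> U \<and> (\<forall>z. z \<notin> K --> be z = 0))"

section \<open>The weighted Bochner identity for forms of compact support\<close>

lemma norm_curl: "(norm (curl be z))^2 = (\<Sum>j\<in>UNIV. \<Sum>k\<in>UNIV. (cmod (db j (%z. be z $ k) z - db k (%z. be z $ j) z))^2)"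
 by (simp add: curl_def norm_vec_def L2_set_def sum_nonneg)

lemma c2_component: "c2 U be ==> open U ==> c2 U (%z. be z $ j)"
 by (rule c2_linear[OF bounded_linear_vec_nth])

text \<open>The cross terms equal the full squared gradient minus half of the squared curl; only the
  gradient is discarded.\<close>

lemma cross_terms_bound:
 fixes D :: "'n::finite => 'n => complex"
 shows "- (1/2) * (\<Sum>j\<in>UNIV. \<Sum>k\<in>UNIV. (cmod (D k j - D j k))^2) <= Re (\<Sum>j\<in>UNIV. \<Sum>k\<in>UNIV. D j k * cnj (D k j))"
proof -
 have "(cmod (D k j - D j k))^2 = (cmod (D k j))^2 + (cmod (D j k))^2 - 2 * Re (D j k * cnj (D k j))" for j k
  by (simp add: cmod_power2) (simp add: power2_eq_square algebra_simps)
 hence "(\<Sum>j\<in>UNIV. \<Sum>k\<in>UNIV. (cmod (D k j - D j k))^2)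
   = (\<Sum>j\<in>UNIV. \<Sum>k\<in>UNIV. (cmod (D k j))^2) + (\<Sum>j\<in>UNIV. \<Sum>k\<in>UNIV. (cmod (D j k))^2) - 2 * Re (\<Sum>j\<in>UNIV. \<Sum>k\<in>UNIV. D j k * cnj (D k j))"
  by (simp add: sum.distrib sum_subtractf sum_distrib_left Re_sum)
 moreover have "0 <= (\<Sum>j\<in>UNIV. \<Sum>k\<in>UNIV. (cmod (D k j))^2)" "0 <= (\<Sum>j\<in>UNIV. \<Sum>k\<in>UNIV. (cmod (D j k))^2)"
  by (intro sum_nonneg; simp)+
 ultimately show ?thesis by linarith
qed

text \<open>The identity behind the Kohn-Morrey-Hoermander formula, arranged so that the left side
  is a sum of derivatives of fields that vanish where \<open>be\<close> does. The second derivatives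
  of the coefficients, called E in the proof, cancel because mixed Wirtinger derivatives commute;
  differentiating the gradient of the weight leaves the Levi form.\<close>

lemma bochner_pointwise:
 fixes be :: "complex ^ 'n => complex ^ 'n"
 assumes U: "open U" and f: "c2 U f" and b: "c2 U be" and z: "z \<in> U"
 defines "\<mu> \<equiv> %z. exp (- f z)" and "a \<equiv> %j z. be z $ j"
 shows "(\<Sum>k\<in>UNIV. db k (%z. cr \<mu> z * (del f be z * cnj (a k z))) z)
   - (\<Sum>j\<in>UNIV. \<Sum>k\<in>UNIV. dz j (%z. cr \<mu> z * (db k (a j) z * cnj (a k z))) z)
  = cr \<mu> z * (of_real ((cmod (del f be z))^2) - (\<Sum>j\<in>UNIV. \<Sum>k\<in>UNIV. db k (a j) z * cnj (db j (a k) z))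
    - (\<Sum>j\<in>UNIV. \<Sum>k\<in>UNIV. db k (dz j (cr f)) z * a j z * cnj (a k z)))"
proof -
 have a2: "c2 U (a j)" for j unfolding a_def by (rule c2_component[OF b U])
 have a1: "c1 U (a j)" for j by (rule c2_c1[OF a2])
 have f1: "c1 U (dz j (cr f))" for j by (rule wirt_c1(1)[OF c2_cr[OF f U]])
 have fc: "c1 U f" by (rule c2_c1[OF f])
 have exd: "((%t. exp (- t)) has_real_derivative - exp (- t)) (at t)" for t :: real
  by (auto intro!: derivative_eq_intros)
 have mu1: "c1 U (cr \<mu>)" unfolding \<mu>_def
  by (intro c1_cr c1_compose[OF fc, where g'="%t. - exp (- t)"] exd) (auto intro!: continuous_intros)
 have dmu: "dz j (cr \<mu>) z = - (cr \<mu> z * dz j (cr f) z)" "db j (cr \<mu>) z = - (cr \<mu> z * cnj (dz j (cr f) z))" for j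
  using wirt_compose[OF fc z exd, of j] wirt_real[OF fc z] unfolding \<mu>_def by simp_all
 define A D E P H Q G where "A = (%j. a j z)" and "D = (%j k. db k (a j) z)" and "E = (%j k. dz j (db k (a j)) z)"
  and "P = (%j. dz j (cr f) z)" and "H = (%j k. db k (dz j (cr f)) z)" and "Q = (%j. dz j (a j) z)" and "G = del f be z"
 have G: "G = (\<Sum>j\<in>UNIV. Q j - A j * P j)" by (simp add: G_def del_def Q_def A_def P_def a_def)
 have dl: "del f be = (%z. \<Sum>j\<in>UNIV. dz j (a j) z - a j z * dz j (cr f) z)"
  by (simp add: del_def[abs_def] a_def)
 have t1: "c1 U (%z. dz j (a j) z - a j z * dz j (cr f) z)" for j
  by (rule c1_diff[OF wirt_c1(1)[OF a2] c1_mult[OF a1 f1]])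
 have del1: "c1 U (del f be)" unfolding dl by (rule c1_sum[OF t1])
 have dbG: "db k (del f be) z = (\<Sum>j\<in>UNIV. E j k - D j k * P j - A j * H j k)" for k
 proof -
  have "db k (del f be) z = (\<Sum>j\<in>UNIV. db k (%z. dz j (a j) z - a j z * dz j (cr f) z) z)"
   unfolding dl by (rule wirt_sum(2)[OF t1 z])
  also have "... = (\<Sum>j\<in>UNIV. E j k - D j k * P j - A j * H j k)"
   unfolding wirt_diff(2)[OF wirt_c1(1)[OF a2] c1_mult[OF a1 f1] z] wirt_mult(2)[OF a1 f1 z] wirt_commute(1)[OF a2 U z]
   by (simp add: E_def D_def P_def A_def H_def algebra_simps)
  finally show ?thesis .
 qed
 have X: "db k (%z. cr \<mu> z * (del f be z * cnj (a k z))) z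
   = cr \<mu> z * (- (cnj (P k) * G * cnj (A k)) + (\<Sum>j\<in>UNIV. E j k - D j k * P j - A j * H j k) * cnj (A k) + G * cnj (Q k))" for k
  unfolding wirt_mult(2)[OF mu1 c1_mult[OF del1 c1_cnj[OF a1]] z] wirt_mult(2)[OF del1 c1_cnj[OF a1] z]
   wirt_cnj(2)[OF a1 z] dmu dbG
  by (simp add: A_def P_def Q_def G_def algebra_simps)
 have Y: "dz j (%z. cr \<mu> z * (db k (a j) z * cnj (a k z))) z
   = cr \<mu> z * (- (P j * D j k * cnj (A k)) + E j k * cnj (A k) + D j k * cnj (D k j))" for j k
  unfolding wirt_mult(1)[OF mu1 c1_mult[OF wirt_c1(2)[OF a2] c1_cnj[OF a1]] z]
   wirt_mult(1)[OF wirt_c1(2)[OF a2] c1_cnj[OF a1] z] wirt_cnj(1)[OF a1 z] dmu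
  by (simp add: A_def P_def D_def E_def algebra_simps)
 have s1: "(\<Sum>k\<in>UNIV. (\<Sum>j\<in>UNIV. E j k - D j k * P j - A j * H j k) * cnj (A k))
   = (\<Sum>j\<in>UNIV. \<Sum>k\<in>UNIV. E j k * cnj (A k)) - (\<Sum>j\<in>UNIV. \<Sum>k\<in>UNIV. P j * D j k * cnj (A k))
    - (\<Sum>j\<in>UNIV. \<Sum>k\<in>UNIV. H j k * A j * cnj (A k))"
  unfolding sum_distrib_right
  by (subst sum.swap) (simp only: left_diff_distrib sum_subtractf, simp add: ac_simps)
 have s2: "(\<Sum>k\<in>UNIV. G * cnj (Q k)) - (\<Sum>k\<in>UNIV. cnj (P k) * G * cnj (A k)) = of_real ((cmod G)^2)"
 proof -
  have "G * cnj G = G * (\<Sum>k\<in>UNIV. cnj (Q k) - cnj (A k) * cnj (P k))"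
   by (subst (2) G) simp
  also have "... = (\<Sum>k\<in>UNIV. G * cnj (Q k)) - (\<Sum>k\<in>UNIV. cnj (P k) * G * cnj (A k))"
   by (simp add: sum_distrib_left sum_subtractf right_diff_distrib ac_simps)
  finally show ?thesis unfolding complex_norm_square ..
 qed
 have "(\<Sum>k\<in>UNIV. db k (%z. cr \<mu> z * (del f be z * cnj (a k z))) z)
   - (\<Sum>j\<in>UNIV. \<Sum>k\<in>UNIV. dz j (%z. cr \<mu> z * (db k (a j) z * cnj (a k z))) z)
  = cr \<mu> z * ((\<Sum>k\<in>UNIV. - (cnj (P k) * G * cnj (A k)) + (\<Sum>j\<in>UNIV. E j k - D j k * P j - A j * H j k) * cnj (A k) + G * cnj (Q k))
   - (\<Sum>j\<in>UNIV. \<Sum>k\<in>UNIV. - (P j * D j k * cnj (A k)) + E j k * cnj (A k) + D j k * cnj (D k j)))"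
  unfolding X Y by (simp add: sum_distrib_left right_diff_distrib)
 also have "(\<Sum>k\<in>UNIV. - (cnj (P k) * G * cnj (A k)) + (\<Sum>j\<in>UNIV. E j k - D j k * P j - A j * H j k) * cnj (A k) + G * cnj (Q k))
   - (\<Sum>j\<in>UNIV. \<Sum>k\<in>UNIV. - (P j * D j k * cnj (A k)) + E j k * cnj (A k) + D j k * cnj (D k j))
  = of_real ((cmod G)^2) - (\<Sum>j\<in>UNIV. \<Sum>k\<in>UNIV. D j k * cnj (D k j)) - (\<Sum>j\<in>UNIV. \<Sum>k\<in>UNIV. H j k * A j * cnj (A k))"
  unfolding sum.distrib sum_negf s1 s2[symmetric] by (simp add: algebra_simps)
 finally show ?thesis by (simp add: G_def D_def H_def A_def)
qed

lemma continuous_zero_extend: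
 assumes "continuous_on U g" "open U" "closed K" "K \<subseteq> U" "!!x. x \<notin> K ==> g x = 0"
 shows "continuous_on UNIV g"
proof -
 have "continuous_on (- K) g"
  by (rule continuous_on_eq[OF continuous_on_const[of _ 0]]) (use assms in auto)
 hence "continuous_on (U \<union> - K) g"
  using assms by (intro continuous_on_open_Un) auto
 moreover have "U \<union> - K = UNIV" using assms by auto
 ultimately show ?thesis by simp
qed

lemma integrable_zero_extend:
 fixes g :: "'a::euclidean_space => 'b::{banach, second_countable_topology}"
 assumes "continuous_on U g" "open U" "compact K" "K \<subseteq> U" "!!x. x \<notin> K ==> g x = 0"
 shows "intbl g"
 by (rule integrable_compact_support[OF continuous_zero_extend[OF assms(1,2) compact_imp_closed[OF assms(3)] assms(4,5)] assms(3,5)])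

lemma tst_zero:
 fixes be :: "complex ^ 'n => complex ^ 'n"
 assumes "closed K" "!!z. z \<notin> K ==> be z = 0" "z \<notin> K"
 shows "del f be z = 0" "curl be z = 0" "db j (%z. be z $ k) z = 0"
proof -
 have w: "dz j (%z. be z $ k) z = 0" "db j (%z. be z $ k) z = 0" for j k
  using wirt_zero[OF assms(1) _ assms(3), of "%z. be z $ k" j] assms(2) by auto
 thus "del f be z = 0" "curl be z = 0" "db j (%z. be z $ k) z = 0"
  using assms by (simp_all add: del_def curl_def vec_eq_iff)
qed

lemma del_continuous:
 assumes "open U" "c2 U f" "c2 U be" shows "continuous_on U (del f be)"
 unfolding del_def[abs_def]
 by (intro continuous_on_sum continuous_on_diff continuous_on_mult wirt_continuous(1)[OF c2_c1[OF c2_component[OF assms(3,1)]]]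
   wirt_continuous(1)[OF c1_cr[OF c2_c1[OF assms(2)]]] c2_continuous[OF c2_component[OF assms(3,1)]])

lemma curl_continuous:
 assumes "open U" "c2 U be" shows "continuous_on U (curl be)"
 unfolding curl_def[abs_def]
 by (intro continuous_on_vec_lambda continuous_on_diff wirt_continuous(2)[OF c2_c1[OF c2_component[OF assms(2,1)]]])

lemma lev_continuous:
 assumes "open U" "c2 U f" "continuous_on U be" shows "continuous_on U (%z. lev f z (be z))"
 unfolding lev_def
 by (intro continuous_on_Re continuous_on_sum continuous_on_mult continuous_on_cnj continuous_on_component[OF assms(3)]
   wirt_continuous(2)[OF wirt_c1(1)[OF c2_cr[OF assms(2,1)]]])

lemma pd_continuous:
 assumes "c1 U f" "continuous_on U be" shows "continuous_on U (%z. pd f z (be z))"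
 unfolding pd_def
 by (intro continuous_on_sum continuous_on_mult continuous_on_component[OF assms(2)] wirt_continuous(1)[OF c1_cr[OF assms(1)]])

lemma lev_zero: "lev f z 0 = 0" and pd_zero: "pd f z 0 = 0" by (simp_all add: lev_def pd_def)

text \<open>Compact support in U makes the left side of the pointwise identity integrate to zero,
  without a boundary term. The cross terms are then traded for the curl.\<close>

lemma bochner_inequality:
 fixes be :: "complex ^ 'n => complex ^ 'n"
 assumes U: "open U" and f: "c2 U f" and b: "c2 UNIV be" and K: "compact K" "K \<subseteq> U" "!!z. z \<notin> K ==> be z = 0"
 shows "intbl (%z. exp (- f z) * lev f z (be z))"
  "intbl (%z. exp (- f z) * (cmod (del f be z))^2)"
  "intbl (%z. exp (- f z) * (norm (curl be z))^2)"
  "(LBINT z. exp (- f z) * lev f z (be z)) <=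
   (LBINT z. exp (- f z) * (cmod (del f be z))^2) + (1/2) * (LBINT z. exp (- f z) * (norm (curl be z))^2)"
proof -
 have bU: "c2 U be" by (rule c2_subset[OF b]) auto
 have Kc: "closed K" by (rule compact_imp_closed[OF K(1)])
 note tz = tst_zero[of K be, OF Kc K(3)]
 define \<mu> where "\<mu> = (%z. exp (- f z))"
 define a where "a = (%j z. be z $ j)"
 have fc: "continuous_on U f" by (rule c2_continuous[OF f])
 have a2: "c2 U (a j)" for j unfolding a_def by (rule c2_component[OF bU U])
 have a1: "c1 U (a j)" for j by (rule c2_c1[OF a2])
 show i1: "intbl (%z. exp (- f z) * lev f z (be z))"
  by (rule integrable_zero_extend[OF _ U K(1,2)])
    (auto intro!: continuous_intros fc lev_continuous[OF U f c2_continuous[OF bU]] simp: K(3) lev_zero)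
 show i2: "intbl (%z. exp (- f z) * (cmod (del f be z))^2)"
  by (rule integrable_zero_extend[OF _ U K(1,2)])
    (auto intro!: continuous_intros fc del_continuous[OF U f bU] simp: tz)
 show i3: "intbl (%z. exp (- f z) * (norm (curl be z))^2)"
  by (rule integrable_zero_extend[OF _ U K(1,2)])
    (auto intro!: continuous_intros fc curl_continuous[OF U bU] simp: tz)
 have exd: "((%t. exp (- t)) has_real_derivative - exp (- t)) (at t)" for t :: real
  by (auto intro!: derivative_eq_intros)
 have mu1: "c1 U (cr \<mu>)" unfolding \<mu>_def
  by (intro c1_cr c1_compose[OF c2_c1[OF f], where g'="%t. - exp (- t)"] exd) (auto intro!: continuous_intros)
 have dl: "del f be = (%z. \<Sum>j\<in>UNIV. dz j (a j) z - a j z * dz j (cr f) z)"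
  by (simp add: del_def[abs_def] a_def)
 have del1: "c1 U (del f be)" unfolding dl
  by (rule c1_sum[OF c1_diff[OF wirt_c1(1)[OF a2] c1_mult[OF a1 wirt_c1(1)[OF c2_cr[OF f U]]]]])
 let ?X = "%k z. cr \<mu> z * (del f be z * cnj (a k z))" and ?Y = "%j k z. cr \<mu> z * (db k (a j) z * cnj (a k z))"
 have X1: "c1 UNIV (?X k)" for k
  by (rule c1_zero_extend[OF c1_mult[OF mu1 c1_mult[OF del1 c1_cnj[OF a1]]] U Kc K(2)]) (simp add: a_def K(3))
 have Y1: "c1 UNIV (?Y j k)" for j k
  by (rule c1_zero_extend[OF c1_mult[OF mu1 c1_mult[OF wirt_c1(2)[OF a2] c1_cnj[OF a1]]] U Kc K(2)]) (simp add: a_def K(3))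
 have X0: "!!z. z \<notin> K ==> ?X k z = 0" and Y0: "!!z. z \<notin> K ==> ?Y j k z = 0" for j k by (simp_all add: a_def K(3))
 note IX = integral_wirt(3,4)[OF X1 K(1) X0] and IY = integral_wirt(1,2)[OF Y1 K(1) Y0]
 let ?D = "%z. (\<Sum>j\<in>UNIV. \<Sum>k\<in>UNIV. db k (a j) z * cnj (db j (a k) z))"
 have id: "intbl (%z. exp (- f z) * Re (?D z))"
 proof (rule integrable_zero_extend[OF _ U K(1,2)])
  show "continuous_on U (%z. exp (- f z) * Re (?D z))"
   by (intro continuous_intros fc wirt_continuous(2)[OF a1])
  show "exp (- f z) * Re (?D z) = 0" if "z \<notin> K" for z using tz(3)[of z] that by (simp add: a_def)
 qed
 have pt: "Re ((\<Sum>k\<in>UNIV. db k (?X k) z) - (\<Sum>j\<in>UNIV. \<Sum>k\<in>UNIV. dz j (?Y j k) z))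
   = exp (- f z) * (cmod (del f be z))^2 - exp (- f z) * Re (?D z) - exp (- f z) * lev f z (be z)" for z
 proof (cases "z \<in> U")
  case True
  show ?thesis using bochner_pointwise[OF U f bU True]
   unfolding a_def \<mu>_def lev_def by (simp add: right_diff_distrib)
 next
  case False
  hence "z \<notin> K" using K(2) by blast
  thus ?thesis
   using wirt_zero(2)[OF Kc X0] wirt_zero(1)[OF Kc Y0] K(3) tz by (simp add: a_def lev_zero)
 qed
 have "0 = Re (LBINT z. ((\<Sum>k\<in>UNIV. db k (?X k) z) - (\<Sum>j\<in>UNIV. \<Sum>k\<in>UNIV. dz j (?Y j k) z)))"
  using IX IY by (simp add: bi_integrable_sum bi_integral_sum)
 also have "... = (LBINT z. Re ((\<Sum>k\<in>UNIV. db k (?X k) z) - (\<Sum>j\<in>UNIV. \<Sum>k\<in>UNIV. dz j (?Y j k) z)))"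
  by (rule integral_Re[symmetric], intro bi_integrable_diff bi_integrable_sum IX(1) IY(1))
 also have "... = (LBINT z. exp (- f z) * (cmod (del f be z))^2) - (LBINT z. exp (- f z) * Re (?D z)) - (LBINT z. exp (- f z) * lev f z (be z))"
  unfolding pt using i1 i2 id by simp
 finally have e: "(LBINT z. exp (- f z) * lev f z (be z)) = (LBINT z. exp (- f z) * (cmod (del f be z))^2) - (LBINT z. exp (- f z) * Re (?D z))"
  by simp
 have "- (1/2) * (LBINT z. exp (- f z) * (norm (curl be z))^2) = (LBINT z. - (1/2) * (exp (- f z) * (norm (curl be z))^2))"
  by simp
 also have "... <= (LBINT z. exp (- f z) * Re (?D z))"
 proof (rule integral_mono)
  show "intbl (%z. - (1/2) * (exp (- f z) * (norm (curl be z))^2))" by (intro integrable_mult_right i3)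
  show "intbl (%z. exp (- f z) * Re (?D z))" by (rule id)
  fix z
  have "- (1/2) * (norm (curl be z))^2 <= Re (?D z)"
   unfolding norm_curl using cross_terms_bound[of "%j k. db k (a j) z"] by (simp add: a_def)
  hence "exp (- f z) * (- (1/2) * (norm (curl be z))^2) <= exp (- f z) * Re (?D z)" by (intro mult_left_mono) auto
  thus "- (1/2) * (exp (- f z) * (norm (curl be z))^2) <= exp (- f z) * Re (?D z)" by (simp add: algebra_simps)
 qed
 finally show "(LBINT z. exp (- f z) * lev f z (be z)) <=
   (LBINT z. exp (- f z) * (cmod (del f be z))^2) + (1/2) * (LBINT z. exp (- f z) * (norm (curl be z))^2)"
  using e by simp
qed

section \<open>Integration by parts against test forms\<close>

lemma inner_complex_cnj: "x \<bullet> y = Re (x * cnj y)" for x y :: complex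
 by (simp add: inner_complex_def)

lemma div_weighted:
 assumes "open U" "c2 U f" "c2 U be" "z \<in> U"
 shows "(\<Sum>j\<in>UNIV. dz j (%z. of_real (exp (- f z)) * be z $ j) z) = of_real (exp (- f z)) * del f be z"
proof -
 have exd: "((%t. exp (- t)) has_real_derivative - exp (- t)) (at t)" for t :: real
  by (auto intro!: derivative_eq_intros)
 have mu1: "c1 U (%z. complex_of_real (exp (- f z)))"
  by (intro c1_cr c1_compose[OF c2_c1[OF assms(2)], where g'="%t. - exp (- t)"] exd) (auto intro!: continuous_intros)
 show ?thesis
  unfolding wirt_mult(1)[OF mu1 c2_c1[OF c2_component[OF assms(3,1)]] assms(4)]
   wirt_compose(1)[OF c2_c1[OF assms(2)] assms(4) exd] del_def
  by (simp add: sum_distrib_left algebra_simps)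
qed

lemma dbar_adjoint:
 fixes be :: "complex ^ 'n => complex ^ 'n"
 assumes U: "open U" and f: "c2 U f" and A: "c1 U A" and b: "c2 UNIV be" and K: "compact K" "K \<subseteq> U" "!!z. z \<notin> K ==> be z = 0"
 shows "(LBINT z. Re (of_real (exp (- f z)) * (\<Sum>j\<in>UNIV. db j A z * cnj (be z $ j))))
   = - (LBINT z. exp (- f z) * (A z \<bullet> del f be z))"
  "intbl (%z. exp (- f z) * (A z \<bullet> del f be z))"
  "intbl (%z. Re (of_real (exp (- f z)) * (\<Sum>j\<in>UNIV. db j A z * cnj (be z $ j))))"
proof -
 have bU: "c2 U be" by (rule c2_subset[OF b]) auto
 have Kc: "closed K" by (rule compact_imp_closed[OF K(1)])
 have exd: "((%t. exp (- t)) has_real_derivative - exp (- t)) (at t)" for t :: real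
  by (auto intro!: derivative_eq_intros)
 have mu1: "c1 U (%z. complex_of_real (exp (- f z)))"
  by (intro c1_cr c1_compose[OF c2_c1[OF f], where g'="%t. - exp (- t)"] exd) (auto intro!: continuous_intros)
 have g1: "c1 U (%z. of_real (exp (- f z)) * be z $ j)" for j by (rule c1_mult[OF mu1 c2_c1[OF c2_component[OF bU U]]])
 let ?X = "%j z. A z * cnj (of_real (exp (- f z)) * be z $ j)"
 have X1: "c1 UNIV (?X j)" for j
  by (rule c1_zero_extend[OF c1_mult[OF A c1_cnj[OF g1]] U Kc K(2)]) (simp add: K(3))
 have X0: "!!z. z \<notin> K ==> ?X j z = 0" for j by (simp add: K(3))
 note IX = integral_wirt(3,4)[OF X1 K(1) X0]
 have fc: "continuous_on U f" by (rule c2_continuous[OF f])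
 show i1: "intbl (%z. exp (- f z) * (A z \<bullet> del f be z))"
  by (rule integrable_zero_extend[OF _ U K(1,2)])
    (auto intro!: continuous_intros fc c1_continuous[OF A] del_continuous[OF U f bU] simp: tst_zero[OF Kc K(3)])
 show i2: "intbl (%z. Re (of_real (exp (- f z)) * (\<Sum>j\<in>UNIV. db j A z * cnj (be z $ j))))"
 proof (rule integrable_zero_extend[OF _ U K(1,2)])
  show "continuous_on U (%z. Re (of_real (exp (- f z)) * (\<Sum>j\<in>UNIV. db j A z * cnj (be z $ j))))"
   by (intro continuous_intros fc wirt_continuous(2)[OF A] c2_continuous[OF c2_component[OF bU U]])
 qed (simp add: K(3))
 have pt: "Re (\<Sum>j\<in>UNIV. db j (?X j) z) = exp (- f z) * (A z \<bullet> del f be z) + Re (of_real (exp (- f z)) * (\<Sum>j\<in>UNIV. db j A z * cnj (be z $ j)))" for z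
 proof (cases "z \<in> U")
  case True
  have "(\<Sum>j\<in>UNIV. db j (?X j) z) = A z * cnj (\<Sum>j\<in>UNIV. dz j (%z. of_real (exp (- f z)) * be z $ j) z)
    + of_real (exp (- f z)) * (\<Sum>j\<in>UNIV. db j A z * cnj (be z $ j))"
   unfolding wirt_mult(2)[OF A c1_cnj[OF g1] True] wirt_cnj(2)[OF g1 True]
   by (simp add: sum.distrib sum_distrib_left algebra_simps)
  thus ?thesis unfolding div_weighted[OF U f bU True] inner_complex_cnj
   by (simp add: algebra_simps)
 next
  case False
  hence "z \<notin> K" using K(2) by blast
  thus ?thesis
   using wirt_zero(2)[OF Kc X0] K(3) tst_zero(1)[OF Kc K(3)] by simp
 qed
 have "0 = Re (LBINT z. (\<Sum>j\<in>UNIV. db j (?X j) z))" using IX by (simp add: bi_integral_sum)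
 also have "... = (LBINT z. Re (\<Sum>j\<in>UNIV. db j (?X j) z))"
  by (rule integral_Re[symmetric], intro bi_integrable_sum IX(1))
 finally show "(LBINT z. Re (of_real (exp (- f z)) * (\<Sum>j\<in>UNIV. db j A z * cnj (be z $ j))))
   = - (LBINT z. exp (- f z) * (A z \<bullet> del f be z))" unfolding pt using i1 i2 by simp
qed

lemma abs_le_imp_sq_le: "\<bar>x\<bar> <= y ==> x\<^sup>2 <= y\<^sup>2" for x y :: real
 by (metis abs_ge_zero power2_abs power_mono)

lemma wirt_lincomb:
 fixes be \<gamma> :: "complex ^ 'n => complex ^ 'n"
 assumes "c2 UNIV be" "c2 UNIV \<gamma>"
 shows "dz j (%z. (be z + s *\<^sub>R \<gamma> z) $ k) z = dz j (%z. be z $ k) z + of_real s * dz j (%z. \<gamma> z $ k) z"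
  "db j (%z. (be z + s *\<^sub>R \<gamma> z) $ k) z = db j (%z. be z $ k) z + of_real s * db j (%z. \<gamma> z $ k) z"
proof -
 have b1: "c1 UNIV (%z. be z $ k)" and g1: "c1 UNIV (%z. \<gamma> z $ k)"
  using c2_c1[OF c2_component] assms by auto
 have g2: "c1 UNIV (%z. of_real s * \<gamma> z $ k)" by (rule c1_mult[OF c1_const g1])
 have eq: "(%z. (be z + s *\<^sub>R \<gamma> z) $ k) = (%z. be z $ k + of_real s * \<gamma> z $ k)"
  by (simp add: scaleR_conv_of_real[where 'a=complex] fun_eq_iff)
 show "dz j (%z. (be z + s *\<^sub>R \<gamma> z) $ k) z = dz j (%z. be z $ k) z + of_real s * dz j (%z. \<gamma> z $ k) z"
  "db j (%z. (be z + s *\<^sub>R \<gamma> z) $ k) z = db j (%z. be z $ k) z + of_real s * db j (%z. \<gamma> z $ k) z"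
  unfolding eq wirt_add[OF b1 g2 UNIV_I] wirt_mult[OF c1_const g1 UNIV_I] by (simp_all add: wirt_const)
qed

lemma del_lincomb:
 assumes "c2 UNIV be" "c2 UNIV \<gamma>"
 shows "del f (%z. be z + s *\<^sub>R \<gamma> z) z = del f be z + s *\<^sub>R del f \<gamma> z"
 unfolding del_def wirt_lincomb[OF assms] scaleR_conv_of_real[where 'a=complex] sum_distrib_left sum.distrib[symmetric]
 by (intro sum.cong refl) (simp add: scaleR_conv_of_real[where 'a=complex] algebra_simps)

lemma curl_lincomb:
 assumes "c2 UNIV be" "c2 UNIV \<gamma>"
 shows "curl (%z. be z + s *\<^sub>R \<gamma> z) z = curl be z + s *\<^sub>R curl \<gamma> z"
 unfolding curl_def wirt_lincomb[OF assms] by (simp add: vec_eq_iff scaleR_conv_of_real[where 'a=complex] algebra_simps)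

lemma tst_lincomb:
 assumes "tst U be" "tst U \<gamma>" shows "tst U (%z. be z + s *\<^sub>R \<gamma> z)"
proof -
 obtain K1 where K1: "compact K1" "K1 \<subseteq> U" "\<forall>z. z \<notin> K1 --> be z = 0" using assms(1) by (auto simp: tst_def)
 obtain K2 where K2: "compact K2" "K2 \<subseteq> U" "\<forall>z. z \<notin> K2 --> \<gamma> z = 0" using assms(2) by (auto simp: tst_def)
 have "c2 UNIV (%z. be z + s *\<^sub>R \<gamma> z)"
  using assms unfolding tst_def by (intro c2_add c2_scaleR c2_const) auto
 moreover have "compact (K1 \<union> K2)" "K1 \<union> K2 \<subseteq> U" "\<forall>z. z \<notin> K1 \<union> K2 --> be z + s *\<^sub>R \<gamma> z = 0"
  using K1 K2 by auto
 ultimately show ?thesis unfolding tst_def by blast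
qed

section \<open>The twisted L2 estimate\<close>

lemma del_change_weight:
 assumes "c1 U f" "c1 U g" "z \<in> U"
 shows "del f be z = del g be z + pd (%z. g z - f z) z (be z)"
 unfolding del_def pd_def of_real_diff wirt_diff(1)[OF c1_cr[OF assms(2)] c1_cr[OF assms(1)] assms(3)] sum.distrib[symmetric]
 by (intro sum.cong refl) (simp add: algebra_simps)

text \<open>The reciprocals of the two factors add up to 1. Written in this form, S is the share of
  the cross term that the curvature has to bear, and \<open>1 - 1 / S\<close> the price paid in the
  norm of the solution.\<close>

lemma cmod_add_sq_le:
 assumes "S > 1" shows "(cmod (x + y))^2 <= (S / (S - 1)) * (cmod x)^2 + S * (cmod y)^2"
proof -
 define a b s where "a = cmod x" and "b = cmod y" and "s = S - 1"
 have s: "s > 0" "S = s + 1" using assms by (auto simp: s_def)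
 have "(cmod (x + y))^2 <= (a + b)^2" unfolding a_def b_def by (intro power_mono norm_triangle_ineq) auto
 also have "(a + b)^2 = a\<^sup>2 + b\<^sup>2 + 2 * a * b" by (simp add: power2_sum)
 also have "2 * a * b <= a\<^sup>2 / s + s * b\<^sup>2"
 proof -
  have "0 <= (a - s * b)^2 / s" using s by simp
  also have "... = a\<^sup>2 / s + s * b\<^sup>2 - 2 * a * b" using s by (simp add: field_simps power2_eq_square)
  finally show ?thesis by simp
 qed
 also have "a\<^sup>2 + b\<^sup>2 + (a\<^sup>2 / s + s * b\<^sup>2) = (S / (S - 1)) * a\<^sup>2 + S * b\<^sup>2"
  using s by (simp add: field_simps)
 finally show ?thesis by (simp add: a_def b_def)
qed

text \<open>Bochner's inequality is used with the weight \<open>xi\<close>, the equation with the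
  weight \<open>zeta\<close>. The two adjoints differ by \<open>pd\<close> of
  \<open>zeta - xi\<close>, and S times its square is charged to the curvature of \<open>xi\<close>.
  In classical terms \<open>exp (zeta - xi)\<close> is the twist factor. R measures dbar of A
  against the curvature that is left.\<close>

lemma l2_estimate:
 fixes be :: "complex ^ 'n => complex ^ 'n"
 assumes U: "open U" and xi: "c2 U xi" and zeta: "c2 U zeta" and A: "c1 U A"
  and S: "continuous_on U S" "!!z. z \<in> U ==> S z > 1"
  and R: "continuous_on U R" "!!z. z \<in> U ==> R z >= 0"
  and nn: "!!z b. z \<in> U ==> 0 <= lev xi z b - S z * (cmod (pd (%z. zeta z - xi z) z b))^2"
  and key: "!!z b. z \<in> U ==> (cmod (\<Sum>j\<in>UNIV. db j A z * cnj (b $ j)))^2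
    <= R z * (lev xi z b - S z * (cmod (pd (%z. zeta z - xi z) z b))^2)"
  and C: "intbl (%z. indicator U z * (exp (xi z - 2 * zeta z) * R z))"
   "(LBINT z. indicator U z * (exp (xi z - 2 * zeta z) * R z)) <= C0"
  and b: "c2 UNIV be" and K: "compact K" "K \<subseteq> U" "!!z. z \<notin> K ==> be z = 0"
 shows "intbl (%z. exp (- xi z) * (S z / (S z - 1)) * (cmod (del zeta be z))^2)"
  "(LBINT z. Re (of_real (exp (- zeta z)) * (\<Sum>j\<in>UNIV. db j A z * cnj (be z $ j))))^2
   <= C0 * ((LBINT z. exp (- xi z) * (S z / (S z - 1)) * (cmod (del zeta be z))^2) + (1/2) * (LBINT z. exp (- xi z) * (norm (curl be z))^2))"
proof -
 have bU: "c2 U be" by (rule c2_subset[OF b]) auto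
 have Kc: "closed K" by (rule compact_imp_closed[OF K(1)])
 note bo = bochner_inequality[OF U xi b K]
 have xc: "continuous_on U xi" "continuous_on U zeta" by (rule c2_continuous[OF xi], rule c2_continuous[OF zeta])
 let ?p = "%z. pd (%z. zeta z - xi z) z (be z)"
 have pc: "continuous_on U ?p" by (rule pd_continuous[OF c1_diff[OF c2_c1[OF zeta] c2_c1[OF xi]] c2_continuous[OF bU]])
 show i1: "intbl (%z. exp (- xi z) * (S z / (S z - 1)) * (cmod (del zeta be z))^2)"
  by (rule integrable_zero_extend[OF _ U K(1,2)])
    (auto intro!: continuous_intros xc S(1) del_continuous[OF U zeta bU] simp: tst_zero[OF Kc K(3)] dest: S(2))
 have i2: "intbl (%z. exp (- xi z) * (S z * (cmod (?p z))^2))"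
  by (rule integrable_zero_extend[OF _ U K(1,2)])
    (auto intro!: continuous_intros xc S(1) pc simp: K(3) pd_zero)
 let ?q = "%z. lev xi z (be z) - S z * (cmod (?p z))^2"
 have iq: "intbl (%z. exp (- xi z) * ?q z)" unfolding right_diff_distrib
  by (intro bi_integrable_diff bo(1) i2)
 have i4: "intbl (%z. exp (- xi z) * (cmod (del xi be z))^2)" by (rule bo(2))
 have "(LBINT z. exp (- xi z) * ?q z) = (LBINT z. exp (- xi z) * lev xi z (be z)) - (LBINT z. exp (- xi z) * (S z * (cmod (?p z))^2))"
  unfolding right_diff_distrib by (rule bi_integral_diff[OF bo(1) i2])
 also have "... <= (LBINT z. exp (- xi z) * (cmod (del xi be z))^2) - (LBINT z. exp (- xi z) * (S z * (cmod (?p z))^2)) + (1/2) * (LBINT z. exp (- xi z) * (norm (curl be z))^2)"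
  using bo(4) by simp
 also have "(LBINT z. exp (- xi z) * (cmod (del xi be z))^2) - (LBINT z. exp (- xi z) * (S z * (cmod (?p z))^2))
   = (LBINT z. exp (- xi z) * (cmod (del xi be z))^2 - exp (- xi z) * (S z * (cmod (?p z))^2))"
  by (rule bi_integral_diff[OF i4 i2, symmetric])
 also have "... <= (LBINT z. exp (- xi z) * (S z / (S z - 1)) * (cmod (del zeta be z))^2)"
 proof (rule integral_mono[OF bi_integrable_diff[OF i4 i2] i1])
  fix z
  show "exp (- xi z) * (cmod (del xi be z))^2 - exp (- xi z) * (S z * (cmod (?p z))^2) <= exp (- xi z) * (S z / (S z - 1)) * (cmod (del zeta be z))^2"
  proof (cases "z \<in> U")
   case True
   have "(cmod (del xi be z))^2 - S z * (cmod (?p z))^2 <= (S z / (S z - 1)) * (cmod (del zeta be z))^2"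
    using cmod_add_sq_le[OF S(2)[OF True], of "del zeta be z" "?p z"] del_change_weight[OF c2_c1[OF xi] c2_c1[OF zeta] True, of be] by simp
   hence "exp (- xi z) * ((cmod (del xi be z))^2 - S z * (cmod (?p z))^2) <= exp (- xi z) * ((S z / (S z - 1)) * (cmod (del zeta be z))^2)"
    by (intro mult_left_mono) auto
   thus ?thesis by (simp add: right_diff_distrib mult.assoc)
  next
   case False
   hence "z \<notin> K" using K(2) by blast
   thus ?thesis using tst_zero(1)[OF Kc K(3)] K(3) by (simp add: pd_zero)
  qed
 qed
 finally have Q: "(LBINT z. exp (- xi z) * ?q z) <= (LBINT z. exp (- xi z) * (S z / (S z - 1)) * (cmod (del zeta be z))^2) + (1/2) * (LBINT z. exp (- xi z) * (norm (curl be z))^2)"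
  by simp
 let ?L = "%z. Re (of_real (exp (- zeta z)) * (\<Sum>j\<in>UNIV. db j A z * cnj (be z $ j)))"
 \<comment> \<open>Cauchy-Schwarz is applied with \<open>exp (- zeta)\<close> written as the product
   of the square roots of \<open>exp (xi - 2 * zeta)\<close> and \<open>exp (- xi)\<close>.\<close>
 let ?u = "%z. indicator U z * sqrt (exp (xi z - 2 * zeta z) * R z)" and ?v = "%z. sqrt (exp (- xi z) * ?q z)"
 have q0: "?q z = 0" if "z \<notin> K" for z using K(3)[OF that] by (simp add: lev_zero pd_zero)
 have qn: "?q z >= 0" for z
 proof (cases "z \<in> U")
  case False
  hence "z \<notin> K" using K(2) by blast
  thus ?thesis using q0[of z] by simp
 qed (use nn in simp)
 have mu: "?u \<in> borel_measurable lborel"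
 proof -
  have "(%z. indicator U z *\<^sub>R sqrt (exp (xi z - 2 * zeta z) * R z)) \<in> borel_measurable borel"
   by (rule borel_measurable_continuous_on_indicator) (use U in \<open>auto intro!: continuous_intros xc R(1)\<close>)
  thus ?thesis by simp
 qed
 have mv: "?v \<in> borel_measurable lborel" using borel_measurable_integrable[OF iq] by measurable
 have u2: "(?u z)^2 = indicator U z * (exp (xi z - 2 * zeta z) * R z)" for z
  using R(2)[of z] by (cases "z \<in> U") (auto simp: power_mult_distrib)
 have v2: "(?v z)^2 = exp (- xi z) * ?q z" for z using qn[of z] by simp
 note cs = cs_integral[OF mu mv, unfolded u2 v2, OF C(1) iq]
 have "\<bar>\<integral>z. ?L z \<partial>lborel\<bar> <= (LBINT z. ?u z * ?v z)"
 proof (rule order_trans[OF integral_abs_bound integral_mono])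
  show "intbl (%z. \<bar>?L z\<bar>)" using dbar_adjoint(3)[OF U zeta A b K] by simp
  show "intbl (%z. ?u z * ?v z)" by (rule cs(1))
  fix z
  show "\<bar>?L z\<bar> <= ?u z * ?v z"
  proof (cases "z \<in> U")
   case True
   have "\<bar>?L z\<bar> <= exp (- zeta z) * cmod (\<Sum>j\<in>UNIV. db j A z * cnj (be z $ j))"
    by (rule order_trans[OF abs_Re_le_cmod]) (simp add: norm_mult)
   also have "... <= exp (- zeta z) * sqrt (R z * ?q z)"
    by (intro mult_left_mono real_le_rsqrt key[OF True]) auto
   also have "... = sqrt ((exp (- zeta z))^2) * sqrt (R z * ?q z)" by simp
   also have "(exp (- zeta z))^2 = exp (xi z - 2 * zeta z) * exp (- xi z)"
    unfolding exp_add[symmetric] exp_double[symmetric] by simp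
   also have "sqrt (exp (xi z - 2 * zeta z) * exp (- xi z)) * sqrt (R z * ?q z) = ?u z * ?v z"
    using True by (simp add: real_sqrt_mult)
   finally show ?thesis .
  next
   case False
   hence "z \<notin> K" using K(2) by blast
   thus ?thesis using K(3) False by simp
  qed
 qed
 hence "(LBINT z. ?L z)^2 <= (LBINT z. ?u z * ?v z)^2"
  by (rule abs_le_imp_sq_le)
 also have "... <= (LBINT z. indicator U z * (exp (xi z - 2 * zeta z) * R z)) * (LBINT z. exp (- xi z) * ?q z)" by (rule cs(2))
 also have "... <= C0 * ((LBINT z. exp (- xi z) * (S z / (S z - 1)) * (cmod (del zeta be z))^2) + (1/2) * (LBINT z. exp (- xi z) * (norm (curl be z))^2))"
 proof (rule mult_mono[OF C(2) Q])
  show "0 <= C0" by (rule order_trans[OF _ C(2)]) (auto intro!: bi_integral_nonneg simp: indicator_def R(2))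
  show "0 <= (LBINT z. exp (- xi z) * ?q z)" using qn by (intro bi_integral_nonneg mult_nonneg_nonneg) auto
 qed
 finally show "(LBINT z. ?L z)^2 <= C0 * ((LBINT z. exp (- xi z) * (S z / (S z - 1)) * (cmod (del zeta be z))^2) + (1/2) * (LBINT z. exp (- xi z) * (norm (curl be z))^2))" .
qed

text \<open>Test forms are not restricted to closed ones. The curl is kept as a second component of
  the L2 vector, so duality yields a pair: the solution u and a field w paired with the curl. The
  last conclusion says that dbar of \<open>A - u\<close> is, weakly and up to sign and weights, the
  adjoint of dbar applied to w; that it vanishes is a separate matter.\<close>

lemma l2_solve:
 fixes A :: "complex ^ 'n => complex"
 assumes U: "open U" and xi: "c2 U xi" and zeta: "c2 U zeta" and A: "c1 U A"
  and S: "continuous_on U S" "!!z. z \<in> U ==> S z > 1"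
  and R: "continuous_on U R" "!!z. z \<in> U ==> R z >= 0"
  and nn: "!!z b. z \<in> U ==> 0 <= lev xi z b - S z * (cmod (pd (%z. zeta z - xi z) z b))^2"
  and key: "!!z b. z \<in> U ==> (cmod (\<Sum>j\<in>UNIV. db j A z * cnj (b $ j)))^2
    <= R z * (lev xi z b - S z * (cmod (pd (%z. zeta z - xi z) z b))^2)"
  and C: "intbl (%z. indicator U z * (exp (xi z - 2 * zeta z) * R z))"
   "(LBINT z. indicator U z * (exp (xi z - 2 * zeta z) * R z)) <= C0"
 obtains u :: "complex ^ 'n => complex" and w :: "complex ^ 'n => complex ^ 'n ^ 'n"
 where "u \<in> borel_measurable borel"
  "intbl (%z. indicator U z * (exp (xi z - 2 * zeta z) * (1 - 1 / S z) * (cmod (u z))^2))"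
  "(LBINT z. indicator U z * (exp (xi z - 2 * zeta z) * (1 - 1 / S z) * (cmod (u z))^2)) <= C0"
  "w \<in> borel_measurable borel" "intbl (%z. (norm (w z))^2)"
  "!!be. tst U be ==> (LBINT z. exp (- zeta z) * (A z \<bullet> del zeta be z)) - (LBINT z. exp (- zeta z) * (u z \<bullet> del zeta be z))
    = - (LBINT z. w z \<bullet> (sqrt (exp (- xi z) / 2) *\<^sub>R curl be z))
    \<and> intbl (%z. exp (- zeta z) * (u z \<bullet> del zeta be z))"
proof -
 have xc: "continuous_on U xi" "continuous_on U zeta" by (rule c2_continuous[OF xi], rule c2_continuous[OF zeta])
 define sg where "sg z = exp (- xi z) * (S z / (S z - 1))" for z
 have sgn: "sg z > 0" if "z \<in> U" for z using S(2)[OF that] by (simp add: sg_def)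
 have sgc: "continuous_on U sg" unfolding sg_def[abs_def]
  by (intro continuous_intros xc S(1)) (use S(2) in force)
 define W where "W be z = (sqrt (sg z) *\<^sub>R del zeta be z, sqrt (exp (- xi z) / 2) *\<^sub>R curl be z)" for be :: "complex ^ 'n => complex ^ 'n" and z
 define L where "L be = - (LBINT z. exp (- zeta z) * (A z \<bullet> del zeta be z))" for be
 have Wc: "continuous_on UNIV (W be) \<and> (\<exists>K. compact K \<and> K \<subseteq> U \<and> (\<forall>z. z \<notin> K --> W be z = 0))" if t: "tst U be" for be
 proof -
  obtain K where K: "compact K" "K \<subseteq> U" "!!z. z \<notin> K ==> be z = 0" and b: "c2 UNIV be" using t by (auto simp: tst_def)
  have bU: "c2 U be" by (rule c2_subset[OF b]) auto
  have z: "W be z = 0" if "z \<notin> K" for z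
   using tst_zero(1,2)[OF compact_imp_closed[OF K(1)] K(3)] that by (simp add: W_def zero_prod_def)
  have "continuous_on U (W be)" unfolding W_def[abs_def]
   by (intro continuous_intros sgc xc del_continuous[OF U zeta bU] curl_continuous[OF U bU]) auto
  hence "continuous_on UNIV (W be)" by (rule continuous_zero_extend[OF _ U compact_imp_closed[OF K(1)] K(2) z])
  thus ?thesis using K z by blast
 qed
 have C0: "C0 >= 0" by (rule order_trans[OF _ C(2)]) (auto intro!: bi_integral_nonneg simp: indicator_def R(2))
 have nW: "(norm (W be z))^2 = exp (- xi z) * (S z / (S z - 1)) * (cmod (del zeta be z))^2 + (1/2) * (exp (- xi z) * (norm (curl be z))^2)"
  if "tst U be" for be z
 proof -
  have "sg z >= 0 \<or> del zeta be z = 0"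
  proof (cases "z \<in> U")
   case False
   obtain K where K: "compact K" "K \<subseteq> U" "!!z. z \<notin> K ==> be z = 0" using \<open>tst U be\<close> by (auto simp: tst_def)
   thus ?thesis using tst_zero(1)[of K be z zeta] False compact_imp_closed by blast
  qed (use sgn in force)
  hence 1: "\<bar>sg z\<bar> * (cmod (del zeta be z))^2 = sg z * (cmod (del zeta be z))^2" by auto
  have 2: "(sqrt x)^2 = \<bar>x\<bar>" for x :: real by (simp flip: real_sqrt_power)
  have "(norm (W be z))^2 = \<bar>sg z\<bar> * (cmod (del zeta be z))^2 + (1/2) * (exp (- xi z) * (norm (curl be z))^2)"
   by (simp add: W_def norm_Pair power_mult_distrib 2)
  thus ?thesis unfolding 1 by (simp add: sg_def)
 qed
 have iW: "intbl (%z. (norm (W be z))^2)" if t: "tst U be" for be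
 proof -
  obtain K where K: "compact K" "K \<subseteq> U" "\<forall>z. z \<notin> K --> W be z = 0" and c: "continuous_on UNIV (W be)" using Wc[OF t] by blast
  show ?thesis by (rule integrable_compact_support[OF _ K(1)]) (use K(3) c in \<open>auto intro!: continuous_intros\<close>)
 qed
 obtain w where w: "w \<in> borel_measurable lborel" "intbl (%x. (norm (w x))^2)"
  "(LBINT x. (norm (w x))^2) <= C0" "!!be. be \<in> {be. tst U be} ==> L be = (LBINT x. w x \<bullet> W be x)"
 proof (rule riesz_L2[of "{be. tst U be}" W L C0 lborel])
  fix b c s assume bc: "b \<in> {be. tst U be}" "c \<in> {be. tst U be}"
  then obtain Kb Kc where b: "c2 UNIV b" "compact Kb" "Kb \<subseteq> U" "!!z. z \<notin> Kb ==> b z = 0"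
   and c: "c2 UNIV c" "compact Kc" "Kc \<subseteq> U" "!!z. z \<notin> Kc ==> c z = 0" by (auto simp: tst_def)
  let ?d = "%z. b z + s *\<^sub>R c z"
  have "W ?d x = W b x + s *\<^sub>R W c x" for x
   unfolding W_def del_lincomb[OF b(1) c(1)] curl_lincomb[OF b(1) c(1)]
   by (simp add: scaleR_add_right mult.commute)
  moreover have "L ?d = L b + s * L c"
   unfolding L_def del_lincomb[OF b(1) c(1)] inner_add_right inner_scaleR_right distrib_left
   using dbar_adjoint(2)[OF U zeta A b] dbar_adjoint(2)[OF U zeta A c]
   by (simp add: mult.left_commute[of _ s])
  ultimately show "\<exists>d\<in>{be. tst U be}. (\<forall>x. W d x = W b x + s *\<^sub>R W c x) \<and> L d = L b + s * L c"
   using tst_lincomb[of U b c s] bc by blast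
 next
  have "tst U (%z. 0)" unfolding tst_def using c2_const[of UNIV "0::complex ^ 'n"] by (auto intro!: exI[of _ "{}"])
  thus "{be. tst U be} \<noteq> {}" by blast
 next
  fix b assume "b \<in> {be. tst U be}"
  hence t: "tst U b" by simp
  then obtain K where b: "c2 UNIV b" and K: "compact K" "K \<subseteq> U" "!!z. z \<notin> K ==> b z = 0" by (auto simp: tst_def)
  show "W b \<in> borel_measurable lborel" using borel_measurable_continuous_onI[OF conjunct1[OF Wc[OF t]]] by simp
  show "intbl (%x. (norm (W b x))^2)" by (rule iW[OF t])
  note est = l2_estimate[OF U xi zeta A S R nn key C b K]
  have "L b = (LBINT z. Re (of_real (exp (- zeta z)) * (\<Sum>j\<in>UNIV. db j A z * cnj (b z $ j))))"
   using dbar_adjoint(1)[OF U zeta A b K] by (simp add: L_def)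
  moreover have "(LBINT x. (norm (W b x))^2) = (LBINT z. exp (- xi z) * (S z / (S z - 1)) * (cmod (del zeta b z))^2) + (1/2) * (LBINT z. exp (- xi z) * (norm (curl b z))^2)"
   unfolding nW[OF t] using est(1) bochner_inequality(3)[OF U xi b K] by simp
  ultimately show "(L b)^2 <= C0 * (LBINT x. (norm (W b x))^2)" using est(2) by simp
 qed (use C0 in auto)
 have mw[measurable]: "w \<in> borel_measurable borel" using w(1) by simp
 \<comment> \<open>This undoes the normalisation in W. Up to sign, the first component of w then
   pairs with W as u pairs with \<open>exp (- zeta) * del zeta be\<close>, and on U its squared norm
   is the weighted square of u in the claim.\<close>
 define r where "r z = indicator U z *\<^sub>R (sqrt (sg z) * exp (zeta z))" for z
 have mr[measurable]: "r \<in> borel_measurable borel"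
  unfolding r_def[abs_def] by (rule borel_measurable_continuous_on_indicator) (use U in \<open>auto intro!: continuous_intros sgc xc\<close>)
 define u where "u z = - (r z *\<^sub>R fst (w z))" for z
 have mww [measurable]: "(%z. fst (w z)) \<in> borel_measurable borel" "(%z. snd (w z)) \<in> borel_measurable borel"
  by (rule measurable_compose[OF mw borel_measurable_continuous_onI[OF continuous_on_fst[OF continuous_on_id]]],
    rule measurable_compose[OF mw borel_measurable_continuous_onI[OF continuous_on_snd[OF continuous_on_id]]])
 have iw: "intbl (%z. (norm (fst (w z)))^2)" "intbl (%z. (norm (snd (w z)))^2)"
  by (rule bi_integrable_bound[OF w(2)], simp, simp add: norm_prod_def)+
 have ueq: "indicator U z * (exp (xi z - 2 * zeta z) * (1 - 1 / S z) * (cmod (u z))^2) = indicator U z * (norm (fst (w z)))^2" for z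
 proof (cases "z \<in> U")
  case True
  have "exp (xi z - 2 * zeta z) * (1 - 1 / S z) * (sg z * (exp (zeta z))^2) = 1"
  proof -
   have "exp (xi z - 2 * zeta z) = exp (xi z) / (exp (zeta z))^2" by (simp add: exp_diff exp_double)
   thus ?thesis using S(2)[OF True] by (simp add: sg_def exp_minus field_simps)
  qed
  thus ?thesis using True sgn[OF True]
   by (simp add: u_def r_def power_mult_distrib)
 qed simp
 show ?thesis
 proof (rule that[of u "%z. snd (w z)"])
  show "u \<in> borel_measurable borel" unfolding u_def[abs_def]
   by measurable
  show "(%z. snd (w z)) \<in> borel_measurable borel"
   by (rule mww)
  have ii: "intbl (%z. indicator U z * (norm (fst (w z)))^2)"
   using integrable_mult_indicator[OF _ iw(1), of U] U by simp
  show "intbl (%z. indicator U z * (exp (xi z - 2 * zeta z) * (1 - 1 / S z) * (cmod (u z))^2))"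
   unfolding ueq by (rule ii)
  show "(LBINT z. indicator U z * (exp (xi z - 2 * zeta z) * (1 - 1 / S z) * (cmod (u z))^2)) <= C0"
   unfolding ueq
   by (rule order_trans[OF integral_mono[OF ii w(2)] w(3)]) (auto simp: indicator_def norm_prod_def)
  show "intbl (%z. (norm (snd (w z)))^2)" by (rule iw(2))
  fix be assume t: "tst U be"
  then obtain K where b: "c2 UNIV be" and K: "compact K" "K \<subseteq> U" "!!z. z \<notin> K ==> be z = 0" by (auto simp: tst_def)
  have nz: "del zeta be z = 0" if "z \<notin> U" for z
   using tst_zero(1)[of K be z zeta] K compact_imp_closed that by blast
  have e1: "fst (w z) \<bullet> fst (W be z) = - (exp (- zeta z) * (u z \<bullet> del zeta be z))" for z
   using nz[of z] by (cases "z \<in> U") (auto simp: u_def r_def W_def exp_minus field_simps)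
  have nf: "(norm (fst (W be z)))^2 <= (norm (W be z))^2" "(norm (snd (W be z)))^2 <= (norm (W be z))^2" for z
   by (simp_all add: norm_prod_def)
  have cW: "continuous_on UNIV (W be)" using Wc[OF t] by blast
  have mW: "(%z. fst (W be z)) \<in> borel_measurable borel" "(%z. snd (W be z)) \<in> borel_measurable borel"
   by (auto intro!: borel_measurable_continuous_onI continuous_intros cW)

  have j1: "intbl (%z. fst (w z) \<bullet> fst (W be z))"
   by (rule cs_inner(1)[OF _ _ iw(1)]) (use mW mww nf(1) in \<open>auto intro!: bi_integrable_bound[OF iW[OF t]]\<close>)
  have j2: "intbl (%z. snd (w z) \<bullet> snd (W be z))"
   by (rule cs_inner(1)[OF _ _ iw(2)]) (use mW mww nf(2) in \<open>auto intro!: bi_integrable_bound[OF iW[OF t]]\<close>)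
  have "- (LBINT z. exp (- zeta z) * (A z \<bullet> del zeta be z)) = (LBINT z. fst (w z) \<bullet> fst (W be z) + snd (w z) \<bullet> snd (W be z))"
   using w(4)[of be] t by (simp add: L_def inner_prod_def)
  also have "... = (LBINT z. fst (w z) \<bullet> fst (W be z)) + (LBINT z. snd (w z) \<bullet> snd (W be z))"
   by (rule bi_integral_add[OF j1 j2])
  finally have "(LBINT z. exp (- zeta z) * (A z \<bullet> del zeta be z)) - (LBINT z. exp (- zeta z) * (u z \<bullet> del zeta be z))
    = - (LBINT z. snd (w z) \<bullet> snd (W be z))" unfolding e1 by simp
  thus "(LBINT z. exp (- zeta z) * (A z \<bullet> del zeta be z)) - (LBINT z. exp (- zeta z) * (u z \<bullet> del zeta be z))
    = - (LBINT z. snd (w z) \<bullet> (sqrt (exp (- xi z) / 2) *\<^sub>R curl be z))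
    \<and> intbl (%z. exp (- zeta z) * (u z \<bullet> del zeta be z))"
   using j1 unfolding e1 by (simp add: W_def)
 qed
qed

section \<open>Weak solutions\<close>

lemma conv_component:
 fixes T :: "complex ^ 'n => complex ^ 'n"
 assumes "e > 0" "intbl T" shows "conv (moll e) T z $ j = conv (moll e) (%w. T w $ j) z"
 unfolding conv_def using integral_bounded_linear[OF bounded_linear_vec_nth[of j] moll_conv_integrable[OF assms, of z]]
 by simp

lemma conv_zero:
 fixes z :: "'a::euclidean_space" and T :: "'a => 'b::{banach, second_countable_topology}"
 assumes "e > 0" "!!w. w \<notin> K ==> T w = 0" "!!x. x \<in> K ==> cball x e \<subseteq> K'" "z \<notin> K'"
 shows "conv (moll e) T z = 0"
proof -
 have "moll e (z - w) *\<^sub>R T w = 0" for w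
 proof (cases "w \<in> K")
  case True
  hence "z \<notin> cball w e" using assms(3,4) by blast
  hence "norm (z - w) >= e" by (simp add: dist_norm norm_minus_commute)
  thus ?thesis using moll_zero[OF assms(1), of "z - w"] by simp
 qed (simp add: assms(2))
 thus ?thesis unfolding conv_def by (simp only: Bochner_Integration.integral_zero)
qed

text \<open>The derivative moves from the kernel to T, because the derivative of
  \<open>moll e (z - w)\<close> times \<open>T w\<close> has integral zero.\<close>

lemma dd_conv_right:
 fixes T :: "'a::euclidean_space => 'b::{banach, second_countable_topology}"
 assumes e: "e > 0" and T: "c1 UNIV T" "compact K" "!!w. w \<notin> K ==> T w = 0"
 shows "dd (conv (moll e) T) v z = conv (moll e) (dd T v) z"
proof -
 have iT: "intbl T" by (rule integrable_compact_support[OF c1_continuous[OF T(1)] T(2,3)])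
 have m1: "c1 UNIV (moll e :: 'a => real)" by (rule c2_c1[OF c2_moll])
 have d: "((%w. moll e (z - w)) has_derivative (%h. dd (moll e) (- h) (z - w))) (at w)" for w
  by (rule has_derivative_compose[where g="moll e" and f="%w. z - w" and f'="%h. - h", OF _ c1_has[OF m1 UNIV_I]])
    (auto intro!: derivative_eq_intros)
 have dneg: "dd (moll e) (- h) x = - dd (moll e) h x" for h x :: 'a
  using linear_neg[OF dd_linear_vec[OF m1 UNIV_I]] by blast
 have k1: "c1 UNIV (%w. moll e (z - w))"
 proof (rule c1I[OF d])
  show "continuous_on UNIV (%w. dd (moll e) (- v) (z - w))" for v :: 'a
   by (rule continuous_on_compose2[OF c1_cont_dd[OF m1]]) (auto intro!: continuous_intros)
 qed
 have g1: "c1 UNIV (%w. moll e (z - w) *\<^sub>R T w)" by (rule c1_scaleR[OF k1 T(1)])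
 have "0 = (LBINT w. dd (%w. moll e (z - w) *\<^sub>R T w) v w)"
  by (rule integral_dd_zero(2)[OF g1 T(2), symmetric]) (simp add: T(3))
 also have "... = (LBINT w. moll e (z - w) *\<^sub>R dd T v w - dd (moll e) v (z - w) *\<^sub>R T w)"
  unfolding dd_scaleR[OF k1 T(1) UNIV_I] dd_eq[OF d] dneg by simp
 also have "... = conv (moll e) (dd T v) z - conv (dd (moll e) v) T z"
  unfolding conv_def
 proof (rule bi_integral_diff)
  show "intbl (%w. moll e (z - w) *\<^sub>R dd T v w)"
   by (rule moll_conv_integrable[OF e integral_dd_zero(1)[OF T]])
  have mz: "dd (moll e) v x = 0" if "x \<notin> cball 0 e" for x :: 'a
   by (rule dd_zero_outside[OF closed_cball _ that]) (use moll_zero'[OF e] in auto)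
  obtain B where "!!x. \<bar>dd (moll e) v x\<bar> <= B"
   using bounded_compact_support[OF c1_cont_dd[OF m1] compact_cball[of 0 e] mz] by auto
  thus "intbl (%w. dd (moll e) v (z - w) *\<^sub>R T w)"
   by (rule conv_integrable[OF c1_cont_dd[OF m1] _ iT])
 qed
 finally show ?thesis using dd_conv[OF m1 compact_cball[of 0 e] moll_zero'[OF e] iT, where v=v and z=z] by simp
qed

lemma wirt_conv_right:
 assumes e: "e > 0" and T: "c1 UNIV T" "compact K" "!!w. w \<notin> K ==> T w = (0::complex)"
 shows "dz j (conv (moll e) T) z = conv (moll e) (dz j T) z" "db j (conv (moll e) T) z = conv (moll e) (db j T) z"
proof -
 have i: "intbl (%w. moll e (z - w) *\<^sub>R dd T v w)" for v
  by (rule moll_conv_integrable[OF e integral_dd_zero(1)[OF T]])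
 have a: "(LBINT w. moll e (z - w) *\<^sub>R ((1/2) * (dd T v w + c * dd T v' w)))
   = (1/2) * ((LBINT w. moll e (z - w) *\<^sub>R dd T v w) + c * (LBINT w. moll e (z - w) *\<^sub>R dd T v' w))" for v v' and c :: complex
 proof -
  have "(%w. moll e (z - w) *\<^sub>R ((1/2) * (dd T v w + c * dd T v' w))) =
   (%w. (1/2) * (moll e (z - w) *\<^sub>R dd T v w + c * (moll e (z - w) *\<^sub>R dd T v' w)))"
   by (simp add: fun_eq_iff scaleR_conv_of_real algebra_simps)
  moreover have "intbl X ==> intbl Y ==> (LBINT w. (1/2) * (X w + c * Y w)) = (1/2) * (integral\<^sup>L lborel X + c * integral\<^sup>L lborel Y)"
   for X Y :: "complex ^ 'a => complex" by simp
  ultimately show ?thesis using i[of v] i[of v'] by (simp only:)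
 qed
 have d: "dd (conv (moll e) T) v z = (LBINT w. moll e (z - w) *\<^sub>R dd T v w)" for v
  using dd_conv_right[OF e T, of v z] by (simp add: conv_def[of "moll e" "dd T v"])
 show "dz j (conv (moll e) T) z = conv (moll e) (dz j T) z" "db j (conv (moll e) T) z = conv (moll e) (db j T) z"
  unfolding dz_def[of j "conv (moll e) T"] db_def[of j "conv (moll e) T"] d
   conv_def[of "moll e" "dz j T"] conv_def[of "moll e" "db j T"] dz_def[of j T] db_def[of j T]
  using a[of "axis j 1" "-\<i>" "axis j \<i>"] a[of "axis j 1" "\<i>" "axis j \<i>"] by simp_all
qed

lemma conv_moll_uniform:
 fixes g :: "'a::euclidean_space => 'b::{banach, second_countable_topology}"
 assumes g: "continuous_on UNIV g" "compact K" "!!x. x \<notin> K ==> g x = 0" and r: "r > 0"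
 shows "\<exists>d>0. \<forall>e z. 0 < e \<and> e < d --> norm (conv (moll e) g z - g z) <= r"
proof -
 obtain d where d: "d > 0" "!!x y. dist y x < d ==> dist (g y) (g x) < r"
  using uniformly_continuous_compact_support[OF g] r unfolding uniformly_continuous_on_def by (metis UNIV_I)
 have "norm (conv (moll e) g z - g z) <= r" if e: "0 < e" "e < d" for e z
 proof -
  have i: "intbl (%w. moll e (z - w) *\<^sub>R g w)"
   by (rule moll_conv_integrable[OF e(1) integrable_compact_support[OF g]])
  have "g z = (LBINT w. moll e (z - w) *\<^sub>R g z)"
   using integral_moll_shift[OF e(1), of z] by simp
  hence "conv (moll e) g z - g z = (LBINT w. moll e (z - w) *\<^sub>R (g w - g z))"
   unfolding conv_def scaleR_diff_right
   using bi_integral_diff[OF i, of "%w. moll e (z - w) *\<^sub>R g z"] integral_moll_shift(2)[OF e(1), of z] by simp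
  also have "norm ... <= (LBINT w. moll e (z - w) * r)"
  proof (rule bi_norm_bound)
   show "intbl (%w. moll e (z - w) *\<^sub>R (g w - g z))"
    unfolding scaleR_diff_right using i integral_moll_shift(2)[OF e(1), of z] by simp
   show "intbl (%w. moll e (z - w) * r)" using integral_moll_shift(2)[OF e(1), of z] by simp
   fix w
   show "norm (moll e (z - w) *\<^sub>R (g w - g z)) <= moll e (z - w) * r"
   proof (cases "norm (z - w) < e")
    case True
    hence "norm (g w - g z) <= r" using d(2)[of w z] e by (simp add: dist_norm norm_minus_commute)
    thus ?thesis using moll_nonneg[OF e(1), of "z - w"] by (simp add: mult_left_mono)
   next
    case False
    thus ?thesis using moll_zero[OF e(1), of "z - w"] by simp
   qed
  qed
  also have "... = r" using integral_moll_shift(1)[OF e(1), of z] by simp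
  finally show ?thesis .
 qed
 thus ?thesis using d(1) by blast
qed

text \<open>Up to sign, pairing f with \<open>dv B\<close> is pairing the weak dbar of f with B.
  Vanishing of all these pairings is the weak form of holomorphy, free of any weight.\<close>

definition dv :: "(complex ^ 'n => complex ^ 'n) => complex ^ 'n => complex" where
 "dv B z = (\<Sum>j\<in>UNIV. dz j (%z. B z $ j) z)"

lemma c2_exp: fixes f :: "'a::euclidean_space => real"
 shows "c2 U f ==> open U ==> c2 U (%x. exp (f x))"
 by (rule c2_compose[where g'=exp and g''=exp]) (auto intro!: continuous_intros)

lemma dv_weighted:
 fixes B :: "complex ^ 'n => complex ^ 'n"
 assumes "open U" "c2 U zeta" "c2 UNIV B" "z \<in> U"
 shows "of_real (exp (- zeta z)) * del zeta (%z. exp (zeta z) *\<^sub>R B z) z = dv B z"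
proof -
 have B: "c2 U B" by (rule c2_subset[OF assms(3)]) auto
 have "c2 U (%z. exp (zeta z) *\<^sub>R B z)" by (rule c2_scaleR[OF c2_exp[OF assms(2,1)] B assms(1)])
 from div_weighted[OF assms(1,2) this assms(4)]
 have "of_real (exp (- zeta z)) * del zeta (%z. exp (zeta z) *\<^sub>R B z) z
   = (\<Sum>j\<in>UNIV. dz j (%z. of_real (exp (- zeta z)) * (exp (zeta z) *\<^sub>R B z) $ j) z)" by simp
 also have "(%j. dz j (%z. of_real (exp (- zeta z)) * (exp (zeta z) *\<^sub>R B z) $ j) z) = (%j. dz j (%z. B z $ j) z)"
 proof
  fix j
  have "(%z. of_real (exp (- zeta z)) * (exp (zeta z) *\<^sub>R B z) $ j) = (%z. B z $ j)"
   by (simp add: fun_eq_iff scaleR_conv_of_real[where 'a=complex] exp_minus)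
  thus "dz j (%z. of_real (exp (- zeta z)) * (exp (zeta z) *\<^sub>R B z) $ j) z = dz j (%z. B z $ j) z" by simp
 qed
 finally show ?thesis by (simp add: dv_def)
qed

lemma tst_exp_scale:
 assumes "open U" "c2 U zeta" "tst U B" shows "tst U (%z. exp (zeta z) *\<^sub>R B z)"
proof -
 obtain K where K: "compact K" "K \<subseteq> U" "!!z. z \<notin> K ==> B z = 0" and B: "c2 UNIV B" using assms(3) by (auto simp: tst_def)
 have "c2 UNIV (%z. exp (zeta z) *\<^sub>R B z)"
  by (rule c2_zero_extend[OF c2_scaleR[OF c2_exp[OF assms(2,1)] c2_subset[OF B subset_UNIV] assms(1)] assms(1) compact_imp_closed[OF K(1)] K(2)])
    (simp add: K(3))
 thus ?thesis unfolding tst_def using K by (intro conjI exI[of _ K]) auto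
qed

lemma dbar_div_parts:
 fixes T :: "complex ^ 'n => complex ^ 'n"
 assumes "c1 UNIV g" "c1 UNIV T" "compact K" "!!z. z \<notin> K ==> T z = 0"
 shows "(LBINT z. g z \<bullet> dv T z) = - (LBINT z. Re (\<Sum>j\<in>UNIV. db j g z * cnj (T z $ j)))"
  "intbl (%z. g z \<bullet> dv T z)" "intbl (%z. Re (\<Sum>j\<in>UNIV. db j g z * cnj (T z $ j)))"
proof -
 have T1: "c1 UNIV (%z. T z $ j)" for j by (rule c1_linear[OF bounded_linear_vec_nth assms(2)])
 let ?X = "%j z. g z * cnj (T z $ j)"
 have X1: "c1 UNIV (?X j)" for j by (rule c1_mult[OF assms(1) c1_cnj[OF T1]])
 have X0: "!!z. z \<notin> K ==> ?X j z = 0" for j by (simp add: assms(4))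
 note IX = integral_wirt(3,4)[OF X1 assms(3) X0]
 have "db j (?X j) z = g z * cnj (dz j (%z. T z $ j) z) + db j g z * cnj (T z $ j)" for j z
  unfolding wirt_mult(2)[OF assms(1) c1_cnj[OF T1] UNIV_I] wirt_cnj(2)[OF T1 UNIV_I] ..
 hence pt: "Re (\<Sum>j\<in>UNIV. db j (?X j) z) = g z \<bullet> dv T z + Re (\<Sum>j\<in>UNIV. db j g z * cnj (T z $ j))" for z
  by (simp add: sum.distrib dv_def inner_complex_cnj sum_distrib_left)
 have dz0: "dz j (%z. T z $ j) z = 0" if "z \<notin> K" for j z
  by (rule wirt_zero(1)[OF compact_imp_closed[OF assms(3)] _ that]) (simp add: assms(4))
 show i1: "intbl (%z. g z \<bullet> dv T z)"
  unfolding dv_def by (rule integrable_compact_support[OF _ assms(3)])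
   (auto intro!: continuous_intros c1_continuous[OF assms(1)] wirt_continuous(1)[OF T1] simp: dz0)
 show i2: "intbl (%z. Re (\<Sum>j\<in>UNIV. db j g z * cnj (T z $ j)))"
  by (rule integrable_compact_support[OF _ assms(3)])
   (auto intro!: continuous_intros wirt_continuous(2)[OF assms(1)] c1_continuous[OF T1] simp: assms(4))
 have "0 = Re (LBINT z. (\<Sum>j\<in>UNIV. db j (?X j) z))" using IX by (simp add: bi_integral_sum)
 also have "... = (LBINT z. Re (\<Sum>j\<in>UNIV. db j (?X j) z))"
  by (rule integral_Re[symmetric], intro bi_integrable_sum IX(1))
 finally show "(LBINT z. g z \<bullet> dv T z) = - (LBINT z. Re (\<Sum>j\<in>UNIV. db j g z * cnj (T z $ j)))"
  unfolding pt using i1 i2 by simp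
qed

section \<open>Vanishing of the defect by Gaffney's cutoff argument\<close>

lemma norm_vec_le_sum: "norm (x :: 'a::real_normed_vector ^ 'n) <= (\<Sum>i\<in>UNIV. norm (x $ i))"
 unfolding norm_vec_def by (rule L2_set_le_sum) simp

lemma norm_curl_entries: "(!!j k. cmod (M $ j $ k) <= c) ==> norm (M :: complex ^ 'n ^ 'n) <= (real CARD('n))^2 * c"
proof -
 assume *: "!!j k. cmod (M $ j $ k) <= c"
 have "norm M <= (\<Sum>j\<in>UNIV. norm (M $ j))" by (rule norm_vec_le_sum)
 also have "... <= (\<Sum>j\<in>(UNIV::'n set). \<Sum>k\<in>(UNIV::'n set). c)"
  by (intro sum_mono order_trans[OF norm_vec_le_sum] *)
 finally show ?thesis by (simp add: power2_eq_square)
qed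

text \<open>The equation is tested with a mollification of \<open>(eta z)^2 * exp (- zeta z)\<close>
  times dbar of the mollified f. The left side becomes, up to sign, the weighted square integral Q
  in the claim. On the right the second derivatives cancel, since the curl of dbar is zero. What
  survives is the gradient of \<open>eta\<close> and the variation of the gradient of
  \<open>zeta\<close> over the mollification radius, both at most \<open>tau\<close> by hypothesis.
  So Q is bounded by c times the norm of w times the square root of Q.\<close>

lemma gaffney_step:
 fixes f :: "complex ^ 'n => complex" and w :: "complex ^ 'n => complex ^ 'n ^ 'n"
 assumes U: "open U" and xi: "c2 U xi" and zeta: "c2 U zeta"
  and K': "compact K'" "K' \<subseteq> U" and F: "intbl (%z. indicator K' z *\<^sub>R f z)"
  and eta: "c2 UNIV eta" "!!z. 0 <= eta z" "!!z. eta z <= 1" and K: "compact K" "!!z. z \<notin> K ==> eta z = 0"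
  and e: "e > 0" and KK: "!!x. x \<in> K ==> cball x e \<subseteq> K'"
  and weak: "!!be. tst U be ==> (LBINT z. exp (- zeta z) * (f z \<bullet> del zeta be z))
    = - (LBINT z. w z \<bullet> (sqrt (exp (- xi z) / 2) *\<^sub>R curl be z))"
  and w: "w \<in> borel_measurable borel" "intbl (%z. (norm (w z))^2)"
  and tau: "!!z j. z \<in> K ==> cmod (db j (cr eta) z) * exp ((zeta z - xi z) / 2) <= tau"
  and om: "!!x y j. x \<in> K' ==> y \<in> K ==> dist x y <= e ==>
    cmod (db j (cr zeta) x - db j (cr zeta) y) * exp ((zeta y - xi y) / 2) <= tau"
  and gg: "!!x y. x \<in> K' ==> y \<in> K ==> dist x y <= e ==> (zeta x - xi x / 2) - (zeta y - xi y / 2) <= 1"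
 defines "c \<equiv> (real CARD('n))^2 * (18 * tau)"
 defines "fe \<equiv> conv (moll e) (%z. indicator K' z *\<^sub>R f z)"
 shows "(LBINT z. (eta z)^2 * exp (- zeta z) * (\<Sum>j\<in>UNIV. (cmod (db j fe z))^2)) <= c\<^sup>2 * (LBINT z. (norm (w z))^2)"
proof -
 have KU: "K \<subseteq> K'" using KK e by fastforce
 hence KU': "K \<subseteq> U" using K' by blast
 have Kc: "closed K" by (rule compact_imp_closed[OF K(1)])
 have fe2: "c2 UNIV fe" unfolding fe_def by (rule c2_conv_moll[OF e F])
 have h1: "c1 UNIV (db j fe)" for j by (rule wirt_c1(2)[OF fe2])
 have hc: "continuous_on UNIV (db j fe)" for j by (rule c1_continuous[OF h1])
 have zc: "continuous_on U zeta" "continuous_on U xi" by (rule c2_continuous[OF zeta], rule c2_continuous[OF xi])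
 have etaU: "c1 U eta" by (rule c1_subset[OF c2_c1[OF eta(1)]]) auto
 have exd: "((%t. exp (- t)) has_real_derivative - exp (- t)) (at t)" for t :: real
  by (auto intro!: derivative_eq_intros)
 have nu1: "c1 U (%z. exp (- zeta z))"
  by (intro c1_compose[OF c2_c1[OF zeta], where g'="%t. - exp (- t)"] exd) (auto intro!: continuous_intros)
 define q where "q = (%z. eta z * eta z * exp (- zeta z))"
 have q1U: "c1 U q" unfolding q_def by (rule c1_mult[OF c1_mult[OF etaU etaU] nu1])
 have q0: "q z = 0" if "z \<notin> K" for z using K(2)[OF that] by (simp add: q_def)
 have q1: "c1 UNIV q" by (rule c1_zero_extend[OF q1U U Kc KU' q0])
 have dq: "db j (cr q) y = of_real (exp (- zeta y)) * (of_real (2 * eta y) * db j (cr eta) y - of_real ((eta y)^2) * db j (cr zeta) y)" if "y \<in> U" for j y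
 proof -
  have "db j (cr q) y = db j (%z. (of_real (eta z) * of_real (eta z)) * of_real (exp (- zeta z))) y" by (simp add: q_def)
  also have "... = (of_real (eta y) * of_real (eta y)) * db j (%z. of_real (exp (- zeta z))) y
    + db j (%z. of_real (eta z) * of_real (eta z)) y * of_real (exp (- zeta y))"
   by (rule wirt_mult(2)[OF c1_mult[OF c1_cr[OF etaU] c1_cr[OF etaU]] c1_cr[OF nu1] that])
  also have "db j (%z. of_real (exp (- zeta z))) y = of_real (- exp (- zeta y)) * db j (cr zeta) y"
   by (rule wirt_compose(2)[OF c2_c1[OF zeta] that exd])
  also have "db j (%z. of_real (eta z) * of_real (eta z)) y = of_real (eta y) * db j (cr eta) y + db j (cr eta) y * of_real (eta y)"
   by (rule wirt_mult(2)[OF c1_cr[OF etaU] c1_cr[OF etaU] that])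
  finally show ?thesis by (simp add: algebra_simps power2_eq_square)
 qed
 define T where "T = (%z. (\<chi> j. of_real (q z) * db j fe z))"
 have Tj: "(%z. T z $ j) = (%z. of_real (q z) * db j fe z)" for j by (simp add: T_def)
 have Tj1: "c1 UNIV (%z. T z $ j)" for j unfolding Tj by (rule c1_mult[OF c1_cr[OF q1] h1])
 have T1: "c1 UNIV T"
 proof -
  have "T = (%z. \<Sum>j\<in>UNIV. axis j (T z $ j))"
   by (simp add: fun_eq_iff vec_eq_iff axis_def if_distrib cong: if_cong)
  moreover have "bounded_linear (axis j :: complex => complex ^ 'n)" for j
   by (rule linear_conv_bounded_linear[THEN iffD1]) (auto intro!: linearI simp: vec_eq_iff axis_def)
  hence "c1 UNIV (%z. \<Sum>j\<in>UNIV. axis j (T z $ j))"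
   by (intro c1_sum c1_linear[OF _ Tj1])
  ultimately show ?thesis by simp
 qed
 have T0: "T z = 0" if "z \<notin> K" for z using q0[OF that] by (simp add: T_def vec_eq_iff)
 have iT: "intbl T" by (rule integrable_compact_support[OF c1_continuous[OF T1] K(1) T0])
 \<comment> \<open>The test field is mollified with the kernel used for f. Mollification is
   self-adjoint, so in the pairing the kernel moves over to f.\<close>
 define B where "B = conv (moll e) T"
 have B2: "c2 UNIV B" unfolding B_def by (rule c2_conv_moll[OF e iT])
 have B0: "B z = 0" if "z \<notin> K'" for z unfolding B_def by (rule conv_zero[OF e T0 KK that])
 have Bj: "(%z. B z $ j) = conv (moll e) (%z. T z $ j)" for j
  unfolding B_def using conv_component[OF e iT] by (simp add: fun_eq_iff)
 have Tj0: "T z $ j = 0" if "z \<notin> K" for z j using T0[OF that] by simp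
 have dBj: "dz i (%z. B z $ j) z = conv (moll e) (dz i (%z. T z $ j)) z" "db i (%z. B z $ j) z = conv (moll e) (db i (%z. T z $ j)) z" for i j z
  unfolding Bj using wirt_conv_right[OF e Tj1 K(1) Tj0] by blast+
 have tB: "tst U B" unfolding tst_def using B2 B0 K' by blast
 let ?be = "%z. exp (zeta z) *\<^sub>R B z"
 have tbe: "tst U ?be" by (rule tst_exp_scale[OF U zeta tB])
 let ?Q = "\<integral>z. (eta z)^2 * exp (- zeta z) * (\<Sum>j\<in>UNIV. (cmod (db j fe z))^2) \<partial>lborel"
 have idz: "intbl (dz i (%z. T z $ j))" for i j by (rule integral_wirt(1)[OF Tj1 K(1) Tj0])
 have idv: "intbl (dv T)" unfolding dv_def[abs_def] by (rule bi_integrable_sum[OF idz])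
 have dvB: "dv B z = conv (moll e) (dv T) z" for z
 proof -
  have "dv B z = (\<Sum>j\<in>UNIV. conv (moll e) (dz j (%z. T z $ j)) z)" unfolding dv_def dBj ..
  also have "... = conv (moll e) (dv T) z" unfolding conv_def dv_def scaleR_sum_right
   by (rule bi_integral_sum[symmetric]) (rule moll_conv_integrable[OF e idz])
  finally show ?thesis .
 qed
 have "exp (- zeta z) * (f z \<bullet> del zeta ?be z) = (indicator K' z *\<^sub>R f z) \<bullet> conv (moll e) (dv T) z" for z
 proof (cases "z \<in> K'")
  case True
  hence zU: "z \<in> U" using K' by blast
  have "exp (- zeta z) * (f z \<bullet> del zeta ?be z) = f z \<bullet> (of_real (exp (- zeta z)) * del zeta ?be z)"
   by (simp flip: scaleR_conv_of_real)
  thus ?thesis using True unfolding dv_weighted[OF U zeta B2 zU] dvB by simp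
 next
  case False
  thus ?thesis using tst_zero(1)[OF compact_imp_closed[OF K'(1)], of ?be z zeta] B0 by simp
 qed
 hence "(LBINT z. exp (- zeta z) * (f z \<bullet> del zeta ?be z)) = (LBINT z. (indicator K' z *\<^sub>R f z) \<bullet> conv (moll e) (dv T) z)"
  by simp
 also have "... = (LBINT z. fe z \<bullet> dv T z)" unfolding fe_def by (rule conv_moll_adjoint[OF e F idv, symmetric])
 also have "... = - (LBINT z. Re (\<Sum>j\<in>UNIV. db j fe z * cnj (T z $ j)))"
  by (rule dbar_div_parts(1)[OF c2_c1[OF fe2] T1 K(1) T0])
 also have "(LBINT z. Re (\<Sum>j\<in>UNIV. db j fe z * cnj (T z $ j))) = ?Q"
 proof (rule bi_integral_cong[OF refl])
  fix z
  have "Re (\<Sum>j\<in>UNIV. db j fe z * cnj (T z $ j)) = (\<Sum>j\<in>UNIV. q z * (cmod (db j fe z))^2)"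
   unfolding Re_sum T_def by (intro sum.cong refl) (simp add: cmod_power2, simp add: power2_eq_square algebra_simps)
  thus "Re (\<Sum>j\<in>UNIV. db j fe z * cnj (T z $ j)) = (eta z)^2 * exp (- zeta z) * (\<Sum>j\<in>UNIV. (cmod (db j fe z))^2)"
   by (simp add: q_def power2_eq_square sum_distrib_left)
 qed
 finally have Qeq: "?Q = (LBINT z. w z \<bullet> (sqrt (exp (- xi z) / 2) *\<^sub>R curl ?be z))"
  using weak[OF tbe] by simp
 define H where "H z = sqrt (\<Sum>j\<in>UNIV. (cmod (db j fe z))^2)" for z
 have Hj: "cmod (db j fe z) <= H z" for j z
  unfolding H_def by (rule real_le_rsqrt) (rule member_le_sum[of j UNIV "%j. (cmod (db j fe z))^2"], auto)
 have H0: "H z >= 0" for z unfolding H_def by (simp add: sum_nonneg)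
 define G where "G z = eta z * sqrt (exp (- zeta z)) * H z" for z
 have Gc: "continuous_on U G" unfolding G_def[abs_def] H_def
  by (intro continuous_intros zc continuous_on_subset[OF c2_continuous[OF eta(1)]] continuous_on_subset[OF hc]) auto
 have G0: "G z = 0" if "z \<notin> K" for z using K(2)[OF that] by (simp add: G_def)
 have Gc': "continuous_on UNIV G" by (rule continuous_zero_extend[OF Gc U Kc KU' G0])
 have Gn: "G z >= 0" for z using eta(2) H0 by (simp add: G_def)
 have iG: "intbl G" by (rule integrable_compact_support[OF Gc' K(1) G0])
 have iG2: "intbl (%z. (norm (G z))^2)"
  by (rule integrable_compact_support[OF _ K(1)]) (auto intro!: continuous_intros Gc' simp: G0)
 have G2: "(norm (G z))^2 = (eta z)^2 * exp (- zeta z) * (\<Sum>j\<in>UNIV. (cmod (db j fe z))^2)" for z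
  by (simp add: G_def H_def power_mult_distrib sum_nonneg)
 have cest: "norm (sqrt (exp (- xi x) / 2) *\<^sub>R curl ?be x) <= c * conv (moll e) G x" for x
 proof (cases "x \<in> K'")
  case False
  hence "curl ?be x = 0" using tst_zero(2)[OF compact_imp_closed[OF K'(1)], of ?be x] B0 by simp
  moreover have "conv (moll e) G x = 0" by (rule conv_zero[OF e G0 KK False])
  ultimately show ?thesis by simp
 next
  case True
  hence xU: "x \<in> U" using K' by blast
  have "cmod ((sqrt (exp (- xi x) / 2) *\<^sub>R curl ?be x) $ j $ k) <= 18 * tau * conv (moll e) G x" for j k
  proof -
   \<comment> \<open>The integrand of the curl at x. The factor \<open>exp (zeta z)\<close>
     multiplies B after mollification, so the gradient of \<open>zeta\<close> is frozen at the outer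
     point x, while T is taken at y.\<close>
   define P where "P y = (db j (%z. T z $ k) y + db j (cr zeta) x * T y $ k) - (db k (%z. T z $ j) y + db k (cr zeta) x * T y $ j)" for y
   have BU: "c1 U (%z. B z $ i)" for i by (rule c1_subset[OF c2_c1[OF c2_component[OF B2 open_UNIV]]]) auto
   have exd': "(exp has_real_derivative exp t) (at t)" for t :: real by (rule DERIV_exp)
   have ez1: "c1 U (%z. complex_of_real (exp (zeta z)))"
    by (intro c1_cr c1_compose[OF c2_c1[OF zeta], where g'="exp"] exd') (auto intro!: continuous_intros)
   have dbe: "db a (%z. ?be z $ b) x = of_real (exp (zeta x)) * (conv (moll e) (db a (%z. T z $ b)) x + db a (cr zeta) x * conv (moll e) (%z. T z $ b) x)" for a b
   proof -
    have "(%z. ?be z $ b) = (%z. of_real (exp (zeta z)) * B z $ b)" by (simp add: fun_eq_iff scaleR_conv_of_real[where 'a=complex])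
    hence "db a (%z. ?be z $ b) x = of_real (exp (zeta x)) * db a (%z. B z $ b) x + of_real (exp (zeta x)) * db a (cr zeta) x * B x $ b"
     using wirt_mult(2)[OF ez1 BU xU] wirt_compose(2)[OF c2_c1[OF zeta] xU exd'] by simp
    thus ?thesis unfolding dBj(2) using fun_cong[OF Bj[of b], of x] by (simp add: algebra_simps)
   qed
   have idb: "intbl (db a (%z. T z $ b))" for a b by (rule integral_wirt(3)[OF Tj1 K(1) Tj0])
   have iTj: "intbl (%z. T z $ b)" for b by (rule integrable_compact_support[OF c1_continuous[OF Tj1] K(1) Tj0])
   have iP: "intbl P" unfolding P_def using idb iTj by simp
   have lin1: "conv (moll e) (%y. X y + a * Y y) x = conv (moll e) X x + a * conv (moll e) Y x"
    if "intbl X" "intbl Y" for X Y and a :: complex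
   proof -
    have i: "intbl (%y. moll e (x - y) *\<^sub>R X y)" "intbl (%y. moll e (x - y) *\<^sub>R Y y)"
     using moll_conv_integrable[OF e that(1)] moll_conv_integrable[OF e that(2)] by blast+
    have "(%y. moll e (x - y) *\<^sub>R (X y + a * Y y)) = (%y. moll e (x - y) *\<^sub>R X y + a * (moll e (x - y) *\<^sub>R Y y))"
     by (simp add: fun_eq_iff scaleR_add_right)
    thus ?thesis unfolding conv_def using bi_integral_add[OF i(1) integrable_mult_right[OF i(2), of a]] integral_mult_right_zero[of lborel a "%y. moll e (x - y) *\<^sub>R Y y"] by presburger
   qed
   have cPx: "conv (moll e) P x = (conv (moll e) (db j (%z. T z $ k)) x + db j (cr zeta) x * conv (moll e) (%z. T z $ k) x)
     + (-1) * (conv (moll e) (db k (%z. T z $ j)) x + db k (cr zeta) x * conv (moll e) (%z. T z $ j) x)"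
   proof -
    have "P = (%y. (db j (%z. T z $ k) y + db j (cr zeta) x * T y $ k) + (-1) * (db k (%z. T z $ j) y + db k (cr zeta) x * T y $ j))"
     by (simp add: fun_eq_iff P_def)
    thus ?thesis
     using lin1[of "%y. db j (%z. T z $ k) y + db j (cr zeta) x * T y $ k" "%y. db k (%z. T z $ j) y + db k (cr zeta) x * T y $ j" "-1"]
      lin1[OF idb iTj, of j k "db j (cr zeta) x" k] lin1[OF idb iTj, of k j "db k (cr zeta) x" j] idb iTj by simp
   qed
   have cP: "curl ?be x $ j $ k = of_real (exp (zeta x)) * conv (moll e) P x"
    unfolding curl_def vec_lambda_beta dbe cPx by (simp add: algebra_simps)
   have Pb: "exp (- xi x / 2 + zeta x) * (moll e (x - y) * cmod (P y)) <= moll e (x - y) * (18 * tau * G y)" for y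
   proof (cases "y \<in> K \<and> norm (x - y) < e")
    case False
    have "moll e (x - y) = 0 \<or> (P y = 0 \<and> G y = 0)"
    proof (cases "y \<in> K")
     case True
     thus ?thesis using False moll_zero[OF e, of "x - y"] by simp
    next
     case False
     have "db a (%z. T z $ b) y = 0" for a b by (rule wirt_zero(2)[OF Kc _ False]) (rule Tj0)
     thus ?thesis using Tj0[OF False] G0[OF False] by (simp add: P_def)
    qed
    thus ?thesis by auto
   next
    case True
    hence yK: "y \<in> K" and dxy: "dist x y <= e" and yU: "y \<in> U" using KU' by (auto simp: dist_norm)
    have dT: "db a (%z. T z $ b) y = of_real (q y) * db a (db b fe) y + db a (cr q) y * db b fe y" for a b
     unfolding Tj by (rule wirt_mult(2)[OF c1_cr[OF q1] h1 UNIV_I])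
    define D where "D a = of_real (2 * eta y) * db a (cr eta) y + of_real ((eta y)^2) * (db a (cr zeta) x - db a (cr zeta) y)" for a
    have Py: "P y = of_real (exp (- zeta y)) * (D j * db k fe y - D k * db j fe y)"
    proof -
     have "P y = (db j (cr q) y + db j (cr zeta) x * of_real (q y)) * db k fe y - (db k (cr q) y + db k (cr zeta) x * of_real (q y)) * db j fe y"
      unfolding P_def dT wirt_commute(2)[OF fe2 open_UNIV UNIV_I, of j k] by (simp add: T_def algebra_simps)
     moreover have "db a (cr q) y + db a (cr zeta) x * of_real (q y) = of_real (exp (- zeta y)) * D a" for a
      unfolding dq[OF yU] D_def by (simp add: q_def power2_eq_square algebra_simps)
     ultimately show ?thesis by (simp only: right_diff_distrib mult.assoc)
    qed
    let ?E = "exp ((zeta y - xi y) / 2)"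
    have Db: "cmod (D a) * ?E <= eta y * (3 * tau)" for a
    proof -
     have "cmod (D a) <= 2 * eta y * cmod (db a (cr eta) y) + (eta y)^2 * cmod (db a (cr zeta) x - db a (cr zeta) y)"
      unfolding D_def by (rule order_trans[OF norm_triangle_ineq]) (simp add: norm_mult eta(2) power2_eq_square)
     hence "cmod (D a) * ?E <= (2 * eta y * cmod (db a (cr eta) y) + (eta y)^2 * cmod (db a (cr zeta) x - db a (cr zeta) y)) * ?E"
      by (intro mult_right_mono) auto
     also have "... = 2 * eta y * (cmod (db a (cr eta) y) * ?E) + (eta y)^2 * (cmod (db a (cr zeta) x - db a (cr zeta) y) * ?E)"
      by (simp add: algebra_simps)
     also have "... <= 2 * eta y * tau + (eta y)^2 * tau"
      by (intro add_mono mult_left_mono tau[OF yK] om[OF \<open>x \<in> K'\<close> yK dxy] | simp add: eta(2))+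
     also have "... <= 2 * eta y * tau + eta y * tau"
     proof -
      have "tau >= 0" using order_trans[OF _ tau[OF yK, of a]] by simp
      moreover have "(eta y)^2 <= eta y" using eta(2,3)[of y] by (simp add: power2_eq_square mult_left_le)
      ultimately show ?thesis by (intro add_left_mono mult_right_mono)
     qed
     finally show ?thesis by (simp add: algebra_simps)
    qed
    have "cmod (P y) <= exp (- zeta y) * (cmod (D j) * H y + cmod (D k) * H y)"
     unfolding Py norm_mult
     by (intro mult_mono order_trans[OF norm_triangle_ineq4] add_mono | simp add: norm_mult mult_left_mono Hj)+
    hence "exp (- xi x / 2 + zeta x) * cmod (P y) <= exp (- xi x / 2 + zeta x) * (exp (- zeta y) * (cmod (D j) * H y + cmod (D k) * H y))"
     by (intro mult_left_mono) auto
    also have "... = exp ((zeta x - xi x / 2) - (zeta y - xi y / 2)) * sqrt (exp (- zeta y)) * H y * (cmod (D j) * ?E + cmod (D k) * ?E)"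
    proof -
     have "exp (- xi x / 2 + zeta x) * exp (- zeta y) = exp ((zeta x - xi x / 2) - (zeta y - xi y / 2)) * exp (- zeta y / 2) * ?E"
      unfolding exp_add[symmetric] by (simp add: field_simps)
     moreover have "sqrt (exp (- zeta y)) = exp (- zeta y / 2)"
      by (rule real_sqrt_unique) (simp_all flip: exp_double)
     ultimately show ?thesis by (simp add: algebra_simps)
    qed
    \<comment> \<open>Origin of the constant 18: a factor 3 for \<open>exp 1\<close>, times twice
      \<open>3 * tau\<close>, where \<open>2 * tau\<close> comes from \<open>eta\<close> and
      \<open>tau\<close> from \<open>zeta\<close>.\<close>
    also have "... <= 3 * sqrt (exp (- zeta y)) * H y * (eta y * (3 * tau) + eta y * (3 * tau))"
    proof (rule mult_mono[OF _ add_mono[OF Db Db]])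
     have "exp ((zeta x - xi x / 2) - (zeta y - xi y / 2)) <= exp 1" using gg[OF \<open>x \<in> K'\<close> yK dxy] by simp
     also have "... <= 3" by (rule exp_le)
     finally have "exp ((zeta x - xi x / 2) - (zeta y - xi y / 2)) <= 3" .
     thus "exp ((zeta x - xi x / 2) - (zeta y - xi y / 2)) * sqrt (exp (- zeta y)) * H y <= 3 * sqrt (exp (- zeta y)) * H y"
      by (intro mult_right_mono H0) auto
    qed (use H0 in auto)
    also have "... = 18 * tau * G y" by (simp add: G_def algebra_simps)
    finally have "exp (- xi x / 2 + zeta x) * cmod (P y) <= 18 * tau * G y" .
    hence "moll e (x - y) * (exp (- xi x / 2 + zeta x) * cmod (P y)) <= moll e (x - y) * (18 * tau * G y)"
     by (rule mult_left_mono[OF _ moll_nonneg[OF e]])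
    thus ?thesis by (simp add: algebra_simps)
   qed
   have "cmod ((sqrt (exp (- xi x) / 2) *\<^sub>R curl ?be x) $ j $ k) = sqrt (exp (- xi x) / 2) * exp (zeta x) * cmod (conv (moll e) P x)"
    by (simp add: cP norm_mult)
   also have "... <= sqrt (exp (- xi x)) * exp (zeta x) * cmod (conv (moll e) P x)"
    by (intro mult_right_mono real_sqrt_le_mono) auto
   also have "sqrt (exp (- xi x)) * exp (zeta x) = exp (- xi x / 2 + zeta x)"
   proof -
    have "sqrt (exp (- xi x)) = exp (- xi x / 2)"
     by (rule real_sqrt_unique) (simp_all flip: exp_double)
    thus ?thesis unfolding exp_add by simp
   qed
   also have "exp (- xi x / 2 + zeta x) * cmod (conv (moll e) P x) <= exp (- xi x / 2 + zeta x) * (LBINT y. moll e (x - y) * cmod (P y))"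
   proof (rule mult_left_mono)
    have "cmod (conv (moll e) P x) <= (LBINT y. norm (moll e (x - y) *\<^sub>R P y))" unfolding conv_def by (rule integral_norm_bound)
    thus "cmod (conv (moll e) P x) <= (LBINT y. moll e (x - y) * cmod (P y))"
     unfolding norm_scaleR abs_of_nonneg[OF moll_nonneg[OF e]] .
   qed auto
   also have "... = (LBINT y. exp (- xi x / 2 + zeta x) * (moll e (x - y) * cmod (P y)))" by simp
   also have "... <= (LBINT y. moll e (x - y) * (18 * tau * G y))"
   proof (rule integral_mono[OF _ _ Pb])
    show "intbl (%y. exp (- xi x / 2 + zeta x) * (moll e (x - y) * cmod (P y)))"
     using moll_conv_integrable[OF e integrable_norm[OF iP], of x] by simp
    show "intbl (%y. moll e (x - y) * (18 * tau * G y))"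
     using moll_conv_integrable[OF e integrable_mult_right[OF iG, of "18 * tau"], of x] by simp
   qed
   also have "... = 18 * tau * conv (moll e) G x" unfolding conv_def by (simp add: mult.left_commute flip: integral_mult_right_zero)
   finally show ?thesis .
  qed
  from norm_curl_entries[OF this] show ?thesis by (simp add: c_def mult.assoc)
 qed
 let ?V = "%z. sqrt (exp (- xi z) / 2) *\<^sub>R curl ?be z"
 have be2: "c2 UNIV ?be" using tbe by (simp add: tst_def)
 have Vc: "continuous_on UNIV ?V"
 proof (rule continuous_zero_extend[OF _ U compact_imp_closed[OF K'(1)] K'(2)])
  show "continuous_on U ?V" by (intro continuous_intros zc curl_continuous[OF U c2_subset[OF be2 subset_UNIV]]) auto
  show "?V z = 0" if "z \<notin> K'" for z using tst_zero(2)[OF compact_imp_closed[OF K'(1)], of ?be z] B0 that by simp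
 qed
 have iV: "intbl (%z. (norm (?V z))^2)"
 proof (rule integrable_compact_support[OF _ K'(1)])
  show "continuous_on UNIV (%z. (norm (?V z))^2)" by (rule continuous_on_power[OF continuous_on_norm[OF Vc]])
  show "(norm (?V z))^2 = 0" if "z \<notin> K'" for z using tst_zero(2)[OF compact_imp_closed[OF K'(1)], of ?be z] B0 that by simp
 qed
 have mV: "?V \<in> borel_measurable lborel" using borel_measurable_continuous_onI[OF Vc] by simp
 have "(LBINT z. (norm (?V z))^2) <= (LBINT z. c\<^sup>2 * conv (moll e) (%z. (norm (G z))^2) z)"
 proof (rule integral_mono[OF iV])
  show "intbl (%z. c\<^sup>2 * conv (moll e) (%z. (norm (G z))^2) z)"
   by (intro integrable_mult_right conv_moll_integral(1)[OF e iG2]) auto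
  fix z
  have "(norm (?V z))^2 <= (c * conv (moll e) G z)^2" by (intro power_mono cest) auto
  also have "... = c\<^sup>2 * (norm (conv (moll e) G z))^2" by (simp add: power_mult_distrib)
  also have "... <= c\<^sup>2 * conv (moll e) (%z. (norm (G z))^2) z" by (intro mult_left_mono conv_moll_sq[OF e iG iG2]) auto
  finally show "(norm (?V z))^2 <= c\<^sup>2 * conv (moll e) (%z. (norm (G z))^2) z" .
 qed
 also have "... = c\<^sup>2 * ?Q" using conv_moll_integral(2)[OF e iG2] unfolding G2[symmetric] by simp
 finally have Vle: "(LBINT z. (norm (?V z))^2) <= c\<^sup>2 * ?Q" .
 have Q0: "?Q >= 0" by (intro bi_integral_nonneg mult_nonneg_nonneg sum_nonneg) auto
 have "?Q\<^sup>2 <= (LBINT z. (norm (w z))^2) * (LBINT z. (norm (?V z))^2)"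
  by (subst Qeq) (rule cs_inner(2)[OF _ mV w(2) iV], use w(1) in simp)
 also have "... <= (LBINT z. (norm (w z))^2) * (c\<^sup>2 * ?Q)" by (intro mult_left_mono Vle) auto
 finally have "?Q * ?Q <= (c\<^sup>2 * (LBINT z. (norm (w z))^2)) * ?Q" by (simp add: power2_eq_square algebra_simps)
 thus ?thesis using Q0
  by (cases "?Q = 0") (auto intro!: mult_nonneg_nonneg dest: mult_right_le_imp_le)
qed

text \<open>When \<open>eta\<close> is 1 on the support of B, the preceding bound controls the
  pairing by a fixed constant times \<tau>. The cutoff depends on \<tau> and the mollification
  radius on the cutoff, so a single limit in \<tau> remains.\<close>

lemma weak_dbar_zero:
 fixes f :: "complex ^ 'n => complex" and w :: "complex ^ 'n => complex ^ 'n ^ 'n"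
 assumes U: "open U" and xi: "c2 U xi" and zeta: "c2 U zeta"
  and F: "!!K. compact K ==> K \<subseteq> U ==> intbl (%z. indicator K z *\<^sub>R f z)"
  and weak: "!!be. tst U be ==> (LBINT z. exp (- zeta z) * (f z \<bullet> del zeta be z))
    = - (LBINT z. w z \<bullet> (sqrt (exp (- xi z) / 2) *\<^sub>R curl be z))"
  and w: "w \<in> borel_measurable borel" "intbl (%z. (norm (w z))^2)"
  and cut: "!!K \<tau>. compact K ==> K \<subseteq> U ==> \<tau> > 0 ==> \<exists>eta L. c2 UNIV eta \<and> (\<forall>z. 0 <= eta z \<and> eta z <= 1) \<and> compact L \<and> L \<subseteq> U
    \<and> (\<forall>z. z \<notin> L --> eta z = 0) \<and> (\<forall>z\<in>K. eta z = 1) \<and> (\<forall>z\<in>L. \<forall>j. cmod (db j (cr eta) z) * exp ((zeta z - xi z) / 2) <= \<tau>)"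
  and B: "tst U B"
 shows "(LBINT z. f z \<bullet> dv B z) = 0"
proof -
 obtain K0 where K0: "compact K0" "K0 \<subseteq> U" "!!z. z \<notin> K0 ==> B z = 0" and B2: "c2 UNIV B" using B by (auto simp: tst_def)
 have zc: "continuous_on U zeta" "continuous_on U xi" by (rule c2_continuous[OF zeta], rule c2_continuous[OF xi])
 have B1: "c1 UNIV B" by (rule c2_c1[OF B2])
 have Bj1: "c1 UNIV (%z. B z $ j)" for j by (rule c1_linear[OF bounded_linear_vec_nth B1])
 have dvc: "continuous_on UNIV (dv B)" unfolding dv_def[abs_def] by (intro continuous_intros wirt_continuous(1)[OF Bj1])
 have dv0: "dv B z = 0" if "z \<notin> K0" for z
  unfolding dv_def using wirt_zero(1)[OF compact_imp_closed[OF K0(1)] _ that] K0(3) by (intro sum.neutral) auto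
 have idv: "intbl (dv B)" by (rule integrable_compact_support[OF dvc K0(1) dv0])
 define W where "W = (LBINT z. (norm (w z))^2)"
 \<comment> \<open>The second factor in Cauchy-Schwarz: on the support of B, where
   \<open>eta\<close> is 1, the weight is split between \<open>eta z * exp (- zeta z / 2)\<close> on
   the gradient and \<open>exp (zeta z / 2)\<close> on B.\<close>
 define N0 where "N0 = (LBINT z. exp (zeta z) * (norm (B z))^2)"
 have iN0: "intbl (%z. exp (zeta z) * (norm (B z))^2)"
  by (rule integrable_zero_extend[OF _ U K0(1,2)]) (auto intro!: continuous_intros zc continuous_on_subset[OF c2_continuous[OF B2]] simp: K0(3))
 have W0: "W >= 0" "N0 >= 0" by (simp_all add: W_def N0_def)
 define c where "c = (real CARD('n))^2 * 18"
 have "\<bar>\<integral>z. f z \<bullet> dv B z \<partial>lborel\<bar> <= \<tau> * (c * sqrt (W * N0) + 1)" if \<tau>: "\<tau> > 0" for \<tau>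
 proof -
  obtain eta L where eta: "c2 UNIV eta" "!!z. 0 <= eta z" "!!z. eta z <= 1" and L: "compact L" "L \<subseteq> U" "!!z. z \<notin> L ==> eta z = 0"
   and e1: "!!z. z \<in> K0 ==> eta z = 1" and et: "!!z j. z \<in> L ==> cmod (db j (cr eta) z) * exp ((zeta z - xi z) / 2) <= \<tau>"
   using cut[OF K0(1,2) \<tau>] by blast
  obtain e0 where e0: "e0 > 0" "(\<Union>x\<in>L. cball x e0) \<subseteq> U" using compact_subset_open_imp_cball_epsilon_subset[OF L(1) U L(2)] by blast
  define K' where "K' = (\<Union>x\<in>L. cball x e0)"
  have K': "compact K'" "K' \<subseteq> U" using e0 compact_minkowski_sum_cball[OF L(1)] by (auto simp: K'_def)
  have LK: "L \<subseteq> K'" using e0(1) by (force simp: K'_def)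
  have K0L: "K0 \<subseteq> L" using e1 L(3) by force
  have "continuous_on L (%z. exp ((zeta z - xi z) / 2))"
   by (intro continuous_intros continuous_on_subset[OF zc(1) L(2)] continuous_on_subset[OF zc(2) L(2)]) auto
  hence "bounded ((%z. exp ((zeta z - xi z) / 2)) ` L)" by (intro compact_imp_bounded compact_continuous_image L(1))
  then obtain M where "\<forall>x\<in>(%z. exp ((zeta z - xi z) / 2)) ` L. norm x <= M" unfolding bounded_iff by blast
  hence M: "exp ((zeta z - xi z) / 2) <= \<bar>M\<bar> + 1" if "z \<in> L" for z using that by force
  have uc: "\<exists>d>0. \<forall>x\<in>K'. \<forall>y\<in>K'. dist x y < d --> dist (g x) (g y) < r" if "continuous_on U g" "r > 0" for g :: "complex ^ 'n => complex" and r
   using compact_uniformly_continuous[OF continuous_on_subset[OF that(1) K'(2)] K'(1)] that(2) unfolding uniformly_continuous_on_def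
   by (meson dist_commute_lessI)
  have "\<exists>d. \<forall>j. d j > 0 \<and> (\<forall>x\<in>K'. \<forall>y\<in>K'. dist x y < d j --> dist (db j (cr zeta) x) (db j (cr zeta) y) < \<tau> / (\<bar>M\<bar> + 1))"
  proof (intro choice allI)
   fix j
   have "\<tau> / (\<bar>M\<bar> + 1) > 0" using \<tau> by (simp add: add_nonneg_pos)
   thus "\<exists>d>0. \<forall>x\<in>K'. \<forall>y\<in>K'. dist x y < d --> dist (db j (cr zeta) x) (db j (cr zeta) y) < \<tau> / (\<bar>M\<bar> + 1)"
    by (rule uc[OF wirt_continuous(2)[OF c1_cr[OF c2_c1[OF zeta]]]])
  qed
  then obtain d where d: "!!j. d j > 0" "!!j x y. x \<in> K' ==> y \<in> K' ==> dist x y < d j ==> dist (db j (cr zeta) x) (db j (cr zeta) y) < \<tau> / (\<bar>M\<bar> + 1)"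
   by blast
  have "continuous_on U (cr (%z. zeta z - xi z / 2))" by (intro continuous_intros zc) auto
  then obtain d2 where d2: "d2 > 0" "!!x y. x \<in> K' ==> y \<in> K' ==> dist x y < d2 ==> dist (cr (%z. zeta z - xi z / 2) x) (cr (%z. zeta z - xi z / 2) y) < 1"
   using uc[of "cr (%z. zeta z - xi z / 2)" 1] by auto
  define Fi where "Fi = (LBINT z. norm (indicator K' z *\<^sub>R f z)) + 1"
  have Fi: "Fi > 0" "(LBINT z. norm (indicator K' z *\<^sub>R f z)) <= Fi"
   unfolding Fi_def by (intro add_nonneg_pos bi_integral_nonneg; simp) (simp only: le_add_same_cancel1 zero_le_one)
  obtain d3 where d3: "d3 > 0" "!!e z. 0 < e ==> e < d3 ==> norm (conv (moll e) (dv B) z - dv B z) <= \<tau> / Fi"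
   using conv_moll_uniform[OF dvc K0(1) dv0, of "\<tau> / Fi"] \<tau> Fi by auto
  define m where "m = Min (range d)"
  have m: "m > 0" "!!j. m <= d j" unfolding m_def using d(1) by (auto simp: Min_gr_iff)
  \<comment> \<open>\<open>e0\<close> keeps the balls inside U; m and \<open>d2\<close> control the
    variation of the gradient of \<open>zeta\<close> and of \<open>zeta - xi / 2\<close> on
    \<open>K'\<close>; \<open>d3\<close> makes the mollification of \<open>dv B\<close> uniformly
    close to it.\<close>
  define e where "e = Min {e0, m, d2, d3} / 2"
  have e: "e > 0" "e < e0" "e < m" "e < d2" "e < d3"
  proof -
   have "Min {e0, m, d2, d3} > 0" using e0 m d2 d3 by simp
   moreover have "Min {e0, m, d2, d3} <= e0" "Min {e0, m, d2, d3} <= m" "Min {e0, m, d2, d3} <= d2" "Min {e0, m, d2, d3} <= d3" by auto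
   ultimately show "e > 0" "e < e0" "e < m" "e < d2" "e < d3" unfolding e_def by linarith+
  qed
  let ?F = "%z. indicator K' z *\<^sub>R f z"
  note iF = F[OF K']
  define fe where "fe = conv (moll e) ?F"
  define Q where "Q = (LBINT z. (eta z)^2 * exp (- zeta z) * (\<Sum>j\<in>UNIV. (cmod (db j fe z))^2))"
  have Qle: "Q <= ((real CARD('n))^2 * (18 * \<tau>))^2 * W"
   unfolding Q_def W_def fe_def
  proof (rule gaffney_step[OF U xi zeta K' iF eta L(1,3) e(1) _ weak w et])
   show "cball x e \<subseteq> K'" if "x \<in> L" for x
    using that e(2) unfolding K'_def by (meson UN_upper order_trans less_imp_le subset_cball)
   fix x y assume xy: "x \<in> K'" "y \<in> L" "dist x y <= e"
   hence yK: "y \<in> K'" using LK by blast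
   show "zeta x - xi x / 2 - (zeta y - xi y / 2) <= 1"
   proof -
    have "dist (cr (%z. zeta z - xi z / 2) x) (cr (%z. zeta z - xi z / 2) y) < 1" using d2(2)[OF xy(1) yK] xy(3) e by simp
    thus ?thesis by (simp only: dist_of_real) (simp add: dist_real_def)
   qed
   fix j
   have "cmod (db j (cr zeta) x - db j (cr zeta) y) <= \<tau> / (\<bar>M\<bar> + 1)"
    using d(2)[OF xy(1) yK, of j] xy(3) e m(2)[of j] by (simp add: dist_norm)
   hence "cmod (db j (cr zeta) x - db j (cr zeta) y) * exp ((zeta y - xi y) / 2) <= (\<tau> / (\<bar>M\<bar> + 1)) * (\<bar>M\<bar> + 1)"
    by (intro mult_mono M[OF xy(2)]) (use \<tau> in auto)
   also have "... = \<tau>" by simp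
   finally show "cmod (db j (cr zeta) x - db j (cr zeta) y) * exp ((zeta y - xi y) / 2) <= \<tau>" .
  qed
  have fe2: "c2 UNIV fe" unfolding fe_def by (rule c2_conv_moll[OF e(1) iF])
  note dp = dbar_div_parts[OF c2_c1[OF fe2] B1 K0(1,3)]
  have hc: "continuous_on UNIV (db j fe)" for j by (rule wirt_continuous(2)[OF c2_c1[OF fe2]])
  define h where "h z = (\<chi> j. db j fe z)" for z
  have nh: "(norm (h z))^2 = (\<Sum>j\<in>UNIV. (cmod (db j fe z))^2)" for z
   by (simp add: h_def norm_vec_def L2_set_def sum_nonneg)
  have hcc: "continuous_on S h" for S unfolding h_def[abs_def] by (intro continuous_on_vec_lambda continuous_on_subset[OF hc]) auto
  have ih: "Re (\<Sum>j\<in>UNIV. db j fe z * cnj (B z $ j)) = h z \<bullet> B z" for z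
   by (simp add: h_def inner_vec_def inner_complex_cnj)
  have "(LBINT z. h z \<bullet> B z) = (LBINT z. ((eta z * exp (- zeta z / 2)) *\<^sub>R h z) \<bullet> (exp (zeta z / 2) *\<^sub>R B z))"
  proof (rule bi_integral_cong[OF refl])
   fix z show "h z \<bullet> B z = ((eta z * exp (- zeta z / 2)) *\<^sub>R h z) \<bullet> (exp (zeta z / 2) *\<^sub>R B z)"
    using e1[of z] K0(3)[of z] by (cases "z \<in> K0") (auto simp: exp_minus)
  qed
  moreover have cl: "continuous_on UNIV (%z. (eta z * exp (- zeta z / 2)) *\<^sub>R h z)"
   by (rule continuous_zero_extend[OF _ U compact_imp_closed[OF L(1)] L(2)])
     (auto intro!: continuous_intros hcc zc continuous_on_subset[OF c2_continuous[OF eta(1)]] simp: L(3))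
  moreover have cb: "continuous_on UNIV (%z. exp (zeta z / 2) *\<^sub>R B z)"
   by (rule continuous_zero_extend[OF _ U compact_imp_closed[OF K0(1)] K0(2)])
     (auto intro!: continuous_intros zc continuous_on_subset[OF c2_continuous[OF B2]] simp: K0(3))
  moreover have nl: "(norm ((eta z * exp (- zeta z / 2)) *\<^sub>R h z))^2 = (eta z)^2 * exp (- zeta z) * (\<Sum>j\<in>UNIV. (cmod (db j fe z))^2)" for z
  proof -
   have "(exp (- zeta z / 2))^2 = exp (- zeta z)" by (simp flip: exp_double)
   thus ?thesis by (simp add: power_mult_distrib nh)
  qed
  moreover have nb: "(norm (exp (zeta z / 2) *\<^sub>R B z))^2 = exp (zeta z) * (norm (B z))^2" for z
  proof -
   have "(exp (zeta z / 2))^2 = exp (zeta z)" by (simp flip: exp_double)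
   thus ?thesis by (simp add: power_mult_distrib)
  qed
  moreover have "intbl (%z. (norm ((eta z * exp (- zeta z / 2)) *\<^sub>R h z))^2)"
   by (rule integrable_compact_support[OF continuous_on_power[OF continuous_on_norm[OF cl]] L(1)]) (simp add: L(3))
  moreover have "intbl (%z. (norm (exp (zeta z / 2) *\<^sub>R B z))^2)" unfolding nb by (rule iN0)
  ultimately have "(LBINT z. h z \<bullet> B z)^2 <= Q * N0"
   using cs_inner(2)[of "%z. (eta z * exp (- zeta z / 2)) *\<^sub>R h z" lborel "%z. exp (zeta z / 2) *\<^sub>R B z"]
    borel_measurable_continuous_onI[OF cl] borel_measurable_continuous_onI[OF cb] by (simp add: Q_def N0_def)
  also have "... <= ((real CARD('n))^2 * (18 * \<tau>))^2 * W * N0" using Qle W0 by (intro mult_right_mono)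
  also have "... = (\<tau> * (c * sqrt (W * N0)))^2" using W0 by (simp add: c_def power_mult_distrib)
  finally have "\<bar>\<integral>z. h z \<bullet> B z \<partial>lborel\<bar> <= \<tau> * (c * sqrt (W * N0))"
   using W0 \<tau> by (subst (asm) power2_le_iff_abs_le) (auto simp: c_def)
  hence b1: "\<bar>\<integral>z. fe z \<bullet> dv B z \<partial>lborel\<bar> <= \<tau> * (c * sqrt (W * N0))" using dp(1) unfolding ih by simp
  have ifc: "intbl (%z. ?F z \<bullet> g z)" if "continuous_on UNIV g" "!!z. norm (g z) <= b" for g b
  proof (rule bi_integrable_bound[OF integrable_mult_right[OF integrable_norm[OF iF], of b]])
   show "(%z. ?F z \<bullet> g z) \<in> borel_measurable lborel"
    using borel_measurable_inner[OF borel_measurable_integrable[OF iF], of g] borel_measurable_continuous_onI[OF that(1)] by simp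
   have "\<bar>?F z \<bullet> g z\<bar> <= \<bar>b * norm (?F z)\<bar>" for z
   proof -
    have "\<bar>?F z \<bullet> g z\<bar> <= norm (?F z) * norm (g z)" by (rule Cauchy_Schwarz_ineq2)
    also have "... <= norm (?F z) * b" by (intro mult_left_mono that(2)) auto
    finally show ?thesis by (simp add: mult.commute)
   qed
   thus "AE z in lborel. norm (?F z \<bullet> g z) <= norm (b * norm (?F z))" by (simp only: real_norm_def) simp
  qed
  obtain bd where bd: "!!z. norm (dv B z) <= bd" using bounded_compact_support[OF dvc K0(1) dv0] by blast
  have cdv: "continuous_on UNIV (conv (moll e) (dv B))" by (rule c2_continuous[OF c2_conv_moll[OF e(1) idv]])
  have bd': "norm (conv (moll e) (dv B) z) <= bd + \<tau> / Fi" for z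
   using d3(2)[OF e(1,5), of z] bd[of z] norm_triangle_sub[of "conv (moll e) (dv B) z" "dv B z"] by linarith
  have eq1: "(LBINT z. f z \<bullet> dv B z) = (LBINT z. ?F z \<bullet> dv B z)"
  proof (rule bi_integral_cong[OF refl])
   fix z show "f z \<bullet> dv B z = ?F z \<bullet> dv B z"
   proof (cases "z \<in> K'")
    case False
    hence "z \<notin> K0" using K0L LK by blast
    thus ?thesis using dv0 by simp
   qed simp
  qed
  have eq2: "(LBINT z. fe z \<bullet> dv B z) = (LBINT z. ?F z \<bullet> conv (moll e) (dv B) z)"
   unfolding fe_def by (rule conv_moll_adjoint[OF e(1) iF idv])
  have "\<bar>(LBINT z. ?F z \<bullet> conv (moll e) (dv B) z) - (LBINT z. ?F z \<bullet> dv B z)\<bar> = \<bar>\<integral>z. ?F z \<bullet> (conv (moll e) (dv B) z - dv B z) \<partial>lborel\<bar>"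
   unfolding inner_diff_right by (subst bi_integral_diff[OF ifc[OF cdv bd'] ifc[OF dvc bd]]) simp
  also have "... <= (LBINT z. (\<tau> / Fi) * norm (?F z))"
  proof (rule order_trans[OF integral_abs_bound integral_mono])
   show "intbl (%z. \<bar>?F z \<bullet> (conv (moll e) (dv B) z - dv B z)\<bar>)"
    unfolding inner_diff_right by (intro integrable_abs bi_integrable_diff ifc[OF cdv bd'] ifc[OF dvc bd])
   show "intbl (%z. (\<tau> / Fi) * norm (?F z))" by (intro integrable_mult_right integrable_norm iF)
   show "\<bar>?F z \<bullet> (conv (moll e) (dv B) z - dv B z)\<bar> <= (\<tau> / Fi) * norm (?F z)" for z
    by (rule order_trans[OF Cauchy_Schwarz_ineq2]) (subst mult.commute, intro mult_right_mono d3(2)[OF e(1,5)] norm_ge_zero)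
  qed
  also have "... = (\<tau> / Fi) * (LBINT z. norm (?F z))" by (rule integral_mult_right_zero)
  also have "... <= (\<tau> / Fi) * Fi" using Fi \<tau> by (intro mult_left_mono Fi(2)) auto
  also have "... = \<tau>" using Fi by simp
  finally show ?thesis using b1 unfolding eq1 eq2 by (simp add: algebra_simps)
 qed
 hence all: "!!\<tau>. \<tau> > 0 ==> \<bar>\<integral>z. f z \<bullet> dv B z \<partial>lborel\<bar> <= \<tau> * (c * sqrt (W * N0) + 1)" .
 define s where "s = c * sqrt (W * N0) + 1"
 have s: "s > 0" using W0 by (simp add: s_def c_def add_nonneg_pos)
 have "\<bar>\<integral>z. f z \<bullet> dv B z \<partial>lborel\<bar> <= 0"
 proof (rule field_le_epsilon)
  fix r :: real assume "r > 0"
  thus "\<bar>\<integral>z. f z \<bullet> dv B z \<partial>lborel\<bar> <= 0 + r" using all[of "r / s"] s unfolding s_def[symmetric] by simp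
 qed
 thus ?thesis by simp
qed

section \<open>Weyl's lemma\<close>

lemma norm_smult: "norm (c *s x) = cmod c * norm x" for x :: "complex ^ 'n"
 by (simp add: norm_vec_def L2_set_def norm_mult power_mult_distrib flip: sum_distrib_left)
   (simp add: real_sqrt_mult)

lemma bounded_linear_smult: "bounded_linear (%x. c *s x)" for c :: complex
 by (rule linear_conv_bounded_linear[THEN iffD1])
   (auto intro!: linearI simp: vec_eq_iff algebra_simps)

lemma smult_measurable [measurable]: "(%x. c *s x) \<in> borel_measurable borel" for c :: complex
 by (rule borel_measurable_continuous_onI[OF linear_continuous_on[OF bounded_linear_smult]])

text \<open>This is the uniqueness proof for Haar measure: a measure invariant under translations is
  determined up to a factor, and the factor is 1 because the unit ball is mapped to itself. No
  determinant is computed.\<close>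

lemma lborel_rotate:
 fixes t :: real
 shows "distr lborel borel (%x :: complex ^ 'n. cis t *s x) = lborel"
proof (rule measure_eqI)
 fix A :: "(complex ^ 'n) set" assume "A \<in> sets (distr lborel borel (%x :: complex ^ 'n. cis t *s x))"
 hence A[measurable]: "A \<in> sets borel" by simp
 define R where "R = (%x :: complex ^ 'n. cis t *s x)"
 define S where "S = (%x :: complex ^ 'n. cis (- t) *s x)"
 have [measurable]: "R \<in> borel_measurable borel" unfolding R_def by simp
 have RS: "R (x + S y) = R x + y" for x y
  by (simp add: R_def S_def vec_eq_iff algebra_simps cis_mult flip: mult.assoc)
 have nR: "norm (R x) = norm x" for x by (simp add: R_def norm_smult)
 let ?b = "ball (0 :: complex ^ 'n) 1"
 let ?be = "emeasure lborel ?b"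
 have b: "?be \<noteq> 0" "?be \<noteq> \<infinity>"
  using emeasure_lborel_ball_finite[of "0 :: complex ^ 'n" 1] less_imp_neq[OF unit_ball_vol_pos[of "real CARD('n) * 2"]] by (simp_all add: emeasure_ball)
 have [measurable]: "?b \<in> sets borel" by simp
 \<comment> \<open>Integrated first in y this gives the measure of the preimage of A; after the
   shift of x by \<open>S y\<close> it gives the measure of A. The measure of the ball is a common
   factor, finite and not zero.\<close>
 let ?h = "%x y. indicator A (R x) * indicator ?b (y - R x) :: ennreal"
 have "(NNL x. \<integral>\<^sup>+y. ?h x y \<partial>lborel) = (NNL x. indicator A (R x) * ?be)"
 proof (rule nn_integral_cong)
  fix x
  have "(NNL y. ?h x y) = indicator A (R x) * (NNL y. indicator ?b (y + (- R x)))"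
   by (subst nn_integral_cmult) auto
  also have "(NNL y. indicator ?b (y + (- R x))) = ?be" by (subst nn_integral_shift) auto
  finally show "(NNL y. ?h x y) = indicator A (R x) * ?be" .
 qed
 also have "... = (NNL x. indicator A (R x)) * ?be" by (rule nn_integral_multc) simp
 finally have 1: "(NNL x. \<integral>\<^sup>+y. ?h x y \<partial>lborel) = (NNL x. indicator A (R x)) * ?be" .
 have "(NNL x. \<integral>\<^sup>+y. ?h x y \<partial>lborel) = (NNL y. \<integral>\<^sup>+x. ?h x y \<partial>lborel)"
  by (rule lborel_pair.Fubini'[symmetric]) measurable
 also have "... = (NNL y. \<integral>\<^sup>+x. indicator A (R x + y) * indicator ?b x \<partial>lborel)"
 proof (rule nn_integral_cong)
  fix y
  have "(NNL x. ?h x y) = (NNL x. ?h (x + S y) y)"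
   by (rule nn_integral_shift[symmetric]) measurable
  also have "... = (NNL x. indicator A (R x + y) * indicator ?b x)"
   by (intro nn_integral_cong) (simp add: RS indicator_def nR)
  finally show "(NNL x. ?h x y) = (NNL x. indicator A (R x + y) * indicator ?b x)" .
 qed
 also have "... = (NNL x. \<integral>\<^sup>+y. indicator A (R x + y) * indicator ?b x \<partial>lborel)"
  by (rule lborel_pair.Fubini') measurable
 also have "... = (NNL x. emeasure lborel A * indicator ?b x)"
 proof (rule nn_integral_cong)
  fix x
  have "(NNL y. indicator A (R x + y) * indicator ?b x) = (NNL y. indicator A (y + R x)) * indicator ?b x"
   by (subst nn_integral_multc) (auto simp: add.commute)
  also have "(NNL y. indicator A (y + R x)) = emeasure lborel A" by (subst nn_integral_shift) auto
  finally show "(NNL y. indicator A (R x + y) * indicator ?b x) = emeasure lborel A * indicator ?b x" .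
 qed
 also have "... = emeasure lborel A * ?be" by (subst nn_integral_cmult) auto
 finally have "(NNL x. indicator A (R x)) * ?be = emeasure lborel A * ?be" using 1 by simp
 hence "(NNL x. indicator A (R x)) = emeasure lborel A"
  using b by (simp add: mult.commute[of _ ?be] ennreal_mult_cancel_left del: emeasure_lborel_ball_finite)
 moreover have "(NNL x. indicator A (R x)) = (\<integral>\<^sup>+x. indicator A x \<partial>distr lborel borel R)"
  by (rule nn_integral_distr[symmetric]) auto
 ultimately show "emeasure (distr lborel borel (%x. cis t *s x)) A = emeasure lborel A" by (simp add: R_def)
qed simp

lemma
 fixes f :: "complex ^ 'n => 'b::{banach, second_countable_topology}"
 assumes "f \<in> borel_measurable borel"
 shows integral_rotate: "(LBINT x. f (cis t *s x)) = (LBINT x. f x)"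
  and integrable_rotate: "intbl (%x. f (cis t *s x)) \<longleftrightarrow> intbl f"
 using integral_distr[of "%x. cis t *s x" lborel borel f] integrable_distr_eq[of "%x. cis t *s x" lborel borel f]
  lborel_rotate[of t, where 'n='n] assms by simp_all

lemma conv_moll_shifted:
 fixes G :: "'a::euclidean_space => 'b::{banach, second_countable_topology}"
 assumes e: "e > 0" and G: "intbl G"
 shows "conv (moll e) G z = (LBINT v. moll e v *\<^sub>R G (z + v))" "intbl (%v. moll e v *\<^sub>R G (z + v))"
proof -
 have m: "(%w. moll e (z - w) *\<^sub>R G w) \<in> borel_measurable borel" using G by measurable
 show "conv (moll e) G z = (LBINT v. moll e v *\<^sub>R G (z + v))"
  unfolding conv_def using integral_shift[OF m, of z] by (simp add: moll_even add.commute)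
 show "intbl (%v. moll e v *\<^sub>R G (z + v))"
  using integrable_shift[OF m, of z] moll_conv_integrable[OF e G, of z] by (simp add: moll_even add.commute)
qed

text \<open>A radial kernel is unchanged by averaging over rotations, so a mollification is a
  weighted average of circle means. Mean value equalities and sub-mean inequalities both pass to
  mollifications through this formula.\<close>

lemma conv_moll_average:
 fixes G :: "complex ^ 'n => 'b::{banach, second_countable_topology}" and z :: "complex ^ 'n"
 assumes e: "e > 0" and G: "intbl G"
 defines "av \<equiv> %w. (LBINT t. indicator {0..2*pi} t *\<^sub>R G (z + cis t *s w))"
 shows "intbl (%w. moll e w *\<^sub>R av w)" "(2 * pi) *\<^sub>R conv (moll e) G z = (LBINT w. moll e w *\<^sub>R av w)"
proof -
 have mG[measurable]: "G \<in> borel_measurable borel" using G by simp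
 have mp[measurable]: "(%p :: real \<times> (complex ^ 'n). z + cis (fst p) *s snd p) \<in> borel_measurable (borel \<Otimes>\<^sub>M borel)"
  unfolding borel_prod
  by (rule borel_measurable_continuous_onI)
    (auto simp: vector_scalar_mult_def intro!: continuous_intros continuous_on_component)
 let ?\<phi> = "%v. moll e v *\<^sub>R G (z + v)"
 have rot: "moll e w *\<^sub>R G (z + cis t *s w) = ?\<phi> (cis t *s w)" for w t
  using moll_norm[of "cis t *s w" w e] by (simp add: norm_smult)
 have m\<phi>: "?\<phi> \<in> borel_measurable borel" by measurable
 have it: "intbl (%w. moll e w *\<^sub>R G (z + cis t *s w))" "(LBINT w. moll e w *\<^sub>R G (z + cis t *s w)) = conv (moll e) G z" for t
  unfolding rot using integrable_rotate[OF m\<phi>] integral_rotate[OF m\<phi>] conv_moll_shifted[OF e G, of z] by simp_all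
 let ?h = "%(t, w). indicator {0..2*pi} t *\<^sub>R (moll e w *\<^sub>R G (z + cis t *s w))"
 have mh: "?h \<in> borel_measurable (lborel \<Otimes>\<^sub>M lborel)"
 proof -
  have "(%p. indicator {0..2*pi} (fst p) *\<^sub>R (moll e (snd p) *\<^sub>R G (z + cis (fst p) *s snd p))) \<in> borel_measurable (borel \<Otimes>\<^sub>M borel)"
   using measurable_compose[OF mp mG] by measurable
  thus ?thesis by (simp add: case_prod_unfold cong: measurable_cong_sets[OF sets_pair_measure_cong[OF sets_lborel sets_lborel] refl])
 qed
 have nit: "(LBINT w. norm (moll e w *\<^sub>R G (z + cis t *s w))) = (LBINT v. norm (?\<phi> v))" for t
  unfolding rot by (rule integral_rotate) measurable
 have ifin: "intbl (%t. indicator {0..2*pi} t *\<^sub>R c)" for c :: "'c::{banach, second_countable_topology}"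
  by (intro integrable_scaleR_left integrable_real_indicator) auto
 have ih: "integrable (lborel \<Otimes>\<^sub>M lborel) ?h"
 proof (rule lborel_pair.Fubini_integrable[OF mh])
  have "(LBINT y. norm (case (x, y) of (t, w) => indicator {0..2*pi} t *\<^sub>R (moll e w *\<^sub>R G (z + cis t *s w))))
    = indicator {0..2*pi} x *\<^sub>R (LBINT v. norm (?\<phi> v))" for x
   using nit[of x] by (cases "x \<in> {0..2*pi}") simp_all
  thus "intbl (%x. \<integral>y. norm (case (x, y) of (t, w) => indicator {0..2*pi} t *\<^sub>R (moll e w *\<^sub>R G (z + cis t *s w))) \<partial>lborel)"
   using ifin by simp
  show "AE x in lborel. intbl (%y. case (x, y) of (t, w) => indicator {0..2*pi} t *\<^sub>R (moll e w *\<^sub>R G (z + cis t *s w)))"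
   using it(1) by (simp del: scaleR_scaleR)
 qed
 have in1: "(LBINT t. ?h (t, w)) = moll e w *\<^sub>R av w" for w
  unfolding av_def by (simp add: scaleR_left_commute[of _ "moll e w"] del: scaleR_scaleR)
 show "intbl (%w. moll e w *\<^sub>R av w)"
  using lborel_pair.integrable_snd[of "%t w. ?h (t, w)"] ih in1 by simp
 have "(LBINT w. moll e w *\<^sub>R av w) = (LBINT w. (LBINT t. ?h (t, w)))" unfolding in1 ..
 also have "... = (LBINT t. (LBINT w. ?h (t, w)))"
  using lborel_pair.Fubini_integral[of "%t w. ?h (t, w)"] ih by simp
 also have "... = (LBINT t. indicator {0..2*pi} t *\<^sub>R conv (moll e) G z)" using it(2) by (simp del: scaleR_scaleR)
 also have "... = (2 * pi) *\<^sub>R conv (moll e) G z" by simp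
 finally show "(2 * pi) *\<^sub>R conv (moll e) G z = (LBINT w. moll e w *\<^sub>R av w)" ..
qed

lemma conv_moll_mean_value:
 fixes G :: "complex ^ 'n => 'b::{banach, second_countable_topology}"
 assumes e: "e > 0" and G: "intbl G"
  and mv: "!!w. norm w < e ==> (LBINT t. indicator {0..2*pi} t *\<^sub>R G (z + cis t *s w)) = (2 * pi) *\<^sub>R c"
 shows "conv (moll e) G z = c"
proof -
 have "moll e w *\<^sub>R (LBINT t. indicator {0..2*pi} t *\<^sub>R G (z + cis t *s w)) = moll e w *\<^sub>R ((2 * pi) *\<^sub>R c)" for w
  using mv[of w] moll_zero[OF e, of w] by (cases "norm w < e") simp_all
 hence "(2 * pi) *\<^sub>R conv (moll e) G z = (LBINT w. moll e (w :: complex ^ 'n) *\<^sub>R ((2 * pi) *\<^sub>R c))"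
  using conv_moll_average(2)[OF e G, of z] by simp
 also have "... = (2 * pi) *\<^sub>R c"
  using integral_scaleR_left[of "(2 * pi) *\<^sub>R c" lborel "moll e :: complex ^ 'n => real"] moll_integrable[OF e, where 'a="complex ^ 'n"] moll_integral[OF e, where 'a="complex ^ 'n"] by simp
 finally show ?thesis by simp
qed

section \<open>Mean values and regularity of holomorphic functions\<close>

lemma c1_local: "open U ==> (!!z. z \<in> U ==> \<exists>V. open V \<and> z \<in> V \<and> c1 V f) ==> c1 U f"
 unfolding c1_def by (metis continuous_at_imp_continuous_on continuous_on_eq_continuous_at)

lemma c2_local: "open U ==> (!!z. z \<in> U ==> \<exists>V. open V \<and> z \<in> V \<and> c2 V f) ==> c2 U f"
 unfolding c2_def by (meson c1_local)

lemma vec_axis_decomp: "v = (\<Sum>j\<in>UNIV. Re (v $ j) *\<^sub>R axis j 1 + Im (v $ j) *\<^sub>R axis j \<i>)" for v :: "complex ^ 'n"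
proof -
 have e: "(\<Sum>j\<in>UNIV. Re (v $ j) *\<^sub>R axis j (1::complex) + Im (v $ j) *\<^sub>R axis j \<i>) $ i = v $ i" for i
 proof -
  have "(\<Sum>j\<in>UNIV. Re (v $ j) *\<^sub>R axis j (1::complex) + Im (v $ j) *\<^sub>R axis j \<i>) $ i = (\<Sum>j\<in>UNIV. if j = i then v $ i else 0)"
   unfolding sum_component by (intro sum.cong refl) (auto simp: axis_def complex_eq_iff)
  thus ?thesis by simp
 qed
 thus ?thesis by (simp add: vec_eq_iff)
qed

lemma holomorphic_onI:
 fixes f :: "complex ^ 'n => complex"
 assumes "open D" "c1 D f" "!!z j. z \<in> D ==> db j f z = 0"
 shows "holomorphic_on_Cn f D"
 unfolding holomorphic_on_Cn_def
proof (intro conjI ballI exI allI)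
 fix z assume z: "z \<in> D"
 show "(f has_derivative (%v. dd f v z)) (at z)" by (rule c1_has[OF assms(2) z])
 have lin: "linear (%v. dd f v z)" by (rule dd_linear_vec[OF assms(2) z])
 have ai: "dd f (axis j \<i>) z = \<i> * dd f (axis j 1) z" for j
  using assms(3)[OF z, of j] unfolding db_def
  by (simp add: complex_eq_iff)
 have *: "dd f v z = (\<Sum>j\<in>UNIV. v $ j * dd f (axis j 1) z)" for v
 proof -
  have "dd f v z = dd f (\<Sum>j\<in>UNIV. Re (v $ j) *\<^sub>R axis j 1 + Im (v $ j) *\<^sub>R axis j \<i>) z" using vec_axis_decomp[of v] by simp
  also have "... = (\<Sum>j\<in>UNIV. Re (v $ j) *\<^sub>R dd f (axis j 1) z + Im (v $ j) *\<^sub>R dd f (axis j \<i>) z)"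
   by (simp add: linear_sum[OF lin] linear_add[OF lin] linear_scale[OF lin])
  also have "... = (\<Sum>j\<in>UNIV. v $ j * dd f (axis j 1) z)"
   by (intro sum.cong refl) (simp add: ai complex_eq_iff algebra_simps)
  finally show ?thesis .
 qed
 show "dd f (c *s v) z = c * dd f v z" for c v
  unfolding *[of "c *s v"] *[of v] by (simp add: sum_distrib_left mult.assoc)
qed fact

lemma holomorphic_db_zero: "holomorphic_on_Cn f D ==> z \<in> D ==> db j f z = 0"
proof -
 assume "holomorphic_on_Cn f D" "z \<in> D"
 then obtain L where L: "(f has_derivative L) (at z)" "!!c v. L (c *s v) = c * L v" unfolding holomorphic_on_Cn_def by blast
 have "axis j \<i> = \<i> *s (axis j 1 :: complex ^ _)" by (simp add: vec_eq_iff axis_def)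
 hence "dd f (axis j \<i>) z = \<i> * dd f (axis j 1) z" unfolding dd_eq[OF L(1)] using L(2) by simp
 thus ?thesis by (simp add: db_def flip: mult.assoc)
qed

lemma holomorphic_on_Cn_continuous: "holomorphic_on_Cn f D ==> continuous_on D f"
 unfolding holomorphic_on_Cn_def by (metis continuous_at_imp_continuous_on has_derivative_continuous)

text \<open>Cauchy's integral formula in one variable, for the slice \<open>f (z + s *s w)\<close>
  as a function of s.\<close>

lemma holomorphic_circle_mean:
 fixes f :: "complex ^ 'n => complex"
 assumes f: "holomorphic_on_Cn f D" and d: "!!s. cmod s <= 1 ==> z + s *s w \<in> D"
 shows "(LBINT t. indicator {0..2*pi} t *\<^sub>R f (z + cis t *s w)) = (2 * pi) *\<^sub>R f z"
proof -
 define g where "g s = f (z + s *s w)" for s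
 have lin: "((%s. z + s *s w) has_derivative (%h. h *s w)) (at s)" for s
 proof -
  have "bounded_linear (%h::complex. h *s w)"
   by (rule linear_conv_bounded_linear[THEN iffD1]) (auto intro!: linearI simp: vec_eq_iff algebra_simps)
  from has_derivative_add[OF has_derivative_const[of z] bounded_linear_imp_has_derivative[OF this]] show ?thesis by simp
 qed
 have hol: "g holomorphic_on cball 0 1"
  unfolding holomorphic_on_def
 proof
  fix s :: complex assume "s \<in> cball 0 1"
  hence "z + s *s w \<in> D" using d by simp
  then obtain L where L: "(f has_derivative L) (at (z + s *s w))" "!!c v. L (c *s v) = c * L v"
   using f unfolding holomorphic_on_Cn_def by blast
  have "(g has_derivative (%h. L (h *s w))) (at s)"
   unfolding g_def by (rule has_derivative_compose[OF lin L(1)])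
  moreover have "(%h. L (h *s w)) = (*) (L w)" using L(2) by (auto simp: mult.commute)
  ultimately have "(g has_field_derivative L w) (at s)" by (simp add: has_field_derivative_def)
  thus "g field_differentiable at s within cball 0 1"
   using field_differentiable_def has_field_derivative_at_within by blast
 qed
 have "((%u. g u / (u - 0)) has_contour_integral (2 * of_real pi * \<i> * g 0)) (circlepath 0 1)"
  by (rule Cauchy_integral_circlepath_simple[OF hol]) simp
 hence "((%t. g (0 + 1 * cis t) / (0 + 1 * cis t - 0) * 1 * \<i> * cis t) has_integral (2 * of_real pi * \<i> * g 0)) {0..2*pi}"
  unfolding circlepath_def by (subst (asm) has_contour_integral_part_circlepath_iff) (simp_all add: mult_ac)
 hence "((%t. \<i> * g (cis t)) has_integral (\<i> * (2 * of_real pi * g 0))) {0..2*pi}" by (simp add: mult_ac)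
 from has_integral_mult_right[OF this, of "- \<i>"]
 have hi: "((%t. g (cis t)) has_integral (2 * of_real pi * g 0)) {0..2*pi}" by (simp flip: mult.assoc)
 have "continuous_on {0..2*pi} (%t. g (cis t))"
  by (rule continuous_on_compose2[OF holomorphic_on_imp_continuous_on[OF hol]]) (auto intro!: continuous_intros)
 hence i: "intbl (%t. indicator {0..2*pi} t *\<^sub>R g (cis t))" by (intro borel_integrable_compact) auto
 have "((%t. indicator {0..2*pi} t *\<^sub>R g (cis t)) has_integral (LBINT t. indicator {0..2*pi} t *\<^sub>R g (cis t))) UNIV"
  by (rule has_integral_integral_lborel[OF i])
 moreover have "((%t. indicator {0..2*pi} t *\<^sub>R g (cis t)) has_integral (2 * of_real pi * g 0)) UNIV"
 proof -
  have "(%t. indicator {0..2*pi} t *\<^sub>R g (cis t)) = (%x. if x \<in> {0..2*pi} then g (cis x) else 0)"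
   by (auto simp: fun_eq_iff indicator_def)
  thus ?thesis using hi has_integral_restrict_UNIV[of "{0..2*pi}" "%t. g (cis t)"] by simp
 qed
 ultimately have "(LBINT t. indicator {0..2*pi} t *\<^sub>R g (cis t)) = 2 * of_real pi * g 0" by (rule has_integral_unique)
 thus ?thesis by (simp add: g_def scaleR_conv_of_real)
qed

lemma integrable_on_compact:
 fixes f :: "'a::euclidean_space => 'b::{banach, second_countable_topology}"
 assumes "continuous_on D f" "compact K" "K \<subseteq> D" shows "intbl (%z. indicator K z *\<^sub>R f z)"
 by (rule borel_integrable_compact[OF assms(2) continuous_on_subset[OF assms(1,3)]])

lemma holomorphic_conv:
 fixes f :: "complex ^ 'n => complex"
 assumes f: "holomorphic_on_Cn f D" and K: "compact K" "K \<subseteq> D" and e: "e > 0" "cball z e \<subseteq> K"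
 shows "conv (moll e) (%z. indicator K z *\<^sub>R f z) z = f z"
proof (rule conv_moll_mean_value[OF e(1) integrable_on_compact[OF holomorphic_on_Cn_continuous[OF f] K]])
 fix w :: "complex ^ 'n" assume w: "norm w < e"
 have inK: "z + s *s w \<in> K" if "cmod s <= 1" for s
 proof -
  have "norm (s *s w) <= 1 * norm w" unfolding norm_smult using that by (intro mult_right_mono) auto
  hence "z + s *s w \<in> cball z e" using w by (simp add: dist_norm)
  thus ?thesis using e by blast
 qed
 have "(%t. indicator {0..2*pi} t *\<^sub>R (indicator K (z + cis t *s w) *\<^sub>R f (z + cis t *s w))) = (%t. indicator {0..2*pi} t *\<^sub>R f (z + cis t *s w))"
  using inK by (simp add: fun_eq_iff)
 thus "(LBINT t. indicator {0..2*pi} t *\<^sub>R (indicator K (z + cis t *s w) *\<^sub>R f (z + cis t *s w))) = (2 * pi) *\<^sub>R f z"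
  using holomorphic_circle_mean[OF f, of z w] inK K by (metis (no_types, lifting) subsetD)
qed

text \<open>Regularity comes from the mean value property: locally f equals its own mollification,
  which is C^2.\<close>

lemma holomorphic_c2:
 fixes f :: "complex ^ 'n => complex"
 assumes f: "holomorphic_on_Cn f D" shows "c2 D f"
proof (rule c2_local)
 show "open D" using f by (simp add: holomorphic_on_Cn_def)
 fix z assume "z \<in> D"
 then obtain r where r: "r > 0" "cball z r \<subseteq> D" using \<open>open D\<close> open_contains_cball by blast
 let ?g = "conv (moll (r/2)) (%z. indicator (cball z r) z *\<^sub>R f z)"
 let ?h = "conv (moll (r/2)) (%x. indicator (cball z r) x *\<^sub>R f x)"
 have "c2 (ball z (r/2)) ?h"
  by (rule c2_subset[OF c2_conv_moll[OF _ integrable_on_compact[OF holomorphic_on_Cn_continuous[OF f] compact_cball r(2)]]]) (use r in auto)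
 moreover have "?h x = f x" if "x \<in> ball z (r/2)" for x
 proof (rule holomorphic_conv[OF f compact_cball r(2)])
  show "cball x (r/2) \<subseteq> cball z r" using that by (intro cball_subset_cball_iff[THEN iffD2]) (auto simp: dist_commute)
 qed (use r in auto)
 ultimately have "c2 (ball z (r/2)) f" by (rule c2_cong[OF open_ball, rotated])
 thus "\<exists>V. open V \<and> z \<in> V \<and> c2 V f" using r by (intro exI[of _ "ball z (r/2)"]) auto
qed

section \<open>Weakly holomorphic functions\<close>

lemma conv_moll_restrict:
 fixes f :: "'a::euclidean_space => 'b::{banach, second_countable_topology}"
 assumes "e > 0" "cball z e \<subseteq> K" shows "conv (moll e) (%z. indicator K z *\<^sub>R f z) z = conv (moll e) f z"
 unfolding conv_def
proof (rule bi_integral_cong[OF refl])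
 fix w
 show "moll e (z - w) *\<^sub>R (indicator K w *\<^sub>R f w) = moll e (z - w) *\<^sub>R f w"
 proof (cases "norm (z - w) >= e")
  case False
  hence "w \<in> cball z e" by (simp add: dist_norm)
  thus ?thesis using assms(2) by (auto simp: indicator_def)
 qed (simp add: moll_zero[OF assms(1)])
qed

lemma c2_moll_shift: "c2 UNIV (%w. moll e (z - w))" for z :: "'a::euclidean_space"
proof -
 have id: "c2 UNIV (%w::'a. z - w)" by (rule c2_diff[OF c2_const c2_bounded_linear[OF bounded_linear_ident]]) auto
 have "c2 UNIV (%w::'a. 1 - (1/e\<^sup>2) * ((z - w) \<bullet> (z - w)))"
  by (rule c2_diff[OF c2_const c2_mult[OF c2_const c2_bilinear[OF bounded_bilinear_inner id id]]]) auto
 hence "c2 UNIV (%w. ker0 e (z - w))" unfolding ker0_def[abs_def] by (rule c2_pcube) auto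
 thus ?thesis unfolding moll_def using c2_mult[OF c2_const[OF open_UNIV]] open_UNIV by blast
qed

text \<open>The derivative of the mollification at z is the pairing of f with a derivative of the
  kernel, and the kernel centred at z, placed in the j-th slot, is a test field. The factors 1 and
  \<i> in that slot yield the real and the imaginary part.\<close>

lemma weyl_db_zero:
 fixes f :: "complex ^ 'n => complex"
 assumes F: "intbl (%z. indicator K' z *\<^sub>R f z)" and K': "compact K'" "K' \<subseteq> U" and e: "e > 0" and z: "cball z e \<subseteq> K'"
  and wk: "!!B. tst U B ==> (LBINT z. f z \<bullet> dv B z) = 0"
 shows "db j (conv (moll e) (%z. indicator K' z *\<^sub>R f z)) z = 0"
proof -
 let ?F = "%z. indicator K' z *\<^sub>R f z"
 let ?k = "%w. moll e (z - w)"
 have k2: "c2 UNIV ?k" by (rule c2_moll_shift)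
 have k1: "c1 UNIV (cr ?k)" by (rule c1_cr[OF c2_c1[OF k2]])
 have k0: "?k w = 0" if "w \<notin> cball z e" for w using that by (intro moll_zero[OF e]) (simp add: dist_norm)
 have m1: "c1 UNIV (moll e :: complex ^ 'n => real)" by (rule c2_c1[OF c2_moll])
 define m where "m w = dz j (cr ?k) w" for w
 have mc: "continuous_on UNIV m" unfolding m_def[abs_def] by (rule wirt_continuous(1)[OF k1])
 have m0: "m w = 0" if "w \<notin> cball z e" for w unfolding m_def by (rule wirt_zero(1)[OF closed_cball _ that]) (use k0 in auto)
 obtain b where b: "!!w. norm (m w) <= b" using bounded_compact_support[OF mc compact_cball m0] by blast
 have iX: "intbl (%w. ?F w * cnj (m w))"
 proof (rule bi_integrable_bound[OF integrable_mult_right[OF integrable_norm[OF F], of b]])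
  show "(%w. ?F w * cnj (m w)) \<in> borel_measurable lborel"
   using borel_measurable_times[OF borel_measurable_integrable[OF F], of "%w. cnj (m w)"] borel_measurable_continuous_onI[OF continuous_on_cnj[OF mc]] by simp
  have "cmod (?F w * cnj (m w)) <= \<bar>b * norm (?F w)\<bar>" for w
  proof -
   have "cmod (?F w * cnj (m w)) = norm (?F w) * cmod (m w)" by (simp only: norm_mult complex_mod_cnj)
   also have "... <= norm (?F w) * b" by (intro mult_left_mono b) auto
   finally show ?thesis by (simp add: mult.commute)
  qed
  thus "AE w in lborel. norm (?F w * cnj (m w)) <= norm (b * norm (?F w))" by (simp only: real_norm_def) simp
 qed
 define X where "X = (LBINT w. ?F w * cnj (m w))"
 have "Re (cnj c * X) = 0" for c
 proof -
  define B where "B w = (axis j (c * of_real (?k w)) :: complex ^ 'n)" for w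
  have bl: "bounded_linear (%x. axis j (c * complex_of_real x) :: complex ^ 'n)"
   by (rule linear_conv_bounded_linear[THEN iffD1]) (auto intro!: linearI simp: vec_eq_iff axis_def algebra_simps scaleR_conv_of_real[where 'a=complex])
  have B2: "c2 UNIV B" unfolding B_def[abs_def] by (rule c2_linear[OF bl k2]) simp
  have B0: "B w = 0" if "w \<notin> cball z e" for w using k0[OF that] by (simp add: B_def axis_def vec_eq_iff)
  have t: "tst U B" unfolding tst_def using B2 B0 z K' by (intro conjI exI[of _ "cball z e"]) auto
  have "dz k (%w. B w $ k) w = (if k = j then c * m w else 0)" for k w
  proof (cases "k = j")
   case True
   have "(%w. B w $ k) = (%w. c * cr ?k w)" using True by (simp add: B_def axis_def)
   thus ?thesis using wirt_mult(1)[OF c1_const k1 UNIV_I, of k c w] True by (simp add: wirt_const m_def)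
  next
   case False
   hence "(%w. B w $ k) = (%w. 0)" by (simp add: B_def axis_def)
   thus ?thesis using False by (simp add: wirt_const)
  qed
  hence dvB: "dv B w = c * m w" for w by (simp add: dv_def)
  have pt: "f w \<bullet> dv B w = Re (cnj c * (?F w * cnj (m w)))" for w
  proof (cases "w \<in> K'")
   case True thus ?thesis by (simp add: dvB inner_complex_cnj algebra_simps)
  next
   case False
   hence "m w = 0" using z m0 by blast
   thus ?thesis by (simp add: dvB)
  qed
  have "Re (cnj c * X) = Re (LBINT w. cnj c * (?F w * cnj (m w)))" unfolding X_def integral_mult_right_zero ..
  also have "... = (LBINT w. Re (cnj c * (?F w * cnj (m w))))" by (rule integral_Re[symmetric, OF integrable_mult_right[OF iX]])
  also have "... = 0" using wk[OF t] unfolding pt .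
  finally show ?thesis .
 qed
 from this[of 1] this[of \<i>] have X0: "X = 0" by (simp add: complex_eq_iff)
 have dk: "dd ?k v w = - dd (moll e) v (z - w)" for v w
 proof -
  have "((%w. moll e (z - w)) has_derivative (%h. dd (moll e) (- h) (z - w))) (at w)"
   by (rule has_derivative_compose[where g="moll e" and f="%w. z - w" and f'="%h. - h", OF _ c1_has[OF m1 UNIV_I]])
     (auto intro!: derivative_eq_intros)
  from dd_eq[OF this] show ?thesis using linear_neg[OF dd_linear_vec[OF m1 UNIV_I]] by simp
 qed
 have cm: "cnj (m w) = - ((1/2) * (of_real (dd (moll e) (axis j 1) (z - w)) + \<i> * of_real (dd (moll e) (axis j \<i>) (z - w))))" for w
  unfolding m_def dz_def dd_linear[OF bounded_linear_of_real c2_c1[OF k2] UNIV_I] dk by (simp add: algebra_simps)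
 have mz: "dd (moll e) v x = 0" if "x \<notin> cball 0 e" for x v :: "complex ^ 'n"
  by (rule dd_zero_outside[OF closed_cball _ that]) (use moll_zero'[OF e] in auto)
 have ik: "intbl (%w. dd (moll e) v (z - w) *\<^sub>R ?F w)" for v
 proof -
  obtain b where "!!x. \<bar>dd (moll e) v x\<bar> <= b" using bounded_compact_support[OF c1_cont_dd[OF m1] compact_cball[of 0 e] mz] by auto
  thus ?thesis by (rule conv_integrable[OF c1_cont_dd[OF m1] _ F])
 qed
 have dcv: "dd (conv (moll e) ?F) v z = (LBINT w. dd (moll e) v (z - w) *\<^sub>R ?F w)" for v
  using dd_conv[OF m1 compact_cball[of 0 e] moll_zero'[OF e] F, where v=v and z=z] by (simp add: conv_def)
 have "db j (conv (moll e) ?F) z = (1/2) * ((LBINT w. dd (moll e) (axis j 1) (z - w) *\<^sub>R ?F w) + \<i> * (LBINT w. dd (moll e) (axis j \<i>) (z - w) *\<^sub>R ?F w))"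
  unfolding db_def dcv ..
 also have "... = (LBINT w. (1/2) * (dd (moll e) (axis j 1) (z - w) *\<^sub>R ?F w + \<i> * (dd (moll e) (axis j \<i>) (z - w) *\<^sub>R ?F w)))"
  unfolding integral_mult_right_zero
  by (subst bi_integral_add[OF ik integrable_mult_right[OF ik]]) (simp only: integral_mult_right_zero)
 also have "... = (LBINT w. - (?F w * cnj (m w)))"
  unfolding cm by (intro bi_integral_cong refl) (simp add: scaleR_conv_of_real algebra_simps)
 also have "... = - X" unfolding X_def by (rule Bochner_Integration.integral_minus)
 finally show ?thesis using X0 by simp
qed

lemma conv_moll_commute:
 fixes F :: "'a::euclidean_space => complex"
 assumes e: "e1 > 0" "e2 > 0" and F: "intbl F"
 shows "conv (moll e2) (conv (moll e1) F) z = conv (moll e1) (conv (moll e2) F) z"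
proof -
 have key: "conv (moll b) (conv (moll a) F) z \<bullet> c = (LBINT w. F w \<bullet> (conv (moll a) (%w. moll b (z - w)) w *\<^sub>R c))"
  if ab: "a > 0" "b > 0" for a b c
 proof -
  have ig: "intbl (%w. moll b (z - w) *\<^sub>R c)" by (rule integrable_scaleR_left[OF integral_moll_shift(2)[OF ab(2)]])
  have "conv (moll a) (%w. moll b (z - w) *\<^sub>R c) w = conv (moll a) (%w. moll b (z - w)) w *\<^sub>R c" for w
   unfolding conv_def using moll_conv_integrable[OF ab(1) integral_moll_shift(2)[OF ab(2), of z], of w] by simp
  hence "(LBINT w. F w \<bullet> (conv (moll a) (%w. moll b (z - w)) w *\<^sub>R c)) = (LBINT w. conv (moll a) F w \<bullet> (moll b (z - w) *\<^sub>R c))"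
   using conv_moll_adjoint[OF ab(1) F ig] by simp
  also have "... = (LBINT w. (moll b (z - w) *\<^sub>R conv (moll a) F w) \<bullet> c)" by simp
  also have "... = conv (moll b) (conv (moll a) F) z \<bullet> c" unfolding conv_def[of "moll b"]
  proof (rule integral_inner_left)
   show "intbl (%w. moll b (z - w) *\<^sub>R conv (moll a) F w)"
    by (rule integrable_compact_support[OF _ compact_cball[of z b]])
      (auto intro!: continuous_intros c2_continuous[OF c2_moll_shift] c2_continuous[OF c2_conv_moll[OF ab(1) F]] moll_zero[OF ab(2)] simp: dist_norm)
  qed
  finally show ?thesis ..
 qed
 have sw: "conv (moll a) (%w. moll b (z - w)) w = conv (moll b) (%w. moll a (z - w)) w" for a b w
 proof -
  have m: "(%v. moll a (w - v) * moll b (z - v)) \<in> borel_measurable borel" by measurable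
  have "(LBINT v. moll a (w - v) * moll b (z - v)) = (LBINT v. moll a (w - (w + z - v)) * moll b (z - (w + z - v)))"
   by (rule integral_reflect[OF m, symmetric])
  also have "... = (LBINT v. moll b (w - v) * moll a (z - v))"
  proof (rule bi_integral_cong[OF refl])
   fix v
   have "w - (w + z - v) = - (z - v)" "z - (w + z - v) = - (w - v)" by simp_all
   thus "moll a (w - (w + z - v)) * moll b (z - (w + z - v)) = moll b (w - v) * moll a (z - v)"
    by (simp only: moll_even mult.commute)
  qed
  finally show ?thesis by (simp add: conv_def)
 qed
 have "conv (moll e2) (conv (moll e1) F) z \<bullet> c = conv (moll e1) (conv (moll e2) F) z \<bullet> c" for c
  unfolding key[OF e] key[OF e(2,1)] sw[of e1 e2] ..
 thus ?thesis using vector_eq_rdot by blast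
qed

text \<open>The representative is described by mollifications of f rather than by agreement with f
  almost everywhere. Mollifications at two scales coincide at z: each is holomorphic near z, so
  mollifying it once more changes nothing, and the two mollifications commute.\<close>

lemma weyl:
 fixes f :: "complex ^ 'n => complex"
 assumes U: "open U" and F: "!!K. compact K ==> K \<subseteq> U ==> intbl (%z. indicator K z *\<^sub>R f z)"
  and wk: "!!B. tst U B ==> (LBINT z. f z \<bullet> dv B z) = 0"
 obtains F0 where "holomorphic_on_Cn F0 U" "!!z e. e > 0 ==> cball z (2 * e) \<subseteq> U ==> F0 z = conv (moll e) f z"
proof -
 have eqc: "conv (moll e1) f z = conv (moll e2) f z" if e: "e1 > 0" "e2 > 0" and z: "cball z (e1 + e2) \<subseteq> U" for e1 e2 z
 proof -
  obtain s where s: "s > 0" "(\<Union>x\<in>cball z (e1 + e2). cball x s) \<subseteq> U"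
   using compact_subset_open_imp_cball_epsilon_subset[OF compact_cball U z] by blast
  \<comment> \<open>The margin s beyond \<open>e1 + e2\<close> makes the mollification of radius a
    holomorphic on an open ball that contains the closed ball of radius b.\<close>
  define K where "K = cball z (e1 + e2 + s)"
  have KU: "K \<subseteq> U"
  proof
   fix x assume x: "x \<in> K"
   show "x \<in> U"
   proof (cases "x \<in> cball z (e1 + e2)")
    case True thus ?thesis using z by blast
   next
    case False
    define t where "t = (e1 + e2) / dist z x"
    have dx: "dist z x > e1 + e2" "dist z x <= e1 + e2 + s" using False x by (auto simp: K_def)
    have dp: "dist z x > 0" using dx e by linarith
    \<comment> \<open>The radial projection of x to the sphere of radius \<open>e1 + e2\<close>
      about z; it is within s of x.\<close>
    define y where "y = z + t *\<^sub>R (x - z)"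
    have "norm (t *\<^sub>R (x - z)) = e1 + e2" using e dp by (simp add: t_def dist_norm norm_minus_commute)
    hence "y \<in> cball z (e1 + e2)" by (simp add: y_def dist_norm)
    moreover have "x - y = (1 - t) *\<^sub>R (x - z)" by (simp add: y_def algebra_simps)
    hence "dist y x = \<bar>1 - t\<bar> * dist z x" by (simp add: dist_norm norm_minus_commute)
    moreover have "\<bar>1 - t\<bar> * dist z x = dist z x - (e1 + e2)"
    proof -
     have "t <= 1" using dx dp e by (simp add: t_def)
     moreover have "t * dist z x = e1 + e2" using dp by (simp add: t_def)
     ultimately show ?thesis by (simp add: left_diff_distrib)
    qed
    ultimately have "x \<in> (\<Union>x\<in>cball z (e1 + e2). cball x s)" using dx by (intro UN_I[of y]) auto
    thus ?thesis using s by blast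
   qed
  qed
  have Kc: "compact K" by (simp add: K_def)
  note iF = F[OF Kc KU]
  let ?F = "%z. indicator K z *\<^sub>R f z"
  have half: "conv (moll b) (conv (moll a) ?F) z = conv (moll a) f z" if ab: "a > 0" "b > 0" "a + b = e1 + e2" for a b
  proof -
   let ?V = "ball z (b + s)"
   have sub: "cball x a \<subseteq> K" if "x \<in> ?V" for x
    using that ab(3) unfolding K_def by (intro cball_subset_cball_iff[THEN iffD2]) (auto simp: dist_commute)
   have hol: "holomorphic_on_Cn (conv (moll a) ?F) ?V"
   proof (rule holomorphic_onI)
    show "c1 ?V (conv (moll a) ?F)" by (rule c1_subset[OF c2_c1[OF c2_conv_moll[OF ab(1) iF]]]) auto
    show "db j (conv (moll a) ?F) x = 0" if "x \<in> ?V" for x j by (rule weyl_db_zero[OF iF Kc KU ab(1) sub[OF that] wk])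
   qed simp
   have "conv (moll b) (%x. indicator (cball z b) x *\<^sub>R conv (moll a) ?F x) z = conv (moll a) ?F z"
    by (rule holomorphic_conv[OF hol compact_cball _ ab(2)]) (use s in auto)
   moreover have "conv (moll b) (%x. indicator (cball z b) x *\<^sub>R conv (moll a) ?F x) z = conv (moll b) (conv (moll a) ?F) z"
    by (rule conv_moll_restrict[OF ab(2)]) simp
   moreover have "conv (moll a) ?F z = conv (moll a) f z" by (rule conv_moll_restrict[OF ab(1) sub]) (use s ab in simp)
   ultimately show ?thesis by simp
  qed
  show ?thesis using half[OF e refl] half[OF e(2,1)] conv_moll_commute[OF e iF, of z] by simp
 qed
 \<comment> \<open>At points of U the sequence is eventually constant; the limit only selects the
   common value.\<close>
 define F0 where "F0 z = lim (%n. conv (moll (1 / real (Suc n))) f z)" for z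
 have F0: "F0 z = conv (moll e) f z" if e: "e > 0" and z: "cball z (2 * e) \<subseteq> U" for z e
 proof -
  have "(%n. conv (moll (1 / real (Suc n))) f z) \<longlonglongrightarrow> conv (moll e) f z"
  proof (rule tendsto_eventually)
   obtain N where N: "1 / real (Suc N) < e" using e nat_approx_posE by blast
   have "conv (moll (1 / real (Suc n))) f z = conv (moll e) f z" if "n >= N" for n
   proof (rule eqc)
    have "1 / real (Suc n) <= 1 / real (Suc N)" using that by (simp add: frac_le)
    hence "1 / real (Suc n) + e <= 2 * e" using N by linarith
    thus "cball z (1 / real (Suc n) + e) \<subseteq> U" using z subset_cball by blast
   qed (use e in auto)
   thus "\<forall>\<^sub>F n in sequentially. conv (moll (1 / real (Suc n))) f z = conv (moll e) f z"
    unfolding eventually_sequentially by blast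
  qed
  thus ?thesis unfolding F0_def by (rule limI)
 qed
 have loc: "\<exists>V. open V \<and> z \<in> V \<and> V \<subseteq> U \<and> c1 V F0 \<and> (\<forall>x\<in>V. \<forall>j. db j F0 x = 0)" if zU: "z \<in> U" for z
 proof -
  obtain r where r: "r > 0" "cball z r \<subseteq> U" using zU U unfolding open_contains_cball by blast
  define e where "e = r / 3"
  have e: "e > 0" using r by (simp add: e_def)
  let ?F = "%x. indicator (cball z r) x *\<^sub>R f x"
  note iF = F[OF compact_cball r(2)]
  have s1: "cball x (2 * e) \<subseteq> cball z r" if "x \<in> ball z e" for x
   using that by (intro cball_subset_cball_iff[THEN iffD2]) (auto simp: dist_commute e_def)
  have s2: "cball x e \<subseteq> cball z r" if "x \<in> ball z e" for x
   using that e by (intro cball_subset_cball_iff[THEN iffD2]) (auto simp: dist_commute e_def)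
  have eq: "conv (moll e) ?F x = F0 x" if "x \<in> ball z e" for x
   using conv_moll_restrict[OF e s2[OF that], of f] F0[OF e order_trans[OF s1[OF that] r(2)]] by simp
  have "c1 (ball z e) (conv (moll e) ?F)" by (rule c1_subset[OF c2_c1[OF c2_conv_moll[OF e iF]]]) auto
  from c1_cong[OF open_ball _ this, of F0] eq have "c1 (ball z e) F0" by blast
  moreover have "db j F0 x = 0" if "x \<in> ball z e" for x j
   using wirt_cong(2)[OF open_ball eq that, where j=j] weyl_db_zero[OF iF compact_cball r(2) e s2[OF that] wk, where j=j] by simp
  moreover have "ball z e \<subseteq> U" using r by (force simp: e_def)
  ultimately show ?thesis using e by (intro exI[of _ "ball z e"]) auto
 qed
 have "holomorphic_on_Cn F0 U"
 proof (rule holomorphic_onI[OF U])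
  show "c1 U F0" by (rule c1_local[OF U]) (use loc in blast)
  show "db j F0 z = 0" if "z \<in> U" for z j using loc[OF that] by blast
 qed
 thus ?thesis using that F0 by blast
qed

section \<open>Transfer of the weighted bound to the holomorphic representative\<close>

lemma conv_moll_close:
 fixes g :: "'a::euclidean_space => 'b::{banach, second_countable_topology}"
 assumes e: "e > 0" and i: "intbl (%w. moll e (z - w) *\<^sub>R g w)" and r: "!!w. norm (z - w) < e ==> norm (g w - c) <= r"
 shows "norm (conv (moll e) g z - c) <= r"
proof -
 have "c = (LBINT w. moll e (z - w) *\<^sub>R c)"
  using integral_moll_shift[OF e, of z] by simp
 hence "conv (moll e) g z - c = (LBINT w. moll e (z - w) *\<^sub>R (g w - c))"
  unfolding conv_def scaleR_diff_right
  using bi_integral_diff[OF i, of "%w. moll e (z - w) *\<^sub>R c"] integral_moll_shift(2)[OF e, of z] by simp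
 also have "norm ... <= (LBINT w. moll e (z - w) * r)"
 proof (rule bi_norm_bound)
  show "intbl (%w. moll e (z - w) *\<^sub>R (g w - c))"
   unfolding scaleR_diff_right using i integral_moll_shift(2)[OF e, of z] by simp
  show "intbl (%w. moll e (z - w) * r)" using integral_moll_shift(2)[OF e, of z] by simp
  fix w
  show "norm (moll e (z - w) *\<^sub>R (g w - c)) <= moll e (z - w) * r"
  proof (cases "norm (z - w) < e")
   case True
   thus ?thesis using moll_nonneg[OF e, of "z - w"] r by (simp add: mult_left_mono)
  next
   case False
   thus ?thesis using moll_zero[OF e, of "z - w"] by simp
  qed
 qed
 also have "... = r" using integral_moll_shift(1)[OF e, of z] by simp
 finally show ?thesis .
qed

lemma L2_loc:
 fixes u :: "'a::euclidean_space => complex"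
 assumes g: "continuous_on U g" "!!z. z \<in> U ==> g z > 0" and u[measurable]: "u \<in> borel_measurable borel"
  and i: "intbl (%z. indicator U z * (g z * (cmod (u z))^2))" and K: "compact K" "K \<subseteq> U"
 shows "intbl (%z. indicator K z * (cmod (u z))^2)" "intbl (%z. indicator K z *\<^sub>R u z)"
proof -
 have [measurable]: "K \<in> sets borel" using compact_imp_closed[OF K(1)] by simp
 obtain m where m: "m > 0" "!!z. z \<in> K ==> m <= g z"
 proof (cases "K = {}")
  case True thus ?thesis using that[of 1] by simp
 next
  case False
  obtain x where "x \<in> K" "\<forall>y\<in>K. g x <= g y" using continuous_attains_inf[OF K(1) False continuous_on_subset[OF g(1) K(2)]] by blast
  thus ?thesis using that[of "g x"] g(2) K(2) by blast
 qed
 show i1: "intbl (%z. indicator K z * (cmod (u z))^2)"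
 proof (rule bi_integrable_bound[OF integrable_mult_right[OF i, of "1 / m"]])
  have "indicator K z * (cmod (u z))^2 <= \<bar>(1 / m) * (indicator U z * (g z * (cmod (u z))^2))\<bar>" for z
  proof (cases "z \<in> K")
   case True
   hence zU: "z \<in> U" using K by blast
   have "m * (cmod (u z))^2 <= g z * (cmod (u z))^2" using m(2)[OF True] by (intro mult_right_mono) auto
   thus ?thesis using True zU m(1) g(2)[OF zU] by (simp add: field_simps abs_mult)
  qed simp
  thus "AE z in lborel. norm (indicator K z * (cmod (u z))^2) <= norm ((1 / m) * (indicator U z * (g z * (cmod (u z))^2)))" by simp
 qed measurable
 have iK: "intbl (indicator K :: 'a => real)"
  using emeasure_compact_finite[OF K(1)] by (intro integrable_real_indicator) auto
 show "intbl (%z. indicator K z *\<^sub>R u z)"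
 proof (rule bi_integrable_bound[OF bi_integrable_add[OF iK i1]])
  have "cmod (u z) <= 1 + (cmod (u z))^2" for z
  proof -
   have "0 <= (cmod (u z) - 1)^2" by simp
   hence "2 * cmod (u z) <= 1 + (cmod (u z))^2" by (simp add: power2_diff)
   thus ?thesis using norm_ge_zero[of "u z"] by linarith
  qed
  thus "AE z in lborel. norm (indicator K z *\<^sub>R u z) <= norm (indicator K z + indicator K z * (cmod (u z))^2)"
   by (auto simp: indicator_def)
 qed measurable
qed

lemma nn_integral_exhaust_le:
 fixes h :: "'a::euclidean_space => ennreal"
 assumes U: "open U" and h: "(%z. indicator U z * h z) \<in> borel_measurable borel"
  and b: "!!K. compact K ==> K \<subseteq> U ==> (NNL z. indicator K z * h z) <= c"
 shows "(NNL z. indicator U z * h z) <= c"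
proof -
 obtain C :: "nat => 'a set" where C: "!!n. compact (C n)" "!!n. C n \<subseteq> U" "!!n. C n \<subseteq> interior (C (Suc n))" "\<Union>(range C) = U"
  using open_Union_compact_subsets[OF U] by metis
 have inc: "incseq C" using C(3) interior_subset by (intro incseq_SucI) blast
 have [measurable]: "C n \<in> sets borel" for n using compact_imp_closed[OF C(1)] by simp
 have eq: "indicator (C n) z * h z = indicator (C n) z * (indicator U z * h z)" for n z
  using C(2)[of n] by (auto simp: indicator_def)
 have "(NNL z. indicator U z * h z) = (NNL z. (SUP n. indicator (C n) z * h z))"
 proof (rule nn_integral_cong)
  fix z
  show "indicator U z * h z = (SUP n. indicator (C n) z * h z)"
  proof (cases "z \<in> U")
   case True
   then obtain n where "z \<in> C n" using C(4) by blast
   hence "indicator (C n) z * h z = h z" by simp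
   hence "h z <= (SUP n. indicator (C n) z * h z)" by (metis SUP_upper UNIV_I)
   moreover have "(SUP n. indicator (C n) z * h z) <= h z" by (rule SUP_least) (auto simp: indicator_def)
   ultimately show ?thesis using True by simp
  next
   case False
   hence "indicator (C n) z = (0::ennreal)" for n using C(2)[of n] by (auto simp: indicator_def)
   thus ?thesis using False by simp
  qed
 qed
 also have "... = (SUP n. (NNL z. indicator (C n) z * h z))"
 proof (rule nn_integral_monotone_convergence_SUP)
  show "incseq (%n z. indicator (C n) z * h z)"
   using inc by (intro incseq_SucI le_funI mult_right_mono) (auto simp: indicator_def dest: incseq_SucD)
  show "(%z. indicator (C n) z * h z) \<in> borel_measurable lborel" for n unfolding eq using h by simp
 qed
 also have "... <= c" by (rule SUP_least) (rule b[OF C(1,2)])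
 finally show ?thesis .
qed

text \<open>On a compact set \<open>A - F0\<close> is the pointwise limit of mollifications of u,
  because A is continuous and F0 is a mollification of \<open>A - u\<close> at every small scale.
  Jensen's inequality bounds each mollification, the continuous weight costs a factor
  \<open>1 + r\<close>, and Fatou's lemma concludes. Thus u itself is never identified with
  \<open>A - F0\<close> almost everywhere.\<close>

lemma weyl_fatou:
 fixes u A F0 :: "complex ^ 'n => complex"
 assumes U: "open U" and A: "continuous_on U A" and g: "continuous_on U g" "!!z. z \<in> U ==> g z > 0"
  and u[measurable]: "u \<in> borel_measurable borel"
  and i: "intbl (%z. indicator U z * (g z * (cmod (u z))^2))"
  and F0: "continuous_on U F0" "!!z e. e > 0 ==> cball z (2 * e) \<subseteq> U ==> F0 z = conv (moll e) (%z. A z - u z) z"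
 shows "(NNL z. indicator U z * ennreal (g z * (cmod (A z - F0 z))^2)) <= ennreal (LBINT z. indicator U z * (g z * (cmod (u z))^2))"
proof (rule nn_integral_exhaust_le[OF U])
 have "(%z. indicator U z *\<^sub>R (g z * (cmod (A z - F0 z))^2)) \<in> borel_measurable borel"
  by (rule borel_measurable_continuous_on_indicator) (use U in \<open>auto intro!: continuous_intros A g(1) F0(1)\<close>)
 hence "(%z. ennreal (indicator U z *\<^sub>R (g z * (cmod (A z - F0 z))^2))) \<in> borel_measurable borel" by measurable
 moreover have "(%z. ennreal (indicator U z *\<^sub>R (g z * (cmod (A z - F0 z))^2))) = (%z. indicator U z * ennreal (g z * (cmod (A z - F0 z))^2))"
  by (auto simp: fun_eq_iff indicator_def)
 ultimately show "(%z. indicator U z * ennreal (g z * (cmod (A z - F0 z))^2)) \<in> borel_measurable borel" by simp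
 let ?I = "\<integral>z. indicator U z * (g z * (cmod (u z))^2) \<partial>lborel"
 have I0: "?I >= 0" using g(2) by (intro bi_integral_nonneg) (auto simp: indicator_def less_imp_le)
 fix K assume K: "compact K" "K \<subseteq> U"
 have [measurable]: "K \<in> sets borel" using compact_imp_closed[OF K(1)] by simp
 obtain e0 where e0: "e0 > 0" "(\<Union>x\<in>K. cball x e0) \<subseteq> U" using compact_subset_open_imp_cball_epsilon_subset[OF K(1) U K(2)] by blast
 define K' where "K' = (\<Union>x\<in>K. cball x e0)"
 have K': "compact K'" "K' \<subseteq> U" using e0 compact_minkowski_sum_cball[OF K(1)] by (auto simp: K'_def)
 have KK: "cball x e \<subseteq> K'" if "x \<in> K" "e <= e0" for x e using that unfolding K'_def by (meson UN_upper order_trans subset_cball)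
 have KK': "K \<subseteq> K'" using e0(1) by (force simp: K'_def)
 have [measurable]: "K' \<in> sets borel" using compact_imp_closed[OF K'(1)] by simp
 note L = L2_loc[OF g u i K']
 have iA: "intbl (%z. indicator K' z *\<^sub>R A z)" by (rule integrable_on_compact[OF A K'])
 have le: "(NNL z. indicator K z * ennreal (g z * (cmod (A z - F0 z))^2)) <= ennreal ((1 + r) * ?I)" if r: "r > 0" for r
 proof -
  \<comment> \<open>Uniform continuity of the logarithm compares nearby values of g by a factor, as
    needed for the weight under the convolution.\<close>
  have ne: "continuous_on K' (%z. ln (g z))" using g K'(2) by (intro continuous_intros continuous_on_subset[OF g(1)]) force+
  have "ln (1 + r) > 0" using r by simp
  then obtain d where d: "d > 0" "!!x y. x \<in> K' ==> y \<in> K' ==> dist y x < d ==> dist (ln (g y)) (ln (g x)) < ln (1 + r)"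
   using compact_uniformly_continuous[OF ne K'(1)] unfolding uniformly_continuous_on_def by metis
  have gr: "g x <= (1 + r) * g y" if "x \<in> K'" "y \<in> K'" "dist x y < d" for x y
  proof -
   have gp: "g x > 0" "g y > 0" using that K' g(2) by blast+
   have "ln (g x) <= ln (1 + r) + ln (g y)" using d(2)[OF that(2,1)] that(3) by (simp add: dist_real_def)
   also have "... = ln ((1 + r) * g y)" using gp r by (simp add: ln_mult_pos)
   finally show ?thesis using gp r by simp
  qed
  obtain N where N: "1 / real (Suc N) < min e0 d / 2" using nat_approx_posE[of "min e0 d / 2"] e0 d by auto
  define en where "en n = 1 / real (Suc (N + n))" for n
  have en: "en n > 0" "2 * en n < e0" "en n < d" "en n < e0" for n
  proof -
   show "en n > 0" by (simp add: en_def)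
   have "en n <= 1 / real (Suc N)" unfolding en_def by (simp add: frac_le)
   moreover have "min e0 d <= e0" "min e0 d <= d" "d > 0" using d by auto
   ultimately show "2 * en n < e0" "en n < d" using N by linarith+
   thus "en n < e0" using \<open>en n > 0\<close> by linarith
  qed
  have en0: "en \<longlonglongrightarrow> 0"
  proof -
   have "(%n. 1 / real (Suc n)) \<longlonglongrightarrow> 0" using LIMSEQ_inverse_real_of_nat by (simp add: inverse_eq_divide)
   from LIMSEQ_ignore_initial_segment[OF this, of N] show ?thesis by (simp add: en_def[abs_def] add.commute)
  qed
  define v where "v n z = conv (moll (en n)) (%z. indicator K' z *\<^sub>R u z) z" for n z
  have vc: "continuous_on UNIV (v n)" for n unfolding v_def[abs_def] by (rule c2_continuous[OF c2_conv_moll[OF en(1) L(2)]])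
  have [measurable]: "v n \<in> borel_measurable borel" for n by (rule borel_measurable_continuous_onI[OF vc])
  have gm: "(%z. indicator K z *\<^sub>R g z) \<in> borel_measurable borel"
   by (rule borel_measurable_continuous_on_indicator) (use continuous_on_subset[OF g(1) K(2)] in auto)
  have vlim: "(%n. v n z) \<longlonglongrightarrow> A z - F0 z" if z: "z \<in> K" for z
  proof -
   have eqv: "v n z = conv (moll (en n)) (%z. indicator K' z *\<^sub>R A z) z - F0 z" for n
   proof -
    have "cball z (2 * en n) \<subseteq> U" using KK[OF z, of "2 * en n"] en(2)[of n] K' by (meson less_imp_le order_trans)
    hence "F0 z = conv (moll (en n)) (%z. A z - u z) z" by (rule F0(2)[OF en(1)])
    also have "... = conv (moll (en n)) (%z. indicator K' z *\<^sub>R (A z - u z)) z"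
     by (rule conv_moll_restrict[symmetric, OF en(1) KK[OF z less_imp_le[OF en(4)]]])
    also have "... = conv (moll (en n)) (%z. indicator K' z *\<^sub>R A z) z - v n z"
     unfolding conv_def v_def scaleR_diff_right
     by (rule bi_integral_diff[OF moll_conv_integrable[OF en(1) iA] moll_conv_integrable[OF en(1) L(2)]])
    finally show ?thesis by simp
   qed
   have "(%n. conv (moll (en n)) (%z. indicator K' z *\<^sub>R A z) z) \<longlonglongrightarrow> A z"
   proof (rule LIMSEQ_I)
    fix s :: real assume s: "s > 0"
    have zU: "z \<in> U" using z K by blast
    obtain d where d: "d > 0" "!!w. w \<in> U ==> dist w z < d ==> dist (A w) (A z) < s / 2"
     using A zU s unfolding continuous_on_iff by (metis half_gt_zero)
    obtain M where M: "!!n. n >= M ==> norm (en n - 0) < d" using LIMSEQ_D[OF en0 d(1)] by blast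
    have "norm (conv (moll (en n)) (%z. indicator K' z *\<^sub>R A z) z - A z) < s" if "n >= M" for n
    proof -
     have "norm (conv (moll (en n)) (%z. indicator K' z *\<^sub>R A z) z - A z) <= s / 2"
     proof (rule conv_moll_close[OF en(1) moll_conv_integrable[OF en(1) iA]])
      fix w assume w: "norm (z - w) < en n"
      hence "w \<in> cball z (en n)" by (simp add: dist_norm)
      hence wK: "w \<in> K'" using KK[OF z less_imp_le[OF en(4)]] by blast
      have "dist w z < d" using w M[OF that] en(1)[of n] by (simp add: dist_norm norm_minus_commute)
      hence "dist (A w) (A z) < s / 2" using d(2) wK K' by blast
      thus "norm (indicator K' w *\<^sub>R A w - A z) <= s / 2" using wK by (simp add: dist_norm)
     qed
     thus ?thesis using s by linarith
    qed
    thus "\<exists>no. \<forall>n\<ge>no. norm (conv (moll (en n)) (%z. indicator K' z *\<^sub>R A z) z - A z) < s" by blast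
   qed
   thus ?thesis unfolding eqv by (intro tendsto_intros)
  qed
  have "(NNL z. indicator K z * ennreal (g z * (cmod (A z - F0 z))^2)) = (NNL z. liminf (%n. ennreal ((indicator K z *\<^sub>R g z) * (cmod (v n z))^2)))"
  proof (rule nn_integral_cong)
   fix z
   show "indicator K z * ennreal (g z * (cmod (A z - F0 z))^2) = liminf (%n. ennreal ((indicator K z *\<^sub>R g z) * (cmod (v n z))^2))"
   proof (cases "z \<in> K")
    case True
    have "(%n. ennreal ((indicator K z *\<^sub>R g z) * (cmod (v n z))^2)) \<longlonglongrightarrow> ennreal ((indicator K z *\<^sub>R g z) * (cmod (A z - F0 z))^2)"
     by (intro tendsto_intros vlim[OF True])
    from lim_imp_Liminf[OF sequentially_bot this] show ?thesis using True by simp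
   next
    case False thus ?thesis by (simp add: Liminf_const)
   qed
  qed
  also have "... <= liminf (%n. \<integral>\<^sup>+z. ennreal ((indicator K z *\<^sub>R g z) * (cmod (v n z))^2) \<partial>lborel)"
   by (rule nn_integral_liminf) (use gm in measurable)
  also have "... <= ennreal ((1 + r) * ?I)"
  proof (rule order_trans[OF Liminf_le_Limsup Limsup_bounded])
   show "\<forall>\<^sub>F n in sequentially. (NNL z. ennreal ((indicator K z *\<^sub>R g z) * (cmod (v n z))^2)) <= ennreal ((1 + r) * ?I)"
   proof (rule always_eventually, rule allI)
    fix n
    let ?w = "%z. indicator K' z * (g z * (cmod (u z))^2)"
    have iw: "intbl ?w"
    proof -
     have "intbl (%z. indicator K' z *\<^sub>R (indicator U z * (g z * (cmod (u z))^2)))"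
      by (rule integrable_mult_indicator[OF _ i]) simp
     moreover have "(%z. indicator K' z *\<^sub>R (indicator U z * (g z * (cmod (u z))^2))) = ?w" using K' by (auto simp: fun_eq_iff indicator_def)
     ultimately show ?thesis by simp
    qed
    have w0: "?w z >= 0" for z
    proof (cases "z \<in> K'")
     case True
     hence "g z > 0" using K' g(2) by blast
     thus ?thesis by (simp add: less_imp_le)
    qed simp
    have i2: "intbl (%z. (norm (indicator K' z *\<^sub>R u z))^2)"
    proof -
     have "(%z. (norm (indicator K' z *\<^sub>R u z))^2) = (%z. indicator K' z * (cmod (u z))^2)"
      by (auto simp: fun_eq_iff indicator_def)
     thus ?thesis using L(1) by simp
    qed
    have pt: "(indicator K z *\<^sub>R g z) * (cmod (v n z))^2 <= (1 + r) * conv (moll (en n)) ?w z" for z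
    proof (cases "z \<in> K")
     case True
     hence zK: "z \<in> K'" and gp: "g z > 0" using KK' K' g(2) by blast+
     have "g z * (cmod (v n z))^2 <= g z * conv (moll (en n)) (%z. (norm (indicator K' z *\<^sub>R u z))^2) z"
      unfolding v_def using conv_moll_sq[OF en(1) L(2) i2] gp by (intro mult_left_mono) auto
     also have "... = (LBINT y. g z * (moll (en n) (z - y) *\<^sub>R (norm (indicator K' y *\<^sub>R u y))\<^sup>2))"
      unfolding conv_def by (rule integral_mult_right_zero[symmetric])
     also have "... <= (LBINT y. (1 + r) * (moll (en n) (z - y) *\<^sub>R ?w y))"
     proof (rule integral_mono[OF integrable_mult_right[OF moll_conv_integrable[OF en(1) i2]] integrable_mult_right[OF moll_conv_integrable[OF en(1) iw]]])
      fix y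
      show "g z * (moll (en n) (z - y) *\<^sub>R (norm (indicator K' y *\<^sub>R u y))\<^sup>2) <= (1 + r) * (moll (en n) (z - y) *\<^sub>R ?w y)"
      proof (cases "y \<in> K' \<and> norm (z - y) < en n")
       case True
       have "g z * (moll (en n) (z - y) * (cmod (u y))^2) <= ((1 + r) * g y) * (moll (en n) (z - y) * (cmod (u y))^2)"
        using gr[OF zK, of y] True en(3)[of n] by (intro mult_right_mono mult_nonneg_nonneg moll_nonneg[OF en(1)]) (auto simp: dist_norm)
       thus ?thesis using True by (simp add: algebra_simps)
      next
       case False
       hence "moll (en n) (z - y) = 0 \<or> indicator K' y = (0::real)" using moll_zero[OF en(1), of n "z - y"] by (auto simp: indicator_def)
       thus ?thesis by auto
      qed
     qed
     also have "... = (1 + r) * conv (moll (en n)) ?w z" unfolding conv_def by (rule integral_mult_right_zero)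
     finally show ?thesis using True by simp
    next
     case False thus ?thesis using conv_moll_nonneg[OF en(1), of ?w n z] w0 r by simp
    qed
    have "(NNL z. ennreal ((indicator K z *\<^sub>R g z) * (cmod (v n z))^2)) <= (NNL z. ennreal ((1 + r) * conv (moll (en n)) ?w z))"
     by (intro nn_integral_mono ennreal_leI pt)
    also have "... = ennreal (LBINT z. (1 + r) * conv (moll (en n)) ?w z)"
     by (rule nn_integral_eq_integral[OF integrable_mult_right[OF conv_moll_integral(1)[OF en(1) iw w0]]])
       (use conv_moll_nonneg[OF en(1), of ?w n] w0 r in auto)
    also have "... = ennreal ((1 + r) * (LBINT z. ?w z))"
     using conv_moll_integral(2)[OF en(1) iw w0] by (simp only: integral_mult_right_zero)
    also have "... <= ennreal ((1 + r) * ?I)"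
     using r g(2) K' by (intro ennreal_leI mult_left_mono integral_mono[OF iw i]) (auto simp: indicator_def less_imp_le)
    finally show "(NNL z. ennreal ((indicator K z *\<^sub>R g z) * (cmod (v n z))^2)) <= ennreal ((1 + r) * ?I)" .
   qed
  qed simp
  finally show ?thesis .
 qed
 show "(NNL z. indicator K z * ennreal (g z * (cmod (A z - F0 z))^2)) <= ennreal ?I"
 proof (rule LIMSEQ_le_const)
  have "(%n. (1 + inverse (real (Suc n))) * ?I) \<longlonglongrightarrow> (1 + 0) * ?I"
   by (intro tendsto_intros LIMSEQ_inverse_real_of_nat)
  thus "(%n. ennreal ((1 + inverse (real (Suc n))) * ?I)) \<longlonglongrightarrow> ennreal ?I" by (simp add: tendsto_ennrealI)
  show "\<exists>N. \<forall>n\<ge>N. (NNL z. indicator K z * ennreal (g z * (cmod (A z - F0 z))^2)) <= ennreal ((1 + inverse (real (Suc n))) * ?I)"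
   using le by (intro exI[of _ 0] allI impI) simp
 qed
qed

section \<open>Montel's theorem\<close>

lemma holomorphic_weak:
 assumes f: "holomorphic_on_Cn f U" and B: "tst U B" shows "(LBINT z. f z \<bullet> dv B z) = 0"
proof -
 have U: "open U" using f by (simp add: holomorphic_on_Cn_def)
 obtain K where K: "compact K" "K \<subseteq> U" "!!z. z \<notin> K ==> B z = 0" and B2: "c2 UNIV B" using B by (auto simp: tst_def)
 have "(LBINT z. Re (of_real (exp (- 0)) * (\<Sum>j\<in>UNIV. db j f z * cnj (B z $ j)))) = - (LBINT z. exp (- 0) * (f z \<bullet> del (%_. 0) B z))"
  by (rule dbar_adjoint(1)[OF U c2_const[OF U] c2_c1[OF holomorphic_c2[OF f]] B2 K])
 moreover have "(\<Sum>j\<in>UNIV. db j f z * cnj (B z $ j)) = 0" for z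
  using holomorphic_db_zero[OF f, of z] K by (cases "z \<in> K") (auto intro!: sum.neutral)
 moreover have "del (%_. 0) B z = dv B z" for z by (simp add: del_def dv_def wirt_const)
 ultimately show ?thesis by simp
qed

text \<open>Each function equals its own mollification at one fixed scale \<open>e0\<close>. An L2
  bound therefore becomes a sup bound, and the modulus of continuity of the kernel becomes a common
  modulus for the family.\<close>

lemma holomorphic_local_bounds:
 fixes F :: "nat => complex ^ 'n => complex"
 assumes D: "open D" and hol: "!!m. holomorphic_on_Cn (F m) (Om m)"
  and ev: "!!K. compact K ==> K \<subseteq> D ==> \<exists>N. \<forall>m\<ge>N. K \<subseteq> Om m"
  and bd: "!!K. compact K ==> K \<subseteq> D ==> \<exists>C N. \<forall>m\<ge>N. (NNL z. indicator K z * ennreal ((cmod (F m z))^2)) <= ennreal C"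
  and K: "compact K" "K \<subseteq> D"
 shows "\<exists>N M. (\<forall>m\<ge>N. K \<subseteq> Om m \<and> (\<forall>z\<in>K. cmod (F m z) <= M)) \<and>
   (\<forall>e>0. \<exists>d>0. \<forall>m\<ge>N. \<forall>x\<in>K. \<forall>y\<in>K. norm (x - y) < d --> cmod (F m x - F m y) < e)"
proof -
 obtain e0 where e0: "e0 > 0" "(\<Union>x\<in>K. cball x e0) \<subseteq> D" using compact_subset_open_imp_cball_epsilon_subset[OF K(1) D K(2)] by blast
 define K' where "K' = (\<Union>x\<in>K. cball x e0)"
 have K': "compact K'" "K' \<subseteq> D" using e0 compact_minkowski_sum_cball[OF K(1)] by (auto simp: K'_def)
 have KK: "cball x e0 \<subseteq> K'" if "x \<in> K" for x using that unfolding K'_def by blast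
 have KK': "K \<subseteq> K'" using e0(1) by (force simp: K'_def)
 have [measurable]: "K' \<in> sets borel" using compact_imp_closed[OF K'(1)] by simp
 obtain N1 where N1: "!!m. m >= N1 ==> K' \<subseteq> Om m" using ev[OF K'] by blast
 obtain C N2 where N2: "!!m. m >= N2 ==> (NNL z. indicator K' z * ennreal ((cmod (F m z))^2)) <= ennreal C" using bd[OF K'] by blast
 define N where "N = max N1 N2"
 define C' where "C' = measure lborel K' + \<bar>C\<bar> + 1"
 have C': "C' > 0" by (simp add: C'_def add_nonneg_pos)
 have iF: "intbl (%z. indicator K' z *\<^sub>R F m z)" if "m >= N" for m
  by (rule integrable_on_compact[OF holomorphic_on_Cn_continuous[OF hol] K'(1) N1]) (use that in \<open>simp add: N_def\<close>)
 have nF: "(LBINT z. norm (indicator K' z *\<^sub>R F m z)) <= C'" if m: "m >= N" for m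
 proof -
  have KO: "K' \<subseteq> Om m" using N1 m by (simp add: N_def)
  have i2: "intbl (%z. indicator K' z *\<^sub>R csq (F m z))"
   by (rule integrable_on_compact[OF _ K'(1) KO]) (intro continuous_intros holomorphic_on_Cn_continuous[OF hol])
  have "ennreal (LBINT z. indicator K' z *\<^sub>R csq (F m z)) = (NNL z. ennreal (indicator K' z *\<^sub>R csq (F m z)))"
   by (rule nn_integral_eq_integral[OF i2, symmetric]) simp
  also have "... = (NNL z. indicator K' z * ennreal ((cmod (F m z))^2))"
   by (rule nn_integral_cong) (auto simp: indicator_def)
  also have "... <= ennreal \<bar>C\<bar>" using N2[of m] m by (simp add: N_def) (meson abs_ge_self ennreal_leI order_trans)
  finally have c2: "(LBINT z. indicator K' z *\<^sub>R csq (F m z)) <= \<bar>C\<bar>" by (simp add: ennreal_le_iff)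
  have iK: "intbl (indicator K' :: complex ^ 'n => real)"
   using emeasure_compact_finite[OF K'(1)] by (intro integrable_real_indicator) auto
  have "(LBINT z. norm (indicator K' z *\<^sub>R F m z)) <= (LBINT z. indicator K' z + indicator K' z *\<^sub>R csq (F m z))"
  proof (rule integral_mono[OF integrable_norm[OF iF[OF m]] bi_integrable_add[OF iK i2]])
   fix z
   have "0 <= (cmod (F m z) - 1)^2" by simp
   hence "2 * cmod (F m z) <= 1 + (cmod (F m z))^2" by (simp add: power2_diff)
   hence "cmod (F m z) <= 1 + (cmod (F m z))^2" using norm_ge_zero[of "F m z"] by linarith
   thus "norm (indicator K' z *\<^sub>R F m z) <= indicator K' z + indicator K' z *\<^sub>R csq (F m z)" by (auto simp: indicator_def)
  qed
  also have "... = measure lborel K' + (LBINT z. indicator K' z *\<^sub>R csq (F m z))"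
   using bi_integral_add[OF iK i2] by simp
  also have "... <= C'" using c2 by (simp add: C'_def)
  finally show ?thesis .
 qed
 have Fc: "F m z = conv (moll e0) (%z. indicator K' z *\<^sub>R F m z) z" if "m >= N" "z \<in> K" for m z
  by (rule holomorphic_conv[OF hol K'(1) N1 e0(1) KK[OF that(2)], symmetric]) (use that in \<open>simp add: N_def\<close>)
 obtain B where B: "!!x::complex ^ 'n. \<bar>moll e0 x\<bar> <= B" using moll_bound[OF e0(1)] by blast
 have B0: "B >= 0" using order_trans[OF abs_ge_zero B] .
 have M: "cmod (F m z) <= B * C'" if "m >= N" "z \<in> K" for m z
 proof -
  have "cmod (F m z) <= (LBINT w. B * norm (indicator K' w *\<^sub>R F m w))"
   unfolding Fc[OF that] conv_def
  proof (rule bi_norm_bound[OF moll_conv_integrable[OF e0(1) iF[OF that(1)]] integrable_mult_right[OF integrable_norm[OF iF[OF that(1)]]]])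
   show "norm (moll e0 (z - w) *\<^sub>R (indicator K' w *\<^sub>R F m w)) <= B * norm (indicator K' w *\<^sub>R F m w)" for w
    unfolding norm_scaleR[of "moll e0 (z - w)"] using B by (intro mult_right_mono) auto
  qed
  also have "... = B * (LBINT w. norm (indicator K' w *\<^sub>R F m w))" by (rule integral_mult_right_zero)
  also have "... <= B * C'" by (intro mult_left_mono nF[OF that(1)] B0)
  finally show ?thesis .
 qed
 have eq: "\<exists>d>0. \<forall>m\<ge>N. \<forall>x\<in>K. \<forall>y\<in>K. norm (x - y) < d --> cmod (F m x - F m y) < e" if e: "e > 0" for e
 proof -
  have "e / (2 * C') > 0" using e C' by simp
  then obtain d where d: "d > 0" "!!x y::complex ^ 'n. dist y x < d ==> dist (moll e0 y) (moll e0 x) < e / (2 * C')"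
   using uniformly_continuous_compact_support[OF c2_continuous[OF c2_moll[of e0]] compact_cball[of 0 e0]] moll_zero'[OF e0(1)]
   unfolding uniformly_continuous_on_def by (metis UNIV_I)
  have "cmod (F m x - F m y) < e" if mxy: "m >= N" "x \<in> K" "y \<in> K" "norm (x - y) < d" for m x y
  proof -
   note im = moll_conv_integrable[OF e0(1) iF[OF mxy(1)]]
   have "F m x - F m y = (LBINT w. (moll e0 (x - w) - moll e0 (y - w)) *\<^sub>R (indicator K' w *\<^sub>R F m w))"
    unfolding Fc[OF mxy(1,2)] Fc[OF mxy(1,3)] unfolding conv_def scaleR_diff_left by (rule bi_integral_diff[OF im im, symmetric])
   also have "cmod ... <= (LBINT w. (e / (2 * C')) * norm (indicator K' w *\<^sub>R F m w))"
   proof (rule bi_norm_bound[OF _ integrable_mult_right[OF integrable_norm[OF iF[OF mxy(1)]]]])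
    show "intbl (%w. (moll e0 (x - w) - moll e0 (y - w)) *\<^sub>R (indicator K' w *\<^sub>R F m w))"
     unfolding scaleR_diff_left by (rule bi_integrable_diff[OF im im])
    fix w
    have "dist (x - w) (y - w) < d" using mxy(4) by (simp add: dist_norm)
    from d(2)[OF this] have "\<bar>moll e0 (x - w) - moll e0 (y - w)\<bar> <= e / (2 * C')" by (simp add: dist_real_def)
    thus "norm ((moll e0 (x - w) - moll e0 (y - w)) *\<^sub>R (indicator K' w *\<^sub>R F m w)) <= (e / (2 * C')) * norm (indicator K' w *\<^sub>R F m w)"
     unfolding norm_scaleR[of "moll e0 (x - w) - moll e0 (y - w)"] by (intro mult_right_mono) auto
   qed
   also have "... = (e / (2 * C')) * (LBINT w. norm (indicator K' w *\<^sub>R F m w))" by (rule integral_mult_right_zero)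
   also have "... <= (e / (2 * C')) * C'" using e C' by (intro mult_left_mono nF[OF mxy(1)]) auto
   also have "... < e" using e C' by simp
   finally show ?thesis .
  qed
  thus ?thesis using d(1) by blast
 qed
 have "K \<subseteq> Om m" if "m >= N" for m using N1[of m] that KK' by (auto simp: N_def)
 thus ?thesis using M eq by blast
qed

text \<open>The domains \<open>Om m\<close> vary and only eventually contain a given compact set,
  which is the situation on an exhaustion. Holomorphy of the limit is obtained from the weak
  equation, which passes to the limit by dominated convergence, followed by Weyl's lemma.\<close>

lemma montel_Cn:
 fixes F :: "nat => complex ^ 'n => complex"
 assumes D: "open D" and hol: "!!m. holomorphic_on_Cn (F m) (Om m)"
  and ev: "!!K. compact K ==> K \<subseteq> D ==> \<exists>N. \<forall>m\<ge>N. K \<subseteq> Om m"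
  and bd: "!!K. compact K ==> K \<subseteq> D ==> \<exists>C N. \<forall>m\<ge>N. (NNL z. indicator K z * ennreal ((cmod (F m z))^2)) <= ennreal C"
 obtains G and r :: "nat => nat" where "holomorphic_on_Cn G D" "strict_mono r" "!!z. z \<in> D ==> (%n. F (r n) z) \<longlonglongrightarrow> G z"
proof -
 have lb: "\<exists>N M. (\<forall>m\<ge>N. K \<subseteq> Om m \<and> (\<forall>z\<in>K. cmod (F m z) <= M)) \<and>
   (\<forall>e>0. \<exists>d>0. \<forall>m\<ge>N. \<forall>x\<in>K. \<forall>y\<in>K. norm (x - y) < d --> cmod (F m x - F m y) < e)" if "compact K" "K \<subseteq> D" for K
  by (rule holomorphic_local_bounds[OF D hol ev bd that])
 obtain C :: "nat => (complex ^ 'n) set" where C: "!!n. compact (C n)" "!!n. C n \<subseteq> D" "\<Union>(range C) = D"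
  using open_Union_compact_subsets[OF D] by metis
 have "\<forall>i. \<exists>N M. (\<forall>m\<ge>N. C i \<subseteq> Om m \<and> (\<forall>z\<in>C i. cmod (F m z) <= M)) \<and>
   (\<forall>e>0. \<exists>d>0. \<forall>m\<ge>N. \<forall>x\<in>C i. \<forall>y\<in>C i. norm (x - y) < d --> cmod (F m x - F m y) < e)"
  using lb[OF C(1,2)] by blast
 then obtain N M where NM: "!!i m z. m >= N i ==> z \<in> C i ==> cmod (F m z) <= M i"
  "!!i e. e > 0 ==> \<exists>d>0. \<forall>m\<ge>N i. \<forall>x\<in>C i. \<forall>y\<in>C i. norm (x - y) < d --> cmod (F m x - F m y) < e"
  by metis
 \<comment> \<open>Before the bounds on \<open>C i\<close> take effect the functions are replaced by
   0, so that Arzela-Ascoli meets a family that is bounded and equicontinuous for every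
   index.\<close>
 define H where "H i m = (if m >= N i then F m else (%_. 0))" for i m
 obtain r :: "nat => nat" where r: "strict_mono r" "!!i. \<forall>z\<in>C i. \<exists>l. (%n. H i ((id \<circ> r) n) z) \<longlonglongrightarrow> l"
 proof (rule subsequence_diagonalization_lemma[of "%i r. \<forall>z\<in>C i. \<exists>l. (%n. H i (r n) z) \<longlonglongrightarrow> l" id])
  fix i and s :: "nat => nat"
  obtain g k where gk: "strict_mono (k :: nat => nat)" "!!e. 0 < e ==> \<exists>N. \<forall>n x. n >= N \<and> x \<in> C i --> norm (H i (s (k n)) x - g x) < e"
  proof (rule Arzela_Ascoli[OF C(1), of i "%n. H i (s n)" "max (M i) 0"])
   show "norm (H i (s n) x) <= max (M i) 0" if "x \<in> C i" for n x using NM(1)[of i "s n" x] that by (auto simp: H_def intro: order_trans[OF _ max.cobounded1])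
   fix x and e :: real assume x: "x \<in> C i" "0 < e"
   obtain d where d: "d > 0" "\<forall>m\<ge>N i. \<forall>x\<in>C i. \<forall>y\<in>C i. norm (x - y) < d --> cmod (F m x - F m y) < e" using NM(2)[OF x(2), of i] by blast
   show "\<exists>d>0. \<forall>n y. y \<in> C i \<and> norm (x - y) < d --> norm (H i (s n) x - H i (s n) y) < e"
    using d x by (intro exI[of _ d]) (auto simp: H_def)
  qed blast
  have "(%n. H i ((s \<circ> k) n) z) \<longlonglongrightarrow> g z" if "z \<in> C i" for z
   unfolding LIMSEQ_iff using gk(2) that by (metis comp_apply)
  thus "\<exists>k. strict_mono (k :: nat => nat) \<and> (\<forall>z\<in>C i. \<exists>l. (%n. H i ((s \<circ> k) n) z) \<longlonglongrightarrow> l)" using gk(1) by blast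
 next
  fix i and s k1 k2 :: "nat => nat" and N0
  assume 1: "\<forall>z\<in>C i. \<exists>l. (%n. H i ((s \<circ> k1) n) z) \<longlonglongrightarrow> l" and 2: "!!j. N0 <= j ==> \<exists>j'\<ge>j. k2 j = k1 j'"
  show "\<forall>z\<in>C i. \<exists>l. (%n. H i ((s \<circ> k2) n) z) \<longlonglongrightarrow> l"
  proof
   fix z assume "z \<in> C i"
   then obtain l where l: "(%n. H i ((s \<circ> k1) n) z) \<longlonglongrightarrow> l" using 1 by blast
   have "(%n. H i ((s \<circ> k2) n) z) \<longlonglongrightarrow> l"
   proof (rule LIMSEQ_I)
    fix e :: real assume "e > 0"
    then obtain n0 where n0: "!!n. n >= n0 ==> norm (H i ((s \<circ> k1) n) z - l) < e" using LIMSEQ_D[OF l] by blast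
    have "norm (H i ((s \<circ> k2) n) z - l) < e" if n: "n >= max n0 N0" for n
    proof -
     obtain j' where j': "j' >= n" "k2 n = k1 j'" using 2[of n] n by auto
     show ?thesis using n0[of j'] j' n by simp
    qed
    thus "\<exists>no. \<forall>n\<ge>no. norm (H i ((s \<circ> k2) n) z - l) < e" by blast
   qed
   thus "\<exists>l. (%n. H i ((s \<circ> k2) n) z) \<longlonglongrightarrow> l" by blast
  qed
 qed blast
 define G where "G z = lim (%n. F (r n) z)" for z
 have G: "(%n. F (r n) z) \<longlonglongrightarrow> G z" if zD: "z \<in> D" for z
 proof -
  obtain i where i: "z \<in> C i" using zD C(3) by blast
  obtain l where l: "(%n. H i (r n) z) \<longlonglongrightarrow> l" using r(2)[of i] i by auto
  have "\<forall>\<^sub>F n in sequentially. H i (r n) z = F (r n) z"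
   unfolding eventually_sequentially H_def using seq_suble[OF r(1)] by (intro exI[of _ "N i"]) (auto intro: order_trans)
  with l have "(%n. F (r n) z) \<longlonglongrightarrow> l" by (rule Lim_transform_eventually)
  thus ?thesis unfolding G_def by (simp add: limI)
 qed
 have dom: "\<exists>M N. (\<forall>n\<ge>N. K \<subseteq> Om (r n) \<and> (\<forall>z\<in>K. cmod (F (r n) z) <= M)) \<and> (\<forall>z\<in>K. cmod (G z) <= M)" if K: "compact K" "K \<subseteq> D" for K
 proof -
  obtain N M where NM: "!!m. m >= N ==> K \<subseteq> Om m \<and> (\<forall>z\<in>K. cmod (F m z) <= M)" using lb[OF K] by blast
  have rn: "r n >= N" if "n >= N" for n using seq_suble[OF r(1), of n] that by linarith
  have "cmod (G z) <= M" if "z \<in> K" for z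
  proof (rule LIMSEQ_le_const2[OF tendsto_norm[OF G]])
   show "z \<in> D" using that K by blast
   show "\<exists>N. \<forall>n\<ge>N. cmod (F (r n) z) <= M" using NM rn that by (intro exI[of _ N]) blast
  qed
  thus ?thesis using NM rn by blast
 qed
 have mG: "(%z. indicator K z *\<^sub>R G z) \<in> borel_measurable borel" and iG: "intbl (%z. indicator K z *\<^sub>R G z)"
  and cG: "!!p :: complex ^ 'n => complex. continuous_on UNIV p ==> (!!z. z \<notin> K ==> p z = 0) ==> (%n. \<integral>z. p z * F (r n) z \<partial>lborel) \<longlonglongrightarrow> (LBINT z. p z * G z)"
  if K: "compact K" "K \<subseteq> D" for K
 proof -
  obtain M N where MN: "!!n. n >= N ==> K \<subseteq> Om (r n)" "!!n z. n >= N ==> z \<in> K ==> cmod (F (r n) z) <= M" "!!z. z \<in> K ==> cmod (G z) <= M"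
   using dom[OF K] by blast
  have Kb[measurable]: "K \<in> sets borel" using compact_imp_closed[OF K(1)] by simp
  have mF: "(%z. indicator K z *\<^sub>R F (r (n + N)) z) \<in> borel_measurable borel" for n
   by (rule borel_measurable_continuous_on_indicator[OF Kb]) (rule continuous_on_subset[OF holomorphic_on_Cn_continuous[OF hol] MN(1)], simp)
  have GN: "(%n. F (r (n + N)) z) \<longlonglongrightarrow> G z" if "z \<in> D" for z by (rule LIMSEQ_ignore_initial_segment[OF G[OF that]])
  have lm: "(%n. indicator K z *\<^sub>R F (r (n + N)) z) \<longlonglongrightarrow> indicator K z *\<^sub>R G z" for z
   using GN[of z] K by (cases "z \<in> K") (auto intro!: tendsto_intros)
  show mG: "(%z. indicator K z *\<^sub>R G z) \<in> borel_measurable borel" by (rule borel_measurable_LIMSEQ_metric[OF mF lm])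
  have iK: "intbl (%z. indicator K z * M :: real)"
   using emeasure_compact_finite[OF K(1)] by (intro integrable_mult_left integrable_real_indicator) auto
  show "intbl (%z. indicator K z *\<^sub>R G z)"
  proof (rule bi_integrable_bound[OF iK])
   show "(%z. indicator K z *\<^sub>R G z) \<in> borel_measurable lborel" using mG by simp
   have "norm (indicator K z *\<^sub>R G z) <= norm (indicator K z * M)" for z
    using MN(3)[of z] by (cases "z \<in> K") auto
   thus "AE z in lborel. norm (indicator K z *\<^sub>R G z) <= norm (indicator K z * M)" by (intro AE_I2)
  qed
  fix p :: "complex ^ 'n => complex" assume p: "continuous_on UNIV p" "!!z. z \<notin> K ==> p z = 0"
  obtain b where b: "!!z. norm (p z) <= b" using bounded_compact_support[OF p(1) K(1) p(2)] by blast
  have pe: "p z * X = p z * (indicator K z *\<^sub>R X)" for z X using p(2)[of z] by (cases "z \<in> K") auto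
  have mp: "p \<in> borel_measurable borel" by (rule borel_measurable_continuous_onI[OF p(1)])
  have "(%n. \<integral>z. p z * (indicator K z *\<^sub>R F (r (n + N)) z) \<partial>lborel) \<longlonglongrightarrow> (LBINT z. p z * (indicator K z *\<^sub>R G z))"
  proof (rule integral_dominated_convergence[OF _ _ integrable_mult_right[OF iK, of b]])
   show "(%z. p z * (indicator K z *\<^sub>R G z)) \<in> borel_measurable lborel" using borel_measurable_times[OF mp mG] by simp
   show "(%z. p z * (indicator K z *\<^sub>R F (r (n + N)) z)) \<in> borel_measurable lborel" for n using borel_measurable_times[OF mp mF] by simp
   show "AE z in lborel. (%n. p z * (indicator K z *\<^sub>R F (r (n + N)) z)) \<longlonglongrightarrow> p z * (indicator K z *\<^sub>R G z)"
    by (intro AE_I2 tendsto_mult tendsto_const lm)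
   show "AE z in lborel. norm (p z * (indicator K z *\<^sub>R F (r (n + N)) z)) <= b * (indicator K z * M)" for n
   proof (rule AE_I2)
    fix z
    show "norm (p z * (indicator K z *\<^sub>R F (r (n + N)) z)) <= b * (indicator K z * M)"
    proof (cases "z \<in> K")
     case True
     thus ?thesis using mult_mono[OF b[of z] MN(2)[of "n + N" z]] order_trans[OF norm_ge_zero b[of z]] by (simp add: norm_mult)
    qed simp
   qed
  qed
  hence "(%n. \<integral>z. p z * F (r (n + N)) z \<partial>lborel) \<longlonglongrightarrow> (LBINT z. p z * G z)" by (simp only: pe[symmetric])
  thus "(%n. \<integral>z. p z * F (r n) z \<partial>lborel) \<longlonglongrightarrow> (LBINT z. p z * G z)" by (rule LIMSEQ_offset)
 qed
 have wk: "(LBINT z. G z \<bullet> dv B z) = 0" if B: "tst D B" for B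
 proof -
  obtain K where K: "compact K" "K \<subseteq> D" "!!z. z \<notin> K ==> B z = 0" and B2: "c2 UNIV B" using B by (auto simp: tst_def)
  have dvc: "continuous_on UNIV (%z. cnj (dv B z))" unfolding dv_def by (intro continuous_intros wirt_continuous(1)[OF c2_c1[OF c2_component[OF B2 open_UNIV]]])
  have dv0: "cnj (dv B z) = 0" if "z \<notin> K" for z
   unfolding dv_def using wirt_zero(1)[OF compact_imp_closed[OF K(1)] _ that] K(3) by simp
  obtain N where N: "!!m. m >= N ==> K \<subseteq> Om m" using ev[OF K(1,2)] by blast
  have eqI: "(LBINT z. g z \<bullet> dv B z) = Re (LBINT z. cnj (dv B z) * g z)" if "intbl (%z. indicator K z *\<^sub>R g z)" for g
  proof -
   obtain b where b: "!!z. norm (cnj (dv B z)) <= b" using bounded_compact_support[OF dvc K(1) dv0] by blast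
   have e: "cnj (dv B z) * g z = cnj (dv B z) * (indicator K z *\<^sub>R g z)" for z using dv0[of z] by (cases "z \<in> K") auto
   have "intbl (%z. cnj (dv B z) * (indicator K z *\<^sub>R g z))"
   proof (rule bi_integrable_bound[OF integrable_mult_right[OF integrable_norm[OF that], of b]])
    show "(%z. cnj (dv B z) * (indicator K z *\<^sub>R g z)) \<in> borel_measurable lborel"
     using borel_measurable_times[OF borel_measurable_continuous_onI[OF dvc], of "%z. indicator K z *\<^sub>R g z"] borel_measurable_integrable[OF that] by simp
    have "norm (cnj (dv B z) * (indicator K z *\<^sub>R g z)) <= b * norm (indicator K z *\<^sub>R g z)" for z
     unfolding norm_mult by (intro mult_right_mono b) auto
    thus "AE z in lborel. norm (cnj (dv B z) * (indicator K z *\<^sub>R g z)) <= norm (b * norm (indicator K z *\<^sub>R g z))"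
     by (intro AE_I2) (metis abs_ge_self order_trans real_norm_def)
   qed
   hence "intbl (%z. cnj (dv B z) * g z)" by (simp only: e[symmetric])
   from integral_Re[OF this] show ?thesis by (simp add: inner_complex_cnj mult.commute)
  qed
  have z: "Re (LBINT z. cnj (dv B z) * F (r n) z) = 0" if "n >= N" for n
  proof -
   have KO: "K \<subseteq> Om (r n)" using N[of "r n"] seq_suble[OF r(1), of n] that by simp
   have "tst (Om (r n)) B" unfolding tst_def using B2 K KO by blast
   thus ?thesis using holomorphic_weak[OF hol, of "r n" B] eqI[of "F (r n)"] integrable_on_compact[OF holomorphic_on_Cn_continuous[OF hol] K(1) KO] by simp
  qed
  have "(%n. Re (LBINT z. cnj (dv B z) * F (r n) z)) \<longlonglongrightarrow> Re (LBINT z. cnj (dv B z) * G z)"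
   by (intro tendsto_Re cG[OF K(1,2) dvc dv0])
  moreover have "(%n. Re (LBINT z. cnj (dv B z) * F (r n) z)) \<longlonglongrightarrow> 0"
   by (rule tendsto_eventually) (use z in \<open>auto simp: eventually_sequentially\<close>)
  ultimately have "Re (LBINT z. cnj (dv B z) * G z) = 0" by (rule LIMSEQ_unique)
  thus ?thesis using eqI[OF iG[OF K(1,2)]] by simp
 qed
 obtain F0 where F0: "holomorphic_on_Cn F0 D" "!!z e. e > 0 ==> cball z (2 * e) \<subseteq> D ==> F0 z = conv (moll e) G z"
  using weyl[OF D iG wk] by blast
 \<comment> \<open>\<open>F (r n)\<close> equals its mollification at z for large n. The values
   converge to G z and the mollifications to that of G, which is \<open>F0 z\<close>.\<close>
 have "F0 z = G z" if zD: "z \<in> D" for z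
 proof -
  obtain s where s: "s > 0" "cball z s \<subseteq> D" using zD D unfolding open_contains_cball by blast
  define e where "e = s / 2"
  have e: "e > 0" "cball z (2 * e) \<subseteq> D" "cball z e \<subseteq> D" using s by (auto simp: e_def)
  obtain N where N: "!!m. m >= N ==> cball z e \<subseteq> Om m" using ev[OF compact_cball e(3)] by blast
  let ?p = "%w. complex_of_real (moll e (z - w))"
  have pc: "continuous_on UNIV ?p" by (intro continuous_intros c2_continuous[OF c2_moll_shift])
  have p0: "?p w = 0" if "w \<notin> cball z e" for w using that by (simp add: dist_norm moll_zero[OF e(1)])
  have cF: "conv (moll e) (F (r n)) z = F (r n) z" if "n >= N" for n
  proof -
   have "cball z e \<subseteq> Om (r n)" using N[of "r n"] seq_suble[OF r(1), of n] that by simp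
   from holomorphic_conv[OF hol compact_cball this e(1) order_refl] conv_moll_restrict[OF e(1) order_refl, of z "F (r n)"] show ?thesis by simp
  qed
  have "(%n. conv (moll e) (F (r n)) z) \<longlonglongrightarrow> conv (moll e) G z"
   unfolding conv_def scaleR_conv_of_real by (rule cG[OF compact_cball e(3) pc p0])
  moreover have "(%n. conv (moll e) (F (r n)) z) \<longlonglongrightarrow> G z"
  proof (rule Lim_transform_eventually[OF G[OF zD]])
   show "\<forall>\<^sub>F n in sequentially. F (r n) z = conv (moll e) (F (r n)) z"
    unfolding eventually_sequentially using cF by (intro exI[of _ N]) simp
  qed
  ultimately show ?thesis using F0(2)[OF e(1,2)] LIMSEQ_unique by metis
 qed
 thus ?thesis using that[OF F0(1) r(1)] G by simp
qed

section \<open>Regularisation of plurisubharmonic functions\<close>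

lemma second_order_taylor:
 fixes w :: "'a::euclidean_space => real"
 assumes w: "c2 V w" and V: "open V" "z \<in> V" and \<eta>: "\<eta> > 0"
 shows "\<exists>\<delta>>0. \<forall>h. norm h < \<delta> --> z + h \<in> V \<and> \<bar>w (z + h) - w z - dd w h z - dd (dd w h) h z / 2\<bar> <= \<eta> * (norm h)^2"
proof -
 define \<eta>' where "\<eta>' = \<eta> / real DIM('a)"
 have \<eta>': "\<eta>' > 0" using \<eta> by (simp add: \<eta>'_def)
 obtain r where r: "r > 0" "ball z r \<subseteq> V" using V openE by blast
 have "\<exists>d>0. \<forall>y. norm (y - z) < d --> norm (dd w b y - dd w b z - dd (dd w b) (y - z) z) <= \<eta>' * norm (y - z)" for b
  using c1_has[OF c2_dd[OF w] V(2), of b] \<eta>' unfolding has_derivative_at_alt by blast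
 then obtain d where d: "!!b. d b > 0" "!!b y. norm (y - z) < d b ==> norm (dd w b y - dd w b z - dd (dd w b) (y - z) z) <= \<eta>' * norm (y - z)"
  by metis
 define \<delta> where "\<delta> = min r (Min (d ` Basis))"
 have \<delta>: "\<delta> > 0" "\<delta> <= r" "!!b. b \<in> Basis ==> \<delta> <= d b" unfolding \<delta>_def using r d(1) by (auto simp: min.coboundedI2)
 have "z + h \<in> V \<and> \<bar>w (z + h) - w z - dd w h z - dd (dd w h) h z / 2\<bar> <= \<eta> * (norm h)^2" if h: "norm h < \<delta>" for h
 proof
  have inV: "z + s *\<^sub>R h \<in> V" if "s \<in> {0..1}" for s
  proof -
   have "norm (s *\<^sub>R h) <= 1 * norm h" using that unfolding norm_scaleR by (intro mult_right_mono) auto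
   hence "z + s *\<^sub>R h \<in> ball z r" using h \<delta> by (simp add: dist_norm)
   thus ?thesis using r by blast
  qed
  show "z + h \<in> V" using inV[of 1] by simp
  define Q where "Q = dd (dd w h) h z"
  define \<phi> where "\<phi> s = w (z + s *\<^sub>R h) - s * dd w h z - s\<^sup>2 / 2 * Q" for s
  have w1: "c1 V w" by (rule c2_c1[OF w])
  have ddh: "dd w h y = (\<Sum>b\<in>Basis. (h \<bullet> b) *\<^sub>R dd w b y)" if "y \<in> V" for y by (rule dd_basis[OF w1 that])
  have Qe: "dd (dd w h) k z = (\<Sum>b\<in>Basis. (h \<bullet> b) *\<^sub>R dd (dd w b) k z)" for k
  proof -
   have s1: "c1 V (%y. (h \<bullet> b) *\<^sub>R dd w b y)" for b by (rule c1_scaleR[OF c1_const c2_dd[OF w]])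
   have "dd (dd w h) k z = dd (%y. \<Sum>b\<in>Basis. (h \<bullet> b) *\<^sub>R dd w b y) k z" by (rule dd_cong[OF V(1) ddh V(2)])
   also have "... = (\<Sum>b\<in>Basis. dd (%y. (h \<bullet> b) *\<^sub>R dd w b y) k z)" by (rule dd_sum[of Basis V]) (use s1 V in auto)
   also have "... = (\<Sum>b\<in>Basis. (h \<bullet> b) *\<^sub>R dd (dd w b) k z)" unfolding dd_scaleR[OF c1_const c2_dd[OF w] V(2)] by (simp add: dd_const)
   finally show ?thesis .
  qed
  have D: "(\<phi> has_derivative (%t. t * (dd w h (z + s *\<^sub>R h) - dd w h z - s * Q))) (at s within {0..1})" if "s \<in> {0..1}" for s
  proof -
   have "((%s. z + s *\<^sub>R h) has_derivative (%t. t *\<^sub>R h)) (at s within {0..1})" by (auto intro!: derivative_eq_intros)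
   from has_derivative_compose[OF this c1_has[OF w1 inV[OF that]]]
   have "((%s. w (z + s *\<^sub>R h)) has_derivative (%t. t * dd w h (z + s *\<^sub>R h))) (at s within {0..1})"
    using linear_scale[OF dd_linear_vec[OF w1 inV[OF that]]] by simp
   thus ?thesis unfolding \<phi>_def by (auto intro!: derivative_eq_intros simp: algebra_simps)
  qed
  have "norm (\<phi> 1 - \<phi> 0) <= (\<eta> * (norm h)^2) * norm (1 - 0 :: real)"
  proof (rule differentiable_bound[OF _ D])
   fix s :: real assume s: "s \<in> {0..1}"
   have sh: "norm (s *\<^sub>R h) <= norm h" using s by (simp add: mult_left_le_one_le)
   have "dd w h (z + s *\<^sub>R h) - dd w h z - s * Q = (\<Sum>b\<in>Basis. (h \<bullet> b) * (dd w b (z + s *\<^sub>R h) - dd w b z - dd (dd w b) (s *\<^sub>R h) z))"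
    unfolding ddh[OF inV[OF s]] ddh[OF V(2)] Q_def Qe
    by (simp add: sum_subtractf right_diff_distrib sum_distrib_left linear_scale[OF dd_linear_vec[OF c2_dd[OF w] V(2)]] mult.left_commute)
   also have "\<bar>...\<bar> <= (\<Sum>b\<in>(Basis::'a set). norm h * (\<eta>' * norm h))"
   proof (rule order_trans[OF sum_abs sum_mono])
    fix b :: 'a assume b: "b \<in> Basis"
    have "norm (dd w b (z + s *\<^sub>R h) - dd w b z - dd (dd w b) (s *\<^sub>R h) z) <= \<eta>' * norm (s *\<^sub>R h)"
     using d(2)[of "z + s *\<^sub>R h" b] \<delta>(3)[OF b] h sh by simp
    also have "... <= \<eta>' * norm h" using sh \<eta>' by (intro mult_left_mono) auto
    finally show "\<bar>(h \<bullet> b) * (dd w b (z + s *\<^sub>R h) - dd w b z - dd (dd w b) (s *\<^sub>R h) z)\<bar> <= norm h * (\<eta>' * norm h)"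
     unfolding abs_mult using Basis_le_norm[OF b, of h] by (intro mult_mono) auto
   qed
   also have "... = \<eta> * (norm h)^2" by (simp add: \<eta>'_def power2_eq_square)
   finally have "\<bar>dd w h (z + s *\<^sub>R h) - dd w h z - s * Q\<bar> <= \<eta> * (norm h)^2" .
   thus "onorm (%t. t * (dd w h (z + s *\<^sub>R h) - dd w h z - s * Q)) <= \<eta> * (norm h)^2"
    using onorm_le[of "%t. t * (dd w h (z + s *\<^sub>R h) - dd w h z - s * Q)" "\<eta> * (norm h)^2"] mult_right_mono[of "\<bar>dd w h (z + s *\<^sub>R h) - dd w h z - s * Q\<bar>" "\<eta> * (norm h)^2"]
    by (metis abs_ge_zero abs_mult mult.commute real_norm_def)
  qed auto
  thus "\<bar>w (z + h) - w z - dd w h z - dd (dd w h) h z / 2\<bar> <= \<eta> * (norm h)^2"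
   by (simp add: \<phi>_def Q_def algebra_simps)
 qed
 thus ?thesis using \<delta>(1) by blast
qed

text \<open>Up to the factor 4, the Levi form on b is the Laplacian of w restricted to the complex
  line through z in direction b.\<close>

lemma lev_real_hessian:
 fixes w :: "complex ^ 'n => real"
 assumes w: "c2 V w" and V: "open V" "z \<in> V"
 shows "4 * lev w z b = dd (dd w b) b z + dd (dd w (\<i> *s b)) (\<i> *s b) z"
proof -
 have w1: "c1 V w" by (rule c2_c1[OF w])
 define Q where "Q u v = dd (dd w u) v z" for u v
 have Q2: "linear (%v. Q u v)" for u unfolding Q_def by (rule dd_linear_vec[OF c2_dd[OF w] V(2)])
 have sym: "Q u v = Q v u" for u v unfolding Q_def by (rule dd_symmetric[OF w V])
 have Q1: "linear (%u. Q u v)" for v using Q2[of v] unfolding sym[of _ v] .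
 define E I where "E = (%j. axis j (1::complex) :: complex ^ 'n)" and "I = (%j. axis j \<i> :: complex ^ 'n)"
 have ex: "Q (\<Sum>j\<in>UNIV. x j *\<^sub>R E j + y j *\<^sub>R I j) (\<Sum>k\<in>UNIV. x k *\<^sub>R E k + y k *\<^sub>R I k)
   = (\<Sum>j\<in>UNIV. \<Sum>k\<in>UNIV. x j * x k * Q (E j) (E k) + x j * y k * Q (E j) (I k) + y j * x k * Q (I j) (E k) + y j * y k * Q (I j) (I k))" for x y
  unfolding linear_sum[OF Q1] unfolding linear_sum[OF Q2]
  by (intro sum.cong refl) (simp add: linear_add[OF Q1] linear_add[OF Q2] linear_scale[OF Q1] linear_scale[OF Q2] algebra_simps)
 have b: "b = (\<Sum>j\<in>UNIV. Re (b $ j) *\<^sub>R E j + Im (b $ j) *\<^sub>R I j)" unfolding E_def I_def by (rule vec_axis_decomp)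
 have ib: "\<i> *s b = (\<Sum>j\<in>UNIV. (- Im (b $ j)) *\<^sub>R E j + Re (b $ j) *\<^sub>R I j)" unfolding E_def I_def
  by (subst vec_axis_decomp) simp
 have q: "4 * db k (dz j (cr w)) z = of_real (Q (E j) (E k) + Q (I j) (I k)) + \<i> * of_real (Q (E j) (I k) - Q (I j) (E k))" for j k
 proof -
  have dzj: "dz j (cr w) y = of_real (1/2) * (of_real (dd w (E j) y) - \<i> * of_real (dd w (I j) y))" if "y \<in> V" for y
   unfolding dz_def dd_linear[OF bounded_linear_of_real w1 that] by (simp add: E_def I_def)
  have c: "c1 V (%y. complex_of_real (dd w u y))" for u by (rule c1_cr[OF c2_dd[OF w]])
  have c2: "c1 V (%y. \<i> * complex_of_real (dd w u y))" for u by (rule c1_mult[OF c1_const c])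
  have dc: "dd (%y. complex_of_real (dd w u y)) v z = of_real (Q u v)" for u v
   unfolding Q_def by (rule dd_linear[OF bounded_linear_of_real c2_dd[OF w] V(2)])
  have "dd (dz j (cr w)) v z = dd (%y. of_real (1/2) * (of_real (dd w (E j) y) - \<i> * of_real (dd w (I j) y))) v z" for v
   by (rule dd_cong[OF V(1) dzj V(2)])
  also have "!!v. dd (%y. of_real (1/2) * (of_real (dd w (E j) y) - \<i> * of_real (dd w (I j) y))) v z = of_real (1/2) * (of_real (Q (E j) v) - \<i> * of_real (Q (I j) v))"
   unfolding dd_mult[OF c1_const c1_diff[OF c c2] V(2)] dd_diff[OF c c2 V(2)] dd_mult[OF c1_const c V(2)] dc by (simp add: dd_const)
  finally have dq: "!!v. dd (dz j (cr w)) v z = of_real (1/2) * (of_real (Q (E j) v) - \<i> * of_real (Q (I j) v))" .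
  have EI: "axis k 1 = E k" "axis k \<i> = I k" by (simp_all add: E_def I_def)
  show ?thesis unfolding db_def dq EI by (simp add: algebra_simps)
 qed
 have "4 * lev w z b = Re (\<Sum>j\<in>UNIV. \<Sum>k\<in>UNIV. (4 * db k (dz j (cr w)) z) * b $ j * cnj (b $ k))"
  unfolding lev_def by (simp add: sum_distrib_left mult.assoc)
 also have "... = Q b b + Q (\<i> *s b) (\<i> *s b)"
 proof -
  have Qb: "Q b b = (\<Sum>j\<in>UNIV. \<Sum>k\<in>UNIV. Re (b$j) * Re (b$k) * Q (E j) (E k) + Re (b$j) * Im (b$k) * Q (E j) (I k) + Im (b$j) * Re (b$k) * Q (I j) (E k) + Im (b$j) * Im (b$k) * Q (I j) (I k))"
   using ex[of "%j. Re (b $ j)" "%j. Im (b $ j)"] unfolding b[symmetric] .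
  have Qib: "Q (\<i> *s b) (\<i> *s b) = (\<Sum>j\<in>UNIV. \<Sum>k\<in>UNIV. (- Im (b$j)) * (- Im (b$k)) * Q (E j) (E k) + (- Im (b$j)) * Re (b$k) * Q (E j) (I k) + Re (b$j) * (- Im (b$k)) * Q (I j) (E k) + Re (b$j) * Re (b$k) * Q (I j) (I k))"
   using ex[of "%j. - Im (b $ j)" "%j. Re (b $ j)"] unfolding ib[symmetric] .
  show ?thesis unfolding Qb Qib q Re_sum sum.distrib[symmetric]
   by (intro sum.cong refl) (simp add: algebra_simps)
 qed
 finally show ?thesis by (simp add: Q_def)
qed

text \<open>Over a small circle the linear terms of the expansion average to zero and the quadratic
  ones to a quarter of the Laplacian on the complex line. A negative Laplacian would violate the
  sub-mean inequality.\<close>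

lemma lev_nonneg_of_submean:
 fixes w :: "complex ^ 'n => real"
 assumes w: "c2 V w" and V: "open V" "z \<in> V"
  and sm: "!!b. (!!s. cmod s <= 1 ==> z + s *s b \<in> V) ==> 2 * pi * w z <= (LBINT t. indicator {0..2*pi} t * w (z + cis t *s b))"
 shows "lev w z b >= 0"
proof -
 have w1: "c1 V w" by (rule c2_c1[OF w])
 define S where "S = dd (dd w b) b z + dd (dd w (\<i> *s b)) (\<i> *s b) z"
 have "0 <= S + \<eta> * (4 * (norm b)^2)" if \<eta>: "\<eta> > 0" for \<eta>
 proof -
  obtain \<delta> where \<delta>: "\<delta> > 0" "!!h. norm h < \<delta> ==> z + h \<in> V \<and> \<bar>w (z + h) - w z - dd w h z - dd (dd w h) h z / 2\<bar> <= \<eta> * (norm h)^2"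
   using second_order_taylor[OF w V \<eta>] by blast
  define s where "s = \<delta> / (2 * (norm b + 1))"
  have s: "s > 0" "s * norm b < \<delta>"
  proof -
   have p: "norm b + 1 > 0" by (simp add: add_nonneg_pos)
   show "s > 0" using \<delta>(1) p by (simp add: s_def)
   have "s * norm b <= s * (norm b + 1)" using \<open>s > 0\<close> by simp
   also have "... = \<delta> / 2" using p by (simp add: s_def field_simps)
   finally show "s * norm b < \<delta>" using \<delta>(1) by linarith
  qed
  define B where "B = s *\<^sub>R b"
  have nB: "norm (c *s B) = cmod c * (s * norm b)" for c using s by (simp add: norm_smult B_def)
  have nb: "norm (c *s B) < \<delta>" if "cmod c <= 1" for c
  proof -
   have "cmod c * (s * norm b) <= 1 * (s * norm b)" using that s by (intro mult_right_mono) auto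
   thus ?thesis unfolding nB using s(2) by linarith
  qed
  define a1 a2 q11 q12 q22 where "a1 = dd w B z" and "a2 = dd w (\<i> *s B) z" and "q11 = dd (dd w B) B z"
   and "q12 = dd (dd w B) (\<i> *s B) z" and "q22 = dd (dd w (\<i> *s B)) (\<i> *s B) z"
  have lin2: "linear (%v. dd (dd w u) v z)" for u by (rule dd_linear_vec[OF c2_dd[OF w] V(2)])
  have sym: "dd (dd w u) v z = dd (dd w v) u z" for u v by (rule dd_symmetric[OF w V])
  have ct: "cis t *s B = cos t *\<^sub>R B + sin t *\<^sub>R (\<i> *s B)" for t
   by (simp add: vec_eq_iff complex_eq_iff algebra_simps)
  have d1: "dd w (cis t *s B) z = cos t * a1 + sin t * a2" for t
   unfolding ct a1_def a2_def by (simp add: linear_add[OF dd_linear_vec[OF w1 V(2)]] linear_scale[OF dd_linear_vec[OF w1 V(2)]])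
  have d2: "dd (dd w (cis t *s B)) (cis t *s B) z = (cos t)^2 * q11 + 2 * (sin t * cos t) * q12 + (sin t)^2 * q22" for t
  proof -
   have "dd (dd w (cis t *s B)) v z = cos t * dd (dd w B) v z + sin t * dd (dd w (\<i> *s B)) v z" for v
    unfolding sym[of "cis t *s B" v] sym[of B v] sym[of "\<i> *s B" v] unfolding ct by (simp add: linear_add[OF lin2] linear_scale[OF lin2])
   moreover have "dd (dd w u) (cis t *s B) z = cos t * dd (dd w u) B z + sin t * dd (dd w u) (\<i> *s B) z" for u
    unfolding ct by (simp add: linear_add[OF lin2] linear_scale[OF lin2])
   ultimately show ?thesis using sym[of "\<i> *s B" B] by (simp add: q11_def q12_def q22_def power2_eq_square algebra_simps)
  qed
  \<comment> \<open>T majorises w on the circle by its expansion written in the angle t, and P is an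
    antiderivative of T, so that the average is evaluated by the fundamental theorem.\<close>
  define T where "T t = w z + (cos t * a1 + sin t * a2) + ((cos t)^2 * q11 + 2 * (sin t * cos t) * q12 + (sin t)^2 * q22) / 2 + \<eta> * (s * norm b)^2" for t
  define P where "P t = w z * t + (sin t * a1 - cos t * a2) + ((t + sin t * cos t) / 2 * q11 + (sin t)^2 * q12 + (t - sin t * cos t) / 2 * q22) / 2 + \<eta> * (s * norm b)^2 * t" for t
  have dP: "(P has_real_derivative T t) (at t)" for t
  proof -
   have c: "(cos t)^2 = 1 - (sin t)^2" by (simp add: cos_squared_eq)
   show ?thesis unfolding P_def T_def
    by (rule derivative_eq_intros refl | simp)+ (simp add: power2_eq_square[of "cos t", symmetric] power2_eq_square[of "sin t", symmetric] c field_simps)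
  qed
  have "intbl (%t. indicator {0..2*pi} t *\<^sub>R T t)"
   by (rule borel_integrable_compact) (auto simp: T_def intro!: continuous_intros)
  hence iT: "intbl (%t. indicator {0..2*pi} t * T t)" by simp
  have IT: "(LBINT t. indicator {0..2*pi} t * T t) = P (2*pi) - P 0"
   using integral_FTC_Icc_real[of 0 "2*pi" P T] dP by (simp add: T_def[abs_def] mult.commute)
  have inV: "z + c *s B \<in> V" if "cmod c <= 1" for c using \<delta>(2)[OF nb[OF that]] by blast
  have "continuous_on {0..2*pi} (%t. w (z + cis t *s B))"
  proof (rule continuous_on_compose2[OF c2_continuous[OF w]])
   show "continuous_on {0..2*pi} (%t. z + cis t *s B)" unfolding ct by (intro continuous_intros)
   show "(%t. z + cis t *s B) ` {0..2*pi} \<subseteq> V" using inV by auto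
  qed
  hence "intbl (%t. indicator {0..2*pi} t *\<^sub>R w (z + cis t *s B))" by (intro borel_integrable_compact) auto
  hence iw: "intbl (%t. indicator {0..2*pi} t * w (z + cis t *s B))" by simp
  have "2 * pi * w z <= (LBINT t. indicator {0..2*pi} t * w (z + cis t *s B))" by (rule sm[OF inV])
  also have "... <= (LBINT t. indicator {0..2*pi} t * T t)"
  proof (rule integral_mono[OF iw iT])
   fix t
   have "w (z + cis t *s B) <= w z + dd w (cis t *s B) z + dd (dd w (cis t *s B)) (cis t *s B) z / 2 + \<eta> * (norm (cis t *s B))^2"
    using conjunct2[OF \<delta>(2)[OF nb[of "cis t"]]] by simp
   hence "w (z + cis t *s B) <= T t" unfolding T_def d1 d2 nB by simp
   thus "indicator {0..2*pi} t * w (z + cis t *s B) <= indicator {0..2*pi} t * T t" by (auto simp: indicator_def)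
  qed
  also have "... = 2 * pi * w z + pi / 2 * (q11 + q22) + 2 * pi * (\<eta> * (s * norm b)^2)" unfolding IT P_def by (simp add: field_simps)
  finally have "0 <= pi / 2 * (q11 + q22) + 2 * pi * (\<eta> * (s * norm b)^2)" by linarith
  also have "... = pi / 2 * (q11 + q22 + \<eta> * (4 * (s * norm b)^2))" by (simp add: distrib_left)
  finally have "0 <= pi / 2 * (q11 + q22 + \<eta> * (4 * (s * norm b)^2))" .
  hence "0 <= q11 + q22 + \<eta> * (4 * (s * norm b)^2)" using pi_gt_zero by (simp add: zero_le_mult_iff)
  moreover have "q11 = s\<^sup>2 * dd (dd w b) b z" "q22 = s\<^sup>2 * dd (dd w (\<i> *s b)) (\<i> *s b) z"
  proof -
   have iB: "\<i> *s B = s *\<^sub>R (\<i> *s b)" by (simp add: B_def vec_eq_iff)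
   have "dd (dd w (s *\<^sub>R u)) (s *\<^sub>R u) z = s\<^sup>2 * dd (dd w u) u z" for u
    unfolding linear_scale[OF lin2] sym[of "s *\<^sub>R u" u] by (simp add: linear_scale[OF lin2] power2_eq_square)
   thus "q11 = s\<^sup>2 * dd (dd w b) b z" "q22 = s\<^sup>2 * dd (dd w (\<i> *s b)) (\<i> *s b) z" unfolding q11_def q22_def iB by (simp_all add: B_def)
  qed
  ultimately have "0 <= s\<^sup>2 * (S + \<eta> * (4 * (norm b)^2))" by (simp add: S_def power_mult_distrib algebra_simps)
  thus ?thesis using s by (simp add: zero_le_mult_iff)
 qed
 hence *: "!!\<eta>. \<eta> > 0 ==> - S <= \<eta> * (4 * (norm b)^2)" by force
 have "- S <= 0"
 proof (rule field_le_epsilon)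
  fix e :: real assume e: "e > 0"
  have p: "4 * (norm b)^2 + 1 > 0" by (simp add: add_nonneg_pos)
  have "- S <= (e / (4 * (norm b)^2 + 1)) * (4 * (norm b)^2)" by (rule *) (use e p in simp)
  also have "... <= e" using e p by (simp add: field_simps)
  finally show "- S <= 0 + e" by simp
 qed
 thus ?thesis using lev_real_hessian[OF w V, of b] by (simp add: S_def)
qed

text \<open>What remains of plurisubharmonicity after truncation from below: the values are real and
  bounded below, so circle means are ordinary integrals. Upper semicontinuity is encoded by open
  sublevel sets.\<close>

definition submean :: "(complex ^ 'n) set => (complex ^ 'n => real) => bool" where
 "submean D v \<longleftrightarrow> open D \<and> (\<forall>c. open {z\<in>D. v z < c}) \<and> (\<exists>c. \<forall>z\<in>D. v z >= c) \<and>
   (\<forall>a b. (\<forall>s. cmod s <= 1 --> a + s *s b \<in> D) --> 2 * pi * v a <= (LBINT t. indicator {0..2*pi} t * v (a + cis t *s b)))"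

text \<open>The open sublevel sets at integer heights cover K, so finitely many of them do.\<close>

lemma usc_bounded:
 assumes "!!c. open {z\<in>D. v z < (c::real)}" "!!z. z \<in> D ==> v z >= c" "compact K" "K \<subseteq> D"
 shows "\<exists>B. \<forall>z\<in>K. \<bar>v z\<bar> <= B"
proof -
 have "K \<subseteq> (\<Union>n::nat. {z\<in>D. v z < real n})" using assms(4) reals_Archimedean2 by blast
 then obtain I where I: "finite I" "K \<subseteq> (\<Union>n\<in>I. {z\<in>D. v z < real n})"
  using compactE_image[OF assms(3), of UNIV "%n::nat. {z\<in>D. v z < real n}"] assms(1) by (metis UNIV_I)
 have "\<bar>v z\<bar> <= max \<bar>c\<bar> (real (\<Sum>I))" if z: "z \<in> K" for z
 proof -
  obtain n where n: "n \<in> I" "v z < real n" using I z by blast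
  have "n <= \<Sum>I" using member_le_sum[of n I "%x. x"] n I by simp
  hence "v z <= real (\<Sum>I)" using n(2) by linarith
  moreover have "v z >= c" using assms(2,4) z by blast
  ultimately show ?thesis by linarith
 qed
 thus ?thesis by blast
qed

lemma usc_measurable:
 assumes "!!c. open {z\<in>D. v z < (c::real)}" "K \<in> sets borel" "K \<subseteq> D"
 shows "(%z. indicator K z * v z) \<in> borel_measurable borel"
 unfolding borel_measurable_iff_less
proof
 fix c :: real
 have "{w \<in> space borel. indicator K w * v w < c} = (K \<inter> {z\<in>D. v z < c}) \<union> (if 0 < c then - K else {})"
  using assms(3) by (auto simp: indicator_def split: if_splits)
 also have "... \<in> sets borel" using assms by auto
 finally show "{w \<in> space borel. indicator K w * v w < c} \<in> sets borel" .
qed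

lemma integrable_bounded_ind:
 fixes f :: "'a::euclidean_space => real"
 assumes "(%z. indicator K z * f z) \<in> borel_measurable borel" "compact K" "!!z. z \<in> K ==> \<bar>f z\<bar> <= B"
 shows "intbl (%z. indicator K z * f z)"
proof (rule bi_integrable_bound[where f="%z. indicator K z * B"])
 show "intbl (%z. indicator K z * B)"
  using assms(2) emeasure_compact_finite[OF assms(2)] compact_imp_closed[OF assms(2)] by (intro integrable_mult_left integrable_real_indicator) auto
 show "AE x in lborel. norm (indicator K x * f x) <= norm (indicator K x * B)"
  using assms(3) by (intro AE_I2) (force simp: indicator_def)
qed (use assms in simp)

text \<open>The mean in \<open>psh_on\<close> is a difference of two extended integrals. As
  \<open>u \<le> v / p\<close>, the positive part of u is below that of \<open>v / p\<close> and the
  negative part above; the parts of \<open>v / p\<close> have finite integrals. So the extended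
  difference is at most the ordinary mean of \<open>v / p\<close>. The other argument of the
  maximum, N, lies below every value of v.\<close>

lemma submean_of_psh:
 fixes u :: "complex ^ 'n => ereal"
 assumes psh: "psh_on D u" and p: "p > 0"
 shows "submean D (%z. real_of_ereal (max (ereal p * u z) (ereal N)))"
proof -
 define v where "v z = real_of_ereal (max (ereal p * u z) (ereal N))" for z
 have D: "open D" and fin: "!!z. z \<in> D ==> u z \<noteq> \<infinity>" using psh by (auto simp: psh_on_def)
 have ve: "ereal (v z) = max (ereal p * u z) (ereal N)" if "z \<in> D" for z
  using fin[OF that] p unfolding v_def by (cases "u z") (auto simp: max_def)
 have vN: "v z >= N" if "z \<in> D" for z using ve[OF that] by (metis ereal_less_eq(3) max.cobounded2)
 have uv: "u z <= ereal (v z / p)" if "z \<in> D" for z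
 proof (cases "u z")
  case (real r)
  have "ereal (p * r) <= ereal (v z)" unfolding ve[OF that] real by simp
  thus ?thesis using p real by (simp add: field_simps)
 qed (use fin[OF that] in auto)
 have vlt: "v z < c \<longleftrightarrow> N < c \<and> u z < ereal (c / p)" if "z \<in> D" for z c
 proof -
  have "v z < c \<longleftrightarrow> max (ereal p * u z) (ereal N) < ereal c" unfolding ve[OF that, symmetric] by simp
  also have "... \<longleftrightarrow> N < c \<and> u z < ereal (c / p)" using fin[OF that] p by (cases "u z") (auto simp: field_simps)
  finally show ?thesis .
 qed
 have usc: "open {z\<in>D. v z < c}" for c
 proof (cases "N < c")
  case True
  have "open {z\<in>D. u z < ereal (c / p)}"
  proof (rule openI)
   fix z assume z: "z \<in> {z\<in>D. u z < ereal (c / p)}"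
   hence "\<forall>\<^sub>F w in at z. u w < ereal (c / p)" using psh by (auto simp: psh_on_def)
   hence "\<forall>\<^sub>F w in nhds z. u w < ereal (c / p)" using z by (auto simp: eventually_nhds_conv_at)
   moreover have "\<forall>\<^sub>F w in nhds z. w \<in> D" using z D eventually_nhds by auto
   ultimately have "\<forall>\<^sub>F w in nhds z. w \<in> {z\<in>D. u z < ereal (c / p)}" by eventually_elim auto
   thus "\<exists>e>0. ball z e \<subseteq> {z\<in>D. u z < ereal (c / p)}"
    unfolding eventually_nhds_metric by (auto simp: subset_iff dist_commute)
  qed
  moreover have "{z\<in>D. v z < c} = {z\<in>D. u z < ereal (c / p)}" using vlt True by auto
  ultimately show ?thesis by simp
 next
  case False
  hence "{z\<in>D. v z < c} = {}" using vlt by auto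
  thus ?thesis by (simp only: open_empty)
 qed
 have sub: "2 * pi * v a <= (LBINT t. indicator {0..2*pi} t * v (a + cis t *s b))" if d: "\<forall>s. cmod s <= 1 --> a + s *s b \<in> D" for a b
 proof -
  let ?I = "indicator {0..2*pi} :: real => real"
  have cD: "a + cis t *s b \<in> D" for t using d by simp
  have aD: "a \<in> D" using d[rule_format, of 0] by simp
  have ci: "continuous_on UNIV (%t. a + cis t *s b)"
  proof -
   have "cis t *s b = cos t *\<^sub>R b + sin t *\<^sub>R (\<i> *s b)" for t by (simp add: vec_eq_iff complex_eq_iff algebra_simps)
   thus ?thesis by (simp, intro continuous_intros)
  qed
  have "(%t. a + cis t *s b) ` {0..2*pi} \<subseteq> D" using cD by auto
  moreover have "compact ((%t. a + cis t *s b) ` {0..2*pi})" by (rule compact_continuous_image[OF continuous_on_subset[OF ci] compact_Icc]) simp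
  ultimately obtain B where B: "\<forall>z\<in>(%t. a + cis t *s b) ` {0..2*pi}. \<bar>v z\<bar> <= B" using usc_bounded[OF usc vN] by blast
  have "(%t. indicator UNIV t * v (a + cis t *s b)) \<in> borel_measurable borel"
  proof (rule usc_measurable[where D=UNIV])
   fix c :: real
   have "{t \<in> UNIV. v (a + cis t *s b) < c} = (%t. a + cis t *s b) -` {z\<in>D. v z < c}" using cD by auto
   thus "open {t \<in> UNIV. v (a + cis t *s b) < c}" using open_vimage[OF usc ci, of c] by (simp add: continuous_on_eq_continuous_at)
  qed auto
  hence mv[measurable]: "(%t. v (a + cis t *s b)) \<in> borel_measurable borel" by simp
  have iv: "intbl (%t. ?I t * v (a + cis t *s b))" by (rule integrable_bounded_ind[where B=B]) (use B in auto)
  define J where "J = (LBINT t. ?I t * v (a + cis t *s b))"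
  have i1: "intbl (%t. ?I t * max 0 (v (a + cis t *s b) / p))" "intbl (%t. ?I t * max 0 (- (v (a + cis t *s b) / p)))"
  proof -
   have b: "\<bar>max 0 (c / p)\<bar> <= B / p" if "\<bar>c\<bar> <= B" for c
   proof -
    have "\<bar>c / p\<bar> <= B / p" using that p by (simp add: abs_divide divide_right_mono)
    thus ?thesis by linarith
   qed
   show "intbl (%t. ?I t * max 0 (v (a + cis t *s b) / p))" by (rule integrable_bounded_ind[OF _ _ b]) (use B in auto)
   show "intbl (%t. ?I t * max 0 (- (v (a + cis t *s b) / p)))"
    unfolding minus_divide_left by (rule integrable_bounded_ind[OF _ _ b]) (use B in auto)
  qed
  have P: "(NNL t. indicator {0..2*pi} t * e2ennreal (max 0 (u (a + cis t *s b)))) <= ennreal (LBINT t. ?I t * max 0 (v (a + cis t *s b) / p))"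
   unfolding nn_integral_eq_integral[OF i1(1) AE_I2, simplified, symmetric]
  proof (rule nn_integral_mono)
   fix t
   have "max 0 (u (a + cis t *s b)) <= max 0 (ereal (v (a + cis t *s b) / p))" by (rule max.mono[OF order_refl uv[OF cD]])
   hence "max 0 (u (a + cis t *s b)) <= ereal (max 0 (v (a + cis t *s b) / p))" by (simp add: ereal_max[symmetric] zero_ereal_def del: ereal_max)
   hence "e2ennreal (max 0 (u (a + cis t *s b))) <= ennreal (max 0 (v (a + cis t *s b) / p))"
    unfolding ennreal.abs_eq[symmetric] using e2ennreal_mono by (metis e2ennreal_ereal)
   thus "indicator {0..2*pi} t * e2ennreal (max 0 (u (a + cis t *s b))) <= ennreal (?I t * max 0 (v (a + cis t *s b) / p))"
    by (auto simp: indicator_def)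
  qed
  have Q: "ennreal (LBINT t. ?I t * max 0 (- (v (a + cis t *s b) / p))) <= (NNL t. indicator {0..2*pi} t * e2ennreal (max 0 (- u (a + cis t *s b))))"
   unfolding nn_integral_eq_integral[OF i1(2) AE_I2, simplified, symmetric]
  proof (rule nn_integral_mono)
   fix t
   have "- ereal (v (a + cis t *s b) / p) <= - u (a + cis t *s b)" using uv[OF cD] by (simp only: ereal_minus_le_minus)
   hence "ereal (max 0 (- (v (a + cis t *s b) / p))) <= max 0 (- u (a + cis t *s b))" by (cases "u (a + cis t *s b)") (auto simp: max_def zero_ereal_def)
   hence "ennreal (max 0 (- (v (a + cis t *s b) / p))) <= e2ennreal (max 0 (- u (a + cis t *s b)))"
    using e2ennreal_mono by (metis e2ennreal_ereal)
   thus "ennreal (?I t * max 0 (- (v (a + cis t *s b) / p))) <= indicator {0..2*pi} t * e2ennreal (max 0 (- u (a + cis t *s b)))"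
    by (auto simp: indicator_def)
  qed
  define p1 p2 where "p1 = (LBINT t. ?I t * max 0 (v (a + cis t *s b) / p))" and "p2 = (LBINT t. ?I t * max 0 (- (v (a + cis t *s b) / p)))"
  have p0: "p1 >= 0" "p2 >= 0" unfolding p1_def p2_def by (auto intro!: bi_integral_nonneg)
  have "p1 - p2 = (LBINT t. ?I t * max 0 (v (a + cis t *s b) / p) - ?I t * max 0 (- (v (a + cis t *s b) / p)))"
   unfolding p1_def p2_def using i1 by simp
  also have "... = (LBINT t. (?I t * v (a + cis t *s b)) / p)"
   by (intro bi_integral_cong refl) (auto simp: max_def indicator_def)
  finally have pp: "p1 - p2 = J / p" by (simp add: J_def)
  have "u a <= circle_mean u a b" using psh d by (auto simp: psh_on_def)
  also have "... <= (enn2ereal (ennreal p1) - enn2ereal (ennreal p2)) / ereal (2 * pi)"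
   unfolding circle_mean_def by (intro ereal_divide_right_mono ereal_minus_mono) (use P Q in \<open>simp_all add: p1_def p2_def less_eq_ennreal.rep_eq\<close>)
  also have "... = ereal (J / p / (2 * pi))" using p0 pp by (simp add: enn2ereal_ennreal)
  finally have 1: "u a <= ereal (J / p / (2 * pi))" .
  have "2 * pi * N = (LBINT t. ?I t * N)" by simp
  also have "... <= J" unfolding J_def
  proof (rule integral_mono[OF _ iv])
   show "intbl (%t. ?I t * N)" by (intro integrable_mult_left integrable_real_indicator) auto
   show "!!t. ?I t * N <= ?I t * v (a + cis t *s b)" using vN[OF cD] by (auto simp: indicator_def)
  qed
  finally have 2: "N <= J / (2 * pi)" by (simp add: field_simps)
  have "max (ereal p * u a) (ereal N) <= ereal (J / (2 * pi))"
   using 1 2 p fin[OF aD] by (cases "u a") (auto simp: field_simps)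
  hence "v a <= J / (2 * pi)" unfolding ve[OF aD, symmetric] by simp
  thus ?thesis by (simp add: J_def field_simps)
 qed
 show ?thesis unfolding submean_def v_def[symmetric] using D usc vN sub by blast
qed

text \<open>The indicator of K makes the convolution global; over V the balls of radius e stay in K,
  so it is not felt there. Averaging the circle inequalities over the radial kernel shows that the
  convolution dominates v, and exchanging the circle mean with the convolution gives the nonnegative
  Levi form.\<close>

lemma submean_regularize:
 fixes v :: "complex ^ 'n => real"
 assumes sm: "submean D v" and K: "compact K" "K \<subseteq> D" and e: "e > 0" and V: "open V" "!!z. z \<in> V ==> cball z e \<subseteq> K"
 defines "F \<equiv> %z. indicator K z * v z"
 shows "c2 UNIV (conv (moll e) F)" "!!z. z \<in> V ==> v z <= conv (moll e) F z" "!!z b. z \<in> V ==> lev (conv (moll e) F) z b >= 0"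
  "!!z M. z \<in> V ==> (!!w. dist z w < e ==> v w <= M) ==> conv (moll e) F z <= M"
proof -
 have usc: "!!c. open {z\<in>D. v z < c}" and sub: "!!a b. (!!s. cmod s <= 1 ==> a + s *s b \<in> D) ==> 2 * pi * v a <= (LBINT t. indicator {0..2*pi} t * v (a + cis t *s b))"
  using sm by (auto simp: submean_def)
 obtain c where c: "!!z. z \<in> D ==> v z >= c" using sm unfolding submean_def by blast
 obtain B where B: "!!z. z \<in> K ==> \<bar>v z\<bar> <= B" using usc_bounded[OF usc c K] by blast
 have mF: "F \<in> borel_measurable borel" unfolding F_def by (rule usc_measurable[OF usc borel_closed[OF compact_imp_closed[OF K(1)]] K(2)])
 have iF: "intbl F" unfolding F_def by (rule integrable_bounded_ind[OF mF[unfolded F_def] K(1) B])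
 show "c2 UNIV (conv (moll e) F)" by (rule c2_conv_moll[OF e iF])
 have FK: "F z = v z" if "z \<in> K" for z using that by (simp add: F_def)
 have cs: "conv (moll e) F y = (LBINT x. moll e x * F (y + x))" "intbl (%x. moll e x * F (y + x))" for y
  using conv_moll_shifted[OF e iF, of y] by simp_all
 have bK: "z + w \<in> K" if "z \<in> V" "norm w < e" for z w using V(2)[OF that(1)] that(2) by (auto simp: subset_iff dist_norm)
 show "v z <= conv (moll e) F z" if z: "z \<in> V" for z
 proof -
  note av = conv_moll_average[OF e iF, of z, simplified]
  have "2 * pi * v z = (LBINT w. moll e (w::complex ^ 'n) * (2 * pi * v z))"
   using moll_integral[OF e, where 'a="complex ^ 'n"] by simp
  also have "... <= (LBINT w. moll e w * (LBINT t. indicator {0..2*pi} t * F (z + cis t *s w)))"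
  proof (rule integral_mono[OF _ av(1)])
   show "intbl (%w::complex ^ 'n. moll e w * (2 * pi * v z))" by (intro integrable_mult_left moll_integrable e)
   fix w :: "complex ^ 'n"
   show "moll e w * (2 * pi * v z) <= moll e w * (LBINT t. indicator {0..2*pi} t * F (z + cis t *s w))"
   proof (cases "norm w < e")
    case True
    have in': "z + s *s w \<in> K" if "cmod s <= 1" for s
    proof -
     have "cmod s * norm w <= 1 * norm w" using that by (intro mult_right_mono) auto
     thus ?thesis using True by (intro bK[OF z]) (simp add: norm_smult)
    qed
    have "2 * pi * v z <= (LBINT t. indicator {0..2*pi} t * v (z + cis t *s w))" by (rule sub) (use in' K in blast)
    also have "... = (LBINT t. indicator {0..2*pi} t * F (z + cis t *s w))" using FK[OF in'] by simp
    finally show ?thesis using moll_nonneg[OF e, of w] by (intro mult_left_mono)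
   qed (use moll_zero[OF e, of w] in auto)
  qed
  also have "... = 2 * pi * conv (moll e) F z" using av(2) by simp
  finally show ?thesis by simp
 qed
 show "lev (conv (moll e) F) z b >= 0" if z: "z \<in> V" for z b
 proof (rule lev_nonneg_of_submean[OF c2_subset[OF c2_conv_moll[OF e iF] subset_UNIV] V(1) z])
  fix b :: "complex ^ 'n" assume d: "!!s. cmod s <= 1 ==> z + s *s b \<in> V"
  let ?I = "indicator {0..2*pi} :: real => real"
  let ?h = "%(t, x). ?I t * (moll e x * F ((z + cis t *s b) + x))"
  have mp: "(%p :: real \<times> (complex ^ 'n). (z + cis (fst p) *s b) + snd p) \<in> borel_measurable (borel \<Otimes>\<^sub>M borel)"
   unfolding borel_prod
  proof (rule borel_measurable_continuous_onI)
   have "cis t *s b = cos t *\<^sub>R b + sin t *\<^sub>R (\<i> *s b)" for t by (simp add: vec_eq_iff complex_eq_iff algebra_simps)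
   thus "continuous_on UNIV (%p :: real \<times> (complex ^ 'n). (z + cis (fst p) *s b) + snd p)" by (simp, intro continuous_intros)
  qed
  have mh: "?h \<in> borel_measurable (lborel \<Otimes>\<^sub>M lborel)"
  proof -
   have "(%p. ?I (fst p) * (moll e (snd p) * F ((z + cis (fst p) *s b) + snd p))) \<in> borel_measurable (borel \<Otimes>\<^sub>M borel)"
    using measurable_compose[OF mp mF] by measurable
   thus ?thesis by (simp add: case_prod_unfold cong: measurable_cong_sets[OF sets_pair_measure_cong[OF sets_lborel sets_lborel] refl])
  qed
  have B0: "\<bar>F y\<bar> <= \<bar>B\<bar>" for y using B[of y] by (auto simp: F_def indicator_def)
  have ih: "integrable (lborel \<Otimes>\<^sub>M lborel) ?h"
  proof (rule bi_integrable_bound[OF _ mh])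
   show "integrable (lborel \<Otimes>\<^sub>M lborel) (%(t::real, x::complex ^ 'n). ?I t *\<^sub>R (moll e x * \<bar>B\<bar>))"
   proof (rule lborel_pair.Fubini_integrable)
    have "(%p. ?I (fst p) * (moll e (snd p :: complex ^ 'n) * \<bar>B\<bar>)) \<in> borel_measurable (borel \<Otimes>\<^sub>M borel)" by measurable
    thus "(%(t::real, x::complex ^ 'n). ?I t *\<^sub>R (moll e x * \<bar>B\<bar>)) \<in> borel_measurable (lborel \<Otimes>\<^sub>M lborel)"
     by (simp add: case_prod_unfold cong: measurable_cong_sets[OF sets_pair_measure_cong[OF sets_lborel sets_lborel] refl])
    have "(LBINT y. norm (case (x, y) of (t, x :: complex ^ 'n) => ?I t *\<^sub>R (moll e x * \<bar>B\<bar>))) = ?I x * \<bar>B\<bar>" for x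
     using moll_nonneg[OF e, where 'a="complex ^ 'n"] moll_integral[OF e, where 'a="complex ^ 'n"] by (simp add: abs_mult)
    thus "intbl (%x. \<integral>y. norm (case (x, y) of (t, x :: complex ^ 'n) => ?I t *\<^sub>R (moll e x * \<bar>B\<bar>)) \<partial>lborel)"
     by simp
    show "AE x in lborel. intbl (%y. case (x, y) of (t, x :: complex ^ 'n) => ?I t *\<^sub>R (moll e x * \<bar>B\<bar>))"
     using moll_integrable[OF e, where 'a="complex ^ 'n"] by simp
   qed
   have "\<bar>?I t * (moll e x * F ((z + cis t *s b) + x))\<bar> <= \<bar>?I t * (moll e x * \<bar>B\<bar>)\<bar>" for t x
    unfolding abs_mult using B0 by (intro mult_left_mono) auto
   thus "AE x in lborel \<Otimes>\<^sub>M lborel. norm (?h x) <= norm (case x of (t, x) => ?I t *\<^sub>R (moll e x * \<bar>B\<bar>))" by (intro AE_I2) auto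
  qed
  have "2 * pi * conv (moll e) F z = (LBINT x. moll e x * (2 * pi * F (z + x)))"
   unfolding cs(1) by (simp add: mult.left_commute flip: integral_mult_right_zero)
  also have "... <= (LBINT x. (LBINT t. ?I t * (moll e x * F ((z + cis t *s b) + x))))"
  proof (rule integral_mono)
   show "intbl (%x. moll e x * (2 * pi * F (z + x)))" using integrable_mult_right[OF cs(2)[of z], of "2*pi"] by (simp add: mult.left_commute)
   show "intbl (%x. \<integral>t. ?I t * (moll e x * F ((z + cis t *s b) + x)) \<partial>lborel)"
    using lborel_pair.integrable_snd[OF ih] by simp
   fix x :: "complex ^ 'n"
   show "moll e x * (2 * pi * F (z + x)) <= (LBINT t. ?I t * (moll e x * F ((z + cis t *s b) + x)))"
   proof (cases "norm x < e")
    case True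
    have in': "(z + x) + s *s b \<in> K" if "cmod s <= 1" for s using bK[OF d[OF that] True] by (simp add: algebra_simps)
    have "2 * pi * F (z + x) = 2 * pi * v (z + x)" using FK[OF bK[OF z True]] by simp
    also have "... <= (LBINT t. ?I t * v ((z + x) + cis t *s b))" by (rule sub) (use in' K in blast)
    also have "... = (LBINT t. ?I t * F ((z + x) + cis t *s b))" using FK[OF in'] by simp
    finally have "moll e x * (2 * pi * F (z + x)) <= moll e x * (LBINT t. ?I t * F ((z + x) + cis t *s b))"
     using moll_nonneg[OF e, of x] by (intro mult_left_mono)
    also have "... = (LBINT t. ?I t * (moll e x * F ((z + cis t *s b) + x)))"
     by (simp add: mult.left_commute algebra_simps flip: integral_mult_right_zero)
    finally show ?thesis .
   qed (use moll_zero[OF e, of x] in auto)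
  qed
  also have "... = (LBINT t. (LBINT x. ?I t * (moll e x * F ((z + cis t *s b) + x))))"
   using lborel_pair.Fubini_integral[OF ih] by simp
  also have "... = (LBINT t. ?I t * conv (moll e) F (z + cis t *s b))" unfolding cs(1) by simp
  finally show "2 * pi * conv (moll e) F z <= (LBINT t. ?I t * conv (moll e) F (z + cis t *s b))" .
 qed
 show "conv (moll e) F z <= M" if z: "z \<in> V" and M: "!!w. dist z w < e ==> v w <= M" for z M
 proof -
  have "conv (moll e) F z <= (LBINT x. moll e (x::complex ^ 'n) * M)" unfolding cs(1)
  proof (rule integral_mono[OF cs(2)])
   show "intbl (%x::complex ^ 'n. moll e x * M)" by (intro integrable_mult_left moll_integrable e)
   fix x :: "complex ^ 'n"
   show "moll e x * F (z + x) <= moll e x * M"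
   proof (cases "norm x < e")
    case True
    hence "F (z + x) <= M" using FK[OF bK[OF z True]] M[of "z + x"] by (simp add: dist_norm)
    thus ?thesis using moll_nonneg[OF e, of x] by (intro mult_left_mono)
   qed (use moll_zero[OF e, of x] in auto)
  qed
  also have "... = M" using moll_integral[OF e, where 'a="complex ^ 'n"] by simp
  finally show ?thesis .
 qed
qed

section \<open>The weights\<close>

text \<open>Derivatives are two-sided at both ends of [0,1]. The power \<open>x^a\<close> itself
  fails this at 0, hence the shift in its later instance. Strict concavity makes b positive and
  increasing in the weak sense; the sign of \<open>l3\<close> bounds q by 1/2.\<close>

locale profile =
 fixes l l1 l2 l3 :: "real => real"
 assumes d1: "!!x. 0 <= x ==> x <= 1 ==> (l has_real_derivative l1 x) (at x)"
  and d2: "!!x. 0 <= x ==> x <= 1 ==> (l1 has_real_derivative l2 x) (at x)"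
  and d3: "!!x. 0 <= x ==> x <= 1 ==> (l2 has_real_derivative l3 x) (at x)"
  and l01: "l 0 = 0" "l 1 = 1"
  and l1_pos: "!!x. 0 <= x ==> x <= 1 ==> l1 x > 0"
  and l2_neg: "!!x. 0 <= x ==> x <= 1 ==> l2 x < 0"
  and l3_nonneg: "!!x. 0 <= x ==> x <= 1 ==> l3 x >= 0"
begin

definition G where "G x = l x - x"

section \<open>Convexity properties of the profile\<close>

lemma taylor_at_1: assumes "0 <= x" "x < 1"
 shows "\<exists>t. 0 <= t \<and> t <= 1 \<and> 1 = l x + l1 x * (1 - x) + l2 t / 2 * (1 - x)^2"
  "\<exists>t. 0 <= t \<and> t <= 1 \<and> 1 = l x + l1 x * (1 - x) + l2 x / 2 * (1 - x)^2 + l3 t / 6 * (1 - x) ^ 3"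
proof -
 define df where "df k = (if k = 0 then l else if k = 1 then l1 else if k = 2 then l2 else l3)" for k :: nat
 have df: "\<forall>m t. m < n \<and> 0 <= t \<and> t <= 1 --> DERIV (df m) t :> (df (Suc m) t)" if "n <= 3" for n
  using that d1 d2 d3 by (auto simp: df_def numeral_eq_Suc less_Suc_eq)
 have "df 0 = l" by (simp add: df_def)
 from Taylor_up[OF _ this df _ assms(2), of 2] assms
 obtain t where "x < t" "t < 1" "l 1 = (\<Sum>m<2. df m x / fact m * (1 - x) ^ m) + df 2 t / fact 2 * (1 - x) ^ 2" by auto
 thus "\<exists>t. 0 <= t \<and> t <= 1 \<and> 1 = l x + l1 x * (1 - x) + l2 t / 2 * (1 - x)^2"
  using assms by (intro exI[of _ t]) (simp add: df_def numeral_eq_Suc l01)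
 from Taylor_up[OF _ \<open>df 0 = l\<close> df _ assms(2), of 3] assms
 obtain t where "x < t" "t < 1" "l 1 = (\<Sum>m<3. df m x / fact m * (1 - x) ^ m) + df 3 t / fact 3 * (1 - x) ^ 3" by auto
 thus "\<exists>t. 0 <= t \<and> t <= 1 \<and> 1 = l x + l1 x * (1 - x) + l2 x / 2 * (1 - x)^2 + l3 t / 6 * (1 - x) ^ 3"
  using assms by (intro exI[of _ t]) (simp add: df_def numeral_eq_Suc l01)
qed

lemma taylor_at_0: assumes "0 < x" "x <= 1"
 shows "\<exists>t. 0 <= t \<and> t <= 1 \<and> 0 = l x - l1 x * x + l2 t / 2 * x\<^sup>2"
  "\<exists>t. 0 <= t \<and> t <= 1 \<and> 0 = l x - l1 x * x + l2 x / 2 * x\<^sup>2 - l3 t / 6 * x ^ 3"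
proof -
 define df where "df k = (if k = 0 then l else if k = 1 then l1 else if k = 2 then l2 else l3)" for k :: nat
 have df: "\<forall>m t. m < n \<and> 0 <= t \<and> t <= 1 --> DERIV (df m) t :> (df (Suc m) t)" if "n <= 3" for n
  using that d1 d2 d3 by (auto simp: df_def numeral_eq_Suc less_Suc_eq)
 have "df 0 = l" by (simp add: df_def)
 from Taylor_down[OF _ this df assms(1), of 2] assms
 obtain t where "0 < t" "t < x" "l 0 = (\<Sum>m<2. df m x / fact m * (0 - x) ^ m) + df 2 t / fact 2 * (0 - x) ^ 2" by auto
 thus "\<exists>t. 0 <= t \<and> t <= 1 \<and> 0 = l x - l1 x * x + l2 t / 2 * x\<^sup>2"
  using assms by (intro exI[of _ t]) (simp add: df_def numeral_eq_Suc l01)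
 from Taylor_down[OF _ \<open>df 0 = l\<close> df assms(1), of 3] assms
 obtain t where "0 < t" "t < x" "l 0 = (\<Sum>m<3. df m x / fact m * (0 - x) ^ m) + df 3 t / fact 3 * (0 - x) ^ 3" by auto
 thus "\<exists>t. 0 <= t \<and> t <= 1 \<and> 0 = l x - l1 x * x + l2 x / 2 * x\<^sup>2 - l3 t / 6 * x ^ 3"
  using assms by (intro exI[of _ t]) (simp add: df_def numeral_eq_Suc l01)
qed

lemma tangent_above: assumes "0 <= x" "x < 1" shows "l1 x * (1 - x) + l x - 1 > 0"
proof -
 obtain t where t: "0 <= t" "t <= 1" "1 = l x + l1 x * (1 - x) + l2 t / 2 * (1 - x)^2" using taylor_at_1(1)[OF assms] by blast
 have "l2 t / 2 * (1 - x)^2 < 0" using l2_neg[OF t(1,2)] assms by (intro mult_neg_pos) auto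
 thus ?thesis using t(3) by linarith
qed

lemma G_pos: assumes "0 < x" "x < 1" shows "G x > 0"
proof -
 obtain t where t: "0 <= t" "t <= 1" "0 = l x - l1 x * x + l2 t / 2 * x\<^sup>2" using taylor_at_0(1)[of x] assms by auto
 have "l2 t / 2 * x\<^sup>2 < 0" using l2_neg[OF t(1,2)] assms by (intro mult_neg_pos) auto
 hence a: "l x - l1 x * x > 0" using t(3) by linarith
 have b: "l1 x * (1 - x) + l x - 1 > 0" using tangent_above assms by simp
 have "0 < (1 - x) * (l x - l1 x * x) + x * (l1 x * (1 - x) + l x - 1)" using a b assms by (intro add_pos_pos mult_pos_pos) auto
 also have "... = G x" by (simp add: G_def algebra_simps)
 finally show ?thesis .
qed

text \<open>This says that \<open>G x / (x * (1 - x))\<close> decreases; it is the sign of a third divided difference of \<open>l\<close>.\<close>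

lemma G_third: assumes "0 < x" "x < 1" shows "x * (1 - x) * (l1 x - 1) - (1 - 2 * x) * G x <= 0"
proof -
 obtain t where t: "0 <= t" "t <= 1" "1 = l x + l1 x * (1 - x) + l2 x / 2 * (1 - x)^2 + l3 t / 6 * (1 - x) ^ 3"
  using taylor_at_1(2)[of x] assms by auto
 obtain s where s: "0 <= s" "s <= 1" "0 = l x - l1 x * x + l2 x / 2 * x\<^sup>2 - l3 s / 6 * x ^ 3"
  using taylor_at_0(2)[of x] assms by auto
 \<comment> \<open>The factors \<open>x^2\<close> and \<open>(1 - x)^2\<close> are those for which
   \<open>l2 x\<close> drops out when the expansions at the two ends are subtracted.\<close>
 have "x * (1 - x) * (l1 x - 1) - (1 - 2 * x) * G x =
   x\<^sup>2 * (l x + l1 x * (1 - x) + l2 x / 2 * (1 - x)^2 - 1) - (1 - x)^2 * (l x - l1 x * x + l2 x / 2 * x\<^sup>2)"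
  by (simp add: G_def power2_eq_square algebra_simps)
 also have "... = - (x\<^sup>2 * (l3 t / 6 * (1 - x) ^ 3) + (1 - x)^2 * (l3 s / 6 * x ^ 3))"
 proof -
  have "l x + l1 x * (1 - x) + l2 x / 2 * (1 - x)^2 - 1 = - (l3 t / 6 * (1 - x) ^ 3)" using t(3) by linarith
  moreover have "l x - l1 x * x + l2 x / 2 * x\<^sup>2 = l3 s / 6 * x ^ 3" using s(3) by linarith
  ultimately show ?thesis by simp
 qed
 also have "... <= 0"
 proof -
  have "0 <= x\<^sup>2 * (l3 t / 6 * (1 - x) ^ 3) + (1 - x)^2 * (l3 s / 6 * x ^ 3)"
   using l3_nonneg[OF t(1,2)] l3_nonneg[OF s(1,2)] assms by (intro add_nonneg_nonneg mult_nonneg_nonneg) auto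
  thus ?thesis by simp
 qed
 finally show ?thesis .
qed

lemma G_cont: "continuous_on {0..1} G"
 unfolding G_def using DERIV_isCont[OF d1] by (auto intro!: continuous_intros continuous_at_imp_continuous_on)

text \<open>The antiderivative of \<open>- G (exp t)\<close> that vanishes at 0. It is the free
  function of the construction: \<open>exp (- M t)\<close> will be \<open>m t * exp (- t)\<close>,
  and this choice of derivative makes the squares of \<open>G / m\<close> cancel in
  \<open>weight_identity\<close>.\<close>

definition m where "m t = integral {0..- t} (%s. G (exp (- s)))"

lemma m_deriv_within: assumes "t <= 0" "a <= t" shows "(m has_real_derivative - G (exp t)) (at t within {a..0})"
proof -
 have c: "continuous_on {0..- a} (%s. G (exp (- s)))" by (rule continuous_on_compose2[OF G_cont]) (auto intro!: continuous_intros)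
 have "((%u. integral {0..u} (%s. G (exp (- s)))) has_real_derivative G (exp (- (- t)))) (at (- t) within {0..- a})"
  using integral_has_real_derivative[OF c, of "- t"] assms by simp
 moreover have "uminus ` {a..0} = {0..- a}" by simp
 moreover have "(uminus has_real_derivative - 1) (at t within {a..0})" by (auto intro!: derivative_eq_intros)
 ultimately have "((%u. integral {0..u} (%s. G (exp (- s)))) \<circ> uminus has_real_derivative G (exp (- (- t))) * - 1) (at t within {a..0})"
  by (intro DERIV_image_chain) auto
 thus ?thesis by (simp add: m_def[abs_def] comp_def)
qed

lemma m_deriv: assumes "t < 0" shows "(m has_real_derivative - G (exp t)) (at t)"
proof -
 have "t \<in> interior {t - 1..0}" using assms by simp
 hence "at t within {t - 1..0} = at t" by (rule at_within_interior)
 thus ?thesis using m_deriv_within[of t "t - 1"] assms by simp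
qed

lemma m_cont: "continuous_on {a..0} m"
 using m_deriv_within by (intro DERIV_continuous_on[where D="%t. - G (exp t)"]) auto

lemma m_0: "m 0 = 0" by (simp add: m_def)

lemma m_pos: assumes "t < 0" shows "m t > 0"
proof -
 have "- m t < - m 0"
 proof (rule DERIV_pos_imp_increasing_open[OF assms])
  show "continuous_on {t..0} (%t. - m t)" by (intro continuous_on_minus m_cont)
  fix s assume s: "t < s" "s < 0"
  show "\<exists>y. ((%t. - m t) has_real_derivative y) (at s) \<and> 0 < y"
   by (rule exI[of _ "G (exp s)"]) (use s DERIV_minus[OF m_deriv] G_pos[of "exp s"] in auto)
 qed
 thus ?thesis by (simp add: m_0)
qed

lemma G_exp_deriv: assumes "t <= 0" shows "((%t. G (exp t)) has_real_derivative exp t * (l1 (exp t) - 1)) (at t)"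
proof -
 have "((%t. l (exp t)) has_real_derivative l1 (exp t) * exp t) (at t)"
  by (rule DERIV_chain2[OF d1]) (use assms in \<open>auto intro!: derivative_eq_intros\<close>)
 thus ?thesis unfolding G_def by (auto intro!: derivative_eq_intros simp: algebra_simps)
qed

text \<open>The difference of the two sides, divided by \<open>exp t\<close>, vanishes at 0 and is
  decreasing by \<open>G_third\<close>. The result is \<open>q \<le> 1/2\<close>, so that the
  constant \<open>1 / (1 - q)\<close> lies between 1 and 2.\<close>

lemma x_m_le: assumes "t < 0" shows "exp t * m t <= (1 - exp t) * G (exp t) / 2"
proof -
 define h where "h t = (exp (- t) - 1) * G (exp t) / 2 - m t" for t
 have "h 0 <= h t"
 proof (rule DERIV_nonpos_imp_decreasing_open[where f=h])
  show "t <= 0" using assms by simp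
  have "continuous_on {t..0} (%t. G (exp t))" by (rule continuous_on_compose2[OF G_cont]) (auto intro!: continuous_intros)
  thus "continuous_on {t..0} h" unfolding h_def by (intro continuous_intros m_cont) auto
  fix s assume s: "t < s" "s < 0"
  define x where "x = exp s"
  have x: "0 < x" "x < 1" "exp (- s) = 1 / x" using s by (simp_all add: x_def exp_minus field_simps)
  have "(h has_real_derivative ((- exp (- s)) * G (exp s) + (exp (- s) - 1) * (exp s * (l1 (exp s) - 1))) / 2 - - G (exp s)) (at s)"
   unfolding h_def using s by (auto intro!: derivative_eq_intros G_exp_deriv m_deriv)
  moreover have "((- exp (- s)) * G (exp s) + (exp (- s) - 1) * (exp s * (l1 (exp s) - 1))) / 2 - - G (exp s) = (x * (1 - x) * (l1 x - 1) - (1 - 2 * x) * G x) / (2 * x)"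
   unfolding x(3) x_def[symmetric] using x by (simp add: field_simps)
  moreover have "... <= 0" using G_third[OF x(1,2)] x by (simp add: divide_le_0_iff)
  ultimately show "\<exists>y. (h has_real_derivative y) (at s) \<and> y <= 0" by metis
 qed
 hence "m t <= (exp (- t) - 1) * G (exp t) / 2" by (simp add: h_def m_0)
 hence "exp t * m t <= exp t * ((exp (- t) - 1) * G (exp t) / 2)" by (intro mult_left_mono) auto
 also have "... = (1 - exp t) * G (exp t) / 2" by (simp add: exp_minus field_simps)
 finally show ?thesis .
qed

definition b where "b t = G (exp t) / (1 - exp t)"
definition b1 where "b1 t = exp t * (l1 (exp t) * (1 - exp t) + l (exp t) - 1) / (1 - exp t)^2"
text \<open>Determined by the weights: \<open>M1 - N1\<close> equals \<open>1 - q\<close> times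
  \<open>G / m\<close>. With \<open>S = 1 / (1 - q)\<close> the cross term
  \<open>S * (N1 - M1)^2\<close> becomes \<open>(G / m)^2 * (1 - q)\<close>, and the factor
  \<open>1 - 1 / S\<close> in front of the solution is q.\<close>

definition q where "q t = exp t * m t / ((1 - exp t) * G (exp t))"

lemma b_deriv: assumes "t < 0" shows "(b has_real_derivative b1 t) (at t)"
proof -
 have n: "1 - exp t \<noteq> 0" using assms by simp
 have "(b has_real_derivative (exp t * (l1 (exp t) - 1) * (1 - exp t) - G (exp t) * (0 - exp t)) / ((1 - exp t) * (1 - exp t))) (at t)"
  unfolding b_def[abs_def] by (rule DERIV_divide[OF G_exp_deriv]) (use assms n in \<open>auto intro!: derivative_eq_intros\<close>)
 moreover have "(exp t * (l1 (exp t) - 1) * (1 - exp t) - G (exp t) * (0 - exp t)) / ((1 - exp t) * (1 - exp t)) = b1 t"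
  unfolding b1_def G_def power2_eq_square by (rule arg_cong[where f="%y. y / ((1 - exp t) * (1 - exp t))"]) (simp add: algebra_simps)
 ultimately show ?thesis by simp
qed

lemma b1_nonneg: "t < 0 ==> b1 t >= 0"
 using tangent_above[of "exp t"] by (simp add: b1_def)

lemma b_bounds: assumes "t < 0" shows "0 < b t" "b t < 1"
proof -
 have x: "0 < exp t" "exp t < 1" using assms by auto
 show "0 < b t" using G_pos[OF x] x by (simp add: b_def)
 have "l (exp t) < l 1"
 proof (rule DERIV_pos_imp_increasing_open[OF x(2)])
  show "continuous_on {exp t..1} l" using order_trans[OF less_imp_le[OF x(1)]] by (intro continuous_at_imp_continuous_on ballI DERIV_isCont[OF d1]) auto
  fix y :: real assume y: "exp t < y" "y < 1"
  have y0: "0 < y" using y x by linarith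
  thus "\<exists>z. (l has_real_derivative z) (at y) \<and> 0 < z" using d1[of y] l1_pos[of y] y y0 by auto
 qed
 thus "b t < 1" using x by (simp add: b_def G_def l01)
qed

lemma b_le: obtains C where "C >= 1" "!!t. t < 0 ==> b t <= C * exp t"
proof -
 have "continuous_on {0..1} l1" using DERIV_isCont[OF d2] by (auto intro!: continuous_at_imp_continuous_on)
 hence "compact (l1 ` {0..1})" by (rule compact_continuous_image) auto
 then obtain C where C: "!!x. 0 <= x ==> x <= 1 ==> l1 x <= C" using compact_imp_bounded bounded_imp_bdd_above
  by (metis atLeastAtMost_iff bdd_above.unfold imageI)
 \<comment> \<open>For \<open>exp t \<le> 1/2\<close> the denominator costs a factor 2 and the mean
   value theorem supplies C; otherwise \<open>2 * exp t\<close> exceeds 1, which bounds b.\<close>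
 have "b t <= (2 * max 1 C) * exp t" if t: "t < 0" for t
 proof -
  have x: "0 < exp t" "exp t < 1" using t by auto
  show ?thesis
  proof (cases "exp t <= 1/2")
   case True
   obtain y where y: "0 < y" "y < exp t" "l (exp t) - l 0 = (exp t - 0) * l1 y" using MVT2[OF x(1), of l l1] d1 x by (metis less_imp_le order_trans)
   have "l1 y <= max 1 C" using C[of y] y(1,2) x by linarith
   hence "l (exp t) <= exp t * max 1 C" using y x l01 by (auto intro!: mult_left_mono)
   hence g: "G (exp t) <= exp t * max 1 C" unfolding G_def using x(1) by linarith
   have "0 <= exp t * max 1 C" using x by simp
   hence "(exp t * max 1 C) * 1 <= (exp t * max 1 C) * (2 * (1 - exp t))" using True by (intro mult_left_mono) auto
   also have "... = (2 * max 1 C * exp t) * (1 - exp t)" by simp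
   finally have "G (exp t) <= (2 * max 1 C * exp t) * (1 - exp t)" using g by linarith
   thus ?thesis unfolding b_def using x by (simp add: pos_divide_le_eq)
  next
   case False
   hence "1 <= 2 * exp t" by simp
   also have "... <= (2 * max 1 C) * exp t" using x by simp
   finally show ?thesis using b_bounds(2)[OF t] by simp
  qed
 qed
 thus ?thesis using that[of "2 * max 1 C"] by simp
qed

lemma q_bounds: assumes "t < 0" shows "0 < q t" "q t <= 1/2"
proof -
 have x: "0 < exp t" "exp t < 1" using assms by auto
 have p: "(1 - exp t) * G (exp t) > 0" using G_pos[OF x] x by simp
 show "0 < q t" unfolding q_def using p m_pos[OF assms] by simp
 show "q t <= 1/2" unfolding q_def using p x_m_le[OF assms] by (simp add: pos_divide_le_eq)
qed

text \<open>\<open>exp (- M)\<close> and \<open>exp (- N)\<close> are the two weights as functions of \<open>t = \<psi>\<close>; the twist factor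
\<open>1 / (1 - q)\<close> leaves exactly the curvature that absorbs \<open>b1\<^sup>2\<close>.\<close>

definition M where "M t = t - ln (m t)"
definition M1 where "M1 t = 1 + G (exp t) / m t"
definition M2 where "M2 t = (exp t * (l1 (exp t) - 1) * m t + (G (exp t))^2) / (m t)^2"
definition N :: "real => real" where "N t = - ln (exp (- t) - 1)"
definition N1 :: "real => real" where "N1 t = 1 / (1 - exp t)"
definition N2 :: "real => real" where "N2 t = exp t / (1 - exp t)^2"

lemma MN_deriv: assumes "t < 0"
 shows "(M has_real_derivative M1 t) (at t)" "(M1 has_real_derivative M2 t) (at t)"
  "(N has_real_derivative N1 t) (at t)" "(N1 has_real_derivative N2 t) (at t)"
proof -
 note p = m_pos[OF assms]
 show "(M has_real_derivative M1 t) (at t)" unfolding M_def[abs_def] M1_def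
  using p by (auto intro!: derivative_eq_intros m_deriv assms simp: field_simps)
 show "(M1 has_real_derivative M2 t) (at t)" unfolding M1_def[abs_def] M2_def
  using p assms by (auto intro!: derivative_eq_intros m_deriv G_exp_deriv simp: power2_eq_square)
 have "exp (- t) > 1" using assms by simp
 thus "(N has_real_derivative N1 t) (at t)" unfolding N_def[abs_def] N1_def
  using assms by (auto intro!: derivative_eq_intros simp: field_simps exp_minus)
 have "1 - exp t \<noteq> 0" using assms by simp
 thus "(N1 has_real_derivative N2 t) (at t)" unfolding N1_def[abs_def] N2_def
  by (auto intro!: derivative_eq_intros simp: power2_eq_square)
qed

lemma cont_neg:
 shows "continuous_on {..<0} m" "continuous_on {..<0} (%t. G (exp t))" "continuous_on {..<0} b" "continuous_on {..<0} b1"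
  "continuous_on {..<0} M2" "continuous_on {..<0} N2" "continuous_on {..<0} q"
proof -
 show cm: "continuous_on {..<0} m" using DERIV_isCont[OF m_deriv] by (auto intro!: continuous_at_imp_continuous_on)
 show cG: "continuous_on {..<0} (%t. G (exp t))" by (rule continuous_on_compose2[OF G_cont]) (auto intro!: continuous_intros)
 show "continuous_on {..<0} b" using DERIV_isCont[OF b_deriv] by (auto intro!: continuous_at_imp_continuous_on)
 have "continuous_on {0..1} l1" "continuous_on {0..1} l" using DERIV_isCont[OF d2] DERIV_isCont[OF d1] by (auto intro!: continuous_at_imp_continuous_on)
 hence cl: "continuous_on {..<0} (%t. l1 (exp t))" "continuous_on {..<0} (%t. l (exp t))"
  by (auto intro!: continuous_on_compose2[of "{0..1}" l1 "{..<0}" exp] continuous_on_compose2[of "{0..1}" l "{..<0}" exp] continuous_intros)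
 show "continuous_on {..<0} b1" unfolding b1_def[abs_def] by (intro continuous_intros cl) auto
 show "continuous_on {..<0} M2" unfolding M2_def[abs_def] by (intro continuous_intros cl cG cm) (use m_pos in force)
 show "continuous_on {..<0} N2" unfolding N2_def[abs_def] by (auto intro!: continuous_intros)
 show "continuous_on {..<0} q" unfolding q_def[abs_def]
 proof (intro continuous_intros cG cm ballI)
  fix t :: real assume "t \<in> {..<0}"
  thus "(1 - exp t) * G (exp t) \<noteq> 0" using G_pos[of "exp t"] by simp
 qed
qed

lemma M1_pos: "t < 0 ==> M1 t > 0"
 using m_pos[of t] G_pos[of "exp t"] by (simp add: M1_def add_pos_pos)

text \<open>The two terms \<open>(G / m)^2\<close> cancel, and the curvature left in the direction
  of the differential of \<psi> is a multiple of \<open>b1\<close>. Hence dbar of \<open>b\<close>,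
  of squared size \<open>b1^2\<close>, can be charged to it at a cost that is again a multiple of
  \<open>b1\<close>, with no division by a quantity that may vanish.\<close>

lemma weight_identity: assumes "t < 0"
 shows "M2 t - 1 / (1 - q t) * (N1 t - M1 t)^2 = (1 - exp t) * b1 t / m t"
proof -
 define x g \<mu> where "x = exp t" and "g = G x" and "\<mu> = m t"
 have x: "0 < x" "x < 1" and g: "g > 0" and mu: "\<mu> > 0" using assms G_pos m_pos by (auto simp: x_def g_def \<mu>_def)
 have qq: "q t = x * \<mu> / ((1 - x) * g)" by (simp add: q_def x_def g_def \<mu>_def)
 have q1: "1 - q t \<noteq> 0" using q_bounds[OF assms] by linarith
 have "N1 t - M1 t = - (g / \<mu>) * (1 - q t)"
  unfolding N1_def M1_def qq x_def[symmetric] g_def[symmetric] \<mu>_def[symmetric] using x g mu by (simp add: field_simps)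
 hence "1 / (1 - q t) * (N1 t - M1 t)^2 = (g / \<mu>)^2 * (1 - q t)"
  using q1 by (simp add: power_mult_distrib power2_eq_square)
 also have "... = (g / \<mu>)^2 - x * g / ((1 - x) * \<mu>)" unfolding qq using x g mu by (simp add: field_simps power2_eq_square)
 finally have e: "1 / (1 - q t) * (N1 t - M1 t)^2 = (g / \<mu>)^2 - x * g / ((1 - x) * \<mu>)" .
 have "M2 t = x * (l1 x - 1) / \<mu> + (g / \<mu>)^2"
  unfolding M2_def x_def[symmetric] g_def[symmetric] \<mu>_def[symmetric] using mu by (simp add: field_simps power2_eq_square)
 hence "M2 t - 1 / (1 - q t) * (N1 t - M1 t)^2 = x * (l1 x - 1) / \<mu> + x * g / ((1 - x) * \<mu>)" unfolding e by simp
 also have "... = (1 - exp t) * b1 t / m t"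
 proof -
  define y where "y = 1 - x"
  have y: "y > 0" using x by (simp add: y_def)
  have "x * (l1 x - 1) / \<mu> + x * g / (y * \<mu>) = x * ((l1 x - 1) * y + g) / (y * \<mu>)" using y mu by (simp add: field_simps)
  also have "(l1 x - 1) * y + g = l1 x * y + l x - 1" by (simp add: y_def g_def G_def algebra_simps)
  also have "x * (l1 x * y + l x - 1) / (y * \<mu>) = y * (x * (l1 x * y + l x - 1) / y\<^sup>2) / \<mu>" using y mu by (simp add: field_simps power2_eq_square)
  finally show ?thesis by (simp add: b1_def y_def x_def \<mu>_def)
 qed
 finally show ?thesis .
qed

text \<open>The three places where the weights enter. The cost of the source and the loss
  \<open>1 - b\<close> in the convexity inequality collapse to the derivative of l; the solution
  carries exactly the weight \<open>1 / b\<close> that this inequality needs; and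
  \<open>b1^2\<close> factors into R times the remaining curvature.\<close>

lemma weight_values: assumes "t < 0"
 shows "exp (M t - 2 * N t) * (b1 t * m t / (1 - exp t)) + (1 - b t) = l1 (exp t)"
  "exp (M t - 2 * N t) * q t = 1 / b t" "(b1 t)^2 = (b1 t * m t / (1 - exp t)) * ((1 - exp t) * b1 t / m t)"
proof -
 define x g \<mu> where "x = exp t" and "g = G x" and "\<mu> = m t"
 have x: "0 < x" "x < 1" and g: "g > 0" and mu: "\<mu> > 0" using assms G_pos m_pos by (auto simp: x_def g_def \<mu>_def)
 define v where "v = exp (- t) - 1"
 have v: "v > 0" "v = (1 - x) / x" using assms x by (simp_all add: v_def x_def exp_minus field_simps)
 have "M t - 2 * N t = t - ln \<mu> + (ln v + ln v)" by (simp add: M_def N_def v_def \<mu>_def)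
 hence "exp (M t - 2 * N t) = x / \<mu> * (v * v)" using v(1) mu by (simp only: exp_add exp_diff x_def exp_ln)
 also have "... = (1 - x)^2 / (x * \<mu>)" unfolding v(2) using x mu by (simp add: power2_eq_square)
 finally have e: "exp (M t - 2 * N t) = (1 - x)^2 / (x * \<mu>)" .
 show "exp (M t - 2 * N t) * (b1 t * m t / (1 - exp t)) + (1 - b t) = l1 (exp t)"
 proof -
  define y p where "y = 1 - x" and "p = l1 x * y + l x - 1"
  have y: "y > 0" using x by (simp add: y_def)
  have "y\<^sup>2 / (x * \<mu>) * (x * p / y\<^sup>2 * \<mu> / y) + (1 - g / y) = (p + y - g) / y" using y mu x by (simp add: field_simps power2_eq_square)
  also have "p + y - g = l1 x * y" by (simp add: p_def y_def g_def G_def)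
  finally show ?thesis unfolding e using y by (simp add: b1_def b_def y_def x_def \<mu>_def g_def p_def)
 qed
 show "exp (M t - 2 * N t) * q t = 1 / b t"
 proof -
  define y where "y = 1 - x"
  have y: "y > 0" using x by (simp add: y_def)
  have "y\<^sup>2 / (x * \<mu>) * (x * \<mu> / (y * g)) = 1 / (g / y)" using y mu x g by (simp add: field_simps power2_eq_square)
  thus ?thesis unfolding e by (simp add: q_def b_def y_def x_def \<mu>_def g_def)
 qed
 show "(b1 t)^2 = (b1 t * m t / (1 - exp t)) * ((1 - exp t) * b1 t / m t)" using x mu by (simp add: x_def \<mu>_def power2_eq_square)
qed

end

section \<open>The estimate on a sublevel set\<close>

text \<open>The gradient of \<open>ln (- r)\<close> is that of r divided by r, which is exactly the
  growth allowed. Spreading the transition over an interval of length i in the logarithm makes the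
  slope as small as desired.\<close>

lemma log_cutoff:
 fixes r :: "complex ^ 'n => real"
 assumes U: "open U" and r: "c2 U r" "!!z. z \<in> U ==> r z < 0" "!!c. c > 0 ==> compact {z\<in>U. r z <= - c}"
  and M0: "!!z j. z \<in> U ==> cmod (db j (cr r) z) <= M0" and K: "compact K" "K \<subseteq> U" and \<tau>: "\<tau> > 0"
 shows "\<exists>eta L. c2 UNIV eta \<and> (\<forall>z. 0 <= eta z \<and> eta z <= 1) \<and> compact L \<and> L \<subseteq> U \<and> (\<forall>z. z \<notin> L --> eta z = 0)
  \<and> (\<forall>z\<in>K. eta z = 1) \<and> (\<forall>z\<in>L. \<forall>j. cmod (db j (cr eta) z) * \<bar>r z\<bar> <= \<tau>)"
proof -
 have rc: "continuous_on U r" by (rule c2_continuous[OF r(1)])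
 obtain r0 where r0: "r0 > 0" "!!z. z \<in> K ==> r z <= - r0"
 proof (cases "K = {}")
  case True thus ?thesis using that[of 1] by simp
 next
  case False
  obtain z where z: "z \<in> K" "\<forall>y\<in>K. r y <= r z" using continuous_attains_sup[OF K(1) False continuous_on_subset[OF rc K(2)]] by blast
  thus ?thesis using that[of "- r z"] r(2)[of z] K by auto
 qed
 \<comment> \<open>The number 9 bounds the slope of the step function \<open>st\<close>, a product
   of two factors at most 3; M0 bounds the gradient of r. The added 1 keeps i positive.\<close>
 define i where "i = (9 * \<bar>M0\<bar> + 1) / \<tau>"
 have i: "i > 0" "9 * \<bar>M0\<bar> / i <= \<tau>"
 proof -
  have p: "9 * \<bar>M0\<bar> + 1 > 0" by simp
  thus "i > 0" using \<tau> by (simp add: i_def)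
  show "9 * \<bar>M0\<bar> / i <= \<tau>" unfolding i_def using p \<tau> by (simp add: field_simps)
 qed
 define w where "w z = 1 + (ln (- r z) - ln r0) / i" for z
 \<comment> \<open>A C^2 step, 0 for \<open>y \<le> 0\<close> and 1 for \<open>y \<ge> 1\<close>;
   each of the two cubes of positive parts flattens one junction.\<close>
 define st where "st y = pcube (1 - pcube (1 - y))" for y
 define L where "L = {z\<in>U. r z <= - (r0 * exp (- i))}"
 define eta where "eta z = (if z \<in> U then st (w z) else 0)" for z
 have pc1: "0 <= pcube y" "y <= 1 ==> pcube y <= 1" "y <= 0 ==> pcube y = 0" "y >= 1 ==> pcube y >= 1" for y
  by (auto simp: pcube_def power_le_one max_def)
 have st01: "0 <= st y" "st y <= 1" "y >= 1 ==> st y = 1" "y <= 0 ==> st y = 0" for y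
 proof -
  show "0 <= st y" "st y <= 1" using pc1 by (simp_all add: st_def)
  show "st y = 1" if "y >= 1" using pc1(3)[of "1 - y"] that by (simp add: st_def pcube_def)
  show "st y = 0" if "y <= 0" using pc1(4)[of "1 - y"] that by (simp add: st_def pc1(3))
 qed
 have wL: "w z >= 0 \<longleftrightarrow> z \<in> L" "w z > 0 ==> z \<in> L" if z: "z \<in> U" for z
 proof -
  have "w z >= 0 \<longleftrightarrow> ln r0 - i <= ln (- r z)" using i by (simp add: w_def field_simps)
  also have "ln r0 - i = ln (r0 * exp (- i))" using r0 by (simp add: ln_mult)
  also have "... <= ln (- r z) \<longleftrightarrow> r0 * exp (- i) <= - r z" using r(2)[OF z] r0 by (intro ln_le_cancel_iff) auto
  finally show "w z >= 0 \<longleftrightarrow> z \<in> L" using z by (auto simp: L_def)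
  thus "w z > 0 ==> z \<in> L" by auto
 qed
 have L: "compact L" "L \<subseteq> U" unfolding L_def using r(3)[of "r0 * exp (- i)"] r0 by auto
 have wd: "((%y. 1 + (ln (- y) - ln r0) / i) has_real_derivative 1 / (i * y)) (at y)" if "y < 0" for y
  using that i by (auto intro!: derivative_eq_intros)
 have wd2: "((%y. 1 / (i * y)) has_real_derivative - 1 / (i * y\<^sup>2)) (at y)" if "y < 0" for y
  using that i by (auto intro!: derivative_eq_intros simp: power2_eq_square)
 have "continuous_on {..<0} (%y. - 1 / (i * y\<^sup>2))" using i by (auto intro!: continuous_intros)
 hence wc: "continuous_on (r ` U) (%y. - 1 / (i * y\<^sup>2))" by (rule continuous_on_subset) (use r(2) in auto)
 have cw: "c2 U w" unfolding w_def[abs_def]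
  by (rule c2_compose[OF r(1) U wd[OF r(2)] wd2[OF r(2)] wc])
 have cst: "c2 U (%z. st (w z))" unfolding st_def
  by (rule c2_pcube[OF c2_diff[OF c2_const[OF U] c2_pcube[OF c2_diff[OF c2_const[OF U] cw U] U] U] U])
 have e0: "eta z = 0" if "z \<notin> L" for z
  using wL[of z] st01(4)[of "w z"] that by (cases "z \<in> U") (auto simp: eta_def not_le)
 have "c2 U eta" by (rule c2_cong[OF U _ cst]) (simp add: eta_def)
 hence ceta: "c2 UNIV eta" by (rule c2_zero_extend[OF _ U compact_imp_closed[OF L(1)] L(2) e0])
 have eK: "eta z = 1" if z: "z \<in> K" for z
 proof -
  have "ln r0 <= ln (- r z)" using r0(2)[OF z] r0(1) by (intro ln_mono) auto
  hence "w z >= 1" using i by (simp add: w_def)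
  thus ?thesis using st01(3) z K by (auto simp: eta_def)
 qed
 have dbd: "cmod (db j (cr eta) z) * \<bar>r z\<bar> <= \<tau>" if z: "z \<in> L" for z j
 proof -
  have zU: "z \<in> U" using z L by blast
  have rz: "r z < 0" by (rule r(2)[OF zU])
  have w0: "w z >= 0" using wL(1)[OF zU] z by blast
  define s' where "s' = 3 * (max 0 (1 - pcube (1 - w z)))^2 * (3 * (max 0 (1 - w z))^2)"
  have std: "(st has_real_derivative s') (at (w z))"
  proof -
   have "((%y. pcube (1 - y)) has_real_derivative 3 * (max 0 (1 - w z))^2 * (- 1)) (at (w z))"
    by (rule DERIV_chain2[OF pcube_deriv]) (auto intro!: derivative_eq_intros)
   from DERIV_diff[OF DERIV_const[of 1] this] have "((%y. 1 - pcube (1 - y)) has_real_derivative 3 * (max 0 (1 - w z))^2) (at (w z))" by simp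
   from DERIV_chain2[OF pcube_deriv this] show ?thesis unfolding st_def[abs_def] s'_def .
  qed
  have s': "\<bar>s'\<bar> <= 9"
  proof -
   have "(max 0 (1 - pcube (1 - w z)))^2 <= 1" "(max 0 (1 - w z))^2 <= 1" using pc1(1)[of "1 - w z"] w0 by (auto intro!: power_le_one)
   hence "(max 0 (1 - pcube (1 - w z)))^2 * (max 0 (1 - w z))^2 <= 1 * 1" by (intro mult_mono) auto
   thus ?thesis by (simp add: s'_def abs_mult)
  qed
  have "db j (cr eta) z = db j (%z. complex_of_real (st (w z))) z" by (rule wirt_cong(2)[OF U _ zU]) (simp add: eta_def)
  also have "... = of_real s' * db j (cr w) z" by (rule wirt_compose(2)[OF c2_c1[OF cw] zU std])
  also have "db j (cr w) z = of_real (1 / (i * r z)) * db j (cr r) z" unfolding w_def by (rule wirt_compose(2)[OF c2_c1[OF r(1)] zU wd[OF rz]])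
  finally have "cmod (db j (cr eta) z) = \<bar>s'\<bar> * ((1 / (i * \<bar>r z\<bar>)) * cmod (db j (cr r) z))"
   using i by (simp add: norm_mult norm_divide abs_mult)
  hence "cmod (db j (cr eta) z) * \<bar>r z\<bar> = \<bar>s'\<bar> * cmod (db j (cr r) z) / i" using i rz by simp
  also have "... <= 9 * \<bar>M0\<bar> / i" using s' M0[OF zU, of j] i by (intro divide_right_mono mult_mono) auto
  also have "... <= \<tau>" by (rule i(2))
  finally show ?thesis .
 qed
 have "\<forall>z. 0 <= eta z \<and> eta z <= 1" using st01(1,2) by (simp add: eta_def)
 thus ?thesis using ceta L e0 eK dbd by (intro exI[of _ eta] exI[of _ L]) simp
qed

lemma cmod_add_sq_le':
 assumes "\<delta> > 0" shows "(cmod (x + y))^2 <= (1 + \<delta>) * (cmod x)^2 + (1 + 1 / \<delta>) * (cmod y)^2"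
proof -
 have "(1 + 1 / \<delta>) / ((1 + 1 / \<delta>) - 1) = 1 + \<delta>" using assms by (simp add: field_simps)
 thus ?thesis using cmod_add_sq_le[of "1 + 1 / \<delta>" x y] assms by simp
qed

context profile begin

text \<open>The functions X and k of r are added to the sharp weights in \<psi>. Near 0, k behaves
  like \<open>- 2 * ln (- r)\<close> up to a constant; this makes
  \<open>exp ((zeta - xi) / 2)\<close> at most a multiple of \<open>- r\<close>, the growth that
  logarithmic cutoffs tolerate. The convexity of X pays for the square of the derivative of k. The
  total price is the factor \<open>(1 - \<theta>)^2\<close> on the set where
  \<open>r \<le> -1\<close>.\<close>

lemma l2_omega:
 fixes F :: "complex ^ 'n => complex"
 assumes U: "open U" and psi: "c2 U \<psi>" "!!z. z \<in> U ==> \<psi> z \<in> {t0..t1}" "t0 <= t1" "t1 < 0" "!!z b. z \<in> U ==> lev \<psi> z b >= 0"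
  and r: "c2 U r" "!!z. z \<in> U ==> r z < 0" "!!z b. z \<in> U ==> lev r z b >= 0" "!!c. c > 0 ==> compact {z\<in>U. r z <= - c}"
  and M0: "!!z j. z \<in> U ==> cmod (db j (cr r) z) <= M0"
  and F: "holomorphic_on_Cn F U" "intbl (%z. indicator U z * (cmod (F z))^2)"
  and th: "0 < \<theta>" "\<theta> < 1"
 obtains F0 where "holomorphic_on_Cn F0 U"
  "(NNL z. indicator {z\<in>U. r z <= -1} z * ennreal ((1 - \<theta>)^2 * (cmod (of_real (b (\<psi> z)) * F z - F0 z))^2 / b (\<psi> z)))
   <= ennreal (LBINT z. indicator U z * ((l1 (exp (\<psi> z)) - 1 + b (\<psi> z)) * (cmod (F z))^2))"
  "intbl (%z. indicator U z * ((l1 (exp (\<psi> z)) - 1 + b (\<psi> z)) * (cmod (F z))^2))"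
proof -
 let ?T = "{t0..t1}"
 have Tneg: "?T \<subseteq> {..<0}" using psi(4) by auto
 have pn: "\<psi> z < 0" if "z \<in> U" for z using psi(2)[OF that] psi(4) by simp
 have pT: "\<psi> ` U \<subseteq> ?T" using psi(2) by blast
 have pneg: "\<psi> ` U \<subseteq> {..<0}" using pT Tneg by blast
 have pc: "continuous_on U \<psi>" and rc: "continuous_on U r" by (rule c2_continuous[OF psi(1)], rule c2_continuous[OF r(1)])
 have cp: "continuous_on U (%z. g (\<psi> z))" if "continuous_on {..<0} g" for g :: "real => real"
  by (rule continuous_on_compose2[OF that pc pneg])
 obtain tm where tm: "tm \<in> ?T" "!!t. t \<in> ?T ==> q tm <= q t"
  using continuous_attains_inf[OF compact_Icc _ continuous_on_subset[OF cont_neg(7) Tneg]] psi(3) by auto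
 have tm0: "tm < 0" using tm(1) psi(4) by simp
 \<comment> \<open>\<delta> pays for separating the cross term between \<psi> and r. It stays below
   \<open>\<theta> * q\<close> on the whole range of \<psi>, so that \<open>1 - 1 / S\<close> loses
   only the factor \<open>1 - \<theta>\<close>.\<close>
 define \<delta> where "\<delta> = \<theta> * q tm"
 have dl: "\<delta> > 0" using th q_bounds[OF tm0] by (simp add: \<delta>_def)
 have dq: "\<delta> <= \<theta> * q (\<psi> z)" if "z \<in> U" for z using tm(2)[OF psi(2)[OF that]] th by (simp add: \<delta>_def)
 \<comment> \<open>The first entry gives \<open>2 * k \<le> X\<close>, so the correction never
   raises the cost of the source. The second makes the second derivative
   \<open>6 * \<theta> / y^4\<close> of X dominate \<open>2 / \<delta>\<close> times the square of
   \<open>k1\<close>.\<close>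
 define c where "c = min (\<theta> / 2) (3 * \<delta> * \<theta>)"
 have c: "c > 0" "2 * c <= \<theta>" "c <= 3 * \<delta> * \<theta>" using th dl by (auto simp: c_def)
 define X X1 X2 where "X y = \<theta> / y\<^sup>2" and "X1 y = - 2 * \<theta> / y ^ 3" and "X2 y = 6 * \<theta> / y ^ 4" for y :: real
 define k k1 k2 where "k y = ln (1 + c / y\<^sup>2)" and "k1 y = - 2 * c / (y ^ 3 + c * y)" and "k2 y = 2 * c * (3 * y\<^sup>2 + c) / (y ^ 3 + c * y)^2" for y :: real
 have ny: "y ^ 3 + c * y \<noteq> 0" if "y < 0" for y
 proof -
  have "y ^ 3 + c * y = y * (y\<^sup>2 + c)" by (simp add: power2_eq_square power3_eq_cube algebra_simps)
  moreover have "y\<^sup>2 + c > 0" using c(1) by (simp add: add_nonneg_pos)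
  ultimately show ?thesis using that by simp
 qed
 have Xd: "(X has_real_derivative X1 y) (at y)" "(X1 has_real_derivative X2 y) (at y)" if "y < 0" for y
  unfolding X_def[abs_def] X1_def[abs_def] X2_def using that by (auto intro!: derivative_eq_intros simp: field_simps power2_eq_square eval_nat_numeral)
 have kd: "(k has_real_derivative k1 y) (at y)" "(k1 has_real_derivative k2 y) (at y)" if y: "y < 0" for y
 proof -
  have p: "1 + c / y\<^sup>2 > 0" using c(1) by (simp add: add_pos_nonneg)
  have "(k has_real_derivative (- (c * (2 * y)) / (y\<^sup>2)^2) / (1 + c / y\<^sup>2)) (at y)" unfolding k_def[abs_def]
   using p y by (auto intro!: derivative_eq_intros simp: power2_eq_square)
  moreover have "(- (c * (2 * y)) / (y\<^sup>2)^2) / (1 + c / y\<^sup>2) = k1 y"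
  proof -
   define s where "s = y\<^sup>2 + c"
   have s: "s > 0" using c(1) by (simp add: s_def add_nonneg_pos)
   have e: "y ^ 3 + c * y = y * s" "1 + c / y\<^sup>2 = s / y\<^sup>2" using y by (simp_all add: s_def power2_eq_square power3_eq_cube field_simps)
   show ?thesis unfolding k1_def e using y s by (simp add: field_simps power2_eq_square)
  qed
  ultimately show "(k has_real_derivative k1 y) (at y)" by simp
  show "(k1 has_real_derivative k2 y) (at y)" unfolding k1_def[abs_def] k2_def
   using ny[OF y] by (auto intro!: derivative_eq_intros simp: power2_eq_square)
 qed
 have rneg: "r ` U \<subseteq> {..<0}" using r(2) by auto
 have Xc: "continuous_on {..<0} X2" unfolding X2_def[abs_def] by (auto intro!: continuous_intros)
 have kc: "continuous_on {..<0} k2" unfolding k2_def[abs_def] using ny by (auto intro!: continuous_intros)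
 have cMpsi: "c2 U (%z. M (\<psi> z))" by (rule c2_compose[OF psi(1) U MN_deriv(1)[OF pn] MN_deriv(2)[OF pn] continuous_on_subset[OF cont_neg(5) pneg]])
 have cNpsi: "c2 U (%z. N (\<psi> z))" by (rule c2_compose[OF psi(1) U MN_deriv(3)[OF pn] MN_deriv(4)[OF pn] continuous_on_subset[OF cont_neg(6) pneg]])
 have cXr: "c2 U (%z. X (r z))" by (rule c2_compose[OF r(1) U Xd(1)[OF r(2)] Xd(2)[OF r(2)] continuous_on_subset[OF Xc rneg]])
 have ckr: "c2 U (%z. k (r z))" by (rule c2_compose[OF r(1) U kd(1)[OF r(2)] kd(2)[OF r(2)] continuous_on_subset[OF kc rneg]])
 define xi zeta where "xi z = M (\<psi> z) + X (r z)" and "zeta z = N (\<psi> z) + (X (r z) - k (r z))" for z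
 have cxi: "c2 U xi" unfolding xi_def[abs_def] by (rule c2_add[OF cMpsi cXr U])
 have czeta: "c2 U zeta" unfolding zeta_def[abs_def] by (rule c2_add[OF cNpsi c2_diff[OF cXr ckr U] U])
 define A where "A z = of_real (b (\<psi> z)) * F z" for z
 have cF1: "c1 U F" by (rule c2_c1[OF holomorphic_c2[OF F(1)]])
 have cb: "c1 U (%z. b (\<psi> z))" by (rule c1_compose[OF c2_c1[OF psi(1)] b_deriv[OF pn] continuous_on_subset[OF cont_neg(4) pneg]])
 have cA: "c1 U A" unfolding A_def[abs_def] by (rule c1_mult[OF c1_cr[OF cb] cF1])
 \<comment> \<open>The ideal value is \<open>1 / (1 - q)\<close>; dividing by
   \<open>1 + \<delta>\<close> leaves room for the terms in r.\<close>
 define S where "S z = (1 / (1 - q (\<psi> z))) / (1 + \<delta>)" for z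
 define Rt where "Rt t = b1 t * m t / (1 - exp t)" for t
 define R where "R z = Rt (\<psi> z) * (cmod (F z))^2" for z
 have qn: "1 - q (\<psi> z) >= 1/2" "q (\<psi> z) > 0" if "z \<in> U" for z using q_bounds[OF pn[OF that]] by auto
 have S_inv: "1 / S z = (1 + \<delta>) * (1 - q (\<psi> z))" if "z \<in> U" for z using qn(1)[OF that] dl by (simp add: S_def)
 have S_low: "1 - 1 / S z >= (1 - \<theta>) * q (\<psi> z)" if z: "z \<in> U" for z
 proof -
  have "\<delta> * (1 - q (\<psi> z)) <= \<delta> * 1" using dl qn(2)[OF z] by (intro mult_left_mono) auto
  thus ?thesis unfolding S_inv[OF z] using dq[OF z] by (simp add: algebra_simps)
 qed
 have S_pos: "S z > 0" if "z \<in> U" for z using qn(1)[OF that] dl by (simp add: S_def)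
 have S1: "S z > 1" if z: "z \<in> U" for z
 proof -
  have "(1 - \<theta>) * q (\<psi> z) > 0" using th qn(2)[OF z] by simp
  hence "1 / S z < 1" using S_low[OF z] by linarith
  thus ?thesis using S_pos[OF z] by (simp add: field_simps)
 qed
 have Sc: "continuous_on U S" unfolding S_def[abs_def] using qn(1) dl by (intro continuous_intros cp[OF cont_neg(7)]) (force+)
 have Rtc: "continuous_on {..<0} Rt" unfolding Rt_def[abs_def] by (intro continuous_intros cont_neg) auto
 have Fc: "continuous_on U F" by (rule holomorphic_on_Cn_continuous[OF F(1)])
 have Rc: "continuous_on U R" unfolding R_def[abs_def] by (intro continuous_intros cp[OF Rtc] Fc)
 have Rt0: "Rt t >= 0" if "t < 0" for t using b1_nonneg[OF that] m_pos[OF that] that by (simp add: Rt_def)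
 have R0: "R z >= 0" if "z \<in> U" for z using Rt0[OF pn[OF that]] by (simp add: R_def)
 have levxi: "lev xi z v = M1 (\<psi> z) * lev \<psi> z v + M2 (\<psi> z) * (cmod (pd \<psi> z v))^2 + (X1 (r z) * lev r z v + X2 (r z) * (cmod (pd r z v))^2)" if z: "z \<in> U" for z v
 proof -
  have "c1 U (%x. M1 (\<psi> x))" by (rule c1_compose[OF c2_c1[OF psi(1)] MN_deriv(2)[OF pn] continuous_on_subset[OF cont_neg(5) pneg]])
  note 1 = lev_compose[where g=M and g'=M1 and g''=M2, OF psi(1) U z MN_deriv(1)[OF pn] MN_deriv(2)[OF pn[OF z]] this]
  have "c1 U (%x. X1 (r x))" by (rule c1_compose[OF c2_c1[OF r(1)] Xd(2)[OF r(2)] continuous_on_subset[OF Xc rneg]])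
  note 2 = lev_compose[where g=X and g'=X1 and g''=X2, OF r(1) U z Xd(1)[OF r(2)] Xd(2)[OF r(2)[OF z]] this]
  show ?thesis unfolding xi_def[abs_def] lev_add[OF cMpsi cXr U z] using 1[of v] 2[of v] by simp
 qed
 have pdd: "pd (%z. zeta z - xi z) z v = of_real (N1 (\<psi> z) - M1 (\<psi> z)) * pd \<psi> z v + of_real (- k1 (r z)) * pd r z v" if z: "z \<in> U" for z v
 proof -
  have e: "cr (%z. zeta z - xi z) = (%z. complex_of_real (N (\<psi> z) - M (\<psi> z)) + complex_of_real (- k (r z)))"
   by (auto simp: zeta_def xi_def fun_eq_iff)
  have d1: "dz j (%z. complex_of_real (N (\<psi> z) - M (\<psi> z))) z = of_real (N1 (\<psi> z) - M1 (\<psi> z)) * dz j (cr \<psi>) z" for j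
   by (rule wirt_compose(1)[OF c2_c1[OF psi(1)] z, of "%t. N t - M t"]) (intro DERIV_diff MN_deriv pn z)
  have d2: "dz j (%z. complex_of_real (- k (r z))) z = of_real (- k1 (r z)) * dz j (cr r) z" for j
   by (rule wirt_compose(1)[OF c2_c1[OF r(1)] z, of "%t. - k t"]) (intro DERIV_minus kd r(2) z)
  have dj: "dz j (cr (%z. zeta z - xi z)) z = of_real (N1 (\<psi> z) - M1 (\<psi> z)) * dz j (cr \<psi>) z + of_real (- k1 (r z)) * dz j (cr r) z" for j
   unfolding e d1[symmetric] d2[symmetric]
   by (rule wirt_add(1)[OF c1_cr[OF c1_diff[OF c2_c1[OF cNpsi] c2_c1[OF cMpsi]]] c1_cr[OF c1_minus[OF c2_c1[OF ckr]]] z])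
  show ?thesis unfolding pd_def dj by (simp only: distrib_right sum.distrib sum_distrib_left mult.assoc)
 qed
 have main: "lev xi z v - S z * (cmod (pd (%z. zeta z - xi z) z v))^2 >= ((1 - exp (\<psi> z)) * b1 (\<psi> z) / m (\<psi> z)) * (cmod (pd \<psi> z v))^2" if z: "z \<in> U" for z v
 proof -
  define P Q lam S0 where "P = (cmod (pd \<psi> z v))^2" and "Q = (cmod (pd r z v))^2" and "lam = N1 (\<psi> z) - M1 (\<psi> z)" and "S0 = 1 / (1 - q (\<psi> z))"
  have PQ: "P >= 0" "Q >= 0" by (simp_all add: P_def Q_def)
  have rz: "r z < 0" by (rule r(2)[OF z])
  have S0: "0 < S0" "S0 <= 2" using qn(1)[OF z] by (simp_all add: S0_def field_simps)
  have "(cmod (pd (%z. zeta z - xi z) z v))^2 <= (1 + \<delta>) * (lam\<^sup>2 * P) + (1 + 1 / \<delta>) * ((k1 (r z))^2 * Q)"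
   unfolding pdd[OF z] using cmod_add_sq_le'[OF dl, of "of_real lam * pd \<psi> z v" "of_real (- k1 (r z)) * pd r z v"]
   by (simp add: norm_mult power_mult_distrib P_def Q_def lam_def del: of_real_diff)
  hence "S z * (cmod (pd (%z. zeta z - xi z) z v))^2 <= S z * ((1 + \<delta>) * (lam\<^sup>2 * P) + (1 + 1 / \<delta>) * ((k1 (r z))^2 * Q))"
   using S_pos[OF z] by (intro mult_left_mono) auto
  also have "... = S0 * lam\<^sup>2 * P + S0 / \<delta> * ((k1 (r z))^2 * Q)"
  proof -
   define D where "D = 1 + \<delta>"
   have D: "D > 0" "1 + 1 / \<delta> = D / \<delta>" using dl by (simp_all add: D_def field_simps)
   have "S0 / D * (D * a + D / \<delta> * d) = S0 * a + S0 / \<delta> * d" for a d using dl D(1) by (simp add: field_simps)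
   from this[of "lam\<^sup>2 * P" "(k1 (r z))^2 * Q"] show ?thesis unfolding D(2) by (simp add: S_def S0_def D_def mult.assoc)
  qed
  also have "S0 / \<delta> * ((k1 (r z))^2 * Q) <= X2 (r z) * Q"
  proof -
   define y where "y = r z"
   have y: "y < 0" using rz by (simp add: y_def)
   have y4: "y ^ 4 > 0" using y by (simp add: zero_less_power_eq)
   have e: "y ^ 3 + c * y = y * (y\<^sup>2 + c)" by (simp add: power2_eq_square power3_eq_cube algebra_simps)
   \<comment> \<open>The arithmetic-geometric mean inequality; it bounds the square of
     \<open>k1 y\<close> by \<open>c / y^4\<close>.\<close>
   have "4 * c * y\<^sup>2 <= (y\<^sup>2 + c)^2" using zero_le_power2[of "y\<^sup>2 - c"] by (simp add: power2_eq_square algebra_simps)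
   hence "4 * c * y ^ 4 <= (y ^ 3 + c * y)^2" unfolding e power_mult_distrib
    using mult_left_mono[of "4 * c * y\<^sup>2" "(y\<^sup>2 + c)^2" "y\<^sup>2"] by (simp add: power4_eq_xxxx power2_eq_square algebra_simps)
   hence "4 * c\<^sup>2 / (y ^ 3 + c * y)^2 <= 4 * c\<^sup>2 / (4 * c * y ^ 4)" using c(1) y4 by (intro divide_left_mono mult_pos_pos) (auto simp: ny[OF y])
   also have "... = c / y ^ 4" using c(1) by (simp add: power2_eq_square)
   finally have "(k1 y)^2 <= c / y ^ 4" by (simp add: k1_def power_divide power_mult_distrib)
   hence "S0 / \<delta> * (k1 y)^2 <= 2 / \<delta> * (c / y ^ 4)" using S0 dl by (intro mult_mono divide_right_mono) auto
   also have "... = (2 * c / \<delta>) / y ^ 4" by simp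
   also have "... <= (6 * \<theta>) / y ^ 4" using c(3) dl y4 by (intro divide_right_mono) (auto simp: field_simps)
   finally have "S0 / \<delta> * (k1 y)^2 <= X2 y" by (simp add: X2_def)
   from mult_right_mono[OF this PQ(2)] show ?thesis by (simp add: y_def mult.assoc)
  qed
  finally have a: "S z * (cmod (pd (%z. zeta z - xi z) z v))^2 <= S0 * lam\<^sup>2 * P + X2 (r z) * Q" by simp
  have "M1 (\<psi> z) * lev \<psi> z v >= 0" using M1_pos[OF pn[OF z]] psi(5)[OF z, of v] by simp
  moreover have "X1 (r z) * lev r z v >= 0"
  proof -
   have "r z ^ 3 < 0" using rz by (simp add: power_less_zero_eq)
   hence "X1 (r z) >= 0" unfolding X1_def using th by (intro divide_nonpos_neg) auto
   thus ?thesis using r(3)[OF z, of v] by simp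
  qed
  ultimately have "lev xi z v >= M2 (\<psi> z) * P + X2 (r z) * Q" unfolding levxi[OF z] P_def Q_def by simp
  hence "lev xi z v - S z * (cmod (pd (%z. zeta z - xi z) z v))^2 >= (M2 (\<psi> z) - S0 * lam\<^sup>2) * P" using a by (simp add: algebra_simps)
  thus ?thesis unfolding S0_def lam_def weight_identity[OF pn[OF z]] P_def .
 qed
 have nn: "0 <= lev xi z v - S z * (cmod (pd (%z. zeta z - xi z) z v))^2" if z: "z \<in> U" for z v
 proof (rule order_trans[OF _ main[OF z]])
  show "0 <= ((1 - exp (\<psi> z)) * b1 (\<psi> z) / m (\<psi> z)) * (cmod (pd \<psi> z v))^2"
   using pn[OF z] b1_nonneg[OF pn[OF z]] m_pos[OF pn[OF z]] by (intro mult_nonneg_nonneg divide_nonneg_pos) auto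
 qed
 have key: "(cmod (\<Sum>j\<in>UNIV. db j A z * cnj (v $ j)))^2 <= R z * (lev xi z v - S z * (cmod (pd (%z. zeta z - xi z) z v))^2)" if z: "z \<in> U" for z v
 proof -
  have "db j A z = of_real (b1 (\<psi> z)) * cnj (dz j (cr \<psi>) z) * F z" for j
   unfolding A_def[abs_def] wirt_mult(2)[OF c1_cr[OF cb] cF1 z] holomorphic_db_zero[OF F(1) z]
    wirt_compose(2)[OF c2_c1[OF psi(1)] z b_deriv[OF pn[OF z]]] wirt_real[OF c2_c1[OF psi(1)] z] by simp
  hence "(\<Sum>j\<in>UNIV. db j A z * cnj (v $ j)) = of_real (b1 (\<psi> z)) * F z * cnj (pd \<psi> z v)"
   by (simp add: pd_def sum_distrib_left mult_ac)
  hence "(cmod (\<Sum>j\<in>UNIV. db j A z * cnj (v $ j)))^2 = (b1 (\<psi> z))^2 * (cmod (F z))^2 * (cmod (pd \<psi> z v))^2"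
   by (simp add: norm_mult power_mult_distrib)
  also have "... = R z * (((1 - exp (\<psi> z)) * b1 (\<psi> z) / m (\<psi> z)) * (cmod (pd \<psi> z v))^2)"
   unfolding weight_values(3)[OF pn[OF z]] by (simp add: R_def Rt_def)
  also have "... <= R z * (lev xi z v - S z * (cmod (pd (%z. zeta z - xi z) z v))^2)" by (rule mult_left_mono[OF main[OF z] R0[OF z]])
  finally show ?thesis .
 qed
 define B where "B t = l1 (exp t) - 1 + b t" for t
 have Bv: "B t = exp (M t - 2 * N t) * Rt t" "B t >= 0" if "t < 0" for t
 proof -
  show "B t = exp (M t - 2 * N t) * Rt t" using weight_values(1)[OF that] unfolding B_def Rt_def by linarith
  thus "B t >= 0" using Rt0[OF that] by simp
 qed
 define E where "E z = exp (2 * k (r z) - X (r z))" for z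
 have ex: "exp (xi z - 2 * zeta z) = exp (M (\<psi> z) - 2 * N (\<psi> z)) * E z" for z
  by (simp add: xi_def zeta_def E_def mult_exp_exp algebra_simps)
 have kr: "2 * k y <= X y" "k y >= 0" if "y < 0" for y
 proof -
  have "k y <= c / y\<^sup>2" unfolding k_def using c(1) ln_add_one_self_le_self[of "c / y\<^sup>2"] by simp
  also have "... <= (\<theta> / 2) / y\<^sup>2" using c(2) by (intro divide_right_mono) auto
  finally show "2 * k y <= X y" by (simp add: X_def)
  show "k y >= 0" unfolding k_def using c(1) by (intro ln_ge_zero) simp
 qed
 have E1: "E z <= 1" "E z > 0" if "z \<in> U" for z using kr(1)[OF r(2)[OF that]] by (simp_all add: E_def)
 have bB: "continuous_on {..<0} B"
 proof -
  have "continuous_on {0..1} l1" using DERIV_isCont[OF d2] by (auto intro!: continuous_at_imp_continuous_on)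
  hence "continuous_on {..<0} (%t. l1 (exp t))" by (rule continuous_on_compose2) (auto intro!: continuous_intros)
  thus ?thesis unfolding B_def[abs_def] by (intro continuous_intros cont_neg)
 qed
 obtain BB where BB: "!!t. t \<in> ?T ==> \<bar>B t\<bar> <= BB"
 proof -
  have "bounded (B ` ?T)" by (intro compact_imp_bounded compact_continuous_image continuous_on_subset[OF bB Tneg]) auto
  thus ?thesis using that unfolding bounded_iff by (metis imageI real_norm_def)
 qed
 have mi: "(%z. indicator U z * g z) \<in> borel_measurable borel" if "continuous_on U g" for g :: "complex ^ 'n => real"
  using borel_measurable_continuous_on_indicator[OF _ that] U by simp
 have iB: "intbl (%z. indicator U z * (B (\<psi> z) * (cmod (F z))^2))"
 proof (rule bi_integrable_bound[OF integrable_mult_left[OF F(2), of BB]])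
  show "(%z. indicator U z * (B (\<psi> z) * (cmod (F z))^2)) \<in> borel_measurable lborel" using mi[of "%z. B (\<psi> z) * (cmod (F z))^2"] by (simp add: cp[OF bB] Fc continuous_intros)
  have "\<bar>B (\<psi> z)\<bar> * (cmod (F z))^2 <= \<bar>csq (F z) * BB\<bar>" if "z \<in> U" for z
  proof -
   have "\<bar>B (\<psi> z)\<bar> * (cmod (F z))^2 <= BB * (cmod (F z))^2" using BB[OF psi(2)[OF that]] by (intro mult_right_mono) auto
   thus ?thesis by (simp add: mult.commute)
  qed
  thus "AE z in lborel. norm (indicator U z * (B (\<psi> z) * (cmod (F z))^2)) <= norm (indicator U z * (cmod (F z))^2 * BB)"
   by (intro AE_I2) (auto simp: indicator_def abs_mult)
 qed
 have XRle: "exp (xi z - 2 * zeta z) * R z <= B (\<psi> z) * (cmod (F z))^2" if z: "z \<in> U" for z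
 proof -
  have "exp (xi z - 2 * zeta z) * R z = (B (\<psi> z) * (cmod (F z))^2) * E z" unfolding ex R_def Bv(1)[OF pn[OF z]] by simp
  also have "... <= (B (\<psi> z) * (cmod (F z))^2) * 1" using E1(1)[OF z] Bv(2)[OF pn[OF z]] by (intro mult_left_mono) auto
  finally show ?thesis by simp
 qed
 have xc: "continuous_on U xi" "continuous_on U zeta" by (rule c2_continuous[OF cxi], rule c2_continuous[OF czeta])
 have iC: "intbl (%z. indicator U z * (exp (xi z - 2 * zeta z) * R z))"
 proof (rule bi_integrable_bound[OF iB])
  have "continuous_on U (%z. exp (xi z - 2 * zeta z) * R z)" by (intro continuous_intros xc Rc)
  thus "(%z. indicator U z * (exp (xi z - 2 * zeta z) * R z)) \<in> borel_measurable lborel" using mi by simp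
  show "AE z in lborel. norm (indicator U z * (exp (xi z - 2 * zeta z) * R z)) <= norm (indicator U z * (B (\<psi> z) * (cmod (F z))^2))"
   using XRle R0 Bv(2)[OF pn] by (intro AE_I2) (auto simp: indicator_def abs_mult)
 qed
 define C0 where "C0 = (LBINT z. indicator U z * (B (\<psi> z) * (cmod (F z))^2))"
 have C0: "(LBINT z. indicator U z * (exp (xi z - 2 * zeta z) * R z)) <= C0"
  unfolding C0_def by (rule integral_mono[OF iC iB]) (use XRle in \<open>auto simp: indicator_def\<close>)
 obtain u :: "complex ^ 'n => complex" and w :: "complex ^ 'n => complex ^ 'n ^ 'n" where u: "u \<in> borel_measurable borel"
  "intbl (%z. indicator U z * (exp (xi z - 2 * zeta z) * (1 - 1 / S z) * (cmod (u z))^2))"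
  "(LBINT z. indicator U z * (exp (xi z - 2 * zeta z) * (1 - 1 / S z) * (cmod (u z))^2)) <= C0"
  and w: "w \<in> borel_measurable borel" "intbl (%z. (norm (w z))^2)"
  and weak: "!!be. tst U be ==> (LBINT z. exp (- zeta z) * (A z \<bullet> del zeta be z)) - (LBINT z. exp (- zeta z) * (u z \<bullet> del zeta be z))
    = - (LBINT z. w z \<bullet> (sqrt (exp (- xi z) / 2) *\<^sub>R curl be z))
    \<and> intbl (%z. exp (- zeta z) * (u z \<bullet> del zeta be z))"
  by (rule l2_solve[OF U cxi czeta cA Sc S1 Rc R0 nn key iC C0]) (assumption | rule that)+
 define g where "g z = exp (xi z - 2 * zeta z) * (1 - 1 / S z)" for z
 have gc: "continuous_on U g" unfolding g_def[abs_def] using S_pos by (intro continuous_intros xc Sc) force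
 have g0: "g z > 0" if z: "z \<in> U" for z
  unfolding g_def using S1[OF z] by (intro mult_pos_pos) auto
 have Ac: "continuous_on U A" by (rule c1_continuous[OF cA])
 note ug = u(2)[folded g_def] note uC = u(3)[folded g_def]
 define f where "f z = A z - u z" for z
 have fK: "intbl (%z. indicator K z *\<^sub>R f z)" if K: "compact K" "K \<subseteq> U" for K
 proof -
  have "intbl (%z. indicator K z *\<^sub>R A z)" by (rule borel_integrable_compact[OF K(1) continuous_on_subset[OF Ac K(2)]])
  from bi_integrable_diff[OF this L2_loc(2)[OF gc g0 u(1) ug K]] show ?thesis by (simp add: f_def scaleR_diff_right)
 qed
 have fweak: "(LBINT z. exp (- zeta z) * (f z \<bullet> del zeta be z)) = - (LBINT z. w z \<bullet> (sqrt (exp (- xi z) / 2) *\<^sub>R curl be z))" if be: "tst U be" for be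
 proof -
  obtain K where K: "compact K" "K \<subseteq> U" "!!z. z \<notin> K ==> be z = 0" and b2: "c2 UNIV be" using be by (auto simp: tst_def)
  have i1: "intbl (%z. exp (- zeta z) * (A z \<bullet> del zeta be z))" by (rule dbar_adjoint(2)[OF U czeta cA b2 K])
  have "(LBINT z. exp (- zeta z) * (f z \<bullet> del zeta be z)) = (LBINT z. exp (- zeta z) * (A z \<bullet> del zeta be z) - exp (- zeta z) * (u z \<bullet> del zeta be z))"
   by (simp add: f_def inner_diff_left right_diff_distrib)
  also have "... = (LBINT z. exp (- zeta z) * (A z \<bullet> del zeta be z)) - (LBINT z. exp (- zeta z) * (u z \<bullet> del zeta be z))"
   by (rule bi_integral_diff[OF i1 conjunct2[OF weak[OF be]]])
  finally show ?thesis using conjunct1[OF weak[OF be]] by simp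
 qed
 have cNM: "continuous_on {..<0} (%t. exp ((N t - M t) / 2))"
 proof -
  have "continuous_on {..<0} N" "continuous_on {..<0} M" using DERIV_isCont[OF MN_deriv(1)] DERIV_isCont[OF MN_deriv(3)] by (auto intro!: continuous_at_imp_continuous_on)
  thus ?thesis by (intro continuous_intros) auto
 qed
 obtain CN where CN: "CN > 0" "!!t. t \<in> ?T ==> exp ((N t - M t) / 2) <= CN"
 proof -
  have "bounded ((%t. exp ((N t - M t) / 2)) ` ?T)" by (intro compact_imp_bounded compact_continuous_image continuous_on_subset[OF cNM Tneg]) auto
  thus ?thesis using that unfolding bounded_pos by auto
 qed
 define cq where "cq = CN / sqrt c"
 have cc: "cq > 0" unfolding cq_def using CN c by (intro divide_pos_pos) auto
 \<comment> \<open>The part in \<psi> is bounded since \<psi> ranges in a compact interval of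
   negative numbers; \<open>exp (- k / 2)\<close> is at most \<open>- r / sqrt c\<close> since the 1
   inside the logarithm may be dropped.\<close>
 have wgt: "exp ((zeta z - xi z) / 2) <= cq * \<bar>r z\<bar>" if z: "z \<in> U" for z
 proof -
  have rz: "r z < 0" by (rule r(2)[OF z])
  have "exp ((zeta z - xi z) / 2) = exp ((N (\<psi> z) - M (\<psi> z)) / 2) * exp (- (k (r z) / 2))"
   by (simp add: zeta_def xi_def mult_exp_exp field_simps)
  also have "... <= CN * (\<bar>r z\<bar> / sqrt c)"
  proof (rule mult_mono[OF CN(2)[OF psi(2)[OF z]]])
   have p: "1 + c / (r z)^2 > 0" using c(1) by (simp add: add_pos_nonneg)
   have "exp (k (r z) / 2) = sqrt (1 + c / (r z)^2)"
   proof (rule sym, rule real_sqrt_unique)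
    show "(exp (k (r z) / 2))^2 = 1 + c / (r z)^2" unfolding k_def using p by (simp add: exp_double[symmetric] flip: exp_of_nat_mult)
   qed simp
   moreover have "sqrt (c / (r z)^2) <= sqrt (1 + c / (r z)^2)" by simp
   moreover have "sqrt (c / (r z)^2) = sqrt c / \<bar>r z\<bar>" by (simp add: real_sqrt_divide)
   ultimately have h: "sqrt c / \<bar>r z\<bar> <= exp (k (r z) / 2)" by simp
   have p2: "sqrt c / \<bar>r z\<bar> > 0" using c(1) rz by (intro divide_pos_pos) auto
   have "exp (- (k (r z) / 2)) = 1 / exp (k (r z) / 2)" by (simp add: exp_minus field_simps)
   also have "... <= 1 / (sqrt c / \<bar>r z\<bar>)" using h p2 by (intro divide_left_mono mult_pos_pos) auto
   finally show "exp (- (k (r z) / 2)) <= \<bar>r z\<bar> / sqrt c" by simp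
  qed (use CN in auto)
  finally show ?thesis by (simp add: cq_def)
 qed
 have wk: "(LBINT z. f z \<bullet> dv Bt z) = 0" if Bt: "tst U Bt" for Bt
 proof (rule weak_dbar_zero[OF U cxi czeta fK fweak w _ Bt])
  fix K \<tau> assume K: "compact K" "K \<subseteq> U" and \<tau>: "(\<tau>::real) > 0"
  have t': "\<tau> / cq > 0" using \<tau> cc by simp
  obtain eta L where eL: "c2 UNIV eta" "\<forall>z. 0 <= eta z \<and> eta z <= 1" "compact L" "L \<subseteq> U" "\<forall>z. z \<notin> L --> eta z = 0" "\<forall>z\<in>K. eta z = 1"
   "\<forall>z\<in>L. \<forall>j. cmod (db j (cr eta) z) * \<bar>r z\<bar> <= \<tau> / cq" using log_cutoff[OF U r(1,2,4) M0 K t'] by blast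
  have "cmod (db j (cr eta) z) * exp ((zeta z - xi z) / 2) <= \<tau>" if z: "z \<in> L" for z j
  proof -
   have "cmod (db j (cr eta) z) * exp ((zeta z - xi z) / 2) <= cmod (db j (cr eta) z) * (cq * \<bar>r z\<bar>)"
    using wgt[of z] z eL(4) by (intro mult_left_mono) auto
   also have "... = cq * (cmod (db j (cr eta) z) * \<bar>r z\<bar>)" by simp
   also have "... <= cq * (\<tau> / cq)" using eL(7) z cc by (intro mult_left_mono) auto
   also have "... = \<tau>" using cc by simp
   finally show ?thesis .
  qed
  thus "\<exists>eta L. c2 UNIV eta \<and> (\<forall>z. 0 <= eta z \<and> eta z <= 1) \<and> compact L \<and> L \<subseteq> U \<and> (\<forall>z. z \<notin> L --> eta z = 0)
    \<and> (\<forall>z\<in>K. eta z = 1) \<and> (\<forall>z\<in>L. \<forall>j. cmod (db j (cr eta) z) * exp ((zeta z - xi z) / 2) <= \<tau>)"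
   using eL(1-6) by (intro exI[of _ eta] exI[of _ L]) simp
 qed
 obtain F0 where F0: "holomorphic_on_Cn F0 U" "!!z e. e > 0 ==> cball z (2 * e) \<subseteq> U ==> F0 z = conv (moll e) f z"
  by (rule weyl[OF U fK wk]) (assumption | rule that)+
 have fat: "(NNL z. indicator U z * ennreal (g z * (cmod (A z - F0 z))^2)) <= ennreal (LBINT z. indicator U z * (g z * (cmod (u z))^2))"
  by (rule weyl_fatou[OF U Ac gc g0 u(1) ug holomorphic_on_Cn_continuous[OF F0(1)] F0(2)[unfolded f_def[abs_def]]])
 have glow: "(1 - \<theta>)^2 / b (\<psi> z) <= g z" if z: "z \<in> U" "r z <= -1" for z
 proof -
  have "(r z)^2 >= 1" using z(2) abs_le_square_iff[of 1 "r z"] by simp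
  hence "X (r z) <= \<theta>" using th by (simp add: X_def divide_le_eq mult_le_cancel_left1)
  hence "1 - \<theta> <= 1 + (2 * k (r z) - X (r z))" using kr(2)[OF r(2)[OF z(1)]] by simp
  also have "... <= E z" unfolding E_def by (rule exp_ge_add_one_self)
  finally have e: "1 - \<theta> <= E z" .
  have "(1 - \<theta>)^2 / b (\<psi> z) = exp (M (\<psi> z) - 2 * N (\<psi> z)) * ((1 - \<theta>) * ((1 - \<theta>) * q (\<psi> z)))"
   using weight_values(2)[OF pn[OF z(1)]] by (simp add: power2_eq_square divide_inverse mult_ac)
  also have "... <= exp (M (\<psi> z) - 2 * N (\<psi> z)) * (E z * (1 - 1 / S z))"
   using e S_low[OF z(1)] th qn(2)[OF z(1)] E1(2)[OF z(1)] by (intro mult_left_mono mult_mono) auto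
  also have "... = g z" unfolding g_def ex by simp
  finally show ?thesis .
 qed
 have "(NNL z. indicator {z\<in>U. r z <= -1} z * ennreal ((1 - \<theta>)^2 * (cmod (of_real (b (\<psi> z)) * F z - F0 z))^2 / b (\<psi> z)))
   <= (NNL z. indicator U z * ennreal (g z * (cmod (A z - F0 z))^2))"
 proof (rule nn_integral_mono)
  fix z
  show "indicator {z\<in>U. r z <= -1} z * ennreal ((1 - \<theta>)^2 * (cmod (of_real (b (\<psi> z)) * F z - F0 z))^2 / b (\<psi> z))
   <= indicator U z * ennreal (g z * (cmod (A z - F0 z))^2)"
   using mult_right_mono[OF glow[of z], of "(cmod (A z - F0 z))^2"] by (auto simp: indicator_def A_def intro!: ennreal_leI)
 qed
 also have "... <= ennreal C0" using fat ennreal_leI[OF uC] by (rule order_trans)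
 finally show ?thesis using that[OF F0(1)] iB unfolding C0_def B_def by blast
qed

end

section \<open>Extension on the whole domain\<close>

lemma lev_diff_const:
 assumes "c2 U f" "open U" "z \<in> U" shows "lev (%z. f z - c) z b = lev f z b"
proof -
 have "dz j (cr (%z. f z - c)) y = dz j (cr f) y" if "y \<in> U" for y j
  using wirt_diff(1)[OF c1_cr[OF c2_c1[OF assms(1)]] c1_const[of U "complex_of_real c"] that, of j] by (simp add: wirt_const)
 hence "db k (dz j (cr (%z. f z - c))) z = db k (dz j (cr f)) z" for j k by (rule wirt_cong(2)[OF assms(2) _ assms(3)])
 thus ?thesis by (simp only: lev_def)
qed

text \<open>The index k sets the truncation level of \<open>p * \<phi>\<close>, the sublevel of
  \<rho> and the mollification radius. Subtracting \<open>1 / (k + 1)\<close> keeps \<psi> away from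
  0, where the weights degenerate. As \<phi> is only upper semicontinuous, an upper bound for \<psi>
  at a point comes from values of \<phi> on a small ball; this is the form of the last
  conclusion.\<close>

lemma exhaustion_step:
 fixes \<phi> :: "complex ^ 'n => ereal" and k :: nat
 assumes psh: "psh_on D \<phi>" "!!z. z \<in> D ==> \<phi> z < 0" and p: "p > 0"
  and rho: "continuous_on D \<rho>" "submean D \<rho>" "!!c. compact (closure {z\<in>D. \<rho> z < c})" "!!c. closure {z\<in>D. \<rho> z < c} \<subseteq> D"
 obtains U \<psi> r M0 where "open U" "U \<subseteq> D" "c2 U \<psi>" "!!z. z \<in> U ==> \<psi> z \<in> {- real k - 1.. - (1 / (real k + 1))}" "!!z b. z \<in> U ==> lev \<psi> z b >= 0"
  "c2 U r" "!!z. z \<in> U ==> r z < 0" "!!z b. z \<in> U ==> lev r z b >= 0" "!!c. c > 0 ==> compact {z\<in>U. r z <= - c}"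
  "!!z j. z \<in> U ==> cmod (db j (cr r) z) <= M0" "!!z. z \<in> U ==> ereal p * \<phi> z <= ereal (\<psi> z + 1 / (real k + 1))"
  "!!z. z \<in> D ==> \<rho> z <= real k - 1 ==> z \<in> U \<and> r z <= - 1"
  "!!z y. z \<in> U ==> y >= - real k ==> (\<forall>w\<in>D. dist z w < 1 / (real k + 1) --> ereal p * \<phi> w <= ereal y) ==> \<psi> z <= y"
proof -
 have D: "open D" using psh(1) by (simp add: psh_on_def)
 define v where "v z = real_of_ereal (max (ereal p * \<phi> z) (ereal (- real k)))" for z
 have sv: "submean D v" unfolding v_def[abs_def] by (rule submean_of_psh[OF psh(1) p])
 have pz: "ereal p * \<phi> z < 0" if "z \<in> D" for z using psh(2)[OF that] p by (cases "\<phi> z") (auto simp: mult_pos_neg)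
 have ve: "ereal (v z) = max (ereal p * \<phi> z) (ereal (- real k))" if "z \<in> D" for z
  using pz[OF that] unfolding v_def by (cases "ereal p * \<phi> z") (auto simp: max_def)
 have v0: "v z <= 0" "- real k <= v z" "ereal p * \<phi> z <= ereal (v z)" if "z \<in> D" for z
 proof -
  have "ereal (v z) <= 0" unfolding ve[OF that] using pz[OF that] by simp
  thus "v z <= 0" by simp
  have "ereal (- real k) <= ereal (v z)" unfolding ve[OF that] by simp
  thus "- real k <= v z" by simp
  show "ereal p * \<phi> z <= ereal (v z)" unfolding ve[OF that] by simp
 qed
 \<comment> \<open>One unit of room: the mollified \<open>rr\<close> dominates \<rho> on V, so the
   points with \<open>rr \<le> k + 1 - c\<close> satisfy \<open>\<rho> < k + 2\<close>, and their
   set is closed.\<close>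
 define V where "V = {z\<in>D. \<rho> z < real k + 2}"
 define K1 where "K1 = closure V"
 have K1: "compact K1" "K1 \<subseteq> D" "V \<subseteq> K1" using rho(3,4)[of "real k + 2"] closure_subset[of V] by (simp_all only: K1_def V_def)
 have oV: "open V" unfolding V_def using rho(2) by (simp add: submean_def)
 obtain e0 where e0: "e0 > 0" "(\<Union>x\<in>K1. cball x e0) \<subseteq> D" using compact_subset_open_imp_cball_epsilon_subset[OF K1(1) D K1(2)] by blast
 define K where "K = (\<Union>x\<in>K1. cball x e0)"
 have K: "compact K" "K \<subseteq> D" unfolding K_def using compact_minkowski_sum_cball[OF K1(1)] e0 by auto
 have K1K: "K1 \<subseteq> K" using e0(1) by (force simp: K_def)
 have "uniformly_continuous_on K \<rho>" by (rule compact_uniformly_continuous[OF continuous_on_subset[OF rho(1) K(2)] K(1)])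
 then obtain e1 where e1: "e1 > 0" "!!x y. x \<in> K ==> y \<in> K ==> dist y x < e1 ==> dist (\<rho> y) (\<rho> x) < 1"
  unfolding uniformly_continuous_on_def by (metis zero_less_one)
 \<comment> \<open>\<open>e0\<close> keeps the balls inside K. \<open>e1\<close> makes \<rho> vary
   by less than 1, whence \<open>rr \<le> \<rho> + 1\<close>, and \<open>\<rho> \<le> k - 1\<close>
   implies \<open>r \<le> -1\<close>. The last entry is the radius promised in the
   statement.\<close>
 define e where "e = min e0 (min e1 (1 / (real k + 1)))"
 have e: "e > 0" "e <= e0" "e <= e1" "e <= 1 / (real k + 1)" using e0 e1 by (auto simp: e_def)
 have cb: "cball z e \<subseteq> K" if "z \<in> V" for z using that K1(3) e(2) by (auto simp: K_def intro!: bexI[of _ z])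
 note regr = submean_regularize[OF rho(2) K e(1) oV cb]
 note regv = submean_regularize[OF sv K e(1) oV cb]
 define rr where "rr = conv (moll e) (%z. indicator K z * \<rho> z)"
 define vv where "vv = conv (moll e) (%z. indicator K z * v z)"
 define r where "r z = rr z - (real k + 1)" for z
 define \<psi> where "\<psi> z = vv z - 1 / (real k + 1)" for z
 define U where "U = {z\<in>V. rr z < real k + 1}"
 have c2r: "c2 UNIV rr" and c2v: "c2 UNIV vv" using regr(1) regv(1) by (simp_all add: rr_def vv_def)
 have rrc: "continuous_on UNIV rr" by (rule c2_continuous[OF c2r])
 have UV: "U \<subseteq> V" by (auto simp: U_def)
 have UD: "U \<subseteq> D" using UV K1 by blast
 have oU: "open U"
 proof -
  have "open {z. rr z < real k + 1}" by (rule open_Collect_less[OF rrc continuous_on_const])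
  hence "open (V \<inter> {z. rr z < real k + 1})" using oV by blast
  moreover have "V \<inter> {z. rr z < real k + 1} = U" by (auto simp: U_def)
  ultimately show ?thesis by simp
 qed
 have inD: "w \<in> D" "w \<in> K" if "z \<in> V" "dist z w < e" for z w using cb[OF that(1)] K(2) that(2) by (auto simp: subset_iff)
 have a1: "c2 U \<psi>" unfolding \<psi>_def[abs_def] by (rule c2_diff[OF c2_subset[OF c2v subset_UNIV] c2_const[OF oU] oU])
 have a2: "\<psi> z \<in> {- real k - 1.. - (1 / (real k + 1))}" if z: "z \<in> U" for z
 proof -
  have zV: "z \<in> V" using z UV by blast
  have "vv z <= 0" unfolding vv_def by (rule regv(4)[OF _ zV]) (use v0(1) inD[OF zV] in auto)
  moreover have "- real k <= vv z" using regv(2)[OF _ zV] v0(2)[of z] zV by (force simp: vv_def V_def)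
  moreover have "1 / (real k + 1) <= 1" by simp
  ultimately show ?thesis unfolding \<psi>_def atLeastAtMost_iff by linarith
 qed
 have a3: "lev \<psi> z b >= 0" if z: "z \<in> U" for z b
  unfolding \<psi>_def[abs_def] lev_diff_const[OF c2v open_UNIV UNIV_I] unfolding vv_def by (rule regv(3)) (use z UV in auto)
 have a4: "c2 U r" unfolding r_def[abs_def] by (rule c2_diff[OF c2_subset[OF c2r subset_UNIV] c2_const[OF oU] oU])
 have a5: "r z < 0" if "z \<in> U" for z using that by (simp add: U_def r_def)
 have a6: "lev r z b >= 0" if z: "z \<in> U" for z b
  unfolding r_def[abs_def] lev_diff_const[OF c2r open_UNIV UNIV_I] unfolding rr_def by (rule regr(3)) (use z UV in auto)
 have a7: "compact {z\<in>U. r z <= - c}" if c: "c > 0" for c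
 proof -
  have low: "\<rho> z <= rr z" if "z \<in> V" for z unfolding rr_def by (rule regr(2)[OF _ that])
  have "{z\<in>U. r z <= - c} = {z\<in>K1. \<rho> z <= real k + 1 - c} \<inter> {z\<in>K1. rr z <= real k + 1 - c}"
   using low c K1 UV by (fastforce simp: U_def r_def V_def)
  also have "... = (K1 \<inter> \<rho> -` {..real k + 1 - c}) \<inter> (K1 \<inter> rr -` {..real k + 1 - c})" by auto
  also have "closed ..."
   by (intro closed_Int continuous_closed_preimage[OF _ compact_imp_closed[OF K1(1)] closed_atMost] continuous_on_subset[OF rho(1) K1(2)] continuous_on_subset[OF rrc subset_UNIV])
  finally have "closed {z\<in>U. r z <= - c}" .
  moreover have "{z\<in>U. r z <= - c} \<subseteq> K1" using UV K1 by auto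
  ultimately show ?thesis using compact_Int_closed[OF K1(1), of "{z\<in>U. r z <= - c}"] by (simp only: Int_absorb1)
 qed
 obtain M0 where a8: "!!z j. z \<in> U ==> cmod (db j (cr r) z) <= M0"
 proof -
  have c2r': "c2 UNIV r" unfolding r_def[abs_def] by (rule c2_diff[OF c2r c2_const[OF open_UNIV] open_UNIV])
  have "\<exists>B. \<forall>z\<in>K1. cmod (db j (cr r) z) <= B" for j
  proof -
   have "continuous_on K1 (db j (cr r))" by (rule continuous_on_subset[OF wirt_continuous(2)[OF c1_cr[OF c2_c1[OF c2r']]]]) simp
   hence "bounded (db j (cr r) ` K1)" using K1(1) compact_continuous_image compact_imp_bounded by blast
   thus ?thesis unfolding bounded_iff by blast
  qed
  then obtain B where B: "!!j z. z \<in> K1 ==> cmod (db j (cr r) z) <= B j" by metis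
  have "cmod (db j (cr r) z) <= Max (range B)" if "z \<in> U" for z j
  proof -
   have "cmod (db j (cr r) z) <= B j" using B that UV K1(3) by blast
   also have "... <= Max (range B)" by simp
   finally show ?thesis .
  qed
  thus ?thesis using that by blast
 qed
 have a9: "ereal p * \<phi> z <= ereal (\<psi> z + 1 / (real k + 1))" if z: "z \<in> U" for z
 proof -
  have zV: "z \<in> V" and zD: "z \<in> D" using z UV UD by auto
  have "v z <= vv z" unfolding vv_def by (rule regv(2)[OF _ zV])
  thus ?thesis by (intro order_trans[OF v0(3)[OF zD]]) (simp add: \<psi>_def)
 qed
 have a10: "z \<in> U \<and> r z <= - 1" if z: "z \<in> D" "\<rho> z <= real k - 1" for z
 proof -
  have zV: "z \<in> V" using z by (simp add: V_def)
  have zK: "z \<in> K" using zV K1(3) K1K by blast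
  have "rr z <= \<rho> z + 1" unfolding rr_def
  proof (rule regr(4)[OF _ zV])
   fix w assume w: "dist z w < e"
   have "dist (\<rho> w) (\<rho> z) < 1" using e1(2)[OF zK inD(2)[OF zV w]] w e(3) by (simp add: dist_commute)
   thus "\<rho> w <= \<rho> z + 1" by (simp add: dist_real_def)
  qed
  thus ?thesis using z zV by (simp add: U_def r_def)
 qed
 have a11: "\<psi> z <= y" if z: "z \<in> U" and y: "y >= - real k" and w: "\<forall>w\<in>D. dist z w < 1 / (real k + 1) --> ereal p * \<phi> w <= ereal y" for z y
 proof -
  have zV: "z \<in> V" using z UV by blast
  have "vv z <= y" unfolding vv_def
  proof (rule regv(4)[OF _ zV])
   fix x assume x: "dist z x < e"
   have xD: "x \<in> D" by (rule inD(1)[OF zV x])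
   have "ereal p * \<phi> x <= ereal y" by (rule w[rule_format, OF xD]) (use x e(4) in linarith)
   hence "ereal (v x) <= ereal y" unfolding ve[OF xD] using y by simp
   thus "v x <= y" by simp
  qed
  moreover have "1 / (real k + 1) >= 0" by simp
  ultimately show ?thesis unfolding \<psi>_def by linarith
 qed
 show ?thesis by (rule that[OF oU UD a1 a2 a3 a4 a5 a6 a7 a8 a9 a10 a11]) assumption+
qed

lemma borel_ind_ennreal:
 fixes f :: "'a::topological_space => real"
 assumes "continuous_on K f" "K \<in> sets borel"
 shows "(%z. indicator K z * ennreal (f z)) \<in> borel_measurable borel"
proof -
 have "(%z. ennreal (indicator K z *\<^sub>R f z)) \<in> borel_measurable borel"
  using borel_measurable_continuous_on_indicator[OF assms(2,1)] by measurable
 moreover have "ennreal (indicator K z *\<^sub>R f z) = indicator K z * ennreal (f z)" for z by (auto simp: indicator_def)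
 ultimately show ?thesis by simp
qed

text \<open>Convexity of the square: \<open>x - y\<close> is the combination of
  \<open>(be * x - y) / be\<close> and x with weights \<open>be\<close> and
  \<open>1 - be\<close>.\<close>

lemma cmod_convex_split:
 assumes "0 < be" "be < 1"
 shows "(cmod (x - y))^2 <= (cmod (of_real be * x - y))^2 / be + (1 - be) * (cmod x)^2"
proof -
 define g where "g = 1 - be"
 have g: "g > 0" "be = 1 - g" using assms by (simp_all add: g_def)
 have "(cmod ((of_real be * x - y) + of_real g * x))^2 <= (1 + g / be) * (cmod (of_real be * x - y))^2 + (1 + 1 / (g / be)) * (cmod (of_real g * x))^2"
  by (rule cmod_add_sq_le') (use assms g in simp)
 also have "(of_real be * x - y) + of_real g * x = x - y" by (simp add: g_def algebra_simps)
 also have "1 + g / be = 1 / be" using assms by (simp add: g_def field_simps)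
 also have "(1 + 1 / (g / be)) * (cmod (of_real g * x))^2 = g * (cmod x)^2"
 proof -
  have "1 + 1 / (g / be) = 1 / g" using assms g by (simp add: field_simps)
  thus ?thesis using g(1) by (simp add: norm_mult power_mult_distrib power2_eq_square)
 qed
 finally show ?thesis by (simp add: g_def)
qed

context profile begin

text \<open>F0 approximates \<open>b F\<close> with an error weighted by \<open>1 / b\<close>.
  Convexity compares it with F at the total cost \<open>l1\<close>. Since
  \<open>exp (- \<psi>)\<close> is at most \<open>C / b\<close>, the same weight also controls F0
  against \<open>exp (- \<psi>)\<close>.\<close>

lemma extension_step:
 fixes F :: "complex ^ 'n => complex"
 assumes U: "open U" and psi: "c2 U \<psi>" "!!z. z \<in> U ==> \<psi> z \<in> {t0..t1}" "t0 <= t1" "t1 < 0" "!!z b. z \<in> U ==> lev \<psi> z b >= 0"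
  and r: "c2 U r" "!!z. z \<in> U ==> r z < 0" "!!z b. z \<in> U ==> lev r z b >= 0" "!!c. c > 0 ==> compact {z\<in>U. r z <= - c}"
  and M0: "!!z j. z \<in> U ==> cmod (db j (cr r) z) <= M0"
  and F: "holomorphic_on_Cn F U" "intbl (%z. indicator U z * (cmod (F z))^2)"
  and th: "0 < \<theta>" "\<theta> < 1" and C: "C >= 1" "!!t. t < 0 ==> b t <= C * exp t"
  and T: "(LBINT z. indicator U z * (l1 (exp (\<psi> z)) * (cmod (F z))^2)) <= T" and I: "(LBINT z. indicator U z * (cmod (F z))^2) <= I"
 obtains F0 where "holomorphic_on_Cn F0 U"
  "(NNL z. indicator {z\<in>U. r z <= -1} z * ennreal ((1 - \<theta>)^2 * (cmod (F z - F0 z))^2)) <= ennreal T"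
  "(NNL z. indicator {z\<in>U. r z <= -1} z * ennreal ((1 - \<theta>)^2 * (cmod (F0 z))^2 * exp (- \<psi> z))) <= ennreal (2 * C * (T + I))"
proof -
 let ?K = "{z\<in>U. r z <= -1}"
 obtain F0 where F0: "holomorphic_on_Cn F0 U"
  "(NNL z. indicator ?K z * ennreal ((1 - \<theta>)^2 * (cmod (of_real (b (\<psi> z)) * F z - F0 z))^2 / b (\<psi> z)))
   <= ennreal (LBINT z. indicator U z * ((l1 (exp (\<psi> z)) - 1 + b (\<psi> z)) * (cmod (F z))^2))"
  "intbl (%z. indicator U z * ((l1 (exp (\<psi> z)) - 1 + b (\<psi> z)) * (cmod (F z))^2))"
  by (rule l2_omega[OF U psi r M0 F th]) (assumption | rule that)+
 define c where "c = (1 - \<theta>)^2"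
 have c: "0 <= c" "c <= 1" unfolding c_def using th by (auto intro!: power_le_one)
 define Q where "Q z = c * (cmod (of_real (b (\<psi> z)) * F z - F0 z))^2 / b (\<psi> z)" for z
 have pn: "\<psi> z < 0" if "z \<in> U" for z using psi(2)[OF that] psi(4) by simp
 have pneg: "\<psi> ` U \<subseteq> {..<0}" using pn by auto
 have bc: "continuous_on U (%z. b (\<psi> z))" by (rule continuous_on_compose2[OF cont_neg(3) c2_continuous[OF psi(1)] pneg])
 have b0: "0 < b (\<psi> z)" "b (\<psi> z) < 1" if "z \<in> U" for z using b_bounds[OF pn[OF that]] by auto
 have Fc: "continuous_on U F" "continuous_on U F0" using holomorphic_on_Cn_continuous F(1) F0(1) by auto
 have K: "compact ?K" using r(4)[of 1] by simp
 have Kb: "?K \<in> sets borel" by (rule borel_closed[OF compact_imp_closed[OF K]])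
 have Q0: "Q z >= 0" if "z \<in> U" for z using b0[OF that] c by (simp add: Q_def)
 have "continuous_on U Q" unfolding Q_def[abs_def] using b0 by (intro continuous_intros bc Fc) force
 hence mQ: "(%z. indicator ?K z * ennreal (Q z)) \<in> borel_measurable borel" by (rule borel_ind_ennreal[OF continuous_on_subset[where s=U] Kb]) auto
 have ib: "intbl (%z. indicator U z * ((1 - b (\<psi> z)) * (cmod (F z))^2))"
 proof (rule bi_integrable_bound[OF F(2)])
  have "continuous_on U (%z. (1 - b (\<psi> z)) * (cmod (F z))^2)" by (intro continuous_intros bc Fc)
  from borel_measurable_continuous_on_indicator[OF borel_open[OF U] this]
  show "(%z. indicator U z * ((1 - b (\<psi> z)) * (cmod (F z))^2)) \<in> borel_measurable lborel" by simp
  have "\<bar>1 - b (\<psi> z)\<bar> * (cmod (F z))^2 <= 1 * (cmod (F z))^2" if "z \<in> U" for z using b0[OF that] by (intro mult_right_mono) auto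
  thus "AE z in lborel. norm (indicator U z * ((1 - b (\<psi> z)) * (cmod (F z))^2)) <= norm (indicator U z * (cmod (F z))^2)"
   by (intro AE_I2) (simp add: indicator_def abs_mult)
 qed
 define TB Tb where "TB = (LBINT z. indicator U z * ((l1 (exp (\<psi> z)) - 1 + b (\<psi> z)) * (cmod (F z))^2))"
  and "Tb = (LBINT z. indicator U z * ((1 - b (\<psi> z)) * (cmod (F z))^2))"
 have tb0: "Tb >= 0" unfolding Tb_def using b0 by (intro bi_integral_nonneg) (auto simp: indicator_def less_imp_le)
 have tB0: "TB >= 0"
 proof -
  have "l1 (exp (\<psi> z)) - 1 + b (\<psi> z) >= 0" if "z \<in> U" for z
  proof -
   have "b1 (\<psi> z) * m (\<psi> z) / (1 - exp (\<psi> z)) >= 0" using b1_nonneg[OF pn[OF that]] m_pos[OF pn[OF that]] pn[OF that] by simp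
   hence "exp (M (\<psi> z) - 2 * N (\<psi> z)) * (b1 (\<psi> z) * m (\<psi> z) / (1 - exp (\<psi> z))) >= 0" by (intro mult_nonneg_nonneg) auto
   thus ?thesis using weight_values(1)[OF pn[OF that]] by linarith
  qed
  thus ?thesis unfolding TB_def by (intro bi_integral_nonneg) (auto simp: indicator_def)
 qed
 \<comment> \<open>The source costs \<open>l1 - 1 + b\<close> and the convexity inequality
   \<open>1 - b\<close>; together they make \<open>l1\<close>.\<close>
 have TT: "TB + Tb <= T"
 proof -
  have "TB + Tb = (LBINT z. indicator U z * ((l1 (exp (\<psi> z)) - 1 + b (\<psi> z)) * (cmod (F z))^2) + indicator U z * ((1 - b (\<psi> z)) * (cmod (F z))^2))"
   unfolding TB_def Tb_def by (rule bi_integral_add[OF F0(3) ib, symmetric])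
  also have "... = (LBINT z. indicator U z * (l1 (exp (\<psi> z)) * (cmod (F z))^2))"
   by (intro bi_integral_cong refl) (simp add: algebra_simps)
  finally show ?thesis using T by simp
 qed
 have Qi: "(NNL z. indicator ?K z * ennreal (Q z)) <= ennreal TB" using F0(2) by (simp add: Q_def c_def TB_def)
 have a: "(NNL z. indicator ?K z * ennreal (c * (cmod (F z - F0 z))^2)) <= ennreal T"
 proof -
  have "(NNL z. indicator ?K z * ennreal (c * (cmod (F z - F0 z))^2))
    <= (NNL z. indicator ?K z * ennreal (Q z) + ennreal (indicator U z * ((1 - b (\<psi> z)) * (cmod (F z))^2)))"
  proof (rule nn_integral_mono)
   fix z
   have "c * (cmod (F z - F0 z))^2 <= Q z + (1 - b (\<psi> z)) * (cmod (F z))^2" if z: "z \<in> U"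
   proof -
    have "c * (cmod (F z - F0 z))^2 <= c * ((cmod (of_real (b (\<psi> z)) * F z - F0 z))^2 / b (\<psi> z) + (1 - b (\<psi> z)) * (cmod (F z))^2)"
     by (rule mult_left_mono[OF cmod_convex_split[OF b0[OF z]] c(1)])
    also have "... = Q z + c * ((1 - b (\<psi> z)) * (cmod (F z))^2)" by (simp add: Q_def distrib_left)
    also have "... <= Q z + 1 * ((1 - b (\<psi> z)) * (cmod (F z))^2)" using c b0[OF z] by (intro add_left_mono mult_right_mono) auto
    finally show ?thesis by simp
   qed
   thus "indicator ?K z * ennreal (c * (cmod (F z - F0 z))^2) <= indicator ?K z * ennreal (Q z) + ennreal (indicator U z * ((1 - b (\<psi> z)) * (cmod (F z))^2))"
    using Q0[of z] b0[of z] by (auto simp: indicator_def ennreal_plus[symmetric] simp del: ennreal_plus intro!: ennreal_leI)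
  qed
  also have "... = (NNL z. indicator ?K z * ennreal (Q z)) + (NNL z. ennreal (indicator U z * ((1 - b (\<psi> z)) * (cmod (F z))^2)))"
   by (rule nn_integral_add) (use mQ ib in auto)
  also have "(NNL z. ennreal (indicator U z * ((1 - b (\<psi> z)) * (cmod (F z))^2))) = ennreal Tb"
   unfolding Tb_def by (rule nn_integral_eq_integral[OF ib]) (use b0 in \<open>auto simp: indicator_def less_imp_le\<close>)
  also have "(NNL z. indicator ?K z * ennreal (Q z)) + ennreal Tb <= ennreal TB + ennreal Tb" by (rule add_right_mono[OF Qi])
  also have "... = ennreal (TB + Tb)" using tb0 tB0 by simp
  also have "... <= ennreal T" by (rule ennreal_leI[OF TT])
  finally show ?thesis .
 qed
 have bb: "(NNL z. indicator ?K z * ennreal (c * (cmod (F0 z))^2 * exp (- \<psi> z))) <= ennreal (2 * C * (T + I))"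
 proof -
  have "(NNL z. indicator ?K z * ennreal (c * (cmod (F0 z))^2 * exp (- \<psi> z)))
    <= (NNL z. ennreal (2 * C) * (indicator ?K z * ennreal (Q z) + ennreal (indicator U z * (cmod (F z))^2)))"
  proof (rule nn_integral_mono)
   fix z
   have "c * (cmod (F0 z))^2 * exp (- \<psi> z) <= 2 * C * (Q z + (cmod (F z))^2)" if z: "z \<in> U"
   proof -
    define be H where "be = b (\<psi> z)" and "H = of_real be * F z - F0 z"
    have be: "0 < be" "be < 1" using b0[OF z] by (simp_all add: be_def)
    have "(cmod (F0 z))^2 = (cmod (- H + of_real be * F z))^2" by (simp add: H_def)
    also have "... <= 2 * (cmod H)^2 + 2 * (be * (be * (cmod (F z))^2))"
     using cmod_add_sq_le'[of 1 "- H" "of_real be * F z"] by (simp add: norm_mult power_mult_distrib power2_eq_square[of be] mult.assoc)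
    finally have f: "(cmod (F0 z))^2 <= 2 * (cmod H)^2 + 2 * (be * (be * (cmod (F z))^2))" .
    have "exp (- \<psi> z) = 1 / exp (\<psi> z)" by (simp add: exp_minus field_simps)
    also have "... <= C / be" using C(2)[OF pn[OF z]] be by (simp add: be_def field_simps)
    finally have x: "exp (- \<psi> z) <= C / be" .
    have "(cmod (F0 z))^2 * exp (- \<psi> z) <= (2 * (cmod H)^2 + 2 * (be * (be * (cmod (F z))^2))) * (C / be)"
     using f x be C(1) by (intro mult_mono) auto
    also have "... = 2 * C * ((cmod H)^2 / be + be * (cmod (F z))^2)" using be by (simp add: field_simps)
    also have "... <= 2 * C * ((cmod H)^2 / be + 1 * (cmod (F z))^2)" using be C(1) by (intro mult_left_mono add_left_mono mult_right_mono) auto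
    finally have "c * ((cmod (F0 z))^2 * exp (- \<psi> z)) <= c * (2 * C * ((cmod H)^2 / be + 1 * (cmod (F z))^2))" using c by (intro mult_left_mono)
    also have "... = 2 * C * (Q z + c * (cmod (F z))^2)" by (simp add: Q_def H_def be_def algebra_simps)
    also have "... <= 2 * C * (Q z + 1 * (cmod (F z))^2)" using c C(1) by (intro mult_left_mono add_left_mono mult_right_mono) auto
    finally show ?thesis by (simp add: mult.assoc)
   qed
   thus "indicator ?K z * ennreal (c * (cmod (F0 z))^2 * exp (- \<psi> z)) <= ennreal (2 * C) * (indicator ?K z * ennreal (Q z) + ennreal (indicator U z * (cmod (F z))^2))"
    using Q0[of z] C(1) by (auto simp: indicator_def ennreal_plus[symmetric] ennreal_mult[symmetric] simp del: ennreal_plus intro!: ennreal_leI)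
  qed
  also have "... = ennreal (2 * C) * ((NNL z. indicator ?K z * ennreal (Q z)) + (NNL z. ennreal (indicator U z * (cmod (F z))^2)))"
  proof -
   have m2: "(%z. ennreal (indicator U z * (cmod (F z))^2)) \<in> borel_measurable borel" using F(2) by measurable
   show ?thesis by (subst nn_integral_cmult) (use mQ m2 in \<open>auto intro!: arg_cong[where f="%y. ennreal (2 * C) * y"] nn_integral_add\<close>)
  qed
  also have "(NNL z. ennreal (indicator U z * (cmod (F z))^2)) = ennreal (LBINT z. indicator U z * (cmod (F z))^2)"
   by (rule nn_integral_eq_integral[OF F(2)]) auto
  also have "ennreal (2 * C) * ((NNL z. indicator ?K z * ennreal (Q z)) + ...) <= ennreal (2 * C) * (ennreal T + ennreal I)"
  proof -
   have "ennreal TB <= ennreal T" using TT tb0 by (intro ennreal_leI) linarith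
   thus ?thesis by (intro mult_left_mono add_mono order_trans[OF Qi] ennreal_leI[OF I]) auto
  qed
  also have "... = ennreal (2 * C * (T + I))"
  proof -
   have "T >= 0" using TT tb0 tB0 by linarith
   moreover have "I >= 0" by (rule order_trans[OF _ I]) (auto intro!: bi_integral_nonneg)
   ultimately show ?thesis using C(1) by (simp add: ennreal_mult[symmetric] ennreal_plus[symmetric] del: ennreal_plus)
  qed
  finally show ?thesis .
 qed
 show ?thesis by (rule that[OF F0(1) a[unfolded c_def] bb[unfolded c_def]])
qed

end

section \<open>Uniform estimates along the exhaustion and passage to the limit\<close>

lemma eexp_ge:
 assumes "x \<noteq> \<infinity>" "ereal p * x <= ereal y" "p > 0" and that: "c > 0"
 shows "eexp (- (ereal c * x)) >= ennreal (exp (- (c * (y / p))))"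
proof (cases x)
 case (real t)
 hence "t <= y / p" using assms by (simp add: field_simps)
 hence "c * t <= c * (y / p)" using that by (intro mult_left_mono) auto
 thus ?thesis unfolding eexp_def real by (auto intro!: ennreal_leI)
qed (use assms that in \<open>auto simp: eexp_def\<close>)

context profile begin

lemma extension_approx:
 fixes F :: "complex ^ 'n => complex" and \<phi> :: "complex ^ 'n => ereal" and k :: nat
 assumes psh: "psh_on D \<phi>" "!!z. z \<in> D ==> \<phi> z < 0" and p: "p >= 1"
  and rho: "continuous_on D \<rho>" "submean D \<rho>" "!!c. compact (closure {z\<in>D. \<rho> z < c})" "!!c. closure {z\<in>D. \<rho> z < c} \<subseteq> D"
  and F: "holomorphic_on_Cn F D" "(NNL z. indicator D z * wsq F 1 \<phi> z) <= ennreal C1" "C1 > 0"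
  and C: "C >= 1" "!!t. t < 0 ==> b t <= C * exp t" and kap: "\<kappa> > 0" "!!t. t < 0 ==> l1 (exp t) <= \<kappa> * exp (- (t / p))"
 obtains U K \<psi> F0 where "U \<subseteq> D" "K \<in> sets borel" "K \<subseteq> U" "continuous_on U \<psi>" "!!z. z \<in> U ==> \<psi> z < 0" "holomorphic_on_Cn F0 U"
  "(NNL z. indicator K z * ennreal ((1 - 1 / (real k + 2))^2 * (cmod (F z - F0 z))^2)) <= ennreal (\<kappa> * exp (1 / (real k + 1)) * C1)"
  "(NNL z. indicator K z * ennreal ((1 - 1 / (real k + 2))^2 * (cmod (F0 z))^2 * exp (- \<psi> z))) <= ennreal (2 * C * (\<kappa> * exp 1 * C1 + C1))"
  "!!z. z \<in> D ==> \<rho> z <= real k - 1 ==> z \<in> K"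
  "!!z y. z \<in> U ==> y >= - real k ==> (\<forall>w\<in>D. dist z w < 1 / (real k + 1) --> ereal p * \<phi> w <= ereal y) ==> \<psi> z <= y"
proof -
 have p0: "p > 0" using p by simp
 obtain U \<psi> r M0 where U: "open U" "U \<subseteq> D" and psi: "c2 U \<psi>" "!!z. z \<in> U ==> \<psi> z \<in> {- real k - 1.. - (1 / (real k + 1))}" "!!z b. z \<in> U ==> lev \<psi> z b >= 0"
  and r: "c2 U r" "!!z. z \<in> U ==> r z < 0" "!!z b. z \<in> U ==> lev r z b >= 0" "!!c. c > 0 ==> compact {z\<in>U. r z <= - c}"
  and M0: "!!z j. z \<in> U ==> cmod (db j (cr r) z) <= M0" and ph: "!!z. z \<in> U ==> ereal p * \<phi> z <= ereal (\<psi> z + 1 / (real k + 1))"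
  and inU: "!!z. z \<in> D ==> \<rho> z <= real k - 1 ==> z \<in> U \<and> r z <= - 1"
  and usc: "!!z y. z \<in> U ==> y >= - real k ==> (\<forall>w\<in>D. dist z w < 1 / (real k + 1) --> ereal p * \<phi> w <= ereal y) ==> \<psi> z <= y"
  by (rule exhaustion_step[where k=k, OF psh p0 rho]) (assumption | rule that)+
 define s where "s = 1 / (real k + 1)"
 have s: "0 < s" "s <= 1" by (simp_all add: s_def)
 have t: "- real k - 1 <= - s" "- s < 0" using s by linarith+
 have pn: "\<psi> z < 0" if "z \<in> U" for z using psi(2)[OF that] t(2) unfolding s_def atLeastAtMost_iff by linarith
 have fU: "\<phi> z \<noteq> \<infinity>" if "z \<in> D" for z using psh(2)[OF that] by auto
 have FU: "holomorphic_on_Cn F U" using F(1) U by (auto simp: holomorphic_on_Cn_def)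
 have Fc: "continuous_on U F" by (rule holomorphic_on_Cn_continuous[OF FU])
 have "(%z. indicator U z *\<^sub>R csq (F z)) \<in> borel_measurable borel"
  by (rule borel_measurable_continuous_on_indicator[OF borel_open[OF U(1)]]) (intro continuous_intros Fc)
 hence mF: "(%z. indicator U z * (cmod (F z))^2) \<in> borel_measurable borel" by simp
 have nI: "(NNL z. ennreal (indicator U z * (cmod (F z))^2)) <= ennreal C1"
 proof (rule order_trans[OF nn_integral_mono F(2)])
  fix z
  have "1 <= eexp (- (ereal 1 * \<phi> z))" if "z \<in> D"
   using eexp_ge[OF fU[OF that], of 1 0 1] psh(2)[OF that] by (simp add: less_imp_le zero_ereal_def one_ereal_def[symmetric])
  hence "ennreal ((cmod (F z))^2) * 1 <= wsq F 1 \<phi> z" if "z \<in> D" unfolding wsq_def using that by (intro mult_left_mono) auto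
  thus "ennreal (indicator U z * (cmod (F z))^2) <= indicator D z * wsq F 1 \<phi> z" using U(2) by (auto simp: indicator_def)
 qed
 have iF: "intbl (%z. indicator U z * (cmod (F z))^2)"
 proof (rule integrableI_nonneg)
  show "(NNL z. ennreal (indicator U z * (cmod (F z))^2)) < \<infinity>" using nI by (rule order_le_less_trans) simp
 qed (use mF in auto)
 have I: "(LBINT z. indicator U z * (cmod (F z))^2) <= C1"
  by (rule integral_real_bounded) (use nI F(3) in auto)
 \<comment> \<open>The bound on \<open>l1\<close> together with
   \<open>p * \<phi> \<le> \<psi> + s\<close> turns the cost into
   \<open>\<kappa> * exp (s / p)\<close> times the given norm; \<open>p \<ge> 1\<close> permits the
   simpler factor \<open>exp s\<close>.\<close>
 have T: "(LBINT z. indicator U z * (l1 (exp (\<psi> z)) * (cmod (F z))^2)) <= \<kappa> * exp s * C1"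
 proof -
  have ke: "\<kappa> * exp s > 0" using kap(1) by simp
  have "(LBINT z. indicator U z * (l1 (exp (\<psi> z)) * (cmod (F z))^2) / (\<kappa> * exp s)) <= C1"
  proof (rule integral_real_bounded)
   show "(NNL z. ennreal (indicator U z * (l1 (exp (\<psi> z)) * (cmod (F z))^2) / (\<kappa> * exp s))) <= ennreal C1"
   proof (rule order_trans[OF nn_integral_mono F(2)])
    fix z
    show "ennreal (indicator U z * (l1 (exp (\<psi> z)) * (cmod (F z))^2) / (\<kappa> * exp s)) <= indicator D z * wsq F 1 \<phi> z"
    proof (cases "z \<in> U")
     case True
     have zD: "z \<in> D" using True U(2) by blast
     have "l1 (exp (\<psi> z)) / (\<kappa> * exp s) <= \<kappa> * exp (- (\<psi> z / p)) / (\<kappa> * exp s)" using kap(2)[OF pn[OF True]] ke by (intro divide_right_mono) auto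
     also have "... = exp (- (\<psi> z / p) - s)" using kap(1) by (simp add: exp_diff)
     also have "... <= exp (- (1 * ((\<psi> z + s) / p)))"
     proof -
      have "s / p <= s / 1" using s p by (intro divide_left_mono) auto
      thus ?thesis by (simp add: add_divide_distrib)
     qed
     finally have "ennreal (l1 (exp (\<psi> z)) / (\<kappa> * exp s)) <= eexp (- (ereal 1 * \<phi> z))"
      using eexp_ge[OF fU[OF zD] ph[OF True] p0, of 1] by (simp add: s_def order_trans[OF ennreal_leI])
     hence "ennreal ((cmod (F z))^2) * ennreal (l1 (exp (\<psi> z)) / (\<kappa> * exp s)) <= wsq F 1 \<phi> z" unfolding wsq_def by (intro mult_left_mono) auto
     moreover have "l1 (exp (\<psi> z)) >= 0" using l1_pos[of "exp (\<psi> z)"] pn[OF True] by simp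
     ultimately show ?thesis using True zD ke by (simp add: ennreal_mult[symmetric] mult.commute)
    qed simp
   qed
  qed (use F(3) in auto)
  thus ?thesis using ke by (simp add: field_simps)
 qed
 have T2: "\<kappa> * exp s * C1 <= \<kappa> * exp 1 * C1" using s kap(1) F(3) by (intro mult_right_mono mult_left_mono) auto
 \<comment> \<open>Any sequence in (0,1) tending to 0 would do; \<open>k + 2\<close> avoids the
   value 1 at k = 0.\<close>
 define \<theta> where "\<theta> = 1 / (real k + 2)"
 have th: "0 < \<theta>" "\<theta> < 1" by (simp_all add: \<theta>_def)
 obtain F0 where F0: "holomorphic_on_Cn F0 U"
  "(NNL z. indicator {z\<in>U. r z <= -1} z * ennreal ((1 - \<theta>)^2 * (cmod (F z - F0 z))^2)) <= ennreal (\<kappa> * exp s * C1)"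
  "(NNL z. indicator {z\<in>U. r z <= -1} z * ennreal ((1 - \<theta>)^2 * (cmod (F0 z))^2 * exp (- \<psi> z))) <= ennreal (2 * C * (\<kappa> * exp s * C1 + C1))"
  by (rule extension_step[OF U(1) psi(1) psi(2)[folded s_def] t psi(3) r M0 FU iF th C T I]) (assumption | rule that)+
 have K: "{z\<in>U. r z <= -1} \<in> sets borel" using r(4)[of 1] borel_closed[OF compact_imp_closed] by simp
 have "2 * C * (\<kappa> * exp s * C1 + C1) <= 2 * C * (\<kappa> * exp 1 * C1 + C1)" using T2 C(1) by (intro mult_left_mono) auto
 note F03 = order_trans[OF F0(3) ennreal_leI[OF this]]
 have KK: "z \<in> D ==> \<rho> z <= real k - 1 ==> z \<in> {z\<in>U. r z <= -1}" for z using inU by blast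
 show ?thesis
  by (rule that[OF U(2) K _ c2_continuous[OF psi(1)] pn F0(1) F0(2)[unfolded \<theta>_def s_def] F03[unfolded \<theta>_def] KK usc]) (assumption | blast)+
qed

text \<open>Fatou's lemma is used twice along one subsequence: for \<open>H = F - G\<close>, where
  the factors \<open>ck\<close> and \<open>exp (1 / (k + 1))\<close> tend to 1 and the constant must
  come out sharp, and for G against the singular weight, where only finiteness matters.\<close>

lemma extension:
 fixes F :: "complex ^ 'n => complex" and \<phi> :: "complex ^ 'n => ereal"
 assumes pc: "pseudoconvex_domain D" and psh: "psh_on D \<phi>" "!!z. z \<in> D ==> \<phi> z < 0" and p: "p >= 1"
  and F: "holomorphic_on_Cn F D" "(NNL z. indicator D z * wsq F 1 \<phi> z) <= ennreal C1" "C1 > 0"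
  and kap: "\<kappa> > 0" "!!t. t < 0 ==> l1 (exp t) <= \<kappa> * exp (- (t / p))"
 obtains H where "holomorphic_on_Cn H D" "(NNL z. indicator D z * ennreal ((cmod (H z))^2)) <= ennreal (\<kappa> * C1)"
  "(NNL z. indicator D z * wsq (%z. H z - F z) p \<phi> z) < \<infinity>"
proof -
 have D: "open D" using psh(1) by (simp add: psh_on_def)
 have p0: "p > 0" using p by simp
 obtain C where C: "C >= 1" "!!t. t < 0 ==> b t <= C * exp t" using b_le by blast
 obtain \<rho>0 :: "complex ^ 'n => real" where \<rho>0: "continuous_on D \<rho>0" "psh_on D (%z. ereal (\<rho>0 z))"
  "!!c. compact (closure {z\<in>D. \<rho>0 z < c})" "!!c. closure {z\<in>D. \<rho>0 z < c} \<subseteq> D" using pc unfolding pseudoconvex_domain_def by blast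
 \<comment> \<open>Truncation at 0 supplies the lower bound in \<open>submean\<close>. Sublevel sets
   at positive heights are unchanged, the others become empty.\<close>
 define \<rho> where "\<rho> z = max (\<rho>0 z) 0" for z
 have rc: "continuous_on D \<rho>" unfolding \<rho>_def by (intro continuous_intros \<rho>0(1))
 have rs: "submean D \<rho>" using submean_of_psh[OF \<rho>0(2), of 1 0] by (simp add: \<rho>_def[abs_def] max_def zero_ereal_def if_distrib cong: if_cong)
 have re: "{z\<in>D. \<rho> z < c} = {} \<or> {z\<in>D. \<rho> z < c} = {z\<in>D. \<rho>0 z < c}" for c by (cases "c > 0") (auto simp: \<rho>_def)
 have rk: "compact (closure {z\<in>D. \<rho> z < c})" "closure {z\<in>D. \<rho> z < c} \<subseteq> D" for c
 proof -
  have "compact (closure {z\<in>D. \<rho> z < c}) \<and> closure {z\<in>D. \<rho> z < c} \<subseteq> D"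
  proof (cases "{z\<in>D. \<rho> z < c} = {}")
   case True thus ?thesis by (simp only: closure_empty compact_empty empty_subsetI)
  next
   case False
   hence "{z\<in>D. \<rho> z < c} = {z\<in>D. \<rho>0 z < c}" using re[of c] by blast
   thus ?thesis using \<rho>0(3,4)[of c] by simp
  qed
  thus "compact (closure {z\<in>D. \<rho> z < c})" "closure {z\<in>D. \<rho> z < c} \<subseteq> D" by simp_all
 qed
 define Cs where "Cs = 2 * C * (\<kappa> * exp 1 * C1 + C1)"
 define ck where "ck k = (1 - 1 / (real k + 2))^2" for k :: nat
 \<comment> \<open>All data of stage k form one tuple, so that a single choice selects them for all
   k at once.\<close>
 define P where "P k = (%(U, K, \<psi>, F0). U \<subseteq> D \<and> K \<in> sets borel \<and> K \<subseteq> U \<and> continuous_on U \<psi> \<and> (\<forall>z\<in>U. \<psi> z < 0) \<and> holomorphic_on_Cn F0 U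
  \<and> (NNL z. indicator K z * ennreal (ck k * (cmod (F z - F0 z))^2)) <= ennreal (\<kappa> * exp (1 / (real k + 1)) * C1)
  \<and> (NNL z. indicator K z * ennreal (ck k * (cmod (F0 z))^2 * exp (- \<psi> z))) <= ennreal Cs
  \<and> (\<forall>z\<in>D. \<rho> z <= real k - 1 --> z \<in> K)
  \<and> (\<forall>z\<in>U. \<forall>y\<ge>- real k. (\<forall>w\<in>D. dist z w < 1 / (real k + 1) --> ereal p * \<phi> w <= ereal y) --> \<psi> z <= y))" for k :: nat
 have "\<exists>x. P k x" for k
 proof (rule extension_approx[where k=k, OF psh p rc rs rk F C kap, folded ck_def Cs_def])
  fix U K \<psi> F0
  assume "U \<subseteq> D" "K \<in> sets borel" "K \<subseteq> U" "continuous_on U \<psi>" "!!z. z \<in> U ==> \<psi> z < 0" "holomorphic_on_Cn F0 U"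
  "(NNL z. indicator K z * ennreal (ck k * (cmod (F z - F0 z))^2)) <= ennreal (\<kappa> * exp (1 / (real k + 1)) * C1)"
  "(NNL z. indicator K z * ennreal (ck k * (cmod (F0 z))^2 * exp (- \<psi> z))) <= ennreal Cs"
  "!!z. z \<in> D ==> \<rho> z <= real k - 1 ==> z \<in> K"
  "!!z y. z \<in> U ==> y >= - real k ==> (\<forall>w\<in>D. dist z w < 1 / (real k + 1) --> ereal p * \<phi> w <= ereal y) ==> \<psi> z <= y"
  hence "P k (U, K, \<psi>, F0)" unfolding P_def by simp
  thus ?thesis ..
 qed
 then obtain x where x: "!!k. P k (x k)" by metis
 define U K \<psi> F0 where "U k = fst (x k)" and "K k = fst (snd (x k))" and "\<psi> k = fst (snd (snd (x k)))" and "F0 k = snd (snd (snd (x k)))" for k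
 have "P k (U k, K k, \<psi> k, F0 k)" for k using x[of k] by (simp add: U_def K_def \<psi>_def F0_def)
 note PP = this[unfolded P_def prod.case]
 define h1 h2 where "h1 k z = indicator (K k) z * ennreal (ck k * (cmod (F z - F0 k z))^2)" and "h2 k z = indicator (K k) z * ennreal (ck k * (cmod (F0 k z))^2 * exp (- \<psi> k z))" for k z
 have UD: "U k \<subseteq> D" and Kb: "K k \<in> sets borel" and KU: "K k \<subseteq> U k" and pc': "continuous_on (U k) (\<psi> k)" and pn: "z \<in> U k ==> \<psi> k z < 0" and F0: "holomorphic_on_Cn (F0 k) (U k)"
  and i1: "(NNL z. h1 k z) <= ennreal (\<kappa> * exp (1 / (real k + 1)) * C1)"
  and i2: "(NNL z. h2 k z) <= ennreal Cs"
  and inK: "z \<in> D ==> \<rho> z <= real k - 1 ==> z \<in> K k"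
  and usc: "z \<in> U k ==> y >= - real k ==> (\<forall>w\<in>D. dist z w < 1 / (real k + 1) --> ereal p * \<phi> w <= ereal y) ==> \<psi> k z <= y" for k z y
  using PP[of k] by (auto simp: h1_def h2_def)
 have Fc: "continuous_on (K k) F" "continuous_on (K k) (F0 k)" "continuous_on (K k) (\<psi> k)" for k
  using continuous_on_subset[OF holomorphic_on_Cn_continuous[OF F(1)]] continuous_on_subset[OF holomorphic_on_Cn_continuous[OF F0]] continuous_on_subset[OF pc'] KU UD by (meson order_trans)+
 have m1: "h1 k \<in> borel_measurable borel" for k
  unfolding h1_def[abs_def] by (rule borel_ind_ennreal[OF _ Kb]) (intro continuous_intros Fc)
 have m2: "h2 k \<in> borel_measurable borel" for k
  unfolding h2_def[abs_def] by (rule borel_ind_ennreal[OF _ Kb]) (intro continuous_intros Fc)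
 have evK: "\<exists>n. \<forall>k\<ge>n. L \<subseteq> K k" if L: "compact L" "L \<subseteq> D" for L
 proof -
  have "bounded (\<rho> ` L)" by (intro compact_imp_bounded compact_continuous_image continuous_on_subset[OF rc L(2)] L(1))
  then obtain B where B: "!!z. z \<in> L ==> \<bar>\<rho> z\<bar> <= B" unfolding bounded_iff by auto
  obtain n :: nat where n: "B + 1 <= real n" using real_arch_simple by blast
  have "L \<subseteq> K k" if "k >= n" for k
  proof
   fix z assume z: "z \<in> L"
   have "\<rho> z <= real k - 1" using B[OF z] n that of_nat_mono[OF that, where 'a=real] by linarith
   thus "z \<in> K k" using inK z L(2) by blast
  qed
  thus ?thesis by blast
 qed
 \<comment> \<open>The smallest value, 1/4, occurs at k = 0. Together with \<open>\<psi> < 0\<close>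
   it explains the constant 4 in the local bound for Montel's theorem.\<close>
 have ck4: "ck k >= 1/4" for k
 proof -
  have "(1/2)^2 <= ck k" unfolding ck_def by (intro power_mono) (auto simp: field_simps)
  thus ?thesis by (simp add: power2_eq_square)
 qed
 obtain G and rr :: "nat => nat" where G: "holomorphic_on_Cn G D" "strict_mono rr" "!!z. z \<in> D ==> (%n. F0 (rr n) z) \<longlonglongrightarrow> G z"
 proof (rule montel_Cn[OF D F0])
  fix L :: "(complex ^ 'n) set" assume L: "compact L" "L \<subseteq> D"
  obtain n where n: "!!k. k >= n ==> L \<subseteq> K k" using evK[OF L] by blast
  thus "\<exists>N. \<forall>m\<ge>N. L \<subseteq> U m" using KU by blast
  have "(NNL z. indicator L z * ennreal ((cmod (F0 k z))^2)) <= ennreal (4 * Cs)" if k: "k >= n" for k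
  proof -
   have "(NNL z. indicator L z * ennreal ((cmod (F0 k z))^2)) <= (NNL z. ennreal 4 * (h2 k z))"
   proof (rule nn_integral_mono)
    fix z
    have "(cmod (F0 k z))^2 <= 4 * (ck k * (cmod (F0 k z))^2 * exp (- \<psi> k z))" if z: "z \<in> L"
    proof -
     have "z \<in> U k" using n[OF k] z KU by blast
     hence "1 * 1 <= (4 * ck k) * exp (- \<psi> k z)" using ck4[of k] pn[of z k] by (intro mult_mono) auto
     from mult_right_mono[OF this, of "(cmod (F0 k z))^2"] show ?thesis by (simp add: mult_ac)
    qed
    thus "indicator L z * ennreal ((cmod (F0 k z))^2) <= ennreal 4 * (h2 k z)"
     using n[OF k] ck4[of k] by (auto simp: h2_def indicator_def ennreal_mult[symmetric] simp del: ennreal_numeral intro!: ennreal_leI)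
   qed
   also have "... = ennreal 4 * (NNL z. h2 k z)" by (rule nn_integral_cmult) (use m2 in simp)
   also have "... <= ennreal 4 * ennreal Cs" by (rule mult_left_mono[OF i2]) simp
   also have "... = ennreal (4 * Cs)" by (rule ennreal_mult'[symmetric]) simp
   finally show ?thesis .
  qed
  thus "\<exists>C N. \<forall>m\<ge>N. (NNL z. indicator L z * ennreal ((cmod (F0 m z))^2)) <= ennreal C" by blast
 qed (rule that)
 define H where "H z = F z - G z" for z
 have H: "holomorphic_on_Cn H D" unfolding holomorphic_on_Cn_def
 proof (intro conjI ballI D)
  fix z assume z: "z \<in> D"
  obtain L1 L2 where "(F has_derivative L1) (at z)" "\<forall>c v. L1 (c *s v) = c * L1 v" "(G has_derivative L2) (at z)" "\<forall>c v. L2 (c *s v) = c * L2 v"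
   using F(1) G(1) z unfolding holomorphic_on_Cn_def by meson
  thus "\<exists>L. (H has_derivative L) (at z) \<and> (\<forall>c v. L (c *s v) = c * L v)"
   unfolding H_def[abs_def] by (intro exI[of _ "%v. L1 v - L2 v"]) (auto intro!: has_derivative_diff simp: algebra_simps)
 qed
 have ck1: "(%n. ck (rr n)) \<longlonglongrightarrow> 1"
 proof -
  have "(%k. 1 / (real k + 2)) \<longlonglongrightarrow> 0" by real_asymp
  hence "(%k. (1 - 1 / (real k + 2))^2) \<longlonglongrightarrow> (1 - 0)^2" by (intro tendsto_intros)
  thus ?thesis using LIMSEQ_subseq_LIMSEQ[OF _ G(2), of ck 1] by (simp add: ck_def[abs_def] comp_def)
 qed
 have evz: "\<forall>\<^sub>F n in sequentially. z \<in> K (rr n)" if zD: "z \<in> D" for z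
 proof -
  obtain n where n: "!!k. k >= n ==> {z} \<subseteq> K k" using evK[of "{z}"] zD by auto
  have "z \<in> K (rr k)" if "k >= n" for k using n[of "rr k"] seq_suble[OF G(2), of k] that by simp
  thus ?thesis unfolding eventually_sequentially by blast
 qed
 have h1: "(NNL z. indicator D z * ennreal ((cmod (H z))^2)) <= ennreal (\<kappa> * C1)"
 proof -
  \<comment> \<open>The integrals extend over the moving sets \<open>K (rr n)\<close>; every point
    of D lies in all but finitely many of them.\<close>
  have "(NNL z. indicator D z * ennreal ((cmod (H z))^2)) <= (NNL z. liminf (%n. h1 (rr n) z))"
  proof (rule nn_integral_mono)
   fix z
   show "indicator D z * ennreal ((cmod (H z))^2) <= liminf (%n. h1 (rr n) z)"
   proof (cases "z \<in> D")
    case True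
    have "(%n. ck (rr n) * (cmod (F z - F0 (rr n) z))^2) \<longlonglongrightarrow> 1 * (cmod (F z - G z))^2" by (intro tendsto_intros ck1 G(3)[OF True])
    hence "(%n. ennreal (ck (rr n) * (cmod (F z - F0 (rr n) z))^2)) \<longlonglongrightarrow> ennreal ((cmod (H z))^2)" by (intro tendsto_ennrealI) (simp add: H_def)
    moreover have "\<forall>\<^sub>F n in sequentially. ennreal (ck (rr n) * (cmod (F z - F0 (rr n) z))^2) = h1 (rr n) z"
     using evz[OF True] by eventually_elim (simp add: h1_def)
    ultimately have "(%n. h1 (rr n) z) \<longlonglongrightarrow> ennreal ((cmod (H z))^2)" by (rule Lim_transform_eventually)
    from lim_imp_Liminf[OF sequentially_bot this] True show ?thesis by simp
   qed simp
  qed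
  also have "... <= liminf (%n. \<integral>\<^sup>+ z. h1 (rr n) z \<partial>lborel)" by (rule nn_integral_liminf) (use m1 in simp)
  also have "... <= liminf (%n. ennreal (\<kappa> * exp (1 / (real (rr n) + 1)) * C1))" by (intro Liminf_mono always_eventually allI i1)
  also have "... = ennreal (\<kappa> * C1)"
  proof -
   have "(%k. 1 / (real k + 1)) \<longlonglongrightarrow> 0" by real_asymp
   hence "(%k. \<kappa> * exp (1 / (real k + 1)) * C1) \<longlonglongrightarrow> \<kappa> * exp 0 * C1" by (intro tendsto_intros)
   hence "(%k. \<kappa> * exp (1 / (real (rr k) + 1)) * C1) \<longlonglongrightarrow> \<kappa> * C1" using LIMSEQ_subseq_LIMSEQ[OF _ G(2)] by (fastforce simp: comp_def)
   thus ?thesis by (intro lim_imp_Liminf[OF sequentially_bot] tendsto_ennrealI)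
  qed
  finally show ?thesis .
 qed
 have "(NNL z. indicator D z * wsq (%z. H z - F z) p \<phi> z) <= (NNL z. liminf (%n. h2 (rr n) z))"
 proof (rule nn_integral_mono)
  fix z
  define L where "L = liminf (%n. h2 (rr n) z)"
  have "wsq (%z. H z - F z) p \<phi> z <= L" if z: "z \<in> D"
  proof -
   \<comment> \<open>Upper semicontinuity: a number y above \<open>p * \<phi> z\<close> bounds
     \<open>p * \<phi>\<close> on a small ball and hence \<open>\<psi> (rr k) z\<close> for large k.
     Only such y are available, so the value at z is reached afterwards by letting y
     decrease.\<close>
   have low: "ennreal ((cmod (G z))^2 * exp (- y)) <= L" if y: "ereal p * \<phi> z < ereal y" for y
   proof -
    have "\<phi> z < ereal (y / p)" using y p0 psh(2)[OF z] by (cases "\<phi> z") (auto simp: field_simps)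
    hence "\<forall>\<^sub>F w in at z. \<phi> w < ereal (y / p)" using psh(1) z by (auto simp: psh_on_def)
    then obtain d where d: "d > 0" "!!w. dist w z < d ==> w \<noteq> z ==> \<phi> w < ereal (y / p)" unfolding eventually_at by auto
    have pw: "ereal p * \<phi> w <= ereal y" if "w \<in> D" "dist z w < d" for w
    proof (cases "w = z")
     case False
     hence "\<phi> w < ereal (y / p)" using d(2)[of w] that by (simp add: dist_commute)
     thus ?thesis using p0 psh(2)[OF that(1)] by (cases "\<phi> w") (auto simp: field_simps)
    qed (use y in simp)
    obtain n :: nat where n: "max (1 / d) \<bar>y\<bar> <= real n" using real_arch_simple by blast
    have le: "\<psi> (rr k) z <= y" if k: "k >= n" "z \<in> K (rr k)" for k
    proof (rule usc)
     have rk: "real n <= real (rr k)" using seq_suble[OF G(2), of k] k(1) by simp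
     show "z \<in> U (rr k)" using k(2) KU by blast
     show "- real (rr k) <= y" using n rk by linarith
     have "1 / d < real (rr k) + 1" using n rk by linarith
     hence "1 / (real (rr k) + 1) <= d" using d(1) by (simp add: field_simps)
     thus "\<forall>w\<in>D. dist z w < 1 / (real (rr k) + 1) --> ereal p * \<phi> w <= ereal y" using pw by auto
    qed
    have "(%n. ck (rr n) * (cmod (F0 (rr n) z))^2 * exp (- y)) \<longlonglongrightarrow> 1 * (cmod (G z))^2 * exp (- y)" by (intro tendsto_intros ck1 G(3)[OF z])
    hence "(%n. ennreal (ck (rr n) * (cmod (F0 (rr n) z))^2 * exp (- y))) \<longlonglongrightarrow> ennreal ((cmod (G z))^2 * exp (- y))" by (intro tendsto_ennrealI) simp
    from lim_imp_Liminf[OF sequentially_bot this] have "ennreal ((cmod (G z))^2 * exp (- y)) = liminf (%n. ennreal (ck (rr n) * (cmod (F0 (rr n) z))^2 * exp (- y)))" ..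
    also have "... <= L" unfolding L_def
    proof (rule Liminf_mono)
     show "\<forall>\<^sub>F n in sequentially. ennreal (ck (rr n) * (cmod (F0 (rr n) z))^2 * exp (- y)) <= h2 (rr n) z"
      using evz[OF z] eventually_ge_at_top[of n]
     proof eventually_elim
      case (elim k)
      have "ck (rr k) * (cmod (F0 (rr k) z))^2 * exp (- y) <= ck (rr k) * (cmod (F0 (rr k) z))^2 * exp (- \<psi> (rr k) z)"
       using le[OF elim(2,1)] by (intro mult_left_mono) (auto simp: ck_def)
      thus ?case using elim(1) by (simp add: h2_def ennreal_leI)
     qed
    qed
    finally show ?thesis .
   qed
   have e: "wsq (%z. H z - F z) p \<phi> z = ennreal ((cmod (G z))^2) * eexp (- (ereal p * \<phi> z))" by (simp add: wsq_def H_def)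
   show ?thesis
   proof (cases "\<phi> z")
    case (real t)
    have "(%n. 1 / (real n + 1)) \<longlonglongrightarrow> 0" by real_asymp
    hence "(%n. (cmod (G z))^2 * exp (- (p * t + 1 / (real n + 1)))) \<longlonglongrightarrow> (cmod (G z))^2 * exp (- (p * t + 0))" by (intro tendsto_intros)
    hence lim: "(%n. ennreal ((cmod (G z))^2 * exp (- (p * t + 1 / (real n + 1))))) \<longlonglongrightarrow> ennreal ((cmod (G z))^2 * exp (- (p * t + 0)))" by (rule tendsto_ennrealI)
    have "ennreal ((cmod (G z))^2 * exp (- (p * t + 0))) <= L"
    proof (rule LIMSEQ_le_const2[OF lim], intro exI allI impI)
     show "ennreal ((cmod (G z))^2 * exp (- (p * t + 1 / (real n + 1)))) <= L" for n by (rule low) (simp add: real)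
    qed
    thus ?thesis unfolding e real by (simp add: eexp_def ennreal_mult)
   next
    case PInf thus ?thesis using psh(2)[OF z] by simp
   next
    case MInf
    show ?thesis
    proof (cases "G z = 0")
     case False
     \<comment> \<open>Here \<phi> is minus infinity at z and every real y is admissible. The choice
       \<open>y = - (l' / g)\<close> contradicts finiteness through
       \<open>1 + x \<le> exp x\<close>.\<close>
     have "L = \<infinity>"
     proof (rule ccontr)
      assume "L \<noteq> \<infinity>"
      then obtain l' where l': "L = ennreal l'" "l' >= 0" by (cases L) auto
      define g where "g = (cmod (G z))^2"
      have g: "g > 0" using False by (simp add: g_def)
      have "ennreal (g * exp (- (- (l' / g)))) <= ennreal l'" unfolding g_def l'(1)[symmetric] by (rule low) (use MInf p0 in simp)
      hence "g * exp (l' / g) <= l'" using l'(2) by simp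
      moreover have "g * (1 + l' / g) <= g * exp (l' / g)" using g by (intro mult_left_mono exp_ge_add_one_self) auto
      moreover have "g * (1 + l' / g) = g + l'" using g by (simp add: field_simps)
      ultimately show False using g by linarith
     qed
     thus ?thesis by simp
    qed (simp add: e)
   qed
  qed
  thus "indicator D z * wsq (%z. H z - F z) p \<phi> z <= L" by (simp add: indicator_def)
 qed
 also have "... <= liminf (%n. \<integral>\<^sup>+ z. h2 (rr n) z \<partial>lborel)"
  by (rule nn_integral_liminf) (use m2 in simp)
 also have "... <= liminf (%n. ennreal Cs)" by (intro Liminf_mono always_eventually allI i2)
 also have "... = ennreal Cs" by (rule Liminf_const) simp
 also have "... < \<infinity>" by simp
 finally show ?thesis by (rule that[OF H h1])
qed

end

section \<open>The theorem\<close>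

text \<open>The shift makes the power smooth up to 0, and d normalises the value at 1. As
  \<open>a < 1\<close>, shifting only decreases \<open>x^(a-1)\<close>, so the bound on the
  derivative survives with the factor \<open>a / d\<close>, which tends to a as \<epsilon> tends to
  0.\<close>

lemma profile_powr:
 fixes a \<epsilon> :: real
 assumes a: "0 < a" "a < 1" and e: "\<epsilon> > 0"
 defines "d \<equiv> (1 + \<epsilon>) powr a - \<epsilon> powr a"
 shows "d > 0"
  "profile (%x. ((x + \<epsilon>) powr a - \<epsilon> powr a) / d) (%x. a * (x + \<epsilon>) powr (a - 1) / d)
   (%x. a * (a - 1) * (x + \<epsilon>) powr (a - 2) / d) (%x. a * (a - 1) * (a - 2) * (x + \<epsilon>) powr (a - 3) / d)"
  "!!t. a * (exp t + \<epsilon>) powr (a - 1) / d <= a / d * exp (t * (a - 1))"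
proof -
 show d: "d > 0" unfolding d_def using powr_less_mono2[of a \<epsilon> "1 + \<epsilon>"] a e by simp
 have D: "((%x. c * (x + \<epsilon>) powr s / d) has_real_derivative c * s * (x + \<epsilon>) powr (s - 1) / d) (at x)" if "x >= 0" for x c s
  using that e d by (auto intro!: derivative_eq_intros)
 show "profile (%x. ((x + \<epsilon>) powr a - \<epsilon> powr a) / d) (%x. a * (x + \<epsilon>) powr (a - 1) / d)
   (%x. a * (a - 1) * (x + \<epsilon>) powr (a - 2) / d) (%x. a * (a - 1) * (a - 2) * (x + \<epsilon>) powr (a - 3) / d)"
 proof
  fix x :: real assume x: "0 <= x" "x <= 1"
  have pw: "(x + \<epsilon>) powr s > 0" for s using x e by simp
  show "((%x. ((x + \<epsilon>) powr a - \<epsilon> powr a) / d) has_real_derivative a * (x + \<epsilon>) powr (a - 1) / d) (at x)"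
   using x e d by (auto intro!: derivative_eq_intros)
  show "((%x. a * (x + \<epsilon>) powr (a - 1) / d) has_real_derivative a * (a - 1) * (x + \<epsilon>) powr (a - 2) / d) (at x)"
   using D[OF x(1), of a "a - 1"] by (simp add: algebra_simps)
  show "((%x. a * (a - 1) * (x + \<epsilon>) powr (a - 2) / d) has_real_derivative a * (a - 1) * (a - 2) * (x + \<epsilon>) powr (a - 3) / d) (at x)"
   using D[OF x(1), of "a * (a - 1)" "a - 2"] by (simp add: algebra_simps)
  show "a * (x + \<epsilon>) powr (a - 1) / d > 0" using a d pw by simp
  have "a * (a - 1) < 0" using a by (simp add: mult_pos_neg)
  hence "a * (a - 1) * (x + \<epsilon>) powr (a - 2) < 0" using pw by (rule mult_neg_pos)
  thus "a * (a - 1) * (x + \<epsilon>) powr (a - 2) / d < 0" using d by (rule divide_neg_pos)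
  have "a * (a - 1) * (a - 2) > 0" using \<open>a * (a - 1) < 0\<close> a by (intro mult_neg_neg) auto
  hence "a * (a - 1) * (a - 2) * (x + \<epsilon>) powr (a - 3) > 0" using pw by (rule mult_pos_pos)
  thus "0 <= a * (a - 1) * (a - 2) * (x + \<epsilon>) powr (a - 3) / d" using d by simp
 qed (use d in \<open>simp_all add: d_def\<close>)
 fix t
 have "(exp t + \<epsilon>) powr (a - 1) <= exp t powr (a - 1)" using a e by (intro powr_mono2') auto
 also have "... = exp (t * (a - 1))" by (simp add: powr_def mult.commute)
 finally have "a / d * (exp t + \<epsilon>) powr (a - 1) <= a / d * exp (t * (a - 1))" using a d by (intro mult_left_mono) auto
 thus "a * (exp t + \<epsilon>) powr (a - 1) / d <= a / d * exp (t * (a - 1))" by simp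
qed

text \<open>The comparison is made before the p-th root is taken: since \<open>p / (p - 1)\<close>
  exceeds 1, it is at most its own p-th power.\<close>

lemma theta_le: assumes p: "p > 1" shows "theta p <= p / (p - 1)"
proof -
 have "1 / ((p - 1) * (2 * p - 1)) <= p / (p - 1)"
 proof -
  have "1 * 1 <= p * (2 * p - 1)" using p by (intro mult_mono) auto
  hence "1 / (2 * p - 1) <= p" using p by (simp add: divide_le_eq)
  hence "1 / (2 * p - 1) / (p - 1) <= p / (p - 1)" using p by (intro divide_right_mono) auto
  thus ?thesis by (simp add: mult.commute)
 qed
 also have "... = (p / (p - 1)) powr 1" using p by simp
 also have "... <= (p / (p - 1)) powr p" using p by (intro powr_mono) auto
 finally have "(1 / ((p - 1) * (2 * p - 1))) powr (1 / p) <= ((p / (p - 1)) powr p) powr (1 / p)" using p by (intro powr_mono2) auto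
 also have "... = p / (p - 1)" using p by (simp add: powr_powr)
 finally show ?thesis by (simp add: theta_def)
qed

text \<open>Where \<phi> is negative, the weight increases with the exponent; as the sign is known
  on D only, the neighbourhood is intersected with D.\<close>

lemma in_mult_ideal_antimono:
 assumes D: "open D" "z0 \<in> D" "!!z. z \<in> D ==> \<phi> z < 0" and c: "0 < c" "c <= c'" and i: "in_mult_ideal F c' \<phi> z0"
 shows "in_mult_ideal F c \<phi> z0"
proof -
 obtain U where U: "open U" "z0 \<in> U" "(NNL z. indicator U z * wsq F c' \<phi> z) < \<infinity>" using i unfolding in_mult_ideal_def by blast
 have "eexp (- (ereal c * \<phi> z)) <= eexp (- (ereal c' * \<phi> z))" if "z \<in> D" for z
 proof (cases "\<phi> z")
  case (real t)
  hence "c' * t <= c * t" using D(3)[OF that] c by (intro mult_right_mono_neg) auto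
  thus ?thesis using real by (simp add: eexp_def ennreal_leI)
 qed (use D(3)[OF that] c in \<open>auto simp: eexp_def\<close>)
 hence "wsq F c \<phi> z <= wsq F c' \<phi> z" if "z \<in> D" for z unfolding wsq_def using that by (intro mult_left_mono) auto
 hence "(NNL z. indicator (U \<inter> D) z * wsq F c \<phi> z) <= (NNL z. indicator U z * wsq F c' \<phi> z)"
  by (intro nn_integral_mono) (auto simp: indicator_def)
 hence "(NNL z. indicator (U \<inter> D) z * wsq F c \<phi> z) < \<infinity>" using U(3) by (rule order_le_less_trans)
 thus ?thesis unfolding in_mult_ideal_def using U(1,2) D(1,2) by (intro exI[of _ "U \<inter> D"]) auto
qed

theorem mainTheorem1:
 fixes D :: "(complex ^ 'n) set" and z0 :: "complex ^ 'n"
  and \<phi> :: "complex ^ 'n \<Rightarrow> ereal" and F :: "complex ^ 'n \<Rightarrow> complex"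
  and C1 C2 :: real
 assumes "pseudoconvex_domain D" and "z0 \<in> D"
  and "C1 > 0" and "C2 > 0"
  and "psh_on D \<phi>" and "\<forall>z\<in>D. \<phi> z < 0"
  and "holomorphic_on_Cn F D"
  and "(\<integral>\<^sup>+ z. indicator D z * wsq F 1 \<phi> z \<partial>lborel) \<le> ennreal C1"
  and "bergman_inv D \<phi> F z0 \<ge> ennreal C2"
 shows "\<forall>p::real. p > 1 \<and> theta p > C1 / C2 \<longrightarrow> in_mult_ideal F p \<phi> z0"
proof (intro allI impI, rule ccontr)
 fix p :: real assume p: "p > 1 \<and> theta p > C1 / C2" and neg: "\<not> in_mult_ideal F p \<phi> z0"
 have D: "open D" using assms(5) by (simp add: psh_on_def)
 have phn: "!!z. z \<in> D ==> \<phi> z < 0" using assms(6) by blast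
 define J where "J = {ereal c | c. c >= 0 \<and> in_mult_ideal F (2 * c) \<phi> z0}"
 have "in_mult_ideal F 1 \<phi> z0" unfolding in_mult_ideal_def using D assms(2,8) by (intro exI[of _ D]) (auto intro: order_le_less_trans)
 \<comment> \<open>The finite norm of F puts it in the ideal of \<phi> itself, so the jumping number
   is at least 1/2 and in particular positive.\<close>
 hence half: "ereal (1/2) \<in> J" unfolding J_def by (intro CollectI exI[of _ "1/2"]) auto
 have up: "x <= ereal (p / 2)" if "x \<in> J" for x
 proof -
  obtain c where c: "x = ereal c" "in_mult_ideal F (2 * c) \<phi> z0" using \<open>x \<in> J\<close> unfolding J_def by blast
  have "2 * c < p" using in_mult_ideal_antimono[OF D assms(2) phn _ _ c(2), of p] neg p by force
  thus ?thesis using c(1) by simp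
 qed
 have J1: "ereal (1/2) <= Sup J" by (rule Sup_upper[OF half])
 have J2: "Sup J <= ereal (p / 2)" using up by (rule Sup_least)
 \<comment> \<open>Finiteness of the jumping number selects the infimum in
   \<open>bergman_inv\<close>, not the default value 0.\<close>
 obtain j where j: "Sup J = ereal j" using J1 J2 by (cases "Sup J") auto
 have j12: "1/2 <= j" "j <= p / 2" using J1 J2 j by auto
 have jn: "jumping_number F \<phi> z0 = ereal j" unfolding jumping_number_def J_def[symmetric] j ..
 have "C1 * (1 - 1 / p) < C2"
 proof -
  have "C1 / C2 < p / (p - 1)" using theta_le[of p] p by linarith
  hence "C1 * (p - 1) < C2 * p" using assms(4) p by (simp add: field_simps)
  thus ?thesis using p by (simp add: field_simps)
 qed
 moreover have "((%x. C1 * (1 - 1 / x)) \<longlongrightarrow> C1 * (1 - 1 / p)) (at_right p)" using p by (auto intro!: tendsto_intros)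
 ultimately have "\<forall>\<^sub>F x in at_right p. C1 * (1 - 1 / x) < C2" by (rule order_tendstoD(2)[rotated])
 then obtain p1 where "p1 > p" "!!x. p < x ==> x < p1 ==> C1 * (1 - 1 / x) < C2" unfolding eventually_at_right_field by blast
 \<comment> \<open>The number \<open>2 * j\<close> may equal p, while the ideal in
   \<open>bergman_inv\<close> asks for integrability with an exponent strictly above
   \<open>2 * j\<close>. The strict inequality between the constants leaves room for some p' above
   p.\<close>
 then obtain p' where p': "p < p'" "C1 * (1 - 1 / p') < C2" using dense[of p p1] by blast
 define a where "a = 1 - 1 / p'"
 have a: "0 < a" "a < 1" using p p' by (simp_all add: a_def)
 \<comment> \<open>As the shift tends to 0 the normaliser tends to 1, because
   \<open>0 powr a\<close> is 0 for positive a; so \<open>a / d\<close> can be taken close to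
   a.\<close>
 have "((%e. a / ((1 + e) powr a - e powr a) * C1) \<longlongrightarrow> a / ((1 + 0) powr a - 0 powr a) * C1) (at_right 0)"
  using a by (intro tendsto_intros) (auto intro: eventually_mono[OF eventually_at_right_less] less_imp_le)
 hence "((%e. a / ((1 + e) powr a - e powr a) * C1) \<longlongrightarrow> a * C1) (at_right 0)" by simp
 moreover have "a * C1 < C2" using p'(2) by (simp add: a_def mult.commute)
 ultimately have "\<forall>\<^sub>F e in at_right 0. a / ((1 + e) powr a - e powr a) * C1 < C2" by (rule order_tendstoD(2))
 hence "\<forall>\<^sub>F e in at_right 0. a / ((1 + e) powr a - e powr a) * C1 < C2 \<and> e > 0" using eventually_at_right_less by eventually_elim simp
 then obtain e where e: "e > 0" "a / ((1 + e) powr a - e powr a) * C1 < C2" using eventually_happens trivial_limit_at_right_real by blast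
 define d where "d = (1 + e) powr a - e powr a"
 note pf = profile_powr[OF a e(1), folded d_def]
 have kb: "a * (exp t + e) powr (a - 1) / d <= a / d * exp (- (t / p'))" for t using pf(3)[of t] by (simp add: a_def)
 obtain H where H: "holomorphic_on_Cn H D" "(NNL z. indicator D z * ennreal ((cmod (H z))^2)) <= ennreal (a / d * C1)"
  "(NNL z. indicator D z * wsq (%z. H z - F z) p' \<phi> z) < \<infinity>"
  by (rule profile.extension[OF pf(2) assms(1,5) phn _ assms(7,8,3) _ kb]) (use p p' a pf(1) in \<open>auto intro: that\<close>)
 have "in_mult_ideal (%z. H z - F z) p' \<phi> z0" unfolding in_mult_ideal_def using D assms(2) H(3) by blast
 \<comment> \<open>The gain in \<open>in_mult_ideal_plus\<close> is chosen so that the exponent is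
   exactly p'; it is positive as \<open>2 * j \<le> p\<close> and \<open>p < p'\<close>.\<close>
 moreover have "(1 + (p' / (2 * j) - 1)) * (2 * j) = p'" "p' / (2 * j) - 1 > 0" using j12 p' by (simp_all add: field_simps)
 ultimately have "in_mult_ideal_plus (%z. H z - F z) (2 * j) \<phi> z0" unfolding in_mult_ideal_plus_def by (intro exI[of _ "p' / (2 * j) - 1"]) simp
 hence "bergman_inv D \<phi> F z0 <= (NNL z. indicator D z * ennreal ((cmod (H z))^2))"
  unfolding bergman_inv_def jn using H(1) by (auto intro!: Inf_lower)
 also have "... <= ennreal (a / d * C1)" by (rule H(2))
 also have "... < ennreal C2" using e(2) assms(4) by (intro ennreal_lessI) (simp_all add: d_def)
 finally show False using assms(9) by simp
qed

end
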